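(* For every integer $k\geq 1$ and every prime number $p$ there exists a residually finite $p$-group $H$ such that $s_n(H)$ is of strict type $n^{(\log n)^k}$. Moreover, the pro-$p$ completion of $H$ is a pro-$p$ group with strict subgroup growth type $n^{(\log n)^k}$.
   Context: $\log=\log_p$. A $p$-group is a (possibly infinite) group in which every element has order a power of $p$. $s_n(G)$ is the number of subgroups of index at most $n$ in $G$ (closed subgroups if $G$ is a topological group). For $f:\mathbb{N}\to\mathbb{R}$, $G$ has subgroup growth of strict type $f(n)$ (equivalently, strict subgroup growth of type $f(n)$; one also says $s_n(G)$ is of strict type $f(n)$) if there exist $a,b>0$ such that $s_n(G)\leq f(n)^a$ for all $n$ and $f(n)^b\leq s_n(G)$ for all large $n$, where for pro-$p$ groups (and $p$-groups, whose finite-index subgroups have $p$-power index) $n$ is restricted to powers of $p$ in the last condition. *)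

theory Defs
  imports "HOL-Analysis.Analysis" "HOL-Algebra.Algebra"
begin

definition is_p_group :: "nat \<Rightarrow> ('a, 'c) monoid_scheme \<Rightarrow> bool" where
  "is_p_group p G \<longleftrightarrow> group G \<and> (\<forall>x \<in> carrier G. \<exists>m::nat. group.ord G x = p ^ m)"

definition residually_finite :: "('a, 'c) monoid_scheme \<Rightarrow> bool" where
  "residually_finite G \<longleftrightarrow> group G \<and>
     (\<forall>x \<in> carrier G. x \<noteq> \<one>\<^bsub>G\<^esub> \<longrightarrow> (\<exists>N. N \<lhd> G \<and> finite (rcosets\<^bsub>G\<^esub> N) \<and> x \<notin> N))"

definition is_topological_group :: "('a, 'c) monoid_scheme \<Rightarrow> 'a topology \<Rightarrow> bool" where
  "is_topological_group G T \<longleftrightarrow> group G \<and> topspace T = carrier G \<and>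
     continuous_map (prod_topology T T) T (\<lambda>(x, y). x \<otimes>\<^bsub>G\<^esub> y) \<and>
     continuous_map T T (\<lambda>x. inv\<^bsub>G\<^esub> x)"

definition is_profinite_group :: "('a, 'c) monoid_scheme \<Rightarrow> 'a topology \<Rightarrow> bool" where
  "is_profinite_group G T \<longleftrightarrow> is_topological_group G T \<and> compact_space T \<and> Hausdorff_space T \<and>
     (\<forall>U. openin T U \<and> \<one>\<^bsub>G\<^esub> \<in> U \<longrightarrow> (\<exists>K. subgroup K G \<and> openin T K \<and> K \<subseteq> U))"

definition is_pro_p_group :: "nat \<Rightarrow> ('a, 'c) monoid_scheme \<Rightarrow> 'a topology \<Rightarrow> bool" where
  "is_pro_p_group p G T \<longleftrightarrow> is_profinite_group G T \<and>
     (\<forall>N. N \<lhd> G \<and> openin T N \<longrightarrow> (\<exists>m::nat. card (rcosets\<^bsub>G\<^esub> N) = p ^ m))"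

definition subgroups_index_le :: "('a, 'c) monoid_scheme \<Rightarrow> nat \<Rightarrow> 'a set set" where
  "subgroups_index_le G n =
     {K. subgroup K G \<and> finite (rcosets\<^bsub>G\<^esub> K) \<and> card (rcosets\<^bsub>G\<^esub> K) \<le> n}"

definition closed_subgroups_index_le ::
    "('a, 'c) monoid_scheme \<Rightarrow> 'a topology \<Rightarrow> nat \<Rightarrow> 'a set set" where
  "closed_subgroups_index_le G T n = {K \<in> subgroups_index_le G n. closedin T K}"

text \<open>
  The family \<open>S\<close> is to be instantiated by the sets of (closed) subgroups of index at most \<open>n\<close>, so
  that \<open>card (S n)\<close> is the number \<open>s\<^sub>n\<close>; finiteness is required explicitly because \<open>card\<close> is \<open>0\<close> on
  infinite sets. The lower bound is only demanded along powers of \<open>p\<close>, as is the convention for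
  \<open>p\<close>-groups and pro-\<open>p\<close> groups.
\<close>

definition strict_growth_type :: "nat \<Rightarrow> (nat \<Rightarrow> real) \<Rightarrow> (nat \<Rightarrow> 'b set) \<Rightarrow> bool" where
  "strict_growth_type p f S \<longleftrightarrow> (\<exists>a > 0. \<exists>b > 0.
     (\<forall>n \<ge> 1. finite (S n) \<and> real (card (S n)) \<le> f n powr a) \<and>
     (\<forall>\<^sub>F m in sequentially. f (p ^ m) powr b \<le> real (card (S (p ^ m)))))"

definition p_power_normal_subgroups :: "nat \<Rightarrow> ('a, 'c) monoid_scheme \<Rightarrow> 'a set set" where
  "p_power_normal_subgroups p G = {N. N \<lhd> G \<and> (\<exists>m::nat. card (rcosets\<^bsub>G\<^esub> N) = p ^ m)}"

text \<open>
  The pro-\<open>p\<close> completion is the inverse limit of the quotients \<open>G Mod N\<close> over the normal subgroups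
  of \<open>p\<close>-power index, inside their product. For \<open>N \<subseteq> M\<close> the transition homomorphism sends a coset
  \<open>C\<close> of \<open>N\<close> to the coset \<open>M <#> C\<close> of \<open>M\<close>. The topology is induced by the product of the discrete
  topologies.
\<close>

definition pro_p_completion ::
    "nat \<Rightarrow> ('a, 'c) monoid_scheme \<Rightarrow> ('a set \<Rightarrow> 'a set) monoid" where
  "pro_p_completion p G =
     (let I = p_power_normal_subgroups p G; P = product_group I (\<lambda>N. G Mod N)
      in P\<lparr>carrier := {x \<in> carrier P. \<forall>N \<in> I. \<forall>M \<in> I. N \<subseteq> M \<longrightarrow> x M = M <#>\<^bsub>G\<^esub> x N}\<rparr>)"

definition pro_p_completion_topology ::
    "nat \<Rightarrow> ('a, 'c) monoid_scheme \<Rightarrow> ('a set \<Rightarrow> 'a set) topology" where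
  "pro_p_completion_topology p G =
     subtopology
       (product_topology (\<lambda>N. discrete_topology (carrier (G Mod N))) (p_power_normal_subgroups p G))
       (carrier (pro_p_completion p G))"

text \<open>
  A residually finite group with only finitely many subgroups of each finite index embeds in a
  countable product of finite groups, so it has at most continuum cardinality. Hence, for groups as
  below, quantifying over groups with elements of type \<^typ>\<open>nat set\<close> loses nothing up to
  isomorphism.
\<close>

type_synonym continuum_group = "nat set monoid"

end

theory Submission
  imports Defs "HOL-Number_Theory.Cong"
begin

text \<open>
  Put \<open>q = p\<^sup>3\<close> and read a natural number in base \<open>q\<close>, lowest digit first, as an end of the
  \<open>q\<close>-regular rooted tree. The group \<open>G j\<close> is generated by the rotations of the first digit and by
  directed elements \<open>dir j x\<close>, \<open>x\<close> in \<open>\<int>\<^sup>2\<close>, which act below the vertex 1 as rotation by a linear form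
  \<open>alpha j x\<close> and below the vertex 0 as \<open>dir (j + 1) x\<close>. The forms \<open>alpha j\<close> run periodically through
  all forms that are unimodular mod \<open>p\<close>, so each \<open>x\<close> is killed infinitely often, and contraction of
  word length makes \<open>G j\<close> a \<open>p\<close>-group. Commuting elements of nearly disjoint support shows that
  \<open>K j = [G j, G j]\<close> satisfies \<open>[K j, K j] \<supseteq> \<Prod> K (j + 1)\<close>, the product over the \<open>q\<close> subtrees, with
  finite index in \<open>G j\<close>.

  Let \<open>U\<close> have index \<open>n\<close> in \<open>G 0\<close>. If the copies of \<open>K\<close> at \<open>m\<close> incomparable vertices \<open>v\<close> have
  \<open>[K\<^sub>v, K\<^sub>v]\<close> not contained in \<open>[U, U]\<close>, then elements of them yield \<open>2\<^bsup>m/2\<^esup>\<close> cosets of \<open>U\<close>; a similar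
  count bounds the vertices whose children are not permuted transitively by \<open>U\<close>. Hence only
  \<open>O(log n)\<close> vertices are bad in either sense, \<open>[U, U]\<close> has index polynomial in \<open>n\<close>, and \<open>U\<close> has
  \<open>O(log n)\<close> orbits on \<open>\<nat>\<close>.

  The group is the semidirect product \<open>H\<close> of \<open>G 0 ^ k\<close> with the finitely supported functions
  \<open>\<nat>\<^sup>k \<rightarrow> \<int>/p\<close> (without this module if \<open>k = 1\<close>). A subgroup of index \<open>p\<^sup>i\<close> has \<open>O(i)\<close> orbits on each
  coordinate, so it has at most \<open>p ^ O(i\<^sup>k)\<close> homomorphisms to \<open>\<int>/p\<close>. Since normalizers grow in \<open>p\<close>-groups,
  every such subgroup is reached by \<open>i\<close> normal steps of index \<open>p\<close>, each with that many choices, which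
  gives \<open>p ^ O(i\<^bsup>k+1\<^esup>)\<close> subgroups. Conversely the stabilizer of level \<open>n\<close> has index \<open>p ^ O(N)\<close>,
  \<open>N = q\<^sup>n\<close>, and maps onto \<open>(\<int>/p) ^ N\<^sup>k\<close>, which has \<open>p ^ (t (N\<^sup>k - t))\<close> subspaces of codimension
  \<open>t = N/2\<close>. Finally, finite index subgroups of a \<open>p\<close>-group and closed finite index subgroups of
  its pro-\<open>p\<close> completion correspond bijectively.
\<close>

section \<open>Coverings by cosets\<close>

text \<open>A word whose rotation exponent is prime to p does not get shorter: its
  \<open>q\<close>-fold multiple has sections with the same length n, the same exponent b and
  rotation exponent \<open>alpha j b\<close>. Cycling through all forms is the way out, since a
  later form kills b and the rotation exponent is then divisible by p.

  The cube in \<open>q = p ^ 3\<close> makes \<open>q\<close> at least 8 even for p = 2. This is the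
  room used to find two elements of \<open>K j\<close> whose supports share a single subtree.

  Only homomorphisms to a group of order p have to be counted, since a normal subgroup of index p is
  the kernel of one. The obstacle is that U need not contain the module M, so a functional on U
  \<inter> M that is invariant under U need not extend to M. Climbing from U to U + M meets one
  obstruction per step of index p, itself a homomorphism vanishing on U \<inter> M, and there are
  p^O(i) of these. Up to i steps cost p^O(i^2), which is harmless for k at least 2 and too much for
  k = 1. This is why the module is dropped there.\<close>

lemmas grp_simps = diff_conv_add_uminus add.assoc minus_add

text \<open>Groups are written additively in types of class \<open>group_add\<close>, whose addition
  need not commute. Subgroups are then plain sets, which can be compared and intersected without
  carriers.\<close>

definition subgrp :: "'g::group_add set \<Rightarrow> bool" where
  "subgrp S \<longleftrightarrow> 0 \<in> S \<and> (\<forall>x\<in>S. \<forall>y\<in>S. x + y \<in> S) \<and> (\<forall>x\<in>S. - x \<in> S)"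

lemma subgrp_0: "subgrp S \<Longrightarrow> 0 \<in> S"
  and subgrp_add: "subgrp S \<Longrightarrow> x \<in> S \<Longrightarrow> y \<in> S \<Longrightarrow> x + y \<in> S"
  and subgrp_minus: "subgrp S \<Longrightarrow> x \<in> S \<Longrightarrow> - x \<in> S"
  by (auto simp: subgrp_def)

lemma subgrp_diff: "subgrp S \<Longrightarrow> x \<in> S \<Longrightarrow> y \<in> S \<Longrightarrow> x - y \<in> S"
  by (metis subgrp_add subgrp_minus diff_conv_add_uminus)

lemma subgrp_add_left: assumes "subgrp S" "x \<in> S" shows "x + y \<in> S \<longleftrightarrow> y \<in> S"
  by (metis assms subgrp_add subgrp_minus minus_add_cancel)

lemma subgrp_add_right: assumes "subgrp S" "x \<in> S" shows "y + x \<in> S \<longleftrightarrow> y \<in> S"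
  by (metis assms add_diff_cancel subgrp_add subgrp_diff)

lemma subgrp_Int: "subgrp A \<Longrightarrow> subgrp B \<Longrightarrow> subgrp (A \<inter> B)"
  by (auto simp: subgrp_def)

lemma subgrp_zero: "subgrp {0}"
  by (auto simp: subgrp_def)

definition gen :: "'g::group_add set \<Rightarrow> 'g set" where
  "gen A = \<Inter> {S. subgrp S \<and> A \<subseteq> S}"

lemma subgrp_gen: "subgrp (gen A)"
  unfolding gen_def subgrp_def by auto

lemma gen_incl: "A \<subseteq> gen A"
  unfolding gen_def by auto

lemma gen_least: "subgrp S \<Longrightarrow> A \<subseteq> S \<Longrightarrow> gen A \<subseteq> S"
  unfolding gen_def by auto

lemma gen_mono: "A \<subseteq> B \<Longrightarrow> gen A \<subseteq> gen B"
  by (meson gen_incl gen_least subgrp_gen subset_trans)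

definition comm_gp :: "'g::group_add set \<Rightarrow> 'g set" where
  "comm_gp U = gen {x + y - x - y | x y. x \<in> U \<and> y \<in> U}"

lemma subgrp_comm_gp: "subgrp (comm_gp U)"
  by (simp add: comm_gp_def subgrp_gen)

lemma comm_gp_I: "x \<in> U \<Longrightarrow> y \<in> U \<Longrightarrow> x + y - x - y \<in> comm_gp U"
  unfolding comm_gp_def by (rule subsetD[OF gen_incl]) blast

lemma comm_gp_least:
  "subgrp S \<Longrightarrow> (\<And>x y. x \<in> U \<Longrightarrow> y \<in> U \<Longrightarrow> x + y - x - y \<in> S) \<Longrightarrow> comm_gp U \<subseteq> S"
  unfolding comm_gp_def by (rule gen_least) auto

lemma comm_gp_sub: "subgrp U \<Longrightarrow> comm_gp U \<subseteq> U"
  by (rule comm_gp_least) (auto intro: subgrp_add subgrp_diff)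

lemma subgrp_vimage:
  assumes "\<And>x y. f (x + y) = f x + f y" "subgrp S"
  shows "subgrp {x. f x \<in> S}"
proof -
  have "f 0 + f 0 = f 0 + 0"
    by (simp add: assms(1)[symmetric])
  then have 0: "f 0 = 0" by (rule add_left_imp_eq)
  then have "f (- x) = - f x" for x
    by (metis assms(1) add_eq_0_iff right_minus)
  with 0 assms show ?thesis by (auto simp: subgrp_def)
qed

lemma subgrp_conj:
  assumes "subgrp S" shows "subgrp {x. g + x - g \<in> S}"
proof (rule subgrp_vimage[OF _ assms])
  show "g + (x + y) - g = (g + x - g) + (g + y - g)" for x y
    by (simp add: grp_simps del: add_uminus_conv_diff)
qed

lemma comm_gp_conj:
  assumes g: "\<And>x. x \<in> U \<Longrightarrow> g + x - g \<in> V" and "x \<in> comm_gp U"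
  shows "g + x - g \<in> comm_gp V"
proof -
  have "comm_gp U \<subseteq> {x. g + x - g \<in> comm_gp V}"
  proof (rule comm_gp_least[OF subgrp_conj[OF subgrp_comm_gp]], clarify)
    fix x y assume "x \<in> U" "y \<in> U"
    then have "(g + x - g) + (g + y - g) - (g + x - g) - (g + y - g) \<in> comm_gp V"
      by (intro comm_gp_I g)
    then show "g + (x + y - x - y) - g \<in> comm_gp V"
      by (simp add: grp_simps del: add_uminus_conv_diff)
  qed
  with assms show ?thesis by auto
qed

lemma comm_gp_conj_self:
  assumes "subgrp U" "g \<in> U" "x \<in> comm_gp U" shows "g + x - g \<in> comm_gp U"
  using assms by (intro comm_gp_conj) (auto intro: subgrp_add subgrp_diff)

lemma subgrp_centralizer: "subgrp {x::'g::group_add. \<forall>a\<in>A. x + a = a + x}"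
  unfolding subgrp_def
proof (intro conjI ballI CollectI; clarsimp)
  fix x y a :: 'g assume "\<forall>a\<in>A. x + a = a + x" "\<forall>a\<in>A. y + a = a + y" "a \<in> A"
  then show "x + y + a = a + (x + y)" by (metis add.assoc)
next
  fix x a :: 'g assume "\<forall>a\<in>A. x + a = a + x" "a \<in> A"
  then show "- x + a = a - x"
    by (metis add_diff_cancel add.assoc minus_add_cancel)
qed

lemma gen_commute:
  assumes "\<And>a b. a \<in> A \<Longrightarrow> b \<in> B \<Longrightarrow> a + b = b + a" "x \<in> gen A" "y \<in> gen B"
  shows "x + y = y + x"
proof -
  have 1: "gen A \<subseteq> {x. \<forall>b\<in>B. x + b = b + x}"
    by (rule gen_least[OF subgrp_centralizer]) (auto intro: assms(1))
  have "gen B \<subseteq> {y. \<forall>x\<in>gen A. y + x = x + y}"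
    by (rule gen_least[OF subgrp_centralizer]) (use 1 in force)
  then show ?thesis using assms(2,3) by auto
qed

lemma gen_commute1:
  assumes "\<And>a. a \<in> A \<Longrightarrow> a + b = b + a" "x \<in> gen A"
  shows "x + b = b + x"
proof -
  have "gen A \<subseteq> {x. \<forall>b'\<in>{b}. x + b' = b' + x}"
    by (rule gen_least[OF subgrp_centralizer]) (use assms(1) in blast)
  then show ?thesis using assms(2) by auto
qed

text \<open>For subgroups \<open>W \<subseteq> L\<close>, \<open>cov n L W\<close> says that the index is at most \<open>n\<close>.\<close>

definition cov :: "nat \<Rightarrow> 'g::group_add set \<Rightarrow> 'g set \<Rightarrow> bool" where
  "cov n L W \<longleftrightarrow> (\<exists>F. finite F \<and> card F \<le> n \<and> (\<forall>x\<in>L. \<exists>f\<in>F. - f + x \<in> W))"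

lemma cov_mono: "cov n L W \<Longrightarrow> n \<le> m \<Longrightarrow> L' \<subseteq> L \<Longrightarrow> W \<subseteq> W' \<Longrightarrow> cov m L' W'"
  unfolding cov_def by (meson in_mono order_trans)

lemma cov_one: "subgrp W \<Longrightarrow> L \<subseteq> W \<Longrightarrow> cov 1 L W"
  unfolding cov_def by (rule exI[of _ "{0}"]) auto

lemma coset_trans:
  assumes "subgrp W" "- f + x \<in> W" "- f + y \<in> W" shows "- x + y \<in> W"
proof -
  have "- (- f + x) + (- f + y) \<in> W"
    by (rule subgrp_add[OF assms(1) subgrp_minus[OF assms(1,2)] assms(3)])
  then show ?thesis by (simp add: grp_simps del: add_uminus_conv_diff)
qed

text \<open>The set \<open>F\<close> in \<open>cov\<close> may lie anywhere. Each of its elements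
  whose coset meets \<open>L\<close> is traded for an element of \<open>L\<close> in that
  coset.\<close>

lemma cov_inner:
  assumes "cov n L W" "subgrp W"
  obtains F where "finite F" "card F \<le> n" "F \<subseteq> L" "\<And>x. x \<in> L \<Longrightarrow> \<exists>f\<in>F. - f + x \<in> W"
proof -
  obtain F where F: "finite F" "card F \<le> n" "\<And>x. x \<in> L \<Longrightarrow> \<exists>f\<in>F. - f + x \<in> W"
    using assms(1) unfolding cov_def by auto
  define F' where "F' = {f \<in> F. \<exists>x\<in>L. - f + x \<in> W}"
  define c where "c f = (SOME x. x \<in> L \<and> - f + x \<in> W)" for f
  have c: "c f \<in> L \<and> - f + c f \<in> W" if "f \<in> F'" for f
    unfolding c_def by (rule someI_ex) (use that in \<open>auto simp: F'_def\<close>)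
  show ?thesis
  proof
    show "finite (c ` F')" using F by (auto simp: F'_def)
    have "card (c ` F') \<le> card F'" using F by (intro card_image_le) (auto simp: F'_def)
    also have "\<dots> \<le> card F" by (intro card_mono F) (auto simp: F'_def)
    finally show "card (c ` F') \<le> n" using F by simp
    show "c ` F' \<subseteq> L" using c by auto
    fix x assume x: "x \<in> L"
    then obtain f where f: "f \<in> F" "- f + x \<in> W" using F by blast
    then have "f \<in> F'" using x by (auto simp: F'_def)
    with c[of f] f coset_trans[OF assms(2)] show "\<exists>f\<in>c ` F'. - f + x \<in> W" by blast
  qed
qed

lemma cov_trans:
  assumes "cov n L L'" "cov m L' W" shows "cov (n * m) L W"
proof -
  obtain F where F: "finite F" "card F \<le> n" "\<And>x. x \<in> L \<Longrightarrow> \<exists>f\<in>F. - f + x \<in> L'"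
    using assms(1) unfolding cov_def by auto
  obtain F' where F': "finite F'" "card F' \<le> m" "\<And>x. x \<in> L' \<Longrightarrow> \<exists>f\<in>F'. - f + x \<in> W"
    using assms(2) unfolding cov_def by auto
  let ?E = "(\<lambda>(f, g). f + g) ` (F \<times> F')"
  have "card ?E \<le> card (F \<times> F')" using F F' by (intro card_image_le) auto
  also have "\<dots> \<le> n * m" using F F' by (simp add: card_cartesian_product mult_le_mono)
  finally have "card ?E \<le> n * m" .
  moreover have "\<exists>e\<in>?E. - e + x \<in> W" if x: "x \<in> L" for x
  proof -
    obtain f where f: "f \<in> F" "- f + x \<in> L'" using F(3)[OF x] by blast
    obtain g where g: "g \<in> F'" "- g + (- f + x) \<in> W" using F'(3)[OF f(2)] by blast
    have "- (f + g) + x \<in> W" using g by (simp add: grp_simps del: add_uminus_conv_diff)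
    then show ?thesis using f g by force
  qed
  ultimately show ?thesis unfolding cov_def using F F' by (intro exI[of _ ?E]) auto
qed

text \<open>Additivity is asked for on \<open>L\<close> only, because the lemma is applied to maps
  such as \<open>sec v\<close>, which are known to be additive just there.\<close>

lemma cov_vimage:
  assumes "cov n G K" "subgrp K"
    and hom: "\<And>x y. x \<in> L \<Longrightarrow> y \<in> L \<Longrightarrow> f (- x + y) = - f x + f y"
    and L: "\<And>x y. x \<in> L \<Longrightarrow> y \<in> L \<Longrightarrow> - x + y \<in> L" and G: "f ` L \<subseteq> G"
  shows "cov n L {x\<in>L. f x \<in> K}"
proof -
  have "cov n (f ` L) K" by (rule cov_mono[OF assms(1)]) (use G in auto)
  from cov_inner[OF this assms(2)] obtain F where F: "finite F" "card F \<le> n" "F \<subseteq> f ` L"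
    "\<And>x. x \<in> f ` L \<Longrightarrow> \<exists>f\<in>F. - f + x \<in> K" by metis
  define c where "c y = (SOME x. x \<in> L \<and> f x = y)" for y
  have c: "c y \<in> L \<and> f (c y) = y" if "y \<in> F" for y
    unfolding c_def by (rule someI_ex) (use F that in auto)
  have "\<exists>e\<in>c ` F. - e + x \<in> {x\<in>L. f x \<in> K}" if x: "x \<in> L" for x
  proof -
    obtain y where y: "y \<in> F" "- y + f x \<in> K" using F x by blast
    have "f (- c y + x) \<in> K" using hom[of "c y" x] c[OF y(1)] y x by auto
    then show ?thesis using L[of "c y" x] c[OF y(1)] x y(1) by auto
  qed
  then show ?thesis unfolding cov_def using F(1,2) card_image_le[OF F(1), of c]
    by (intro exI[of _ "c ` F"]) auto
qed

lemma cov_Int: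
  assumes "cov n L A" "cov m L B" "subgrp A" "subgrp B"
  shows "cov (n * m) L (A \<inter> B)"
proof -
  obtain F where F: "finite F" "card F \<le> n" "\<And>x. x \<in> L \<Longrightarrow> \<exists>f\<in>F. - f + x \<in> A"
    using assms(1) unfolding cov_def by auto
  obtain F' where F': "finite F'" "card F' \<le> m" "\<And>x. x \<in> L \<Longrightarrow> \<exists>f\<in>F'. - f + x \<in> B"
    using assms(2) unfolding cov_def by auto
  define c where "c = (\<lambda>(f, g). SOME x. x \<in> L \<and> - f + x \<in> A \<and> - g + x \<in> B)"
  have "card (c ` (F \<times> F')) \<le> card (F \<times> F')" using F F' by (intro card_image_le) auto
  also have "\<dots> \<le> n * m" using F F' by (simp add: card_cartesian_product mult_le_mono)
  finally have "card (c ` (F \<times> F')) \<le> n * m" .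
  moreover have "\<exists>e\<in>c ` (F \<times> F'). - e + x \<in> A \<inter> B" if x: "x \<in> L" for x
  proof -
    obtain f g where fg: "f \<in> F" "- f + x \<in> A" "g \<in> F'" "- g + x \<in> B" using F F' x by blast
    have "c (f, g) \<in> L \<and> - f + c (f, g) \<in> A \<and> - g + c (f, g) \<in> B"
      unfolding c_def prod.case by (rule someI_ex) (use fg x in auto)
    then have "- c (f, g) + x \<in> A \<inter> B" using fg coset_trans assms(3,4) by blast
    then show ?thesis using fg by blast
  qed
  ultimately show ?thesis unfolding cov_def using F F'
    by (intro exI[of _ "c ` (F \<times> F')"]) auto
qed

lemma cov_commuting_sum:
  assumes "cov n A W" "cov m B W" "subgrp A" "subgrp B" "subgrp W"
    and comm: "\<And>a b. a \<in> A \<Longrightarrow> b \<in> B \<Longrightarrow> a + b = b + a"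
  shows "cov (n * m) {a + b | a b. a \<in> A \<and> b \<in> B} W"
proof -
  obtain F where F: "finite F" "card F \<le> n" "F \<subseteq> A" "\<And>x. x \<in> A \<Longrightarrow> \<exists>f\<in>F. - f + x \<in> W"
    using cov_inner[OF assms(1,5)] by metis
  obtain F' where F': "finite F'" "card F' \<le> m" "F' \<subseteq> B" "\<And>x. x \<in> B \<Longrightarrow> \<exists>f\<in>F'. - f + x \<in> W"
    using cov_inner[OF assms(2,5)] by metis
  let ?E = "(\<lambda>(f, g). f + g) ` (F \<times> F')"
  have "card ?E \<le> card (F \<times> F')" using F F' by (intro card_image_le) auto
  also have "\<dots> \<le> n * m" using F F' by (simp add: card_cartesian_product mult_le_mono)
  finally have "card ?E \<le> n * m" .
  moreover have "\<exists>e\<in>?E. - e + (a + b) \<in> W" if a: "a \<in> A" and b: "b \<in> B" for a b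
  proof -
    obtain f where f: "f \<in> F" "- f + a \<in> W" using F a by blast
    obtain g where g: "g \<in> F'" "- g + b \<in> W" using F' b by blast
    have "- g \<in> B" using F' g assms(4) subgrp_minus by blast
    moreover have "- f + a \<in> A" using F f a assms(3) by (metis subgrp_add subgrp_minus subsetD)
    \<comment> \<open>Commutation lets the correction of b pass that of a, so the two can be made
      independently.\<close>
    ultimately have "- f + a + - g = - g + (- f + a)" by (rule comm[rotated])
    then have "- (f + g) + (a + b) = (- f + a + - g) + b"
      unfolding minus_add by (simp only: add.assoc)
    then have "- (f + g) + (a + b) = (- f + a) + (- g + b)"
      by (simp only: add.assoc)
    then have "- (f + g) + (a + b) \<in> W" using f g assms(5) by (simp add: subgrp_add)
    then show ?thesis using f g by force
  qed
  ultimately show ?thesis unfolding cov_def using F F' by (intro exI[of _ ?E]) auto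
qed

section \<open>Independence modulo a subgroup\<close>

fun prods :: "'g::group_add list \<Rightarrow> 'g set" where
  "prods [] = {0}"
| "prods (x # xs) = prods xs \<union> (+) x ` prods xs"

text \<open>
  Independence modulo \<open>W\<close> makes the \<open>2 ^ length xs\<close> subproducts lie in distinct cosets.
\<close>

fun indep :: "'g::group_add set \<Rightarrow> 'g list \<Rightarrow> bool" where
  "indep W [] \<longleftrightarrow> True"
| "indep W (x # xs) \<longleftrightarrow> indep W xs \<and> (\<forall>t\<in>prods xs. \<forall>t'\<in>prods xs. - t' + (x + t) \<notin> W)"

lemma prods_subset: "subgrp S \<Longrightarrow> set xs \<subseteq> S \<Longrightarrow> prods xs \<subseteq> S"
  by (induction xs) (auto simp: subgrp_0 intro: subgrp_add)

lemma indep_card: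
  assumes W: "subgrp W" and "indep W xs"
  shows "finite (prods xs) \<and> card (prods xs) = 2 ^ length xs \<and>
    (\<forall>a\<in>prods xs. \<forall>b\<in>prods xs. - a + b \<in> W \<longrightarrow> a = b)"
  using assms(2)
proof (induction xs)
  case Nil then show ?case by simp
next
  case (Cons x xs)
  then have IH: "finite (prods xs)" "card (prods xs) = 2 ^ length xs"
      "\<forall>a\<in>prods xs. \<forall>b\<in>prods xs. - a + b \<in> W \<longrightarrow> a = b"
    and cross: "\<forall>t\<in>prods xs. \<forall>t'\<in>prods xs. - t' + (x + t) \<notin> W" by auto
  have cross': "- (x + t) + t' \<notin> W" if "t \<in> prods xs" "t' \<in> prods xs" for t t'
  proof
    assume "- (x + t) + t' \<in> W"
    then have "- (- (x + t) + t') \<in> W" by (rule subgrp_minus[OF W])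
    then show False using cross that by (simp add: minus_add)
  qed
  have disj: "prods xs \<inter> (+) x ` prods xs = {}"
  proof (rule ccontr)
    assume "prods xs \<inter> (+) x ` prods xs \<noteq> {}"
    then obtain t where "t \<in> prods xs" "x + t \<in> prods xs" by auto
    with cross have "- (x + t) + (x + t) \<notin> W" by blast
    then show False using subgrp_0[OF W] by (metis left_minus)
  qed
  have "card (prods (x # xs)) = 2 ^ length (x # xs)"
    using IH disj by (simp add: card_Un_disjoint card_image)
  moreover have "a = b" if ab: "a \<in> prods (x # xs)" "b \<in> prods (x # xs)" "- a + b \<in> W" for a b
  proof -
    have shift: "- (x + t) + (x + t') = - t + t'" for t t'
      by (simp add: grp_simps del: add_uminus_conv_diff)
    consider "a \<in> prods xs" "b \<in> prods xs"
      | t where "a \<in> prods xs" "b = x + t" "t \<in> prods xs"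
      | t where "a = x + t" "t \<in> prods xs" "b \<in> prods xs"
      | t t' where "a = x + t" "b = x + t'" "t \<in> prods xs" "t' \<in> prods xs"
      using ab(1,2) by (simp only: prods.simps Un_iff image_iff) blast
    then show ?thesis
    proof cases
      case 1 then show ?thesis using IH(3) ab(3) by blast
    next
      case 2 then show ?thesis using cross ab(3) by blast
    next
      case 3 then show ?thesis using cross' ab(3) by blast
    next
      case 4
      then have "- t + t' \<in> W" using ab(3) shift by metis
      then show ?thesis using 4 IH(3) by blast
    qed
  qed
  moreover have "finite (prods (x # xs))" using IH(1) by simp
  ultimately show ?case by blast
qed

lemma indep_bound:
  assumes W: "subgrp W" and "indep W xs" "cov n L W" "prods xs \<subseteq> L"
  shows "2 ^ length xs \<le> n"
proof -
  obtain F where F: "finite F" "card F \<le> n" "\<And>x. x \<in> L \<Longrightarrow> \<exists>f\<in>F. - f + x \<in> W"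
    using assms(3) unfolding cov_def by auto
  define c where "c x = (SOME f. f \<in> F \<and> - f + x \<in> W)" for x
  have c: "c x \<in> F \<and> - c x + x \<in> W" if "x \<in> prods xs" for x
    unfolding c_def by (rule someI_ex) (use F assms(4) that in blast)
  have "inj_on c (prods xs)"
  proof
    fix x y assume xy: "x \<in> prods xs" "y \<in> prods xs" "c x = c y"
    then have "- x + y \<in> W" using c[of x] c[of y] coset_trans[OF W] by metis
    then show "x = y" using indep_card[OF W assms(2)] xy by blast
  qed
  then have "card (prods xs) \<le> card F"
    using c by (intro card_inj_on_le[of c] F) auto
  then show ?thesis using indep_card[OF W assms(2)] F by simp
qed

text \<open>Subproducts of the tail lie in the subgroup generated by the entries after i, so
  independence may be tested against this whole subgroup.\<close>

lemma indep_sorted: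
  assumes "sorted_wrt R is"
    and "\<And>i t t'. i \<in> set is \<Longrightarrow> t \<in> gen {x j | j. j \<in> set is \<and> R i j} \<Longrightarrow>
      t' \<in> gen {x j | j. j \<in> set is \<and> R i j} \<Longrightarrow> - t' + (x i + t) \<notin> W"
  shows "indep W (map x is)"
  using assms
proof (induction "is")
  case (Cons i js)
  have sub: "prods (map x js) \<subseteq> gen {x j | j. j \<in> set (i # js) \<and> R i j}"
    by (rule prods_subset[OF subgrp_gen], rule subset_trans[OF _ gen_incl])
      (use Cons.prems(1) in auto)
  have "indep W (map x js)"
  proof (rule Cons.IH)
    fix k t t' assume k: "k \<in> set js" and t: "t \<in> gen {x j |j. j \<in> set js \<and> R k j}"
      "t' \<in> gen {x j |j. j \<in> set js \<and> R k j}"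
    have "gen {x j |j. j \<in> set js \<and> R k j} \<subseteq> gen {x j |j. j \<in> set (i # js) \<and> R k j}"
      by (rule gen_mono) auto
    with k t show "- t' + (x k + t) \<notin> W" by (intro Cons.prems(2)) auto
  qed (use Cons.prems in auto)
  moreover have "- t' + (x i + t) \<notin> W" if "t \<in> prods (map x js)" "t' \<in> prods (map x js)" for t t'
    using that sub by (intro Cons.prems(2)) auto
  ultimately show ?case by simp
qed simp

text \<open>If \<open>x i\<close> commutes with the later entries, the corrections t and t' merge
  into the single later element \<open>- t' + t\<close>. So it suffices that no later element moves
  \<open>x i\<close> into \<open>U\<close>.\<close>

lemma commuting_halves:
  assumes U: "subgrp U" "cov n L U" and L: "subgrp L" "\<And>i. i \<in> set is \<Longrightarrow> x i \<in> L"
    and R: "sorted_wrt R is"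
    and comm: "\<And>i j. R i j \<Longrightarrow> i \<in> set is \<Longrightarrow> j \<in> set is \<Longrightarrow> x i + x j = x j + x i"
    and nf: "\<And>i l. i \<in> set is \<Longrightarrow> l \<in> gen {x j | j. j \<in> set is \<and> R i j} \<Longrightarrow> x i + l \<notin> U"
  shows "2 ^ length is \<le> n"
proof -
  have "indep U (map x is)"
  proof (rule indep_sorted[OF R])
    fix i t t' assume i: "i \<in> set is" and t: "t \<in> gen {x j |j. j \<in> set is \<and> R i j}"
      and t': "t' \<in> gen {x j |j. j \<in> set is \<and> R i j}"
    have "- t' \<in> gen {x j |j. j \<in> set is \<and> R i j}" using t' by (intro subgrp_minus subgrp_gen)
    then have "- t' + x i = x i + - t'"
    proof (rule gen_commute1[rotated])
      fix a assume "a \<in> {x j |j. j \<in> set is \<and> R i j}"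
      then obtain j where "a = x j" "j \<in> set is" "R i j" by blast
      then show "a + x i = x i + a" using comm[of i j] i by simp
    qed
    then have eq: "- t' + (x i + t) = x i + (- t' + t)"
      unfolding add.assoc[symmetric] by (rule arg_cong[where f = "\<lambda>z. z + t"])
    have "- t' + t \<in> gen {x j |j. j \<in> set is \<and> R i j}"
      using t t' by (intro subgrp_add subgrp_minus subgrp_gen)
    then show "- t' + (x i + t) \<notin> U" unfolding eq by (rule nf[OF i])
  qed
  moreover have "prods (map x is) \<subseteq> L" using L by (intro prods_subset) auto
  ultimately have "2 ^ length (map x is) \<le> n" using U by (intro indep_bound)
  then show ?thesis by simp
qed

text \<open>
  An element of \<open>[K i, K i]\<close> outside \<open>[U, U]\<close> comes from a commutator \<open>[x, y]\<close>. If both \<open>x\<close> and \<open>y\<close>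
  could be moved into \<open>U\<close> by elements of the later respectively the earlier factors, which commute with
  each other, then \<open>[x, y]\<close> would lie in \<open>[U, U]\<close>. So each index is counted by \<open>a\<close> or by \<open>b\<close>.
\<close>

lemma commuting_family_bound:
  fixes K :: "nat \<Rightarrow> 'g::group_add set"
  assumes U: "subgrp U" "cov n L U" and L: "subgrp L" "\<And>i. i < m \<Longrightarrow> K i \<subseteq> L"
    and comm: "\<And>i j x y. i < m \<Longrightarrow> j < m \<Longrightarrow> i \<noteq> j \<Longrightarrow> x \<in> K i \<Longrightarrow> y \<in> K j \<Longrightarrow> x + y = y + x"
    and bad: "\<And>i. i < m \<Longrightarrow> \<not> comm_gp (K i) \<subseteq> comm_gp U"
  obtains a b where "m \<le> a + b" "2 ^ a \<le> n" "2 ^ b \<le> n"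
proof -
  have "\<exists>x y. x \<in> K i \<and> y \<in> K i \<and> x + y - x - y \<notin> comm_gp U" if "i < m" for i
    using bad[OF that] comm_gp_least[OF subgrp_comm_gp, of "K i" U] by blast
  then obtain x y where xy: "\<And>i. i < m \<Longrightarrow> x i \<in> K i \<and> y i \<in> K i \<and> x i + y i - x i - y i \<notin> comm_gp U"
    by metis
  define A where "A = {i. i < m \<and> (\<forall>l\<in>gen {x j | j. j < m \<and> i < j}. x i + l \<notin> U)}"
  define B where "B = {i. i < m \<and> (\<forall>l\<in>gen {y j | j. j < m \<and> j < i}. y i + l \<notin> U)}"
  have fin: "finite A" "finite B" by (auto simp: A_def B_def)
  have "i \<in> A \<union> B" if i: "i < m" for i
  proof (rule ccontr)
    assume "i \<notin> A \<union> B"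
    then obtain l l' where l: "l \<in> gen {x j | j. j < m \<and> i < j}" "x i + l \<in> U"
      and l': "l' \<in> gen {y j | j. j < m \<and> j < i}" "y i + l' \<in> U"
      using i by (auto simp: A_def B_def)
    have cx: "x j + z = z + x j" if "j < m" "i < j" "z \<in> K i" for j z
      by (rule comm[of j i]) (use that i xy in auto)
    have cy: "y j + z = z + y j" if "j < m" "j < i" "z \<in> K i" for j z
      by (rule comm[of j i]) (use that i xy in auto)
    have c2: "l + y i = y i + l"
      by (rule gen_commute1[OF _ l(1)]) (use cx xy[OF i] in blast)
    have c3: "l' + x i = x i + l'"
      by (rule gen_commute1[OF _ l'(1)]) (use cy xy[OF i] in blast)
    have c5: "l + l' = l' + l"
    proof (rule gen_commute[OF _ l(1) l'(1)])
      fix a b assume "a \<in> {x j |j. j < m \<and> i < j}" "b \<in> {y j |j. j < m \<and> j < i}"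
      then obtain j j' where "a = x j" "b = y j'" "j < m" "i < j" "j' < m" "j' < i" by blast
      then show "a + b = b + a" by (intro comm[of j j' a b]) (use xy in auto)
    qed
    have e1: "(x i + l) + (y i + l') = (x i + y i) + (l + l')"
      unfolding add.assoc add.assoc[symmetric, of l "y i"] c2 by (simp only: add.assoc)
    have e2: "(y i + l') + (x i + l) = (y i + x i) + (l + l')"
      unfolding add.assoc add.assoc[symmetric, of l' "x i"] c3 by (simp only: add.assoc c5)
    have comm_eq: "a + b - a - b = (a + b) - (b + a)" for a b :: 'g
      by (simp add: grp_simps del: add_uminus_conv_diff)
    \<comment> \<open>After the shifts the corrections stand at the right end in the same order, so
      they cancel in the commutator.\<close>
    have "(x i + l) + (y i + l') - (x i + l) - (y i + l') = (x i + y i) + (l + l') - ((y i + x i) + (l + l'))"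
      by (rule trans[OF comm_eq]) (simp only: e1 e2)
    also have "\<dots> = x i + y i - x i - y i"
      by (simp add: grp_simps del: add_uminus_conv_diff)
    finally have "x i + y i - x i - y i \<in> comm_gp U" using comm_gp_I[OF l(2) l'(2)] by simp
    with xy[OF i] show False by simp
  qed
  then have "{..<m} \<subseteq> A \<union> B" by auto
  then have "card {..<m} \<le> card (A \<union> B)" using fin by (intro card_mono) auto
  also have "\<dots> \<le> card A + card B" by (rule card_Un_le)
  finally have "m \<le> card A + card B" by simp
  moreover have "2 ^ card A \<le> n"
  proof -
    have "2 ^ length (sorted_list_of_set A) \<le> n"
    proof (rule commuting_halves[OF U L(1), where R = "(<)" and x = x])
      fix i l assume i: "i \<in> set (sorted_list_of_set A)"
        and l: "l \<in> gen {x j |j. j \<in> set (sorted_list_of_set A) \<and> i < j}"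
      have "gen {x j |j. j \<in> set (sorted_list_of_set A) \<and> i < j} \<subseteq> gen {x j | j. j < m \<and> i < j}"
        by (rule gen_mono) (use fin in \<open>auto simp: A_def\<close>)
      then show "x i + l \<notin> U" using i l fin by (auto simp: A_def)
    next
      fix i j assume "i < j" "i \<in> set (sorted_list_of_set A)" "j \<in> set (sorted_list_of_set A)"
      then show "x i + x j = x j + x i" by (intro comm[of i j]) (use fin xy in \<open>auto simp: A_def\<close>)
    qed (use fin L xy in \<open>auto simp: A_def\<close>)
    then show ?thesis by simp
  qed
  moreover have "2 ^ card B \<le> n"
  proof -
    \<comment> \<open>In decreasing order the later entries of the list are the smaller indices,
      which are those allowed in the correction of \<open>y i\<close>.\<close>
    have "2 ^ length (rev (sorted_list_of_set B)) \<le> n"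
    proof (rule commuting_halves[OF U L(1), where R = "(>)" and x = y])
      fix i l assume i: "i \<in> set (rev (sorted_list_of_set B))"
        and l: "l \<in> gen {y j |j. j \<in> set (rev (sorted_list_of_set B)) \<and> i > j}"
      have "gen {y j |j. j \<in> set (rev (sorted_list_of_set B)) \<and> i > j} \<subseteq> gen {y j | j. j < m \<and> j < i}"
        by (rule gen_mono) (use fin in \<open>auto simp: B_def\<close>)
      then show "y i + l \<notin> U" using i l fin by (auto simp: B_def)
    next
      fix i j assume "i > j" "i \<in> set (rev (sorted_list_of_set B))" "j \<in> set (rev (sorted_list_of_set B))"
      then show "y i + y j = y j + y i" by (intro comm[of i j]) (use fin xy in \<open>auto simp: B_def\<close>)
    qed (use fin L xy in \<open>auto simp: B_def sorted_wrt_rev\<close>)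
    then show ?thesis by simp
  qed
  ultimately show thesis by (rule that)
qed

section \<open>A spinal p-group\<close>

typedef nperm = "{f :: nat \<Rightarrow> nat. bij f}"
  morphisms ap Abs_nperm
  by (rule exI[of _ id]) auto

lemma bij_ap: "bij (ap f)"
  using ap[of f] by simp

instantiation nperm :: group_add
begin

definition zero_nperm :: nperm where "zero_nperm = Abs_nperm id"
definition plus_nperm :: "nperm \<Rightarrow> nperm \<Rightarrow> nperm" where "plus_nperm f g = Abs_nperm (ap f \<circ> ap g)"
definition uminus_nperm :: "nperm \<Rightarrow> nperm" where "uminus_nperm f = Abs_nperm (Hilbert_Choice.inv (ap f))"
definition minus_nperm :: "nperm \<Rightarrow> nperm \<Rightarrow> nperm" where "minus_nperm f g = f + - g"

lemma ap_0: "ap 0 = id"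
  by (simp add: zero_nperm_def Abs_nperm_inverse)

lemma ap_plus: "ap (f + g) = ap f \<circ> ap g"
  by (simp add: plus_nperm_def Abs_nperm_inverse bij_ap bij_comp)

lemma ap_inv: "ap (- f) = Hilbert_Choice.inv (ap f)"
  by (simp add: uminus_nperm_def Abs_nperm_inverse bij_ap bij_imp_bij_inv)

instance
  by standard (auto simp: ap_inject[symmetric] ap_plus ap_0 ap_inv minus_nperm_def
      inv_o_cancel bij_ap bij_is_inj)

end

lemma nperm_eqI: "(\<And>n. ap f n = ap g n) \<Longrightarrow> f = g"
  by (simp add: ap_inject[symmetric] fun_eq_iff)

lemma ap_zero [simp]: "ap 0 n = n"
  by (simp add: ap_0)

lemma ap_add [simp]: "ap (f + g) n = ap f (ap g n)"
  by (simp add: ap_plus)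

lemma ap_minus1 [simp]: "ap (- f) (ap f n) = n"
  by (simp add: ap_inv bij_ap bij_is_inj)

lemma ap_minus2 [simp]: "ap f (ap (- f) n) = n"
  by (metis ap_add ap_zero right_minus)

lemma ap_eq_iff [simp]: "ap f m = ap f n \<longleftrightarrow> m = n"
  by (metis ap_minus1)

definition mk_nperm :: "(nat \<Rightarrow> nat) \<Rightarrow> nperm" where
  "mk_nperm f = Abs_nperm f"

lemma ap_mk: assumes "\<And>n. g (f n) = n" "\<And>n. f (g n) = n" shows "ap (mk_nperm f) = f"
  unfolding mk_nperm_def by (rule Abs_nperm_inverse) (auto intro: bijI' simp: assms intro!: o_bij[of g] ext)

primrec nm :: "nat \<Rightarrow> 'g::group_add \<Rightarrow> 'g" where
  "nm 0 g = 0"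
| "nm (Suc n) g = g + nm n g"

lemma nm_add: "nm (a + b) g = nm a g + nm b g"
  by (induction a) (simp_all add: add.assoc)

lemma nm_mult: "nm a (nm b g) = nm (a * b) g"
  by (induction a) (simp_all add: nm_add)

lemma nm_zero [simp]: "nm a (0::'g::group_add) = 0"
  by (induction a) simp_all

lemma nm_subgrp: "subgrp S \<Longrightarrow> x \<in> S \<Longrightarrow> nm n x \<in> S"
  by (induction n) (auto intro: subgrp_0 subgrp_add)

definition p_torsion :: "nat \<Rightarrow> 'g::group_add \<Rightarrow> bool" where
  "p_torsion p g \<longleftrightarrow> (\<exists>m. nm (p ^ m) g = 0)"

locale spinal =
  fixes p :: nat
  assumes prime_p: "Factorial_Ring.prime p"
begin

definition q :: nat where "q = p ^ 3"

lemma p_ge2: "p \<ge> 2" using prime_p prime_ge_2_nat by auto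

text \<open>In \<open>comm_kk\<close> the digits 0 to 5 and q - 1 have to be distinct; the exponent
  3 ensures this for p = 2 as well.\<close>

lemma q_ge8: "q \<ge> 8"
proof -
  have "2 ^ 3 \<le> p ^ 3" using p_ge2 by (intro power_mono) auto
  then show ?thesis by (simp add: q_def)
qed

lemma q_gt0 [simp]: "q > 0" using q_ge8 by simp

section \<open>Rotations of the first digit\<close>

definition shf :: "int \<Rightarrow> nat \<Rightarrow> nat" where
  "shf c v = nat ((int v + c) mod int q)"

lemma shf_lt [simp]: "shf c v < q"
  unfolding shf_def using q_gt0 by (metis nat_int nat_less_iff of_nat_0_less_iff pos_mod_bound pos_mod_sign zless_nat_conj)

lemma int_shf: "int (shf c v) = (int v + c) mod int q"
  unfolding shf_def using q_gt0 by simp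

lemma shf_shf [simp]: "shf c (shf d v) = shf (c + d) v"
  by (simp only: of_nat_eq_iff[where 'a=int, symmetric] int_shf)
    (simp add: mod_simps algebra_simps)

lemma shf_0 [simp]: "v < q \<Longrightarrow> shf 0 v = v"
  by (simp add: shf_def)

lemma shf_eq_iff: "shf c v = shf d v \<longleftrightarrow> int q dvd c - d"
proof -
  have "shf c v = shf d v \<longleftrightarrow> (int v + c) mod int q = (int v + d) mod int q"
    by (simp add: of_nat_eq_iff[where 'a=int, symmetric] int_shf)
  also have "\<dots> \<longleftrightarrow> int q dvd c - d" by (simp add: mod_eq_dvd_iff)
  finally show ?thesis .
qed

lemma shf_cong: "int q dvd c - d \<Longrightarrow> shf c = shf d"
  using shf_eq_iff by blast

lemma shf_eq_swap: "v < q \<Longrightarrow> w < q \<Longrightarrow> shf c v = w \<longleftrightarrow> v = shf (- c) w"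
  by auto

lemma digits: obtains v m where "n = v + q * m" "v < q"
  by (rule that[of "n mod q" "n div q"]) simp_all

text \<open>Equations between permutations are proved by induction on the number itself. The number
  0 is its own tail and has to be treated apart.\<close>

lemma tail_less: assumes "n = v + q * m" "n \<noteq> 0" shows "m < n"
proof -
  have "8 * m \<le> q * m" using q_ge8 by (rule mult_le_mono1)
  then show ?thesis using assms by linarith
qed

lemma digit_mod [simp]: "v < q \<Longrightarrow> (v + q * m) mod q = v" by simp
lemma digit_div [simp]: "v < q \<Longrightarrow> (v + q * m) div q = m" by simp
lemma digit_eq [simp]: "v < q \<Longrightarrow> w < q \<Longrightarrow> v + q * m = w + q * n \<longleftrightarrow> v = w \<and> m = n"
  by (metis digit_mod digit_div)

definition rotf :: "int \<Rightarrow> nat \<Rightarrow> nat" where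
  "rotf c n = shf c (n mod q) + q * (n div q)"

lemma rotf_digit [simp]: "v < q \<Longrightarrow> rotf c (v + q * m) = shf c v + q * m"
  by (simp add: rotf_def)

lemma rotf_rotf: "rotf c (rotf d n) = rotf (c + d) n"
  by (simp add: rotf_def)

lemma rotf_0: "rotf 0 n = n"
  by (simp add: rotf_def)

definition rot :: "int \<Rightarrow> nperm" where "rot c = mk_nperm (rotf c)"

lemma ap_rot: "ap (rot c) = rotf c"
  unfolding rot_def by (rule ap_mk[of "rotf (- c)"]) (simp_all add: rotf_rotf rotf_0)

lemma rot_add: "rot c + rot d = rot (c + d)"
  by (rule nperm_eqI) (simp add: ap_rot rotf_rotf)

lemma rot_0: "rot 0 = 0"
  by (rule nperm_eqI) (simp add: ap_rot rotf_0)

lemma rot_minus: "- rot c = rot (- c)"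
  by (rule minus_unique) (simp add: rot_add rot_0)

lemma rot_cong: "int q dvd c - d \<Longrightarrow> rot c = rot d"
  by (rule nperm_eqI) (simp add: ap_rot rotf_def shf_cong)

text \<open>
  Period \<open>q\<^sup>2\<close> in \<open>j\<close>; pairs divisible by \<open>p\<close> are replaced by \<open>(1, 0)\<close>, so that all forms are unimodular.
\<close>

definition coef :: "nat \<Rightarrow> int \<times> int" where
  "coef j = (let u = j mod (q * q); s = u div q; t = u mod q
    in if p dvd s \<and> p dvd t then (1, 0) else (int s, int t))"

definition alpha :: "nat \<Rightarrow> int \<times> int \<Rightarrow> int" where
  "alpha j x = fst (coef j) * fst x + snd (coef j) * snd x"

lemma alpha_add: "alpha j (x + y) = alpha j x + alpha j y"
  by (simp add: alpha_def algebra_simps)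

lemma alpha_0 [simp]: "alpha j 0 = 0"
  by (simp add: alpha_def)

text \<open>Unimodular mod p means that one coefficient is prime to \<open>q\<close>; its inverse
  solves the congruence.\<close>

lemma alpha_onto: "\<exists>x. int q dvd alpha j x - c"
proof -
  have "\<not> (int p dvd fst (coef j) \<and> int p dvd snd (coef j))"
    using p_ge2 by (auto simp: coef_def Let_def)
  then have "coprime (fst (coef j)) (int q) \<or> coprime (snd (coef j)) (int q)"
    using prime_p by (auto simp: q_def coprime_commute intro: prime_imp_coprime)
  then show ?thesis
  proof
    assume "coprime (fst (coef j)) (int q)"
    then obtain u where "[fst (coef j) * u = 1] (mod int q)" using cong_solve_coprime_int by blast
    then have "int q dvd (fst (coef j) * u - 1) * c" by (auto simp: cong_iff_dvd_diff)
    then show ?thesis by (intro exI[of _ "(u * c, 0)"]) (simp add: alpha_def algebra_simps)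
  next
    assume "coprime (snd (coef j)) (int q)"
    then obtain u where "[snd (coef j) * u = 1] (mod int q)" using cong_solve_coprime_int by blast
    then have "int q dvd (snd (coef j) * u - 1) * c" by (auto simp: cong_iff_dvd_diff)
    then show ?thesis by (intro exI[of _ "(0, u * c)"]) (simp add: alpha_def algebra_simps)
  qed
qed

text \<open>Dividing a nonzero pair by its gcd g leaves coprime entries, so the form with
  coefficients \<open>b div g\<close> and \<open>- (a div g)\<close> is unimodular, and it kills the
  pair. It stands somewhere in every period.\<close>

lemma alpha_zero: "\<exists>d. int q dvd alpha (j + d) x"
proof -
  obtain a b where x: "x = (a, b)" by (cases x)
  show ?thesis
  proof (cases "a = 0 \<and> b = 0")
    case True then show ?thesis by (simp add: x alpha_def)
  next
    case False
    define g where "g = gcd a b"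
    define s where "s = nat ((b div g) mod int q)"
    define t where "t = nat ((- (a div g)) mod int q)"
    have st: "int s = (b div g) mod int q" "int t = (- (a div g)) mod int q"
      by (simp_all add: s_def t_def)
    have "int s < int q" "int t < int q" unfolding st by simp_all
    then have lt: "s < q" "t < q" by simp_all
    have cop: "coprime (a div g) (b div g)" using False unfolding g_def by (intro div_gcd_coprime) auto
    have pq: "int p dvd int q" by (simp add: q_def)
    have ndvd: "\<not> (p dvd s \<and> p dvd t)"
    proof
      assume "p dvd s \<and> p dvd t"
      then have "int p dvd (b div g) mod int q" "int p dvd (- (a div g)) mod int q"
        by (simp_all add: st[symmetric])
      then have "int p dvd b div g" "int p dvd - (a div g)" using pq by (simp_all add: dvd_mod_iff)
      then have "int p dvd 1" using cop by (metis coprime_common_divisor dvd_minus_iff)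
      then show False using p_ge2 by simp
    qed
    define u where "u = s * q + t"
    have u: "u div q = s" "u mod q = t" using lt by (auto simp: u_def)
    have "s * q + t < s * q + q" using lt by simp
    also have "\<dots> = (s + 1) * q" by simp
    also have "\<dots> \<le> q * q" using lt by (intro mult_right_mono) auto
    finally have uq: "u < q * q" by (simp add: u_def)
    \<comment> \<open>The distance from \<open>j\<close> to an index not before it that is congruent
      to \<open>u\<close> modulo the period.\<close>
    define d where "d = (q * q - j mod (q * q)) + u"
    have "j mod (q * q) < q * q" by simp
    then have "j + d = q * q * (j div (q * q)) + q * q + u"
      using mult_div_mod_eq[of "q * q" j] unfolding d_def by linarith
    then have "j + d = u + q * q * (j div (q * q) + 1)" by (simp add: algebra_simps)
    then have "(j + d) mod (q * q) = u mod (q * q)" by (simp only: mod_mult_self2)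
    then have "coef (j + d) = (int s, int t)" using uq u ndvd by (auto simp: coef_def Let_def)
    then have "alpha (j + d) x = int s * a + int t * b" by (simp add: alpha_def x)
    also have "\<dots> mod int q = ((b div g) * a + (- (a div g)) * b) mod int q"
      unfolding st by (intro mod_add_cong mod_mult_cong) simp_all
    also have "(b div g) * a + (- (a div g)) * b = 0"
    proof -
      obtain A B where AB: "a div g = A" "b div g = B" "a = A * g" "b = B * g"
        by (metis dvd_div_mult_self g_def gcd_dvd1 gcd_dvd2)
      show ?thesis unfolding AB(1,2) by (simp add: AB(3,4))
    qed
    finally show ?thesis by (intro exI[of _ d]) (simp add: dvd_eq_mod_eq_0)
  qed
qed

text \<open>Every directed element fixes the end 0. The clause for it stops the recursion along the
  digit 0; all other recursive calls are at smaller numbers.\<close>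

function dirf :: "nat \<Rightarrow> int \<times> int \<Rightarrow> nat \<Rightarrow> nat" where
  "dirf j x n = (if n = 0 then 0 else if n mod q = 0 then q * dirf (Suc j) x (n div q)
     else if n mod q = 1 then 1 + q * rotf (alpha j x) (n div q) else n)"
  by pat_completeness auto
termination
  by (relation "Wellfounded.measure (\<lambda>(j, x, n). n)") (use q_ge8 in auto)

declare dirf.simps [simp del]

lemma dirf_digit:
  assumes "v < q"
  shows "dirf j x (v + q * m) = (if v = 0 then q * dirf (Suc j) x m
    else if v = 1 then 1 + q * rotf (alpha j x) m else v + q * m)"
  using assms q_ge8 digit_div[of 1 m] by (subst dirf.simps) (auto simp: dirf.simps[of _ _ 0])

lemma dirf_dirf: "dirf j x (dirf j y n) = dirf j (x + y) n"
proof (induction n arbitrary: j rule: less_induct)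
  case (less n)
  obtain v m where n: "n = v + q * m" "v < q" by (rule digits)
  have IH: "dirf (Suc j) x (dirf (Suc j) y m) = dirf (Suc j) (x + y) m"
  proof (cases "n = 0")
    case True
    then have "m = 0" using n by simp
    then show ?thesis by (simp add: dirf.simps[of _ _ 0])
  next
    case False
    then have "m < n" using n tail_less by blast
    then show ?thesis by (rule less)
  qed
  have z: "dirf j z (q * k) = q * dirf (Suc j) z k" for z k using dirf_digit[of 0 j z k] by simp
  have o: "dirf j z (Suc (q * k)) = Suc (q * rotf (alpha j z) k)" for z k
    using dirf_digit[of 1 j z k] q_ge8 by simp
  show ?case using n IH by (auto simp: dirf_digit z o alpha_add rotf_rotf)
qed

lemma dirf_0: "dirf j 0 n = n"
proof (induction n arbitrary: j rule: less_induct)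
  case (less n)
  obtain v m where n: "n = v + q * m" "v < q" by (rule digits)
  have IH: "dirf (Suc j) 0 m = m"
  proof (cases "n = 0")
    case True
    then have "m = 0" using n by simp
    then show ?thesis by (simp add: dirf.simps[of _ _ 0])
  next
    case False
    then have "m < n" using n tail_less by blast
    then show ?thesis by (rule less)
  qed
  show ?case using n IH by (auto simp: dirf_digit rotf_0)
qed

definition dir :: "nat \<Rightarrow> int \<times> int \<Rightarrow> nperm" where "dir j x = mk_nperm (dirf j x)"

lemma ap_dir: "ap (dir j x) = dirf j x"
  unfolding dir_def by (rule ap_mk[of "dirf j (- x)"]) (simp_all add: dirf_dirf dirf_0)

lemma dir_add: "dir j x + dir j y = dir j (x + y)"
  by (rule nperm_eqI) (simp add: ap_dir dirf_dirf)

lemma dir_0: "dir j 0 = 0"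
  by (rule nperm_eqI) (simp add: ap_dir dirf_0)

lemma dir_minus: "- dir j x = dir j (- x)"
  by (rule minus_unique) (simp add: dir_add dir_0)

text \<open>Left multiplication by letters yields a group because the letters are closed under
  negation. The induction rule then reads an element as a word.\<close>

inductive_set G :: "nat \<Rightarrow> nperm set" for j where
  G_zero: "0 \<in> G j"
| G_rot: "g \<in> G j \<Longrightarrow> rot c + g \<in> G j"
| G_dir: "g \<in> G j \<Longrightarrow> dir j x + g \<in> G j"

lemma rot_G: "rot c \<in> G j" using G_rot[OF G_zero] by simp
lemma dir_G: "dir j x \<in> G j" using G_dir[OF G_zero] by simp

lemma G_add: "g \<in> G j \<Longrightarrow> h \<in> G j \<Longrightarrow> g + h \<in> G j"
  by (induction rule: G.induct) (auto simp: add.assoc intro: G.intros)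

lemma G_minus: "g \<in> G j \<Longrightarrow> - g \<in> G j"
  by (induction rule: G.induct)
    (auto simp: minus_add rot_minus dir_minus intro: G_zero G_add rot_G dir_G simp del: add_uminus_conv_diff)

lemma subgrp_G: "subgrp (G j)"
  by (simp add: subgrp_def G_zero G_add G_minus)

lemma G_least:
  assumes "subgrp S" "\<And>c. rot c \<in> S" "\<And>x. dir j x \<in> S" shows "G j \<subseteq> S"
proof
  show "g \<in> S" if "g \<in> G j" for g
    using that by induction (use assms in \<open>auto intro: subgrp_0 subgrp_add\<close>)
qed

text \<open>
  \<open>g\<close> rotates the first digit by \<open>c\<close> and acts on the tail below the digit \<open>v\<close> as \<open>hs v\<close>.
\<close>

definition sections :: "nperm \<Rightarrow> int \<Rightarrow> (nat \<Rightarrow> nperm) \<Rightarrow> bool" where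
  "sections g c hs \<longleftrightarrow> (\<forall>v<q. \<forall>m. ap g (v + q * m) = shf c v + q * ap (hs v) m)"

lemma sections_0: "sections 0 0 (\<lambda>_. 0)"
  by (simp add: sections_def)

lemma sections_add:
  "sections g c hs \<Longrightarrow> sections g' c' hs' \<Longrightarrow> sections (g + g') (c + c') (\<lambda>v. hs (shf c' v) + hs' v)"
  by (simp add: sections_def)

lemma sections_rot: "sections (rot c) c (\<lambda>_. 0)"
  by (simp add: sections_def ap_rot)

lemma sections_dir:
  "sections (dir j x) 0 (\<lambda>v. if v = 0 then dir (Suc j) x else if v = 1 then rot (alpha j x) else 0)"
  by (auto simp: sections_def ap_dir ap_rot dirf_digit)

lemma sections_minus:
  assumes "sections g c hs" shows "sections (- g) (- c) (\<lambda>v. - hs (shf (- c) v))"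
  unfolding sections_def
proof (intro allI impI)
  fix v m assume v: "v < q"
  have "ap g (shf (- c) v + q * ap (- hs (shf (- c) v)) m) = v + q * m"
    using assms v by (simp add: sections_def)
  then show "ap (- g) (v + q * m) = shf (- c) v + q * ap (- hs (shf (- c) v)) m"
    by (metis ap_minus1)
qed

lemma sections_eqI:
  assumes "sections g c hs" "sections g' c hs'" "\<And>v. v < q \<Longrightarrow> hs v = hs' v" shows "g = g'"
proof (rule nperm_eqI)
  fix n
  obtain v m where n: "n = v + q * m" "v < q" by (rule digits)
  show "ap g n = ap g' n" using assms n by (simp add: sections_def)
qed

lemma sections_unique:
  assumes "sections g c hs" "sections g c' hs'" "v < q" shows "int q dvd c - c'" "hs v = hs' v"
proof -
  have "shf c v + q * ap (hs v) m = shf c' v + q * ap (hs' v) m" for m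
    using assms by (metis sections_def)
  then have "shf c v = shf c' v" "\<And>m. ap (hs v) m = ap (hs' v) m" by auto
  then show "int q dvd c - c'" "hs v = hs' v" by (auto simp: shf_eq_iff intro: nperm_eqI)
qed

lemma sections_shift: "sections g c hs \<Longrightarrow> int q dvd c - c' \<Longrightarrow> sections g c' hs"
  by (simp add: sections_def shf_cong)

lemma sections_G:
  assumes "g \<in> G j"
  obtains c hs where "sections g c hs" "\<And>v. v < q \<Longrightarrow> hs v \<in> G (Suc j)"
proof -
  have "\<exists>c hs. sections g c hs \<and> (\<forall>v<q. hs v \<in> G (Suc j))"
    using assms
  proof induction
    case G_zero then show ?case using sections_0 G.G_zero by blast
  next
    case (G_rot g c)
    then obtain c' hs where "sections g c' hs" "\<forall>v<q. hs v \<in> G (Suc j)" by blast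
    with sections_add[OF sections_rot[of c] this(1)] show ?case by auto
  next
    case (G_dir g x)
    then obtain c hs where h: "sections g c hs" "\<forall>v<q. hs v \<in> G (Suc j)" by blast
    from sections_add[OF sections_dir[of j x] h(1)] show ?case
      by (rule_tac exI, rule_tac exI, rule_tac conjI, assumption)
        (use h in \<open>auto intro!: G_add dir_G rot_G G.G_zero\<close>)
  qed
  then show thesis using that by blast
qed

text \<open>
  \<open>n\<close> counts the directed letters, \<open>b\<close> and \<open>c\<close> are the total exponents of the directed letters and of
  the rotations.
\<close>

inductive words :: "nat \<Rightarrow> nat \<Rightarrow> int \<times> int \<Rightarrow> int \<Rightarrow> nperm \<Rightarrow> bool" for j where
  words_0: "words j 0 0 0 0"
| words_rot: "words j n b c g \<Longrightarrow> words j n b (d + c) (rot d + g)"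
| words_dir: "words j n b c g \<Longrightarrow> words j (Suc n) (x + b) c (dir j x + g)"

lemma words_add:
  "words j n b c g \<Longrightarrow> words j n' b' c' g' \<Longrightarrow> words j (n + n') (b + b') (c + c') (g + g')"
  by (induction rule: words.induct) (auto simp: add.assoc intro: words.intros)

lemma words_G:
  assumes "g \<in> G j" obtains n b c where "words j n b c g"
proof -
  have "\<exists>n b c. words j n b c g"
    using assms by induction (blast intro: words.intros)+
  then show thesis using that by blast
qed

text \<open>A directed letter puts one directed letter into the section at some digit and one
  rotation into the section at the next digit; a rotation letter leaves no trace in the sections. So
  lengths and exponents of the sections add up, and a section whose left neighbour received no
  directed letter contains no rotation.\<close>

lemma words_sections:
  assumes "words j n b c g"
  shows "\<exists>hs nn bb cc. sections g c hs \<and> (\<forall>v<q. words (Suc j) (nn v) (bb v) (cc v) (hs v)) \<and>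
    (\<Sum>v<q. nn v) = n \<and> (\<Sum>v<q. bb v) = b \<and> (\<Sum>v<q. cc v) = alpha j b \<and>
    (\<forall>v<q. nn (shf (- 1) v) = 0 \<longrightarrow> hs v = dir (Suc j) (bb v))"
  using assms
proof induction
  case words_0
  show ?case
    by (rule exI[of _ "\<lambda>_. 0"], rule exI[of _ "\<lambda>_. 0"], rule exI[of _ "\<lambda>_. 0"], rule exI[of _ "\<lambda>_. 0"])
      (simp add: sections_0 words.words_0 dir_0)
next
  case (words_rot n b c g d)
  then obtain hs nn bb cc where h: "sections g c hs" "\<forall>v<q. words (Suc j) (nn v) (bb v) (cc v) (hs v)"
    "(\<Sum>v<q. nn v) = n" "(\<Sum>v<q. bb v) = b" "(\<Sum>v<q. cc v) = alpha j b"
    "\<forall>v<q. nn (shf (- 1) v) = 0 \<longrightarrow> hs v = dir (Suc j) (bb v)" by blast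
  have "sections (rot d + g) (d + c) hs" using sections_add[OF sections_rot[of d] h(1)] by simp
  with h(2-) show ?case by blast
next
  case (words_dir n b c g x)
  then obtain hs nn bb cc where h: "sections g c hs" "\<forall>v<q. words (Suc j) (nn v) (bb v) (cc v) (hs v)"
    "(\<Sum>v<q. nn v) = n" "(\<Sum>v<q. bb v) = b" "(\<Sum>v<q. cc v) = alpha j b"
    "\<forall>v<q. nn (shf (- 1) v) = 0 \<longrightarrow> hs v = dir (Suc j) (bb v)" by blast
  \<comment> \<open>The rotation by \<open>c\<close> acts first and carries these digits to 0 and 1,
    the two places where \<open>dir j x\<close> acts below the first digit.\<close>
  define v0 v1 where "v0 = shf (- c) 0" and "v1 = shf (- c) 1"
  have v: "v0 < q" "v1 < q" by (simp_all add: v0_def v1_def)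
  have sh: "shf c w = 0 \<longleftrightarrow> w = v0" "shf c w = 1 \<longleftrightarrow> w = v1" if "w < q" for w
    using that q_ge8 by (simp_all add: shf_eq_swap v0_def v1_def)
  have ne: "v0 \<noteq> v1" using sh(1)[OF v(1)] sh(2)[OF v(2)] by auto
  have "shf (- 1 - c) 1 = shf (- c) 0"
    by (simp only: of_nat_eq_iff[where 'a=int, symmetric] int_shf) simp
  then have v01: "v0 = shf (- 1) v1" by (simp add: v0_def v1_def)
  define hs' where "hs' v = (if v = v0 then dir (Suc j) x else if v = v1 then rot (alpha j x) else 0) + hs v" for v
  define nn' where "nn' v = (if v = v0 then 1 else 0) + nn v" for v
  define bb' where "bb' v = (if v = v0 then x else 0) + bb v" for v
  define cc' where "cc' v = (if v = v1 then alpha j x else 0) + cc v" for v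
  have "sections (dir j x + g) c hs'"
    using sections_add[OF sections_dir[of j x] h(1)]
    unfolding sections_def hs'_def using sh by simp
  moreover have "words (Suc j) (nn' v) (bb' v) (cc' v) (hs' v)" if "v < q" for v
    using h(2) that ne words.words_dir words.words_rot
    by (auto simp: nn'_def bb'_def cc'_def hs'_def)
  moreover have "(\<Sum>v<q. nn' v) = Suc n" "(\<Sum>v<q. bb' v) = x + b" "(\<Sum>v<q. cc' v) = alpha j (x + b)"
    using v h(3-5) by (simp_all add: nn'_def bb'_def cc'_def sum.distrib alpha_add)
  moreover have "hs' w = dir (Suc j) (bb' w)" if w: "w < q" "nn' (shf (- 1) w) = 0" for w
  proof -
    have "shf (- 1) w \<noteq> v0" "nn (shf (- 1) w) = 0" using w by (auto simp: nn'_def split: if_splits)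
    then have "w \<noteq> v1" "hs w = dir (Suc j) (bb w)" using v01 h(6) w by auto
    then show ?thesis by (simp add: hs'_def bb'_def dir_add)
  qed
  ultimately show ?case by blast
qed

section \<open>Every element of the spinal group has p-power order\<close>

lemma sections_nm:
  assumes "sections g c hs" shows "sections (nm s g) (int s * c) (\<lambda>v. rec_nat 0 (\<lambda>i h. hs (shf (int i * c) v) + h) s)"
proof (induction s)
  case 0 show ?case using sections_0 by simp
next
  case (Suc s)
  show ?case using sections_add[OF assms Suc] by (simp add: algebra_simps)
qed

text \<open>There are only \<open>q\<close> sections, so one power of p kills them all, and an
  element fixing the first digit is zero as soon as its sections are.\<close>

lemma p_torsion_sections:
  assumes g: "sections (nm (p ^ e) g) 0 hs" and t: "\<And>v. v < q \<Longrightarrow> p_torsion p (hs v)"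
  shows "p_torsion p g"
proof -
  obtain m where m: "\<And>v. v < q \<Longrightarrow> nm (p ^ m v) (hs v) = 0" using t unfolding p_torsion_def by metis
  define M where "M = (\<Sum>v<q. m v)"
  have M: "nm (p ^ M) (hs v) = 0" if v: "v < q" for v
  proof -
    have "m v \<le> M" unfolding M_def using v by (intro member_le_sum) auto
    then have "p ^ M = p ^ (M - m v) * p ^ m v" by (simp flip: power_add)
    then show ?thesis using m[OF v] by (simp flip: nm_mult)
  qed
  have r: "rec_nat 0 (\<lambda>i h. x + h) s = nm s x" for s and x :: nperm
    by (induction s) simp_all
  have "sections (nm (p ^ M) (nm (p ^ e) g)) 0 (\<lambda>v. nm (p ^ M) (hs v))"
    using sections_nm[OF g, of "p ^ M"] by (simp add: r sections_def)
  then have "nm (p ^ M) (nm (p ^ e) g) = 0"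
    by (rule sections_eqI[OF _ sections_0]) (simp add: M)
  then show ?thesis unfolding p_torsion_def nm_mult power_add[symmetric] by blast
qed

lemma dir_nm: "nm s (dir j x) = dir j (of_nat s * fst x, of_nat s * snd x)"
  by (induction s; cases x) (simp_all add: dir_0[unfolded zero_prod_def] dir_add algebra_simps)

lemma dir_cong:
  assumes "int q dvd fst x - fst y" "int q dvd snd x - snd y" shows "dir j x = dir j y"
proof -
  have alpha: "int q dvd alpha i x - alpha i y" for i
  proof -
    have "alpha i x - alpha i y = fst (coef i) * (fst x - fst y) + snd (coef i) * (snd x - snd y)"
      by (simp add: alpha_def algebra_simps)
    then show ?thesis using assms by simp
  qed
  have "dirf j x n = dirf j y n" for n
  proof (induction n arbitrary: j rule: less_induct)
    case (less n)
    obtain v m where n: "n = v + q * m" "v < q" by (rule digits)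
    have IH: "dirf (Suc j) x m = dirf (Suc j) y m"
    proof (cases "n = 0")
      case True
      then have "m = 0" using n by simp
      then show ?thesis by (simp add: dirf.simps[of _ _ 0])
    next
      case False
      then have "m < n" using n tail_less by blast
      then show ?thesis by (rule less)
    qed
    show ?case using n IH alpha[of j] by (simp add: dirf_digit rotf_def shf_cong)
  qed
  then have "dirf j x = dirf j y" by (rule ext)
  then show ?thesis by (simp add: dir_def)
qed

lemma p_torsion_dir: "p_torsion p (dir j x)"
proof -
  have "nm (p ^ 3) (dir j x) = dir j 0"
    unfolding dir_nm by (rule dir_cong) (simp_all add: q_def)
  then show ?thesis unfolding p_torsion_def dir_0 by blast
qed

lemma words_power:
  assumes "\<And>i. i < s \<Longrightarrow> words j (nn (f i)) (bb (f i)) (cc (f i)) (hs (f i))"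
  shows "words j (\<Sum>i<s. nn (f i)) (\<Sum>i<s. bb (f i)) (\<Sum>i<s. cc (f i))
    (rec_nat 0 (\<lambda>i h. hs (f i) + h) s)"
  using assms
proof (induction s)
  case 0 show ?case by (simp add: words_0)
next
  case (Suc s)
  have "words j (nn (f s) + (\<Sum>i<s. nn (f i))) (bb (f s) + (\<Sum>i<s. bb (f i)))
    (cc (f s) + (\<Sum>i<s. cc (f i))) (hs (f s) + rec_nat 0 (\<lambda>i h. hs (f i) + h) s)"
    using Suc by (intro words_add) auto
  then show ?case by (simp add: add_ac)
qed

lemma shf_inj_coprime:
  assumes s: "\<And>i::int. int q dvd i * c \<Longrightarrow> int s dvd i"
  shows "inj_on (\<lambda>i. shf (int i * c) v) {..<s}"
proof
  fix i i' assume "i \<in> {..<s}" "i' \<in> {..<s}" "shf (int i * c) v = shf (int i' * c) v"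
  then have lt: "i < s" "i' < s" "int q dvd (int i - int i') * c" by (auto simp: shf_eq_iff algebra_simps)
  then have "int s dvd int i - int i'" using s by blast
  moreover have "\<bar>int i - int i'\<bar> < int s" using lt by linarith
  ultimately have "int i - int i' = 0" using dvd_imp_le_int[of "int i - int i'" "int s"] by auto
  then show "i = i'" by simp
qed

text \<open>A rotation prime to p runs through all digits in one cycle, so each section of the
  \<open>q\<close>-fold multiple is the sum of all sections of g in some order. The word gets no
  shorter, but its rotation exponent becomes \<open>alpha j b\<close>.\<close>

lemma unit_step:
  assumes w: "words j n b c g" and c: "\<not> int p dvd c"
  shows "\<exists>hs. sections (nm (p ^ 3) g) 0 hs \<and> (\<forall>v<q. words (Suc j) n b (alpha j b) (hs v))"
proof -
  obtain hs nn bb cc where h: "sections g c hs" "\<forall>v<q. words (Suc j) (nn v) (bb v) (cc v) (hs v)"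
    "(\<Sum>v<q. nn v) = n" "(\<Sum>v<q. bb v) = b" "(\<Sum>v<q. cc v) = alpha j b"
    using words_sections[OF w] by blast
  have "coprime (int q) c" using prime_p c by (auto simp: q_def intro: prime_imp_coprime)
  then have inj: "inj_on (\<lambda>i. shf (int i * c) v) {..<q}" for v
    by (intro shf_inj_coprime) (simp add: coprime_dvd_mult_left_iff)
  then have img: "(\<lambda>i. shf (int i * c) v) ` {..<q} = {..<q}" for v
    by (intro card_subset_eq) (auto simp: card_image)
  have sum: "(\<Sum>i<q. f (shf (int i * c) v)) = (\<Sum>w<q. f w)" for f :: "nat \<Rightarrow> 'a::comm_monoid_add" and v
    using sum.reindex[OF inj[of v], of f] by (simp add: img)
  define H where "H v = rec_nat 0 (\<lambda>i h. hs (shf (int i * c) v) + h) q" for v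
  have "words (Suc j) n b (alpha j b) (H v)" for v
    using words_power[of q "Suc j" nn "\<lambda>i. shf (int i * c) v" bb cc hs] h(2-)
    unfolding H_def sum by simp
  moreover have "sections (nm q g) 0 H"
    by (rule sections_shift[OF sections_nm[OF h(1), of q, folded H_def]]) simp
  then have "sections (nm (p ^ 3) g) 0 H" by (simp only: q_def)
  ultimately show ?thesis by blast
qed

text \<open>The sections of a suitable multiple are sums along orbits of the rotation. An orbit that
  carries fewer than n directed letters falls under the induction hypothesis. If an orbit carries
  all n letters, then, as its digits agree mod p, their left neighbours lie outside it and carry
  none; the sections along it are directed elements, which are known to be torsion.\<close>

lemma nonunit_step:
  assumes w: "words j n b c g" and c: "int p dvd c"
    and IH: "\<And>n' j b c g. n' < n \<Longrightarrow> words j n' b c g \<Longrightarrow> p_torsion p g"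
  shows "p_torsion p g"
proof -
  obtain hs nn bb cc where h: "sections g c hs" "\<forall>v<q. words (Suc j) (nn v) (bb v) (cc v) (hs v)"
    "(\<Sum>v<q. nn v) = n" "\<forall>v<q. nn (shf (- 1) v) = 0 \<longrightarrow> hs v = dir (Suc j) (bb v)"
    using words_sections[OF w] by blast
  define d where "d = gcd c (int q)"
  have d0: "d > 0" using q_gt0 by (simp add: d_def)
  \<comment> \<open>The order of the rotation by \<open>c\<close>, a power of p.\<close>
  define s where "s = nat (int q div d)"
  have ds: "int q = d * int s" using d0 by (simp add: s_def d_def pos_imp_zdiv_nonneg_iff)
  have "int s dvd int q" by (simp add: ds)
  then have "s dvd p ^ 3" by (simp only: of_nat_dvd_iff q_def)
  then obtain e where e: "s = p ^ e" using prime_p by (auto simp: divides_primepow_nat)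
  have c': "c = d * (c div d)" by (simp add: d_def)
  have "coprime (c div d) (int q div d)" unfolding d_def by (rule div_gcd_coprime) (use q_gt0 in auto)
  then have cop: "coprime (int s) (c div d)" using d0 by (simp add: ds coprime_commute)
  have key: "int s dvd i" if "int q dvd i * c" for i
  proof -
    have "d * int s dvd d * (i * (c div d))" using that c' ds by (metis mult.left_commute)
    then have "int s dvd i * (c div d)" using d0 by simp
    then show ?thesis using cop by (simp add: coprime_dvd_mult_left_iff)
  qed
  have inj: "inj_on (\<lambda>i. shf (int i * c) v) {..<s}" for v
    by (rule shf_inj_coprime) (rule key)
  have "int q dvd int s * c"
  proof -
    have "int s * c = int q * (c div d)" using c' ds by (metis mult.assoc mult.commute)
    then show ?thesis by simp
  qed
  then have "sections (nm s g) 0 (\<lambda>v. rec_nat 0 (\<lambda>i h. hs (shf (int i * c) v) + h) s)"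
    using sections_shift[OF sections_nm[OF h(1), of s], of 0] by simp
  then have sc: "sections (nm (p ^ e) g) 0 (\<lambda>v. rec_nat 0 (\<lambda>i h. hs (shf (int i * c) v) + h) s)"
    unfolding e[symmetric] .
  show ?thesis
  proof (rule p_torsion_sections[OF sc])
    fix v assume v: "v < q"
    let ?O = "(\<lambda>i. shf (int i * c) v) ` {..<s}"
    define N where "N = (\<Sum>i<s. nn (shf (int i * c) v))"
    have N: "N = (\<Sum>w\<in>?O. nn w)" unfolding N_def using sum.reindex[OF inj[of v], of nn] by simp
    have Oq: "?O \<subseteq> {..<q}" by auto
    have split: "n = N + (\<Sum>w\<in>{..<q} - ?O. nn w)"
      unfolding N h(3)[symmetric] using sum.subset_diff[OF Oq, of nn] by (simp add: add.commute)
    show "p_torsion p (rec_nat 0 (\<lambda>i h. hs (shf (int i * c) v) + h) s)"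
    proof (cases "N < n")
      case True
      have "words (Suc j) N (\<Sum>i<s. bb (shf (int i * c) v)) (\<Sum>i<s. cc (shf (int i * c) v))
          (rec_nat 0 (\<lambda>i h. hs (shf (int i * c) v) + h) s)"
        unfolding N_def
        by (rule words_power[of s "Suc j" nn "\<lambda>i. shf (int i * c) v" bb cc hs]) (use h(2) in simp)
      then show ?thesis by (rule IH[OF True])
    next
      case False
      then have "(\<Sum>w\<in>{..<q} - ?O. nn w) = 0" using split by simp
      then have z: "nn w = 0" if "w < q" "w \<notin> ?O" for w using that by simp
      have hs: "hs (shf (int i * c) v) = dir (Suc j) (bb (shf (int i * c) v))" for i
      proof -
        have "shf (- 1) (shf (int i * c) v) \<notin> ?O"
        proof
          assume "shf (- 1) (shf (int i * c) v) \<in> ?O"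
          then obtain i' where "shf (- 1 + int i * c) v = shf (int i' * c) v" by auto
          then have "int q dvd - 1 + int i * c - int i' * c" by (simp add: shf_eq_iff)
          moreover have "int p dvd int q" by (simp add: q_def)
          ultimately have "int p dvd - 1 + int i * c - int i' * c" using dvd_trans by blast
          moreover have "int p dvd int i * c - int i' * c" using c by simp
          ultimately have "int p dvd (- 1 + int i * c - int i' * c) - (int i * c - int i' * c)" by (rule dvd_diff)
          then have "int p dvd 1" by simp
          then show False using p_ge2 by simp
        qed
        then have "nn (shf (- 1) (shf (int i * c) v)) = 0" by (intro z) simp_all
        then show ?thesis using h(4) by simp
      qed
      have "rec_nat 0 (\<lambda>i h. hs (shf (int i * c) v) + h) k = dir (Suc j) (\<Sum>i<k. bb (shf (int i * c) v))" for k
        by (induction k) (simp_all add: dir_0 hs dir_add add.commute)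
      then show ?thesis using p_torsion_dir by simp
    qed
  qed
qed

text \<open>Induction on n, and inside it on the distance d to a form that kills b.
  \<open>unit_step\<close> keeps n and b and lowers d. At d = 0 the sections it produces have a
  rotation exponent divisible by p, so \<open>nonunit_step\<close> applies to them.\<close>

theorem words_p_torsion: "words j n b c g \<Longrightarrow> p_torsion p g"
proof (induction n arbitrary: j b c g rule: less_induct)
  case (less n)
  have "p_torsion p g" if "int q dvd alpha (j + d) b" "words j n b c g" for d j b c g
    using that
  proof (induction d arbitrary: j c g)
    case 0
    show ?case
    proof (cases "int p dvd c")
      case True then show ?thesis using nonunit_step[OF 0(2)] less.IH by blast
    next
      case False
      obtain hs where hs: "sections (nm (p ^ 3) g) 0 hs" "\<forall>v<q. words (Suc j) n b (alpha j b) (hs v)"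
        using unit_step[OF 0(2) False] by blast
      have "int p dvd alpha j b" using 0(1) by (auto simp: q_def elim: dvd_trans[rotated])
      then show ?thesis using hs nonunit_step less.IH by (intro p_torsion_sections[OF hs(1)]) blast
    qed
  next
    case (Suc d)
    show ?case
    proof (cases "int p dvd c")
      case True then show ?thesis using nonunit_step[OF Suc.prems(2)] less.IH by blast
    next
      case False
      obtain hs where hs: "sections (nm (p ^ 3) g) 0 hs" "\<forall>v<q. words (Suc j) n b (alpha j b) (hs v)"
        using unit_step[OF Suc.prems(2) False] by blast
      show ?thesis
        by (rule p_torsion_sections[OF hs(1)], rule Suc.IH[of "Suc j"]) (use Suc.prems hs in auto)
    qed
  qed
  then show ?case using alpha_zero less.prems by blast
qed

lemma G_p_torsion: "g \<in> G j \<Longrightarrow> p_torsion p g"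
  using words_G words_p_torsion by metis

end

section \<open>Branching\<close>

lemma cov_image:
  assumes "cov n L W" and f: "\<And>x y. f (x + y) = f x + f y"
  shows "cov n (f ` L) (f ` W)"
proof -
  obtain F where F: "finite F" "card F \<le> n" "\<And>x. x \<in> L \<Longrightarrow> \<exists>f\<in>F. - f + x \<in> W"
    using assms(1) unfolding cov_def by auto
  have "f 0 + f 0 = f 0 + 0" by (simp add: f[symmetric])
  then have "f 0 = 0" by (rule add_left_imp_eq)
  then have m: "f (- x) = - f x" for x by (metis f add_eq_0_iff right_minus)
  have "\<exists>e\<in>f ` F. - e + f x \<in> f ` W" if x: "x \<in> L" for x
  proof -
    obtain e where "e \<in> F" "- e + x \<in> W" using F(3)[OF x] by blast
    then have "f (- e + x) \<in> f ` W" "f e \<in> f ` F" by blast+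
    then show ?thesis unfolding f m by blast
  qed
  then show ?thesis unfolding cov_def using F card_image_le[OF F(1), of f]
    by (intro exI[of _ "f ` F"]) auto
qed

lemma subgrp_commuting_sum:
  assumes A: "subgrp A" and B: "subgrp B"
    and comm: "\<And>a b. a \<in> A \<Longrightarrow> b \<in> B \<Longrightarrow> a + b = b + a"
  shows "subgrp {a + b | a b. a \<in> A \<and> b \<in> B}"
  unfolding subgrp_def
proof (intro conjI ballI)
  show "0 \<in> {a + b | a b. a \<in> A \<and> b \<in> B}" using subgrp_0[OF A] subgrp_0[OF B] by force
next
  fix x y assume "x \<in> {a + b | a b. a \<in> A \<and> b \<in> B}" "y \<in> {a + b | a b. a \<in> A \<and> b \<in> B}"
  then obtain a b a' b' where x: "x = a + b" "a \<in> A" "b \<in> B" and y: "y = a' + b'" "a' \<in> A" "b' \<in> B"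
    by blast
  have "x + y = a + (b + a') + b'" by (simp add: x y add.assoc)
  also have "b + a' = a' + b" using comm[of a' b] x y by simp
  finally have "x + y = (a + a') + (b + b')" by (simp add: add.assoc)
  then show "x + y \<in> {a + b | a b. a \<in> A \<and> b \<in> B}"
    using subgrp_add[OF A x(2) y(2)] subgrp_add[OF B x(3) y(3)] by blast
next
  fix x assume "x \<in> {a + b | a b. a \<in> A \<and> b \<in> B}"
  then obtain a b where x: "x = a + b" "a \<in> A" "b \<in> B" by blast
  have "- x = - (b + a)" using comm[OF x(2,3)] x by simp
  then have "- x = - a + - b" by (simp add: minus_add)
  then show "- x \<in> {a + b | a b. a \<in> A \<and> b \<in> B}"
    using subgrp_minus[OF A x(2)] subgrp_minus[OF B x(3)] by blast
qed

lemma gen_Suc: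
  fixes f :: "nat \<Rightarrow> 'g::group_add set"
  assumes f: "\<And>x. x \<le> m \<Longrightarrow> subgrp (f x)"
    and comm: "\<And>x a b. x < m \<Longrightarrow> a \<in> f x \<Longrightarrow> b \<in> f m \<Longrightarrow> a + b = b + a"
  shows "gen (\<Union>x<Suc m. f x) \<subseteq> {a + b | a b. a \<in> gen (\<Union>x<m. f x) \<and> b \<in> f m}"
proof (rule gen_least)
  show "subgrp {a + b | a b. a \<in> gen (\<Union>x<m. f x) \<and> b \<in> f m}"
  proof (rule subgrp_commuting_sum[OF subgrp_gen f])
    fix a b assume a: "a \<in> gen (\<Union>x<m. f x)" and b: "b \<in> f m"
    show "a + b = b + a"
    proof (rule gen_commute1[OF _ a])
      fix a assume "a \<in> (\<Union>x<m. f x)"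
      then obtain x where "x < m" "a \<in> f x" by blast
      then show "a + b = b + a" using b by (intro comm[of x])
    qed
  qed simp
  show "(\<Union>x<Suc m. f x) \<subseteq> {a + b | a b. a \<in> gen (\<Union>x<m. f x) \<and> b \<in> f m}"
  proof
    fix z assume "z \<in> (\<Union>x<Suc m. f x)"
    then have "z \<in> (\<Union>x<m. f x) \<or> z \<in> f m" by (auto simp: less_Suc_eq)
    then show "z \<in> {a + b | a b. a \<in> gen (\<Union>x<m. f x) \<and> b \<in> f m}"
    proof
      assume "z \<in> (\<Union>x<m. f x)"
      then have zg: "z \<in> gen (\<Union>x<m. f x)" by (rule subsetD[OF gen_incl])
      then have "z + 0 \<in> {a + b | a b. a \<in> gen (\<Union>x<m. f x) \<and> b \<in> f m}"
        using subgrp_0[OF f[of m]] zg by (intro CollectI exI conjI) auto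
      then show ?thesis by simp
    next
      assume "z \<in> f m"
      then have "0 + z \<in> {a + b | a b. a \<in> gen (\<Union>x<m. f x) \<and> b \<in> f m}"
        using subgrp_0[OF subgrp_gen] by (intro CollectI exI conjI) auto
      then show ?thesis by simp
    qed
  qed
qed

lemma cov_gen_commuting:
  fixes f :: "nat \<Rightarrow> 'g::group_add set"
  assumes "subgrp W" "\<And>x. x < m \<Longrightarrow> subgrp (f x)" "\<And>x. x < m \<Longrightarrow> cov (n x) (f x) W"
    and "\<And>x y a b. x < y \<Longrightarrow> y < m \<Longrightarrow> a \<in> f x \<Longrightarrow> b \<in> f y \<Longrightarrow> a + b = b + a"
  shows "cov (\<Prod>x<m. n x) (gen (\<Union>x<m. f x)) W"
  using assms(2-)
proof (induction m)
  case 0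
  have "gen {} \<subseteq> {0::'g}" by (rule gen_least[OF subgrp_zero]) simp
  then show ?case using cov_one[OF assms(1)] subgrp_0[OF assms(1)] by auto
next
  case (Suc m)
  have c: "cov ((\<Prod>x<m. n x) * n m) {a + b | a b. a \<in> gen (\<Union>x<m. f x) \<and> b \<in> f m} W"
  proof (rule cov_commuting_sum[OF Suc.IH _ subgrp_gen _ assms(1)])
    fix a b assume a: "a \<in> gen (\<Union>x<m. f x)" and b: "b \<in> f m"
    show "a + b = b + a"
    proof (rule gen_commute1[OF _ a])
      fix a assume "a \<in> (\<Union>x<m. f x)"
      then obtain x where "x < m" "a \<in> f x" by blast
      then show "a + b = b + a" using b by (intro Suc.prems(3)[of x m]) auto
    qed
  next
    fix x y a b assume "x < y" "y < m" "a \<in> f x" "b \<in> f y"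
    then show "a + b = b + a" by (intro Suc.prems(3)[of x y]) auto
  qed (simp_all add: Suc.prems(1,2))
  have s: "gen (\<Union>x<Suc m. f x) \<subseteq> {a + b | a b. a \<in> gen (\<Union>x<m. f x) \<and> b \<in> f m}"
  proof (rule gen_Suc)
    fix x a b assume "x < m" "a \<in> f x" "b \<in> f m"
    then show "a + b = b + a" by (intro Suc.prems(3)[of x m]) auto
  qed (simp add: Suc.prems(1))
  have "prod n {..<Suc m} = (\<Prod>x<m. n x) * n m" by simp
  then show ?case using cov_mono[OF c order_refl s order_refl] by presburger
qed

text \<open>These elements centralize \<open>s\<close> modulo \<open>T\<close>, without forming the
  quotient. Commutator relations modulo \<open>T\<close> can thus be checked on generators.\<close>

lemma subgrp_commutes_mod:
  assumes T: "subgrp T" and G: "subgrp G" and nrm: "\<And>g t. g \<in> G \<Longrightarrow> t \<in> T \<Longrightarrow> g + t - g \<in> T"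
  shows "subgrp {g \<in> G. g + s - g - s \<in> T}"
  unfolding subgrp_def
proof (intro conjI ballI CollectI)
  show "0 + s - 0 - s \<in> T" by (simp add: subgrp_0[OF T])
next
  fix x y assume "x \<in> {g \<in> G. g + s - g - s \<in> T}" "y \<in> {g \<in> G. g + s - g - s \<in> T}"
  then have xy: "x \<in> G" "x + s - x - s \<in> T" "y \<in> G" "y + s - y - s \<in> T" by auto
  have "x + (y + s - y - s) - x + (x + s - x - s) \<in> T" using xy by (intro subgrp_add[OF T] nrm)
  then show "(x + y) + s - (x + y) - s \<in> T"
    by (simp add: grp_simps del: add_uminus_conv_diff)
next
  fix x assume "x \<in> {g \<in> G. g + s - g - s \<in> T}"
  then have x: "x \<in> G" "x + s - x - s \<in> T" by auto
  have "- x + - (x + s - x - s) - (- x) \<in> T"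
    using x by (intro nrm subgrp_minus[OF T] subgrp_minus[OF G])
  then show "- x + s - (- x) - s \<in> T"
    by (simp add: grp_simps del: add_uminus_conv_diff)
qed (use subgrp_0[OF G] subgrp_add[OF G] subgrp_minus[OF G] in auto)

context spinal
begin

text \<open>\<open>g\<close> acting below the vertex \<open>r < q ^ l\<close> of level \<open>l\<close>.\<close>

definition below :: "nat \<Rightarrow> nat \<Rightarrow> nperm \<Rightarrow> nperm" where
  "below l r g = mk_nperm (\<lambda>n. if n mod q ^ l = r then r + q ^ l * ap g (n div q ^ l) else n)"

lemma level_mod [simp]: "r < q ^ l \<Longrightarrow> (r + q ^ l * m) mod q ^ l = r" by simp
lemma level_div [simp]: "r < q ^ l \<Longrightarrow> (r + q ^ l * m) div q ^ l = m" by simp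
lemma qpow_gt0 [simp]: "q ^ l > 0" by simp

lemma ap_below: "ap (below l r g) n = (if n mod q ^ l = r then r + q ^ l * ap g (n div q ^ l) else n)"
proof -
  have id: "r + q ^ l * (n div q ^ l) = n" if "n mod q ^ l = r" for n
    using that by (metis mod_mult_div_eq add.commute)
  have lt: "r < q ^ l" if "n mod q ^ l = r" for n using that by (metis mod_less_divisor qpow_gt0)
  show ?thesis unfolding below_def
    by (subst ap_mk[of "\<lambda>n. if n mod q ^ l = r then r + q ^ l * ap (- g) (n div q ^ l) else n"])
      (use id lt in auto)
qed

lemma below_add: "below l r (g + h) = below l r g + below l r h"
proof (rule nperm_eqI)
  fix n
  have lt: "r < q ^ l" if "n mod q ^ l = r" using that by (metis mod_less_divisor qpow_gt0)
  show "ap (below l r (g + h)) n = ap (below l r g + below l r h) n" using lt by (simp add: ap_below)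
qed

lemma below_0 [simp]: "below l r 0 = 0"
proof -
  have "below l r 0 + below l r 0 = below l r 0 + 0" by (simp add: below_add[symmetric])
  then show ?thesis by (rule add_left_imp_eq)
qed

lemma below_minus: "below l r (- g) = - below l r g"
  by (rule minus_unique[symmetric]) (simp add: below_add[symmetric])

lemma below_top [simp]: "below 0 0 g = g"
  by (rule nperm_eqI) (simp add: ap_below)

lemma subgrp_below: "subgrp S \<Longrightarrow> subgrp (below l r ` S)"
  by (auto simp: subgrp_def image_iff below_add[symmetric] below_minus[symmetric] intro!: bexI)

lemma child_lt: assumes "r < q ^ l" "x < q" shows "r + q ^ l * x < q ^ Suc l"
proof -
  have "r + q ^ l * x < q ^ l + q ^ l * x" using assms by simp
  also have "\<dots> = q ^ l * Suc x" by simp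
  also have "\<dots> \<le> q ^ l * q" using assms by (intro mult_le_mono2) auto
  finally show ?thesis by (simp add: mult.commute)
qed

lemma child_split: assumes "w < q ^ Suc l"
  obtains r x where "w = r + q ^ l * x" "r < q ^ l" "x < q"
proof (rule that[of "w mod q ^ l" "w div q ^ l"])
  show "w div q ^ l < q" using assms by (simp add: less_mult_imp_div_less mult.commute)
qed simp_all

lemma child_mod:
  assumes "r < q ^ l" "x < q"
  shows "n mod q ^ Suc l = r + q ^ l * x \<longleftrightarrow> n mod q ^ l = r \<and> n div q ^ l mod q = x"
proof -
  have eq: "n mod q ^ Suc l = n mod q ^ l + q ^ l * (n div q ^ l mod q)"
    using mod_mult2_eq[of n "q ^ l" q] by (simp add: mult.commute)
  show ?thesis unfolding eq
  proof
    assume h: "n mod q ^ l + q ^ l * (n div q ^ l mod q) = r + q ^ l * x"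
    have "(n mod q ^ l + q ^ l * (n div q ^ l mod q)) mod q ^ l = n mod q ^ l"
      "(n mod q ^ l + q ^ l * (n div q ^ l mod q)) div q ^ l = n div q ^ l mod q"
      by (intro level_mod level_div; simp)+
    then show "n mod q ^ l = r \<and> n div q ^ l mod q = x" unfolding h using assms by simp
  qed auto
qed

lemma below_below: assumes "r < q ^ l" "x < q"
  shows "below l r (below 1 x g) = below (Suc l) (r + q ^ l * x) g"
proof (rule nperm_eqI)
  fix n
  have "q ^ Suc l = q ^ l * q" by simp
  then have "n div q ^ Suc l = n div q ^ l div q" by (simp only: div_mult2_eq)
  then show "ap (below l r (below 1 x g)) n = ap (below (Suc l) (r + q ^ l * x) g) n"
    unfolding ap_below child_mod[OF assms] power_one_right
    by (auto simp: algebra_simps)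
qed

lemma sections_below: "v < q \<Longrightarrow> sections (below 1 v h) 0 (\<lambda>w. if w = v then h else 0)"
  by (auto simp: sections_def ap_below)

lemma below_conj:
  assumes "sections g c hs" "v < q"
  shows "g + below 1 v h - g = below 1 (shf c v) (hs v + h - hs v)"
proof -
  have "g + below 1 v h = below 1 (shf c v) (hs v + h - hs v) + g"
  proof (rule sections_eqI)
    show "sections (g + below 1 v h) c (\<lambda>w. hs w + (if w = v then h else 0))"
      using sections_add[OF assms(1) sections_below[OF assms(2)], of h] by (simp add: sections_def)
    show "sections (below 1 (shf c v) (hs v + h - hs v) + g) c
      (\<lambda>w. (if shf c w = shf c v then hs v + h - hs v else 0) + hs w)"
      using sections_add[OF sections_below[OF shf_lt] assms(1)] by simp
    fix w assume "w < q"
    then have "shf c w = shf c v \<longleftrightarrow> w = v" using assms(2) by (metis shf_0 shf_shf add.left_inverse)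
    then show "hs w + (if w = v then h else 0) = (if shf c w = shf c v then hs v + h - hs v else 0) + hs w"
      by simp
  qed
  then show ?thesis by simp
qed

section \<open>Derived subgroups and branching\<close>

abbreviation K :: "nat \<Rightarrow> nperm set" where "K j \<equiv> comm_gp (G j)"

lemma subgrp_K: "subgrp (K j)" by (rule subgrp_comm_gp)

lemma K_G: "K j \<subseteq> G j" by (rule comm_gp_sub[OF subgrp_G])

lemma K_conj: "g \<in> G j \<Longrightarrow> k \<in> K j \<Longrightarrow> g + k - g \<in> K j"
  by (rule comm_gp_conj_self[OF subgrp_G])

lemma KK_conj: "g \<in> G j \<Longrightarrow> k \<in> comm_gp (K j) \<Longrightarrow> g + k - g \<in> comm_gp (K j)"
  by (rule comm_gp_conj) (rule K_conj)

definition Stab :: "nat \<Rightarrow> nperm set" where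
  "Stab j = {g \<in> G j. \<exists>hs. sections g 0 hs}"

lemma subgrp_Stab: "subgrp (Stab j)"
  unfolding subgrp_def Stab_def
proof (intro conjI ballI CollectI)
  fix x y assume "x \<in> {g \<in> G j. \<exists>hs. sections g 0 hs}" "y \<in> {g \<in> G j. \<exists>hs. sections g 0 hs}"
  then obtain hs hs' where "sections x 0 hs" "sections y 0 hs'" by blast
  from sections_add[OF this] show "\<exists>hs. sections (x + y) 0 hs" by auto
next
  fix x assume "x \<in> {g \<in> G j. \<exists>hs. sections g 0 hs}"
  then obtain hs where "sections x 0 hs" by blast
  from sections_minus[OF this] show "\<exists>hs. sections (- x) 0 hs" by auto
qed (use sections_0 subgrp_G G_zero G_add G_minus in auto)

lemma Stab_sections:
  assumes "g \<in> Stab j"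
  obtains hs where "sections g 0 hs" "\<And>v. v < q \<Longrightarrow> hs v \<in> G (Suc j)"
proof -
  obtain hs where hs: "sections g 0 hs" using assms by (auto simp: Stab_def)
  have "g \<in> G j" using assms by (simp add: Stab_def)
  then obtain c hs' where hs': "sections g c hs'" "\<And>v. v < q \<Longrightarrow> hs' v \<in> G (Suc j)"
    using sections_G by metis
  have "hs v \<in> G (Suc j)" if "v < q" for v using sections_unique(2)[OF hs hs'(1) that] hs'(2) that by simp
  then show ?thesis using that hs by blast
qed

text \<open>Rotation exponents add up in the integers and hence cancel in a commutator.\<close>

lemma K_Stab: "K j \<subseteq> Stab j"
proof (rule comm_gp_least[OF subgrp_Stab])
  fix x y assume xy: "x \<in> G j" "y \<in> G j"
  obtain c hs where x: "sections x c hs" using sections_G[OF xy(1)] by metis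
  obtain d hs' where y: "sections y d hs'" using sections_G[OF xy(2)] by metis
  have "\<exists>hs. sections (x + y + - x + - y) 0 hs"
    using sections_add[OF sections_add[OF sections_add[OF x y] sections_minus[OF x]] sections_minus[OF y]] by auto
  moreover have "x + y + - x + - y \<in> G j" using xy by (intro G_add G_minus)
  ultimately show "x + y - x - y \<in> Stab j" by (simp add: Stab_def)
qed

definition D :: "nat \<Rightarrow> int \<times> int \<Rightarrow> nat \<Rightarrow> nperm" where
  "D j x v = (if v = 0 then dir (Suc j) x else if v = 1 then rot (alpha j x) else 0)"

lemma sections_conj_dir: "sections (rot c + dir j x + rot (- c)) 0 (\<lambda>v. D j x (shf (- c) v))"
  using sections_add[OF sections_add[OF sections_rot sections_dir] sections_rot, of c j x "- c"]
  by (simp add: D_def sections_def)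

text \<open>The commutator of a directed element with a rotation: it lies in \<open>K j\<close> and
  still has the section \<open>dir (Suc j) x\<close> at 0, as long as the shift t keeps the inverse
  copy away from 0.\<close>

definition kk :: "nat \<Rightarrow> int \<times> int \<Rightarrow> int \<Rightarrow> nperm" where
  "kk j x t = dir j x + rot t - dir j x - rot t"

lemma kk_K: "kk j x t \<in> K j"
  unfolding kk_def by (intro comm_gp_I dir_G rot_G)

lemma sections_kk: "sections (kk j x t) 0 (\<lambda>v. D j x v + D j (- x) (shf (- t) v))"
proof -
  have eq: "kk j x t = dir j x + (rot t + dir j (- x) + rot (- t))"
    unfolding kk_def dir_minus[symmetric] rot_minus[symmetric]
    by (simp add: grp_simps del: add_uminus_conv_diff)
  have "sections (dir j x) 0 (D j x)" using sections_dir by (simp add: D_def[abs_def])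
  from sections_add[OF this sections_conj_dir, of t j "- x"] show ?thesis
    unfolding eq by (simp add: sections_def)
qed

lemma shf_small: "v + t < q \<Longrightarrow> shf (int t) v = v + t"
  by (simp add: shf_def nat_add_distrib flip: of_nat_add)

lemma shf_neg: assumes "t \<le> v" "v < q" shows "shf (- int t) v = v - t"
  using assms by (simp add: shf_eq_swap shf_small)

lemma shf_neg_wrap: assumes "v < t" "t \<le> q" shows "shf (- int t) v = q + v - t"
proof -
  have "(int v + - int t) mod int q = (int v + - int t + int q) mod int q" by simp
  also have "\<dots> = int v + - int t + int q" using assms by (intro mod_pos_pos_trivial) auto
  finally show ?thesis using assms
    by (simp add: of_nat_eq_iff[where 'a=int, symmetric] int_shf of_nat_diff)
qed

lemma q_vals [simp]: "q - 2 \<noteq> 0" "q - 2 \<noteq> Suc 0" "q - Suc 0 \<noteq> Suc 0" "q - 4 \<noteq> Suc 0"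
  using q_ge8 by arith+

lemma D_zero: "v \<noteq> 0 \<Longrightarrow> v \<noteq> 1 \<Longrightarrow> D j x v = 0"
  by (simp add: D_def)

text \<open>Conjugation by \<open>rot (- 1)\<close> moves the digit 1 to 0, so for suitable t the
  section at 0 is the rotation \<open>rot (alpha j x)\<close>.\<close>

definition kk' :: "nat \<Rightarrow> int \<times> int \<Rightarrow> int \<Rightarrow> nperm" where
  "kk' j x t = rot (- 1) + kk j x t - rot (- 1)"

lemma kk'_K: "kk' j x t \<in> K j"
  unfolding kk'_def by (intro K_conj rot_G kk_K)

lemma sections_kk': "sections (kk' j x t) 0 (\<lambda>v. D j x (shf 1 v) + D j (- x) (shf (1 - t) v))"
proof -
  have eq: "kk' j x t = rot (- 1) + kk j x t + rot 1"
    using rot_minus[of "- 1"] by (simp add: kk'_def diff_conv_add_uminus del: add_uminus_conv_diff)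
  show ?thesis
    using sections_add[OF sections_add[OF sections_rot[of "- 1"] sections_kk[of j x t]] sections_rot[of 1]]
    by (simp add: eq sections_def)
qed

lemma shf_vals:
  "shf (- 2) 0 = q - 2" "shf (- 2) 1 = q - 1" "shf 1 0 = 1" "shf (- 4) 0 = q - 4"
  using shf_neg_wrap[of 0 2] shf_neg_wrap[of 1 2] shf_small[of 0 1] shf_neg_wrap[of 0 4] q_ge8
  by (simp_all add: numeral_2_eq_2)

lemma kk_at0: "D j x 0 + D j (- x) (shf (- 2) 0) = dir (Suc j) x"
  using q_ge8 by (simp add: shf_vals D_def)

lemma kk'_at0: "D j x (shf 1 0) + D j (- x) (shf (1 - 5) 0) = rot (alpha j x)"
  using q_ge8 by (simp add: shf_vals D_def)

lemma kk'_2_at0: "D j x (shf 1 0) + D j (- x) (shf (1 - 2) 0) = rot (alpha j x)"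
  using q_ge8 shf_neg_wrap[of 0 1] by (simp add: shf_vals D_def)

text \<open>The first element is supported on the digits 0 to 3, the second on 0, 4, 5 and q - 1.
  The shifts 2 and 5 are chosen so that only 0 is common; at every other digit one of the two
  sections is zero.\<close>

lemma comm_kk:
  "kk j x 2 + kk' j y 5 - kk j x 2 - kk' j y 5 =
    below 1 0 (dir (Suc j) x + rot (alpha j y) - dir (Suc j) x - rot (alpha j y))"
proof -
  let ?f = "\<lambda>v. D j x v + D j (- x) (shf (- 2) v)"
  let ?g = "\<lambda>v. D j y (shf 1 v) + D j (- y) (shf (1 - 5) v)"
  have "sections (kk j x 2 + kk' j y 5 + - kk j x 2 + - kk' j y 5) 0 (\<lambda>v. ?f v + ?g v + - ?f v + - ?g v)"
    using sections_add[OF sections_add[OF sections_add[OF sections_kk[of j x 2] sections_kk'[of j y 5]]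
      sections_minus[OF sections_kk[of j x 2]]] sections_minus[OF sections_kk'[of j y 5]]]
    by (simp add: sections_def del: shf_shf)
  moreover have "sections (below 1 0 (dir (Suc j) x + rot (alpha j y) - dir (Suc j) x - rot (alpha j y))) 0
     (\<lambda>w. if w = 0 then dir (Suc j) x + rot (alpha j y) - dir (Suc j) x - rot (alpha j y) else 0)"
    by (rule sections_below) simp
  moreover have "?f v + ?g v + - ?f v + - ?g v =
      (if v = 0 then dir (Suc j) x + rot (alpha j y) - dir (Suc j) x - rot (alpha j y) else 0)" if v: "v < q" for v
  proof (cases "v = 0")
    case True
    show ?thesis unfolding True kk_at0 kk'_at0 by simp
  next
    case False
    consider "v = 1" | "v = 2" | "v = 3" | "4 \<le> v" using False by linarith
    then have "?f v = 0 \<or> ?g v = 0"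
    proof cases
      case 1
      then show ?thesis using shf_small[of 1 1] shf_neg_wrap[of 1 4] q_ge8 by (simp add: D_zero)
    next
      case 2
      then show ?thesis using shf_small[of 2 1] shf_neg_wrap[of 2 4] q_ge8 by (simp add: D_zero)
    next
      case 3
      then show ?thesis using shf_small[of 3 1] shf_neg_wrap[of 3 4] q_ge8 by (simp add: D_zero)
    next
      case 4
      then show ?thesis using shf_neg[of 2 v] v by (simp add: D_zero)
    qed
    then show ?thesis using False by auto
  qed
  ultimately show ?thesis
    by (simp add: sections_eqI)
qed

text \<open>The sections at 0 that can be reached form a group, so generators suffice:
  \<open>dir j x\<close> provides the directed ones, its conjugate by \<open>rot (- 1)\<close> the
  rotations, and all of these since \<open>alpha j\<close> is onto mod \<open>q\<close>.\<close>

lemma G_lift: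
  assumes "g \<in> G (Suc j)" shows "\<exists>g'\<in>G j. \<exists>hs. sections g' 0 hs \<and> hs 0 = g"
proof -
  let ?S = "{g. \<exists>g'\<in>G j. \<exists>hs. sections g' 0 hs \<and> hs 0 = g}"
  have "G (Suc j) \<subseteq> ?S"
  proof (rule G_least)
    show "subgrp ?S" unfolding subgrp_def
    proof (intro conjI ballI)
      show "0 \<in> ?S" using sections_0 G_zero by blast
    next
      fix x y assume "x \<in> ?S" "y \<in> ?S"
      then obtain x' hs y' hs' where x: "x' \<in> G j" "sections x' 0 hs" "hs 0 = x"
        and y: "y' \<in> G j" "sections y' 0 hs'" "hs' 0 = y" by blast
      show "x + y \<in> ?S" using sections_add[OF x(2) y(2)] G_add[OF x(1) y(1)] x y
        by (intro CollectI bexI[of _ "x' + y'"] exI[of _ "\<lambda>v. hs v + hs' v"] conjI) (auto simp: sections_def)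
    next
      fix x assume "x \<in> ?S"
      then obtain x' hs where x: "x' \<in> G j" "sections x' 0 hs" "hs 0 = x" by blast
      show "- x \<in> ?S" using sections_minus[OF x(2)] G_minus[OF x(1)] x
        by (intro CollectI bexI[of _ "- x'"] exI[of _ "\<lambda>v. - hs v"] conjI) (auto simp: sections_def)
    qed
    fix c
    obtain x where "int q dvd alpha j x - c" using alpha_onto by blast
    then have r: "rot (alpha j x) = rot c" by (rule rot_cong)
    have "sections (rot (- 1) + dir j x + rot 1) 0 (\<lambda>v. D j x (shf 1 v))"
      using sections_conj_dir[of "- 1" j x] by simp
    moreover have "D j x (shf 1 0) = rot c" using r by (simp add: shf_vals D_def)
    moreover have "rot (- 1) + dir j x + rot 1 \<in> G j" by (intro G_add rot_G dir_G)
    ultimately show "rot c \<in> ?S" by blast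
  next
    fix x
    have "sections (dir j x) 0 (D j x)" using sections_dir by (simp add: D_def[abs_def])
    moreover have "D j x 0 = dir (Suc j) x" by (simp add: D_def)
    ultimately show "dir (Suc j) x \<in> ?S" using dir_G by blast
  qed
  then show ?thesis using assms by blast
qed

text \<open>The argument of \<open>G_lift\<close> carried out inside \<open>K j\<close>, where
  \<open>kk\<close> and \<open>kk'\<close> with shift 2 have the required sections at 0.\<close>

lemma K_lift0:
  assumes "g \<in> G (Suc j)" shows "\<exists>g'\<in>K j. \<exists>hs. sections g' 0 hs \<and> hs 0 = g"
proof -
  let ?S = "{g. \<exists>g'\<in>K j. \<exists>hs. sections g' 0 hs \<and> hs 0 = g}"
  have "G (Suc j) \<subseteq> ?S"
  proof (rule G_least)
    show "subgrp ?S" unfolding subgrp_def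
    proof (intro conjI ballI)
      show "0 \<in> ?S" using sections_0 subgrp_0[OF subgrp_K] by blast
    next
      fix x y assume "x \<in> ?S" "y \<in> ?S"
      then obtain x' hs y' hs' where x: "x' \<in> K j" "sections x' 0 hs" "hs 0 = x"
        and y: "y' \<in> K j" "sections y' 0 hs'" "hs' 0 = y" by blast
      show "x + y \<in> ?S" using sections_add[OF x(2) y(2)] subgrp_add[OF subgrp_K x(1) y(1)] x y
        by (intro CollectI bexI[of _ "x' + y'"] exI[of _ "\<lambda>v. hs v + hs' v"] conjI) (auto simp: sections_def)
    next
      fix x assume "x \<in> ?S"
      then obtain x' hs where x: "x' \<in> K j" "sections x' 0 hs" "hs 0 = x" by blast
      show "- x \<in> ?S" using sections_minus[OF x(2)] subgrp_minus[OF subgrp_K x(1)] x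
        by (intro CollectI bexI[of _ "- x'"] exI[of _ "\<lambda>v. - hs v"] conjI) (auto simp: sections_def)
    qed
    fix c
    obtain x where "int q dvd alpha j x - c" using alpha_onto by blast
    then have "rot (alpha j x) = rot c" by (rule rot_cong)
    then show "rot c \<in> ?S" using sections_kk'[of j x 2] kk'_2_at0[of j x] kk'_K[of j x 2] by force
  next
    fix x
    show "dir (Suc j) x \<in> ?S" using sections_kk[of j x 2] kk_at0[of j x] kk_K by blast
  qed
  then show ?thesis using assms by blast
qed

lemma K_lift:
  assumes "g \<in> G (Suc j)" "v < q" shows "\<exists>g'\<in>K j. \<exists>hs. sections g' 0 hs \<and> hs v = g"
proof -
  obtain g' hs where g: "g' \<in> K j" "sections g' 0 hs" "hs 0 = g" using K_lift0[OF assms(1)] by blast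
  have "sections (rot (int v) + g' + rot (- int v)) 0 (\<lambda>w. hs (shf (- int v) w))"
    using sections_add[OF sections_add[OF sections_rot[of "int v"] g(2)] sections_rot[of "- int v"]]
    by (simp add: sections_def)
  moreover have "shf (- int v) v = 0" using shf_neg[of v v] assms by simp
  moreover have "rot (int v) + g' + rot (- int v) \<in> K j"
    using K_conj[OF rot_G g(1), of "int v"] rot_minus[of "int v"]
    by (simp add: diff_conv_add_uminus del: add_uminus_conv_diff)
  ultimately show ?thesis using g(3) by metis
qed

text \<open>The elements of \<open>G (Suc j)\<close> whose copy below the digit 0 lies in
  \<open>comm_gp (K j)\<close> form a normal subgroup, because conjugating elements lift by
  \<open>G_lift\<close>. By \<open>comm_kk\<close> it contains the commutators of directed elements
  with rotations, the only nontrivial ones between generators, and so the derived subgroup.\<close>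

lemma K_branch0: "k \<in> K (Suc j) \<Longrightarrow> below 1 0 k \<in> comm_gp (K j)"
proof -
  let ?T = "{g \<in> G (Suc j). below 1 0 g \<in> comm_gp (K j)}"
  have T: "subgrp ?T"
    using subgrp_Int[OF subgrp_G subgrp_vimage[of "below 1 0", OF below_add subgrp_comm_gp]] by (simp add: Int_def)
  have nrm: "g + t - g \<in> ?T" if g: "g \<in> G (Suc j)" and t: "t \<in> ?T" for g t
  proof -
    obtain g' hs where g': "g' \<in> G j" "sections g' 0 hs" "hs 0 = g" using G_lift[OF g] by blast
    have "g' + below 1 0 t - g' \<in> comm_gp (K j)" using KK_conj[OF g'(1)] t by blast
    then have "below 1 0 (g + t - g) \<in> comm_gp (K j)" using below_conj[OF g'(2), of 0 t] g'(3) by simp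
    then show ?thesis using g t by (auto intro!: subgrp_diff[OF subgrp_G] subgrp_add[OF subgrp_G])
  qed
  have base: "dir (Suc j) x + rot c - dir (Suc j) x - rot c \<in> ?T" for x c
  proof -
    obtain y where "int q dvd alpha j y - c" using alpha_onto by blast
    then have r: "rot (alpha j y) = rot c" by (rule rot_cong)
    have "kk j x 2 + kk' j y 5 - kk j x 2 - kk' j y 5 \<in> comm_gp (K j)"
      by (intro comm_gp_I kk_K kk'_K)
    then show ?thesis unfolding comm_kk r
      using K_G[of "Suc j"] comm_gp_I[OF dir_G rot_G] by blast
  qed
  \<comment> \<open>One argument at a time: first a generator is kept on the right and the left one
    varies, then an arbitrary element stands on the right.\<close>
  have rot: "G (Suc j) \<subseteq> {g \<in> G (Suc j). g + rot c - g - rot c \<in> ?T}" for c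
    by (rule G_least[OF subgrp_commutes_mod[OF T subgrp_G nrm]])
      (use base subgrp_0[OF T] rot_G dir_G in \<open>simp_all add: rot_minus rot_add diff_conv_add_uminus del: add_uminus_conv_diff\<close>,
        simp add: rot_0)
  have inv: "y + x - y - x \<in> ?T" if "x + y - x - y \<in> ?T" for x y
  proof -
    have "- (x + y - x - y) \<in> ?T" using that by (rule subgrp_minus[OF T])
    moreover have "- (x + y - x - y) = y + x - y - x" by (simp add: grp_simps del: add_uminus_conv_diff)
    ultimately show ?thesis by simp
  qed
  have dir: "G (Suc j) \<subseteq> {g \<in> G (Suc j). g + dir (Suc j) x - g - dir (Suc j) x \<in> ?T}" for x
  proof (rule G_least[OF subgrp_commutes_mod[OF T subgrp_G nrm]])
    fix c show "rot c \<in> {g \<in> G (Suc j). g + dir (Suc j) x - g - dir (Suc j) x \<in> ?T}"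
      using inv[OF base] rot_G by blast
  next
    fix y
    have "dir (Suc j) y + dir (Suc j) x - dir (Suc j) y - dir (Suc j) x = 0"
      by (simp add: dir_minus dir_add dir_0 diff_conv_add_uminus del: add_uminus_conv_diff)
    then show "dir (Suc j) y \<in> {g \<in> G (Suc j). g + dir (Suc j) x - g - dir (Suc j) x \<in> ?T}"
      using dir_G subgrp_0[OF T] by simp
  qed
  have "K (Suc j) \<subseteq> ?T"
  proof (rule comm_gp_least[OF T])
    fix x y assume x: "x \<in> G (Suc j)" and y: "y \<in> G (Suc j)"
    have "G (Suc j) \<subseteq> {g \<in> G (Suc j). g + x - g - x \<in> ?T}"
    proof (rule G_least[OF subgrp_commutes_mod[OF T subgrp_G nrm]])
      show "rot c \<in> {g \<in> G (Suc j). g + x - g - x \<in> ?T}" for c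
        using inv[of x "rot c"] rot[of c] x rot_G by blast
      show "dir (Suc j) c \<in> {g \<in> G (Suc j). g + x - g - x \<in> ?T}" for c
        using inv[of x "dir (Suc j) c"] dir[of c] x dir_G by blast
    qed
    then show "x + y - x - y \<in> ?T" using inv[of y x] y by blast
  qed
  then show "k \<in> K (Suc j) \<Longrightarrow> below 1 0 k \<in> comm_gp (K j)" by blast
qed

lemma K_branch:
  assumes "k \<in> K (Suc j)" "v < q" shows "below 1 v k \<in> comm_gp (K j)"
proof -
  have "rot (int v) + below 1 0 k - rot (int v) \<in> comm_gp (K j)"
    by (rule KK_conj[OF rot_G K_branch0[OF assms(1)]])
  moreover have "shf (int v) 0 = v" using shf_small[of 0 v] assms by simp
  ultimately show ?thesis using below_conj[OF sections_rot, of 0 "int v" k] by simp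
qed

text \<open>Modulo commutators every element is some \<open>dir j x + rot c\<close>, and only the
  residues mod \<open>q\<close> of c and of the two entries of x matter.\<close>

lemma cov_G_K: "cov (q ^ 3) (G j) (K j)"
proof -
  have ex: "\<exists>x c. - (dir j x + rot c) + g \<in> K j" if "g \<in> G j" for g
    using that
  proof induction
    case G_zero
    then show ?case using subgrp_0[OF subgrp_K]
      by (intro exI[of _ 0]) (simp add: dir_0 rot_0)
  next
    case (G_rot g d)
    then obtain x c where k: "- (dir j x + rot c) + g \<in> K j" by blast
    have "- rot c + (- rot d + - dir j x - - rot d - - dir j x) - (- rot c) \<in> K j"
      by (intro K_conj comm_gp_I G_minus rot_G dir_G)
    from subgrp_add[OF subgrp_K this k]
    have "- (dir j x + (rot d + rot c)) + (rot d + g) \<in> K j"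
      by (simp add: grp_simps del: add_uminus_conv_diff)
    then show ?case unfolding rot_add by blast
  next
    case (G_dir g y)
    then obtain x c where k: "- (dir j x + rot c) + g \<in> K j" by blast
    have "- ((dir j y + dir j x) + rot c) + (dir j y + g) \<in> K j"
      using k by (simp add: grp_simps del: add_uminus_conv_diff)
    then show ?case unfolding dir_add by blast
  qed
  define I where "I = int ` {..<q}"
  have I: "finite I" "card I = q" by (simp_all add: I_def card_image)
  have mI: "a mod int q \<in> I" for a
    unfolding I_def by (rule image_eqI[of _ _ "nat (a mod int q)"]) (auto simp: nat_less_iff)
  let ?F = "(\<lambda>((a, b), c). dir j (a, b) + rot c) ` ((I \<times> I) \<times> I)"
  have "card ?F \<le> card ((I \<times> I) \<times> I)" using I by (intro card_image_le) auto
  also have "\<dots> = q ^ 3" by (simp add: card_cartesian_product I power3_eq_cube)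
  finally have c: "card ?F \<le> q ^ 3" .
  show ?thesis unfolding cov_def
  proof (intro exI[of _ ?F] conjI ballI)
    fix g assume "g \<in> G j"
    then obtain x c where k: "- (dir j x + rot c) + g \<in> K j" using ex by blast
    have "dir j x = dir j (fst x mod int q, snd x mod int q)"
      by (rule dir_cong) (auto simp: mod_eq_dvd_iff[symmetric])
    moreover have "rot c = rot (c mod int q)" by (rule rot_cong) (auto simp: mod_eq_dvd_iff[symmetric])
    ultimately have "- (dir j (fst x mod int q, snd x mod int q) + rot (c mod int q)) + g \<in> K j"
      using k by simp
    then show "\<exists>f\<in>?F. - f + g \<in> K j"
      by (rule bexI) (auto intro!: image_eqI[of _ _ "((fst x mod int q, snd x mod int q), c mod int q)"] mI)
  qed (use c I in auto)
qed

lemma cov_G_Stab: "cov q (G j) (Stab j)"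
proof -
  let ?F = "(\<lambda>c. rot (int c)) ` {..<q}"
  have "card ?F \<le> q" using card_image_le[of "{..<q}" "\<lambda>c. rot (int c)"] by simp
  moreover have "\<exists>f\<in>?F. - f + g \<in> Stab j" if g: "g \<in> G j" for g
  proof -
    obtain c hs where h: "sections g c hs" using sections_G[OF g] by metis
    let ?c = "nat (c mod int q)"
    have "int q dvd c - c mod int q" by (simp add: mod_eq_dvd_iff[symmetric])
    then have "int q dvd (- int ?c + c) - 0" by (simp add: algebra_simps)
    with sections_shift[OF sections_add[OF sections_rot[of "- int ?c"] h]]
    have "sections (rot (- int ?c) + g) 0 (\<lambda>v. 0 + hs v)" by blast
    moreover have "- rot (int ?c) + g \<in> G j" by (intro G_add G_minus rot_G g)
    ultimately have "- rot (int ?c) + g \<in> Stab j" unfolding Stab_def rot_minus by blast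
    moreover have "?c < q" by (simp add: nat_less_iff)
    ultimately show ?thesis by blast
  qed
  ultimately show ?thesis unfolding cov_def by (intro exI[of _ ?F]) auto
qed

text \<open>A total function, as \<open>cov_vimage\<close> expects; its value is meaningful for
  elements that fix the first digit.\<close>

definition sec :: "nat \<Rightarrow> nperm \<Rightarrow> nperm" where
  "sec v g = (SOME h. \<forall>m. ap g (v + q * m) = v + q * ap h m)"

lemma sec_eq: assumes "sections g 0 hs" "v < q" shows "sec v g = hs v"
  unfolding sec_def
proof (rule some_equality)
  show *: "\<forall>m. ap g (v + q * m) = v + q * ap (hs v) m" using assms by (simp add: sections_def)
  fix h assume "\<forall>m. ap g (v + q * m) = v + q * ap h m"
  then have "\<forall>m. v + q * ap (hs v) m = v + q * ap h m" using * by metis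
  then have "ap (hs v) m = ap h m" for m using digit_eq[OF assms(2) assms(2)] by blast
  then show "h = hs v" by (intro nperm_eqI) simp
qed

lemma sec_add:
  assumes "x \<in> Stab j" "y \<in> Stab j" "v < q" shows "sec v (- x + y) = - sec v x + sec v y"
proof -
  obtain hs where x: "sections x 0 hs" using assms by (auto simp: Stab_def)
  obtain hs' where y: "sections y 0 hs'" using assms by (auto simp: Stab_def)
  have "sections (- x + y) 0 (\<lambda>v. - hs v + hs' v)"
    using sections_add[OF sections_minus[OF x] y] by (simp add: sections_def)
  from sec_eq[OF this assms(3)] show ?thesis
    by (simp only: sec_eq[OF x assms(3)] sec_eq[OF y assms(3)])
qed

definition P :: "nat \<Rightarrow> nperm set" where
  "P j = {g \<in> Stab j. \<forall>v<q. sec v g \<in> K (Suc j)}"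

lemma subgrp_sec: assumes "v < q" shows "subgrp {g \<in> Stab j. sec v g \<in> K (Suc j)}"
proof -
  have 0: "sec v 0 = 0" using sec_eq[OF sections_0 assms] .
  have m: "sec v (- x) = - sec v x" if "x \<in> Stab j" for x
    using sec_add[OF that subgrp_0[OF subgrp_Stab] assms] 0 by simp
  have a: "sec v (x + y) = sec v x + sec v y" if "x \<in> Stab j" "y \<in> Stab j" for x y
    using sec_add[OF subgrp_minus[OF subgrp_Stab that(1)] that(2) assms] m[OF that(1)] by simp
  show ?thesis unfolding subgrp_def
    using subgrp_0[OF subgrp_Stab] subgrp_add[OF subgrp_Stab] subgrp_minus[OF subgrp_Stab]
      subgrp_0[OF subgrp_K] subgrp_add[OF subgrp_K] subgrp_minus[OF subgrp_K]
    by (auto simp: 0 m a)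
qed

lemma cov_Stab_P: "cov ((q ^ 3) ^ q) (Stab j) (P j)"
proof -
  have "cov ((q ^ 3) ^ m) (Stab j) {g \<in> Stab j. \<forall>v<m. sec v g \<in> K (Suc j)} \<and>
      subgrp {g \<in> Stab j. \<forall>v<m. sec v g \<in> K (Suc j)}" if "m \<le> q" for m
    using that
  proof (induction m)
    case 0
    show ?case using cov_one[OF subgrp_Stab] subgrp_Stab by simp
  next
    case (Suc m)
    have "cov (q ^ 3) (Stab j) {g \<in> Stab j. sec m g \<in> K (Suc j)}"
    proof (rule cov_vimage[OF cov_G_K subgrp_K])
      show "sec m ` Stab j \<subseteq> G (Suc j)"
      proof clarify
        fix g assume "g \<in> Stab j"
        then obtain hs where "sections g 0 hs" "\<And>v. v < q \<Longrightarrow> hs v \<in> G (Suc j)"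
          using Stab_sections by metis
        then show "sec m g \<in> G (Suc j)" using Suc.prems sec_eq by simp
      qed
    qed (use Suc.prems sec_add subgrp_add[OF subgrp_Stab] subgrp_minus[OF subgrp_Stab] in auto)
    from cov_Int[OF this conjunct1[OF Suc.IH] subgrp_sec conjunct2[OF Suc.IH]]
      subgrp_Int[OF subgrp_sec conjunct2[OF Suc.IH], of m]
    have "cov (q ^ 3 * (q ^ 3) ^ m) (Stab j) ({g \<in> Stab j. sec m g \<in> K (Suc j)} \<inter> {g \<in> Stab j. \<forall>v<m. sec v g \<in> K (Suc j)})"
      "subgrp ({g \<in> Stab j. sec m g \<in> K (Suc j)} \<inter> {g \<in> Stab j. \<forall>v<m. sec v g \<in> K (Suc j)})"
      using Suc.prems by auto
    moreover have "{g \<in> Stab j. sec m g \<in> K (Suc j)} \<inter> {g \<in> Stab j. \<forall>v<m. sec v g \<in> K (Suc j)}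
        = {g \<in> Stab j. \<forall>v<Suc m. sec v g \<in> K (Suc j)}"
      by (auto simp: less_Suc_eq)
    ultimately show ?case by simp
  qed
  from this[of q] show ?thesis by (simp add: P_def)
qed

text \<open>A factor \<open>q\<close> for the rotation of the first digit and \<open>q ^ 3\<close>
  for each of the \<open>q\<close> sections.\<close>

definition branch_index :: nat where "branch_index = q * (q ^ 3) ^ q"

lemma cov_G_P: "cov branch_index (G j) (P j)"
  unfolding branch_index_def by (rule cov_trans[OF cov_G_Stab cov_Stab_P])

lemma P_gen: "P j \<subseteq> gen (\<Union>x<q. below 1 x ` K (Suc j))"
proof
  fix g assume g: "g \<in> P j"
  then obtain hs where hs: "sections g 0 hs" by (auto simp: P_def Stab_def)
  have hK: "hs v \<in> K (Suc j)" if "v < q" for v using g sec_eq[OF hs that] that by (auto simp: P_def)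
  define S where "S = rec_nat 0 (\<lambda>m s. s + below 1 m (hs m))"
  have S: "sections (S m) 0 (\<lambda>v. if v < m then hs v else 0)" if "m \<le> q" for m
    using that
  proof (induction m)
    case 0 then show ?case using sections_0 by (simp add: S_def)
  next
    case (Suc m)
    have "sections (S m + below 1 m (hs m)) 0 (\<lambda>v. (if v < m then hs v else 0) + (if v = m then hs m else 0))"
      using sections_add[OF Suc.IH sections_below, of m] Suc.prems by (simp add: sections_def)
    then show ?case using less_Suc_eq by (fastforce simp: S_def sections_def)
  qed
  have "g = S q" by (rule sections_eqI[OF hs S]) auto
  moreover have "S m \<in> gen (\<Union>x<q. below 1 x ` K (Suc j))" if "m \<le> q" for m
    using that
  proof (induction m)
    case 0 then show ?case by (simp add: S_def subgrp_0[OF subgrp_gen])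
  next
    case (Suc m)
    have "below 1 m (hs m) \<in> (\<Union>x<q. below 1 x ` K (Suc j))" using Suc.prems hK[of m] by auto
    then have "below 1 m (hs m) \<in> gen (\<Union>x<q. below 1 x ` K (Suc j))" by (rule subsetD[OF gen_incl])
    moreover have "S (Suc m) = S m + below 1 m (hs m)" by (simp add: S_def)
    ultimately show ?case using Suc subgrp_add[OF subgrp_gen] by simp
  qed
  ultimately show "g \<in> gen (\<Union>x<q. below 1 x ` K (Suc j))" by simp
qed

text \<open>Rotate the first digit to 0, then move the tail to 0 by an element lifted from the next
  level.\<close>

lemma G_trans: "\<exists>g\<in>G j. ap g n = 0"
proof (induction n arbitrary: j rule: less_induct)
  case (less n)
  show ?case
  proof (cases "n = 0")
    case True then show ?thesis using G_zero by force
  next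
    case False
    obtain v m where n: "n = v + q * m" "v < q" by (rule digits)
    then obtain h where h: "h \<in> G (Suc j)" "ap h m = 0" using less tail_less False by blast
    obtain g hs where g: "g \<in> G j" "sections g 0 hs" "hs 0 = h" using G_lift[OF h(1)] by blast
    have "ap (g + rot (- int v)) n = ap g (0 + q * m)"
      using n shf_neg[of v v] by (simp add: ap_rot)
    also have "\<dots> = shf 0 0 + q * ap (hs 0) m" using g(2) q_gt0 unfolding sections_def by blast
    also have "\<dots> = 0" using g(3) h(2) by simp
    finally show ?thesis using G_add[OF g(1) rot_G] by blast
  qed
qed

end

section \<open>Bad vertices of a subgroup of finite index\<close>

context spinal
begin

lemma q_neq0 [simp]: "q \<noteq> 0" using q_gt0 by simp

definition Kv :: "nat \<Rightarrow> nat \<Rightarrow> nperm set" where "Kv l r = below l r ` K l"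

lemma subgrp_Kv: "subgrp (Kv l r)"
  unfolding Kv_def by (rule subgrp_below[OF subgrp_K])

lemma comm_gp_image:
  assumes f: "\<And>x y. f (x + y) = f x + f y"
  shows "f ` comm_gp S \<subseteq> comm_gp (f ` S)"
proof -
  have "f 0 + f 0 = f 0 + 0" by (simp add: f[symmetric])
  then have "f 0 = 0" by (rule add_left_imp_eq)
  then have m: "f (- x) = - f x" for x by (metis f add_eq_0_iff right_minus)
  have "comm_gp S \<subseteq> {x. f x \<in> comm_gp (f ` S)}"
  proof (rule comm_gp_least[OF subgrp_vimage[OF f subgrp_comm_gp]], clarify)
    fix x y assume "x \<in> S" "y \<in> S"
    then have "f x + f y - f x - f y \<in> comm_gp (f ` S)" by (intro comm_gp_I) auto
    then show "f (x + y - x - y) \<in> comm_gp (f ` S)"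
      by (simp add: diff_conv_add_uminus f m del: add_uminus_conv_diff)
  qed
  then show ?thesis by auto
qed

text \<open>Branching at a vertex. It is what makes the children of a good vertex covered.\<close>

lemma Kv_child:
  assumes "r < q ^ l" "x < q" shows "Kv (Suc l) (r + q ^ l * x) \<subseteq> comm_gp (Kv l r)"
proof
  fix k assume "k \<in> Kv (Suc l) (r + q ^ l * x)"
  then obtain k' where k': "k' \<in> K (Suc l)" "k = below l r (below 1 x k')"
    using below_below[OF assms] by (auto simp: Kv_def)
  then have "k \<in> below l r ` comm_gp (K l)" using K_branch[OF _ assms(2)] by blast
  then show "k \<in> comm_gp (Kv l r)"
    using comm_gp_image[of "below l r", OF below_add] unfolding Kv_def by blast
qed

lemma Kv_child_sub: "r < q ^ l \<Longrightarrow> x < q \<Longrightarrow> Kv (Suc l) (r + q ^ l * x) \<subseteq> Kv l r"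
  using Kv_child comm_gp_sub[OF subgrp_Kv] by blast

lemma Kv_G: "r < q ^ l \<Longrightarrow> Kv l r \<subseteq> G 0"
proof (induction l arbitrary: r)
  case 0 then show ?case using K_G by (auto simp: Kv_def)
next
  case (Suc l)
  obtain r' x where "r = r' + q ^ l * x" "r' < q ^ l" "x < q" using child_split[OF Suc.prems] .
  then show ?case using Suc.IH Kv_child_sub by blast
qed

lemma level_section:
  assumes "g \<in> G 0" "r < q ^ l"
  shows "\<exists>h\<in>G l. \<exists>r'<q ^ l. \<forall>m. ap g (r + q ^ l * m) = r' + q ^ l * ap h m"
  using assms(2)
proof (induction l arbitrary: r)
  case 0 then show ?case using assms(1) by (intro bexI[of _ g] exI[of _ 0]) auto
next
  case (Suc l)
  obtain r0 x where r: "r = r0 + q ^ l * x" "r0 < q ^ l" "x < q" using child_split[OF Suc.prems] .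
  obtain h r' where h: "h \<in> G l" "r' < q ^ l" "\<And>m. ap g (r0 + q ^ l * m) = r' + q ^ l * ap h m"
    using Suc.IH[OF r(2)] by blast
  obtain c hs where hs: "sections h c hs" "\<And>v. v < q \<Longrightarrow> hs v \<in> G (Suc l)" using sections_G[OF h(1)] by metis
  have "ap g (r + q ^ Suc l * m) = (r' + q ^ l * shf c x) + q ^ Suc l * ap (hs x) m" for m
  proof -
    have "r + q ^ Suc l * m = r0 + q ^ l * (x + q * m)" by (simp add: r algebra_simps)
    then have "ap g (r + q ^ Suc l * m) = r' + q ^ l * ap h (x + q * m)" by (simp only: h(3))
    also have "ap h (x + q * m) = shf c x + q * ap (hs x) m" using hs(1) r(3) by (simp add: sections_def)
    finally show ?thesis by (simp add: algebra_simps)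
  qed
  moreover have "r' + q ^ l * shf c x < q ^ Suc l" by (rule child_lt[OF h(2) shf_lt])
  ultimately show ?case using hs(2)[OF r(3)] by blast
qed

lemma level_eq: "n mod q ^ l = r \<Longrightarrow> n = r + q ^ l * (n div q ^ l)"
  by (metis mod_mult_div_eq)

text \<open>Conjugation permutes the copies of \<open>K\<close>. The image of the vertex r is
  described through a number n passing through r, which avoids a separate action on
  vertices.\<close>

lemma Kv_conj:
  assumes g: "g \<in> G 0" and r: "r < q ^ l" and a: "ap g n mod q ^ l = r'" "n mod q ^ l = r"
    and k: "k \<in> Kv l r"
  shows "g + k - g \<in> Kv l r'"
proof -
  obtain h r'' where h: "h \<in> G l" "r'' < q ^ l" "\<And>m. ap g (r + q ^ l * m) = r'' + q ^ l * ap h m"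
    using level_section[OF g r] by blast
  have r'': "r'' = r'" using h(3)[of "n div q ^ l"] level_eq[OF a(2)] a(1) h(2) by auto
  obtain k' where k': "k' \<in> K l" "k = below l r k'" using k by (auto simp: Kv_def)
  have "g + k = below l r' (h + k' - h) + g"
  proof (rule nperm_eqI)
    fix n
    show "ap (g + k) n = ap (below l r' (h + k' - h) + g) n"
    proof (cases "n mod q ^ l = r")
      case True
      then have n: "n = r + q ^ l * (n div q ^ l)" by (rule level_eq)
      show ?thesis using h(2,3) r by (subst n, subst (2) n)
          (simp add: k' ap_below r'' diff_conv_add_uminus del: add_uminus_conv_diff)
    next
      case False
      have "ap g n mod q ^ l \<noteq> r'"
      proof
        assume "ap g n mod q ^ l = r'"
        then have "ap g n = r' + q ^ l * (ap g n div q ^ l)" by (rule level_eq)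
        also have "\<dots> = ap g (r + q ^ l * ap (- h) (ap g n div q ^ l))" by (simp add: h(3) r'')
        finally have "n = r + q ^ l * ap (- h) (ap g n div q ^ l)" by simp
        then have "n mod q ^ l = r" using r by (metis level_mod)
        then show False using False by simp
      qed
      then show ?thesis using False by (simp add: k' ap_below)
    qed
  qed
  then have "g + k - g = below l r' (h + k' - h)" by simp
  then show ?thesis using K_conj[OF h(1) k'(1)] by (auto simp: Kv_def)
qed

text \<open>Elements of \<open>K l\<close> have rotation part 0, so a copy of them fixes the
  children of its vertex as well.\<close>

lemma Kv_mod: assumes "k \<in> Kv l r" shows "ap k n mod q ^ Suc l = n mod q ^ Suc l"
proof -
  obtain k' where k': "k' \<in> K l" "k = below l r k'" using assms by (auto simp: Kv_def)
  obtain hs where hs: "sections k' 0 hs" using k'(1) K_Stab by (auto simp: Stab_def)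
  show ?thesis
  proof (cases "n mod q ^ l = r")
    case True
    then have r: "r < q ^ l" by (metis mod_less_divisor qpow_gt0)
    obtain v m where m: "n div q ^ l = v + q * m" "v < q" by (rule digits)
    have n: "n = r + q ^ l * (v + q * m)" using level_eq[OF True] m by simp
    have "ap k n = r + q ^ l * (v + q * ap (hs v) m)"
      using hs m True by (simp add: k' ap_below sections_def)
    then have "ap k n = (r + q ^ l * v) + q ^ Suc l * ap (hs v) m" by (simp add: algebra_simps)
    moreover have "n = (r + q ^ l * v) + q ^ Suc l * m" by (simp add: n algebra_simps)
    ultimately show ?thesis using child_lt[OF r m(2)] by (metis level_mod)
  qed (simp add: k' ap_below)
qed

lemma Kv_fix: "k \<in> Kv l r \<Longrightarrow> n mod q ^ l \<noteq> r \<Longrightarrow> ap k n = n"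
  by (auto simp: Kv_def ap_below)

lemma Kv_lift:
  assumes "g \<in> G (Suc l)" "r < q ^ l" "x < q"
  shows "\<exists>k\<in>Kv l r. \<forall>m. ap k ((r + q ^ l * x) + q ^ Suc l * m) = (r + q ^ l * x) + q ^ Suc l * ap g m"
proof -
  obtain k hs where k: "k \<in> K l" "sections k 0 hs" "hs x = g" using K_lift[OF assms(1,3)] by blast
  have "ap (below l r k) ((r + q ^ l * x) + q ^ Suc l * m) = (r + q ^ l * x) + q ^ Suc l * ap g m" for m
  proof -
    have eq: "(r + q ^ l * x) + q ^ Suc l * m = r + q ^ l * (x + q * m)" for m by (simp add: algebra_simps)
    show ?thesis unfolding eq using k assms by (simp add: ap_below sections_def)
  qed
  then show ?thesis using k(1) by (auto simp: Kv_def)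
qed

lemma Kv_commute:
  assumes k: "k \<in> Kv l r" "k' \<in> Kv l' r'"
    and disj: "\<And>n. \<not> (n mod q ^ l = r \<and> n mod q ^ l' = r')"
  shows "k + k' = k' + k"
proof (rule nperm_eqI)
  fix n
  have inv: "ap k n mod q ^ l = n mod q ^ l" for n
    using k(1) by (auto simp: Kv_def ap_below)
  have inv': "ap k' n mod q ^ l' = n mod q ^ l'" for n
    using k(2) by (auto simp: Kv_def ap_below)
  show "ap (k + k') n = ap (k' + k) n"
    using Kv_fix[OF k(1)] Kv_fix[OF k(2)] disj inv inv' by (metis ap_add)
qed

lemma disj_blocks:
  assumes "l \<le> l'" "r' mod q ^ l \<noteq> r"
  shows "\<not> (n mod q ^ l = r \<and> n mod q ^ l' = r')"
proof
  assume *: "n mod q ^ l = r \<and> n mod q ^ l' = r'"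
  have "q ^ l dvd q ^ l'" using assms(1) by (rule le_imp_power_dvd)
  then have "n mod q ^ l' mod q ^ l = n mod q ^ l" by (rule mod_mod_cancel)
  then show False using * assms by simp
qed

end

text \<open>The number \<open>d\<close> plays the role of the binary logarithm of the index bound
  \<open>n\<close>.\<close>

locale spinal_sub = spinal +
  fixes U :: "nperm set" and n d :: nat
  assumes U: "subgrp U" "U \<subseteq> G 0" and cov_U: "cov n (G 0) U" and n_lt: "n < 2 ^ Suc d"
begin

lemma log_le: "2 ^ e \<le> n \<Longrightarrow> e \<le> d"
  using n_lt by (metis le_less_trans less_Suc_eq_le one_less_numeral_iff power_strict_increasing_iff semiring_norm(76))

definition good :: "nat \<Rightarrow> nat \<Rightarrow> bool" where "good l r \<longleftrightarrow> comm_gp (Kv l r) \<subseteq> comm_gp U"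
definition covered :: "nat \<Rightarrow> nat \<Rightarrow> bool" where "covered l r \<longleftrightarrow> Kv l r \<subseteq> comm_gp U"
text \<open>Transitivity in a strong form: one element of \<open>U\<close> fixes the vertex and
  turns its children by one step. This form is the one that \<open>nontrans_class\<close> can refute
  by independence.\<close>

definition trans :: "nat \<Rightarrow> nat \<Rightarrow> bool" where
  "trans l r \<longleftrightarrow> (\<exists>u\<in>U. \<forall>m. ap u (r + q ^ l * m) mod q ^ Suc l = r + q ^ l * shf 1 (m mod q))"

lemma good_covered: "good l r \<Longrightarrow> r < q ^ l \<Longrightarrow> x < q \<Longrightarrow> covered (Suc l) (r + q ^ l * x)"
  using Kv_child unfolding good_def covered_def by blast

lemma covered_good: "covered l r \<Longrightarrow> good l r"
  using comm_gp_sub[OF subgrp_Kv] unfolding good_def covered_def by blast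

text \<open>\<open>U\<close> normalizes its derived subgroup, and conjugation permutes the copies of
  \<open>K\<close>; so goodness is constant along orbits of \<open>U\<close>.\<close>

lemma good_conj:
  assumes u: "u \<in> U" and w: "w < q ^ l" "ap u m mod q ^ l = w'" "m mod q ^ l = w" and g: "good l w'"
  shows "good l w"
  unfolding good_def
proof
  fix k assume k: "k \<in> comm_gp (Kv l w)"
  have uG: "u \<in> G 0" using u U by blast
  have "u + k - u \<in> comm_gp (Kv l w')"
    by (rule comm_gp_conj[OF _ k]) (rule Kv_conj[OF uG w])
  then have "u + k - u \<in> comm_gp U" using g by (auto simp: good_def)
  then have "- u + (u + k - u) - (- u) \<in> comm_gp U"
    by (rule comm_gp_conj_self[OF U(1) subgrp_minus[OF U(1) u]])
  moreover have "- u + (u + k - u) - (- u) = k" by (simp add: grp_simps del: add_uminus_conv_diff)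
  ultimately show "k \<in> comm_gp U" by metis
qed

text \<open>Turns the children of the x-th child of r. Its effect below the other children of r is
  not controlled, hence the separate classes for each x in \<open>nontrans_class\<close>.\<close>

definition child_rot :: "nat \<Rightarrow> nat \<times> nat \<Rightarrow> nperm" where
  "child_rot x = (\<lambda>(l, r). SOME k. k \<in> Kv l r \<and>
     (\<forall>m. ap k ((r + q ^ l * x) + q ^ Suc l * m) = (r + q ^ l * x) + q ^ Suc l * rotf 1 m))"

lemma child_rot:
  assumes "r < q ^ l" "x < q"
  shows "child_rot x (l, r) \<in> Kv l r"
    "ap (child_rot x (l, r)) ((r + q ^ l * x) + q ^ Suc l * m) = (r + q ^ l * x) + q ^ Suc l * rotf 1 m"
proof -
  have "\<exists>k. k \<in> Kv l r \<and>
     (\<forall>m. ap k ((r + q ^ l * x) + q ^ Suc l * m) = (r + q ^ l * x) + q ^ Suc l * rotf 1 m)"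
    using Kv_lift[OF rot_G[of 1] assms] unfolding ap_rot by blast
  from someI_ex[OF this]
  show "child_rot x (l, r) \<in> Kv l r"
    "ap (child_rot x (l, r)) ((r + q ^ l * x) + q ^ Suc l * m) = (r + q ^ l * x) + q ^ Suc l * rotf 1 m"
    by (simp_all add: child_rot_def)
qed

text \<open>Listed by level, the elements \<open>child_rot x\<close> of these vertices are
  independent modulo \<open>U\<close>. At a vertex w of the list, entries for other parents on the
  same level have disjoint support, and deeper entries fix the children of w. So multiplying by
  later entries on both sides leaves the turn of the children of w intact, and an element of
  \<open>U\<close> doing this would make w transitive.\<close>

lemma nontrans_class:
  assumes x: "x < q"
  shows "card {(l, r). l < h \<and> r < q ^ l \<and> \<not> trans (Suc l) (r + q ^ l * x)} \<le> d"
proof -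
  define S where "S = {(l, r). l < h \<and> r < q ^ l \<and> \<not> trans (Suc l) (r + q ^ l * x)}"
  have "S \<subseteq> (\<Union>l<h. {l} \<times> {..<q ^ l})" by (auto simp: S_def)
  then have finS: "finite S" by (rule finite_subset) auto
  obtain xs0 where xs0: "set xs0 = S" "distinct xs0" using finite_distinct_list[OF finS] by blast
  define xs where "xs = sort_key fst xs0"
  have xs: "set xs = S" "distinct xs" "sorted (map fst xs)" by (simp_all add: xs_def xs0)
  define R where "R a b \<longleftrightarrow> fst a \<le> fst b \<and> a \<noteq> b" for a b :: "nat \<times> nat"
  have "sorted_wrt R xs"
    unfolding sorted_wrt_iff_nth_less R_def
    using xs(2,3) by (auto simp: nth_eq_iff_index_eq sorted_iff_nth_mono)
  then have "indep U (map (child_rot x) xs)"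
  proof (rule indep_sorted, unfold xs(1))
    fix i t t' assume i: "i \<in> S" and t: "t \<in> gen {child_rot x j |j. j \<in> S \<and> R i j}"
      and t': "t' \<in> gen {child_rot x j |j. j \<in> S \<and> R i j}"
    obtain l r where lr: "i = (l, r)" "r < q ^ l" "\<not> trans (Suc l) (r + q ^ l * x)"
      using i by (auto simp: S_def)
    define w where "w = r + q ^ l * x"
    have w: "w < q ^ Suc l" unfolding w_def by (rule child_lt[OF lr(2) x])
    have wl: "m mod q ^ l = r" if "m mod q ^ Suc l = w" for m
      using that unfolding w_def child_mod[OF lr(2) x] by simp
    \<comment> \<open>Permutations that carry nothing into or out of the block of \<open>w\<close>
      and fix the children of \<open>w\<close>. The second disjunct makes the set closed under
      negation.\<close>
    let ?F = "{t. \<forall>m. m mod q ^ Suc l = w \<or> ap t m mod q ^ Suc l = w \<longrightarrow>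
      ap t m mod q ^ Suc (Suc l) = m mod q ^ Suc (Suc l)}"
    have mm: "m mod q ^ Suc (Suc l) mod q ^ Suc l = m mod q ^ Suc l" for m
      by (rule mod_mod_cancel) (simp add: le_imp_power_dvd)
    have down: "m mod q ^ Suc l = m' mod q ^ Suc l" if "m mod q ^ Suc (Suc l) = m' mod q ^ Suc (Suc l)" for m m'
      using that mm by metis
    have F: "subgrp ?F" unfolding subgrp_def
    proof (intro conjI ballI CollectI allI impI)
      fix t t' m assume "t \<in> ?F" "t' \<in> ?F" "m mod q ^ Suc l = w \<or> ap (t + t') m mod q ^ Suc l = w"
      then show "ap (t + t') m mod q ^ Suc (Suc l) = m mod q ^ Suc (Suc l)"
        using down unfolding mem_Collect_eq ap_add by metis
    next
      fix t m assume "t \<in> ?F" "m mod q ^ Suc l = w \<or> ap (- t) m mod q ^ Suc l = w"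
      then show "ap (- t) m mod q ^ Suc (Suc l) = m mod q ^ Suc (Suc l)"
        unfolding mem_Collect_eq by (metis ap_minus2)
    qed simp
    have "{child_rot x j |j. j \<in> S \<and> R i j} \<subseteq> ?F"
    proof clarify
      fix l' r' m assume j: "(l', r') \<in> S" "R i (l', r')"
        and m: "m mod q ^ Suc l = w \<or> ap (child_rot x (l', r')) m mod q ^ Suc l = w"
      have k: "child_rot x (l', r') \<in> Kv l' r'" using j by (intro child_rot x) (auto simp: S_def)
      show "ap (child_rot x (l', r')) m mod q ^ Suc (Suc l) = m mod q ^ Suc (Suc l)"
      proof (cases "l' = l")
        case True
        then have r': "r' \<noteq> r" using j by (auto simp: R_def lr)
        have "m mod q ^ l \<noteq> r'"
        proof
          assume "m mod q ^ l = r'"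
          moreover have "ap (child_rot x (l', r')) m mod q ^ Suc l = m mod q ^ Suc l"
            using Kv_mod[OF k] True by simp
          ultimately show False using wl m r' by auto
        qed
        then show ?thesis using Kv_fix[OF k] True by simp
      next
        case False
        then have "q ^ Suc (Suc l) dvd q ^ Suc l'" using j by (intro le_imp_power_dvd) (auto simp: R_def lr)
        then show ?thesis using Kv_mod[OF k, of m] by (metis mod_mod_cancel)
      qed
    qed
    then have sub: "gen {child_rot x j |j. j \<in> S \<and> R i j} \<subseteq> ?F" by (rule gen_least[OF F])
    show "- t' + (child_rot x i + t) \<notin> U"
    proof
      assume u: "- t' + (child_rot x i + t) \<in> U"
      have "ap (- t' + (child_rot x i + t)) (w + q ^ Suc l * m) mod q ^ Suc (Suc l) = w + q ^ Suc l * shf 1 (m mod q)" for m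
      proof -
        let ?y = "ap t (w + q ^ Suc l * m)"
        have "(w + q ^ Suc l * m) mod q ^ Suc l = w" using w by (rule level_mod)
        then have y: "?y mod q ^ Suc (Suc l) = (w + q ^ Suc l * m) mod q ^ Suc (Suc l)"
          using t sub by blast
        have split: "(w + q ^ Suc l * m) mod q ^ Suc (Suc l) = w + q ^ Suc l * (m mod q)" for m
          by (subst child_mod[OF w]) (use w in \<open>simp_all del: power_Suc\<close>)
        obtain m' where m': "?y = w + q ^ Suc l * m'"
          using down[OF y] level_eq[of ?y "Suc l"] w by (metis level_mod)
        then have "w + q ^ Suc l * (m' mod q) = w + q ^ Suc l * (m mod q)" using y split by metis
        then have mq: "m' mod q = m mod q" using qpow_gt0[of "Suc l"] by (simp del: power_Suc qpow_gt0)
        have z: "ap (child_rot x i + t) (w + q ^ Suc l * m) = w + q ^ Suc l * rotf 1 m'"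
          using child_rot(2)[OF lr(2) x, of m'] by (simp add: m' lr(1) w_def[symmetric] del: power_Suc)
        have "(w + q ^ Suc l * rotf 1 m') mod q ^ Suc l = w" using w by (rule level_mod)
        moreover have "- t' \<in> ?F" using t' sub subgrp_minus[OF F] by blast
        ultimately have "ap (- t') (w + q ^ Suc l * rotf 1 m') mod q ^ Suc (Suc l)
            = (w + q ^ Suc l * rotf 1 m') mod q ^ Suc (Suc l)" by blast
        then have "ap (- t' + (child_rot x i + t)) (w + q ^ Suc l * m) mod q ^ Suc (Suc l)
            = w + q ^ Suc l * (rotf 1 m' mod q)"
          unfolding split ap_add[of "- t'"] z .
        then show ?thesis by (simp add: rotf_def mq del: power_Suc)
      qed
      then have "trans (Suc l) w" unfolding trans_def using u by blast
      then show False using lr(3) by (simp add: w_def)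
    qed
  qed
  moreover have "child_rot x i \<in> G 0" if "i \<in> S" for i
    using that child_rot(1)[OF _ x] by (auto simp: S_def intro: subsetD[OF Kv_G])
  then have "prods (map (child_rot x) xs) \<subseteq> G 0" using xs by (intro prods_subset[OF subgrp_G]) auto
  ultimately have "2 ^ length (map (child_rot x) xs) \<le> n" using U cov_U by (intro indep_bound)
  then have "length xs \<le> d" by (intro log_le) simp
  moreover have "length xs = card S" using xs distinct_card by metis
  ultimately show ?thesis by (simp add: S_def)
qed

text \<open>
  A leaf is a bad vertex all of whose children are good; leaves form an antichain, so the
  commuting family bound applies to them.
\<close>

definition s :: "nat \<Rightarrow> nat" where "s l = card {r. r < q ^ l \<and> \<not> trans l r}"
definition b :: "nat \<Rightarrow> nat" where "b l = card {r. r < q ^ l \<and> \<not> good l r}"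
definition c :: "nat \<Rightarrow> nat" where "c l = card {r. r < q ^ l \<and> \<not> covered l r}"
definition leaf :: "nat \<Rightarrow> nat \<Rightarrow> bool" where
  "leaf l r \<longleftrightarrow> \<not> good l r \<and> (\<forall>x<q. good (Suc l) (r + q ^ l * x))"
definition lf :: "nat \<Rightarrow> nat" where "lf l = card {r. r < q ^ l \<and> leaf l r}"

lemma card_level_pairs:
  "card {(l, r). l < h \<and> r < q ^ l \<and> Q l r} = (\<Sum>l<h. card {r. r < q ^ l \<and> Q l r})"
proof -
  have "{(l, r). l < h \<and> r < q ^ l \<and> Q l r} = (SIGMA l:{..<h}. {r. r < q ^ l \<and> Q l r})" by auto
  then show ?thesis by simp
qed

text \<open>Every vertex except the root is the x-th child of its parent for one of the
  \<open>q\<close> values of x; the root accounts for the 1.\<close>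

lemma sum_s: "(\<Sum>l<Suc h. s l) \<le> 1 + q * d"
proof -
  have "s (Suc l) \<le> (\<Sum>x<q. card {r. r < q ^ l \<and> \<not> trans (Suc l) (r + q ^ l * x)})" for l
  proof -
    have "{w. w < q ^ Suc l \<and> \<not> trans (Suc l) w} \<subseteq>
      (\<Union>x<q. (\<lambda>r. r + q ^ l * x) ` {r. r < q ^ l \<and> \<not> trans (Suc l) (r + q ^ l * x)})"
    proof clarify
      fix w assume w: "w < q ^ Suc l" "\<not> trans (Suc l) w"
      obtain r x where "w = r + q ^ l * x" "r < q ^ l" "x < q" using child_split[OF w(1)] .
      then show "w \<in> (\<Union>x<q. (\<lambda>r. r + q ^ l * x) ` {r. r < q ^ l \<and> \<not> trans (Suc l) (r + q ^ l * x)})"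
        using w by blast
    qed
    then have "s (Suc l) \<le> card (\<Union>x<q. (\<lambda>r. r + q ^ l * x) ` {r. r < q ^ l \<and> \<not> trans (Suc l) (r + q ^ l * x)})"
      unfolding s_def by (intro card_mono) auto
    also have "\<dots> \<le> (\<Sum>x<q. card ((\<lambda>r. r + q ^ l * x) ` {r. r < q ^ l \<and> \<not> trans (Suc l) (r + q ^ l * x)}))"
      by (intro card_UN_le) auto
    also have "\<dots> \<le> (\<Sum>x<q. card {r. r < q ^ l \<and> \<not> trans (Suc l) (r + q ^ l * x)})"
      by (intro sum_mono card_image_le) auto
    finally show ?thesis .
  qed
  then have "(\<Sum>l<h. s (Suc l)) \<le> (\<Sum>l<h. \<Sum>x<q. card {r. r < q ^ l \<and> \<not> trans (Suc l) (r + q ^ l * x)})"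
    by (intro sum_mono)
  also have "\<dots> = (\<Sum>x<q. card {(l, r). l < h \<and> r < q ^ l \<and> \<not> trans (Suc l) (r + q ^ l * x)})"
    unfolding card_level_pairs by (rule sum.swap)
  also have "\<dots> \<le> (\<Sum>x<q. d)" by (intro sum_mono nontrans_class) simp
  finally have "(\<Sum>l<h. s (Suc l)) \<le> q * d" by simp
  moreover have "s 0 \<le> card {..<1::nat}" unfolding s_def by (intro card_mono) auto
  ultimately show ?thesis unfolding sum.lessThan_Suc_shift by simp
qed

text \<open>The bad vertices of level h are added to the leaves above them, because
  \<open>sum_b\<close> ends with a term \<open>b h\<close>. The whole set is still an antichain, and
  \<open>commuting_family_bound\<close> splits it into two parts of size at most
  \<open>d\<close>.\<close>

lemma sum_leaf: "(\<Sum>l<h. lf l) + b h \<le> 2 * d"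
proof -
  define A where "A = {(l, r). l < Suc h \<and> r < q ^ l \<and> (if l < h then leaf l r else \<not> good l r)}"
  have cardA: "card A = (\<Sum>l<h. lf l) + b h"
    unfolding A_def card_level_pairs by (simp add: lf_def b_def)
  have "A \<subseteq> (\<Union>l<Suc h. {l} \<times> {..<q ^ l})" by (auto simp: A_def)
  then have "finite A" by (rule finite_subset) auto
  then obtain f where f: "bij_betw f {..<card A} A"
    using ex_bij_betw_nat_finite by (metis atLeast0LessThan)
  have fA: "f i \<in> A" if "i < card A" for i using f that by (auto simp: bij_betw_def)
  have bad: "\<not> good l r" if "(l, r) \<in> A" for l r
    using that by (auto simp: A_def leaf_def split: if_splits)
  \<comment> \<open>Badness passes to ancestors, since the children of a good vertex are covered and
    hence good.\<close>
  have bad_up: "\<not> good l (r mod q ^ l)" if "\<not> good (l + i) r" "r < q ^ (l + i)" for l i r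
    using that
  proof (induction i arbitrary: r)
    case (Suc i)
    have "r < q ^ Suc (l + i)" using Suc.prems by simp
    then obtain r' x where r: "r = r' + q ^ (l + i) * x" "r' < q ^ (l + i)" "x < q" by (rule child_split)
    have "\<not> good (l + i) r'"
      using good_covered[of "l + i" r' x] covered_good r Suc.prems by auto
    moreover have "r mod q ^ l = r' mod q ^ l" by (simp add: r power_add mult.assoc)
    ultimately show ?case using Suc.IH r by metis
  qed simp
  have disj: "\<not> (m mod q ^ l = r \<and> m mod q ^ l' = r')"
    if A: "(l, r) \<in> A" "(l', r') \<in> A" "(l, r) \<noteq> (l', r')" "l \<le> l'" for l r l' r' m
  proof (rule disj_blocks[OF A(4)])
    show "r' mod q ^ l \<noteq> r"
    proof (cases "l = l'")
      case True then show ?thesis using A by (auto simp: A_def)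
    next
      case False
      then obtain i where l': "l' = Suc l + i" using A(4) by (metis le_neq_implies_less less_iff_Suc_add add_Suc)
      have "leaf l r" using A l' by (auto simp: A_def split: if_splits)
      have "\<not> good (Suc l) (r' mod q ^ Suc l)" using bad_up[of "Suc l" i r'] bad[OF A(2)] A(2) l' by (auto simp: A_def)
      moreover obtain r0 x where r0: "r' mod q ^ Suc l = r0 + q ^ l * x" "r0 < q ^ l" "x < q"
        by (rule child_split[of "r' mod q ^ Suc l" l]) (auto simp del: power_Suc)
      moreover have "r' mod q ^ l = r0" using child_mod[OF r0(2,3), of r'] r0(1) by simp
      ultimately show ?thesis using \<open>leaf l r\<close> by (auto simp: leaf_def)
    qed
  qed
  have comm: "x + y = y + x" if ij: "i < card A" "j < card A" "i \<noteq> j" and "x \<in> case_prod Kv (f i)" "y \<in> case_prod Kv (f j)" for i j x y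
  proof -
    obtain l r l' r' where fi: "f i = (l, r)" "f j = (l', r')" by fastforce
    have "f i \<noteq> f j" using f ij by (auto simp: bij_betw_def inj_on_def)
    then have "\<not> (m mod q ^ l = r \<and> m mod q ^ l' = r')" for m
      using disj[of l r l' r' m] disj[of l' r' l r m] fA[OF ij(1)] fA[OF ij(2)] fi by (metis nat_le_linear)
    then show ?thesis using that fi by (intro Kv_commute[of x l r y l' r']) auto
  qed
  obtain e e' where "card A \<le> e + e'" "2 ^ e \<le> n" "2 ^ e' \<le> n"
  proof (rule commuting_family_bound[OF U(1) cov_U subgrp_G _ comm])
    show "case_prod Kv (f i) \<subseteq> G 0" if "i < card A" for i
      using fA[OF that] Kv_G by (auto simp: A_def split: prod.splits)
    show "\<not> comm_gp (case_prod Kv (f i)) \<subseteq> comm_gp U" if "i < card A" for i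
      using fA[OF that] bad by (auto simp: good_def split: prod.splits)
  qed
  then show ?thesis using log_le[of e] log_le[of e'] cardA by linarith
qed

text \<open>A bad vertex that is no leaf has a bad child. If \<open>U\<close> turns its children by
  one step, the next child is bad too by \<open>good_conj\<close>. So bad vertices double from level
  to level, up to leaves and nontransitive vertices.\<close>

lemma bad_step: "2 * b l \<le> b (Suc l) + 2 * lf l + 2 * s l"
proof -
  define N where "N = {r. r < q ^ l \<and> \<not> good l r \<and> \<not> leaf l r \<and> trans l r}"
  have "{r. r < q ^ l \<and> \<not> good l r} \<subseteq> N \<union> ({r. r < q ^ l \<and> leaf l r} \<union> {r. r < q ^ l \<and> \<not> trans l r})"
    by (auto simp: N_def)
  then have "b l \<le> card (N \<union> ({r. r < q ^ l \<and> leaf l r} \<union> {r. r < q ^ l \<and> \<not> trans l r}))"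
    unfolding b_def by (intro card_mono) (auto simp: N_def)
  also have "\<dots> \<le> card N + (lf l + s l)"
    unfolding lf_def s_def by (rule order_trans[OF card_Un_le]) (intro add_left_mono card_Un_le)
  finally have 1: "b l \<le> card N + (lf l + s l)" .
  have "\<exists>x. x < q \<and> \<not> good (Suc l) (r + q ^ l * x) \<and> \<not> good (Suc l) (r + q ^ l * shf 1 x)" if r: "r \<in> N" for r
  proof -
    obtain x where x: "x < q" "\<not> good (Suc l) (r + q ^ l * x)" using r by (auto simp: N_def leaf_def)
    obtain u where u: "u \<in> U" "ap u (r + q ^ l * x) mod q ^ Suc l = r + q ^ l * shf 1 (x mod q)"
      using r by (auto simp: N_def trans_def)
    have lt: "r + q ^ l * x < q ^ Suc l" using r x by (intro child_lt) (auto simp: N_def)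
    have "\<not> good (Suc l) (r + q ^ l * shf 1 x)"
      using good_conj[OF u(1) lt u(2)] x lt by auto
    then show ?thesis using x by blast
  qed
  then obtain xc where xc: "\<And>r. r \<in> N \<Longrightarrow> xc r < q \<and> \<not> good (Suc l) (r + q ^ l * xc r) \<and> \<not> good (Suc l) (r + q ^ l * shf 1 (xc r))"
    by metis
  have ne: "xc r \<noteq> shf 1 (xc r)" if "r \<in> N" for r
    using xc[OF that] shf_eq_iff[of 0 "xc r" 1] q_ge8 by auto
  let ?f = "\<lambda>(r, t). r + q ^ l * (if t then xc r else shf 1 (xc r))"
  have inj: "inj_on ?f (N \<times> (UNIV :: bool set))"
  proof (rule inj_onI, clarify)
    fix r t r' t' assume r: "r \<in> N" "r' \<in> N"
      and eq: "r + q ^ l * (if t then xc r else shf 1 (xc r)) = r' + q ^ l * (if t' then xc r' else shf 1 (xc r'))"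
    have lt: "r < q ^ l" "r' < q ^ l" using r by (auto simp: N_def)
    then have "r = r'" "(if t then xc r else shf 1 (xc r)) = (if t' then xc r' else shf 1 (xc r'))"
      using arg_cong[OF eq, of "\<lambda>z. z mod q ^ l"] arg_cong[OF eq, of "\<lambda>z. z div q ^ l"] by simp_all
    then show "r = r' \<and> t = t'" using ne[OF r(1)] by (auto split: if_splits)
  qed
  have "?f ` (N \<times> UNIV) \<subseteq> {r. r < q ^ Suc l \<and> \<not> good (Suc l) r}"
    using xc child_lt by (auto simp: N_def simp del: power_Suc split: if_splits)
  then have "card (N \<times> (UNIV :: bool set)) \<le> b (Suc l)"
    unfolding b_def by (intro card_inj_on_le[OF inj]) auto
  then have "2 * card N \<le> b (Suc l)" by (simp add: card_cartesian_product)
  with 1 show ?thesis by linarith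
qed

definition Cb :: nat where "Cb = (2 * q + 4) * d + 2"

text \<open>Summing \<open>bad_step\<close> puts twice the sum of \<open>b\<close> against the
  shifted sum, which differs from the sum itself by at most \<open>b h\<close>. What remains is at
  most twice \<open>2 * d\<close> plus twice \<open>1 + q * d\<close>, which is
  \<open>Cb\<close>.\<close>

lemma sum_b: "(\<Sum>l<h. b l) \<le> Cb"
proof -
  have "(\<Sum>l<h. 2 * b l) \<le> (\<Sum>l<h. b (Suc l) + 2 * lf l + 2 * s l)" by (intro sum_mono bad_step)
  also have "\<dots> = (\<Sum>l<h. b (Suc l)) + 2 * (\<Sum>l<h. lf l) + 2 * (\<Sum>l<h. s l)"
    by (simp add: sum.distrib sum_distrib_left)
  finally have 1: "2 * (\<Sum>l<h. b l) \<le> (\<Sum>l<h. b (Suc l)) + 2 * (\<Sum>l<h. lf l) + 2 * (\<Sum>l<h. s l)"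
    by (simp add: sum_distrib_left)
  have "(\<Sum>l<h. b (Suc l)) + b 0 = (\<Sum>l<h. b l) + b h"
    using sum.lessThan_Suc_shift[of b h] sum.lessThan_Suc[of b h] by simp
  moreover have "(\<Sum>l<h. s l) \<le> 1 + q * d" using sum_s[of h] by simp
  ultimately show ?thesis using 1 sum_leaf[of h] unfolding Cb_def by (simp add: algebra_simps)
qed

text \<open>The bound \<open>Cb\<close> does not depend on the number of levels, so some level has
  no bad vertex and the level after it is covered.\<close>

lemma covered_level: "\<exists>h. (\<forall>r<q ^ h. covered h r) \<and> (\<Sum>l<h. c l) \<le> 1 + q * Cb"
proof -
  have "\<exists>l\<le>Cb. b l = 0"
  proof (rule ccontr)
    assume "\<not> (\<exists>l\<le>Cb. b l = 0)"
    then have "(\<Sum>l<Suc Cb. 1) \<le> (\<Sum>l<Suc Cb. b l)" by (intro sum_mono) (auto simp: less_Suc_eq_le Suc_leI)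
    then show False using sum_b[of "Suc Cb"] by simp
  qed
  then obtain l where l: "b l = 0" by blast
  have fin: "finite {r. r < q ^ l \<and> Q r}" for l Q by simp
  have "covered (Suc l) w" if w: "w < q ^ Suc l" for w
  proof -
    obtain r x where r: "w = r + q ^ l * x" "r < q ^ l" "x < q" using child_split[OF w] .
    have "good l r" using l r(2) fin by (auto simp: b_def)
    then show ?thesis using good_covered r by blast
  qed
  moreover have "c (Suc i) \<le> q * b i" for i
  proof -
    have "{w. w < q ^ Suc i \<and> \<not> covered (Suc i) w} \<subseteq> (\<lambda>(x, r). r + q ^ i * x) ` ({..<q} \<times> {r. r < q ^ i \<and> \<not> good i r})"
    proof clarify
      fix w assume w: "w < q ^ Suc i" "\<not> covered (Suc i) w"
      obtain r x where r: "w = r + q ^ i * x" "r < q ^ i" "x < q" using child_split[OF w(1)] .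
      then have "\<not> good i r" using good_covered w by blast
      then show "w \<in> (\<lambda>(x, r). r + q ^ i * x) ` ({..<q} \<times> {r. r < q ^ i \<and> \<not> good i r})" using r by force
    qed
    then have "c (Suc i) \<le> card ({..<q} \<times> {r. r < q ^ i \<and> \<not> good i r})"
      unfolding c_def by (intro surj_card_le) auto
    then show ?thesis by (simp add: b_def card_cartesian_product)
  qed
  then have "(\<Sum>i<l. c (Suc i)) \<le> (\<Sum>i<l. q * b i)" by (intro sum_mono)
  then have "(\<Sum>i<l. c (Suc i)) \<le> q * Cb" using mult_le_mono2[OF sum_b[of l], of q] by (simp add: sum_distrib_left)
  moreover have "c 0 \<le> card {..<1::nat}" unfolding c_def by (intro card_mono) auto
  ultimately have "(\<Sum>i<Suc l. c i) \<le> 1 + q * Cb" unfolding sum.lessThan_Suc_shift by simp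
  with \<open>\<And>w. w < q ^ Suc l \<Longrightarrow> covered (Suc l) w\<close> show ?thesis by blast
qed

text \<open>Counts the uncovered vertices met within e levels below (l, r) when covered vertices are
  not entered. Each costs one factor \<open>branch_index\<close> in \<open>cov_Kv\<close>.\<close>

primrec bc :: "nat \<Rightarrow> nat \<Rightarrow> nat \<Rightarrow> nat" where
  "bc 0 l r = 0"
| "bc (Suc e) l r = (if covered l r then 0 else 1 + (\<Sum>x<q. bc e (Suc l) (r + q ^ l * x)))"

lemma sum_children:
  "(\<Sum>r<q ^ l. \<Sum>x<q. f (r + q ^ l * x)) = (\<Sum>w<q ^ Suc l. f w)" for f :: "nat \<Rightarrow> nat"
proof -
  have "(\<Sum>r<q ^ l. \<Sum>x<q. f (r + q ^ l * x)) = (\<Sum>(r, x)\<in>{..<q ^ l} \<times> {..<q}. f (r + q ^ l * x))"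
    by (simp add: sum.cartesian_product)
  also have "\<dots> = (\<Sum>w<q ^ Suc l. f w)"
  proof (rule sum.reindex_bij_witness[of _ "\<lambda>w. (w mod q ^ l, w div q ^ l)" "\<lambda>(r, x). r + q ^ l * x"])
    fix w assume w: "w \<in> {..<q ^ Suc l}"
    then obtain r x where "w = r + q ^ l * x" "r < q ^ l" "x < q" using child_split[of w l] by auto
    then show "(case (w mod q ^ l, w div q ^ l) of (r, x) \<Rightarrow> r + q ^ l * x) = w"
      "(w mod q ^ l, w div q ^ l) \<in> {..<q ^ l} \<times> {..<q}" by auto
  qed (use child_lt in \<open>auto simp del: power_Suc\<close>)
  finally show ?thesis .
qed

lemma sum_bc: "(\<Sum>r<q ^ l. bc e l r) \<le> (\<Sum>i<e. c (l + i))"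
proof (induction e arbitrary: l)
  case (Suc e)
  have "(\<Sum>r<q ^ l. bc (Suc e) l r) \<le> (\<Sum>r<q ^ l. (if covered l r then 0 else 1) + (\<Sum>x<q. bc e (Suc l) (r + q ^ l * x)))"
    by (intro sum_mono) auto
  also have "\<dots> = (\<Sum>r<q ^ l. if covered l r then 0 else 1) + (\<Sum>w<q ^ Suc l. bc e (Suc l) w)"
    unfolding sum.distrib sum_children ..
  also have "(\<Sum>r<q ^ l. if covered l r then 0 else 1) = c l"
  proof -
    have "(\<Sum>r<q ^ l. if covered l r then 0 else 1) = (\<Sum>r<q ^ l. if \<not> covered l r then 1 else 0::nat)"
      by (intro sum.cong) auto
    also have "\<dots> = c l" unfolding c_def
      by (subst sum.inter_filter[symmetric]) (auto intro!: arg_cong[where f = card])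
    finally show ?thesis .
  qed
  also have "c l + (\<Sum>w<q ^ Suc l. bc e (Suc l) w) \<le> c l + (\<Sum>i<e. c (Suc l + i))"
    using Suc.IH[of "Suc l"] by simp
  also have "\<dots> = (\<Sum>i<Suc e. c (l + i))" unfolding sum.lessThan_Suc_shift by simp
  finally show ?case .
qed simp

text \<open>At an uncovered vertex the passage from its copy of \<open>K\<close> to the product of
  the copies at its children costs \<open>branch_index\<close>; the copies at the children commute,
  so their indices multiply.\<close>

lemma cov_Kv:
  assumes "\<And>r. r < q ^ (l + e) \<Longrightarrow> covered (l + e) r" "r < q ^ l"
  shows "cov (branch_index ^ bc e l r) (Kv l r) (comm_gp U)"
  using assms
proof (induction e arbitrary: l r)
  case 0
  then have "Kv l r \<subseteq> comm_gp U" by (simp add: covered_def)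
  from cov_one[OF subgrp_comm_gp this] show ?case by simp
next
  case (Suc e)
  show ?case
  proof (cases "covered l r")
    case True
    then have "Kv l r \<subseteq> comm_gp U" by (simp add: covered_def)
    from cov_one[OF subgrp_comm_gp this] True show ?thesis by simp
  next
    case False
    let ?f = "\<lambda>x. Kv (Suc l) (r + q ^ l * x)"
    have "cov branch_index (Kv l r) (below l r ` P l)"
      by (rule cov_mono[OF cov_image[OF cov_G_P below_add]]) (use K_G in \<open>auto simp: Kv_def\<close>)
    moreover have "below l r ` P l \<subseteq> gen (\<Union>x<q. ?f x)"
    proof -
      have "gen (\<Union>x<q. below 1 x ` K (Suc l)) \<subseteq> {k. below l r k \<in> gen (\<Union>x<q. ?f x)}"
      proof (rule gen_least[OF subgrp_vimage[OF below_add subgrp_gen]], clarify)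
        fix x k assume "x < q" "k \<in> K (Suc l)"
        then have "below l r (below 1 x k) \<in> (\<Union>x<q. ?f x)" using below_below Suc.prems(2) by (auto simp: Kv_def)
        then show "below l r (below 1 x k) \<in> gen (\<Union>x<q. ?f x)" by (rule subsetD[OF gen_incl])
      qed
      then show ?thesis using P_gen[of l] by blast
    qed
    ultimately have 1: "cov branch_index (Kv l r) (gen (\<Union>x<q. ?f x))" by (rule cov_mono[OF _ order_refl order_refl])
    have 2: "cov (\<Prod>x<q. branch_index ^ bc e (Suc l) (r + q ^ l * x)) (gen (\<Union>x<q. ?f x)) (comm_gp U)"
    proof (rule cov_gen_commuting[OF subgrp_comm_gp subgrp_Kv])
      show "cov (branch_index ^ bc e (Suc l) (r + q ^ l * x)) (?f x) (comm_gp U)" if "x < q" for x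
        using Suc.prems(1) child_lt[OF Suc.prems(2) that] by (intro Suc.IH) auto
      fix x y k k' assume xy: "x < y" "y < q" and k: "k \<in> ?f x" "k' \<in> ?f y"
      show "k + k' = k' + k"
        by (rule Kv_commute[OF k]) (use xy Suc.prems(2) in \<open>auto dest!: sym[of _ "_ + _"]\<close>)
    qed
    have "(\<Prod>x<q. branch_index ^ bc e (Suc l) (r + q ^ l * x)) = branch_index ^ (\<Sum>x<q. bc e (Suc l) (r + q ^ l * x))"
      by (simp add: power_sum)
    with cov_trans[OF 1 2] False show ?thesis by simp
  qed
qed

theorem cov_comm: "cov (q ^ 3 * branch_index ^ (1 + q * Cb)) (G 0) (comm_gp U)"
proof -
  obtain h where h: "\<forall>r<q ^ h. covered h r" "(\<Sum>l<h. c l) \<le> 1 + q * Cb" using covered_level by blast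
  have "bc h 0 0 \<le> (\<Sum>i<h. c i)" using sum_bc[where l = 0 and e = h] by (simp add: lessThan_Suc)
  also have "\<dots> \<le> 1 + q * Cb" by (rule h)
  finally have "branch_index ^ bc h 0 0 \<le> branch_index ^ (1 + q * Cb)" by (intro power_increasing) (auto simp: branch_index_def Suc_leI)
  moreover have "cov (branch_index ^ bc h 0 0) (Kv 0 0) (comm_gp U)" using h by (intro cov_Kv) auto
  moreover have "Kv 0 0 = K 0" by (simp add: Kv_def)
  ultimately have "cov (branch_index ^ (1 + q * Cb)) (K 0) (comm_gp U)"
    using cov_mono[OF _ _ order_refl order_refl] by simp
  then show ?thesis by (rule cov_trans[OF cov_G_K])
qed

section \<open>Orbits of U on the natural numbers\<close>

lemma orbit_level:
  "\<exists>Ob. Ob \<subseteq> {..<q ^ l} \<and> card Ob \<le> 1 + q * (\<Sum>i<l. s i) \<and> (\<forall>m. \<exists>u\<in>U. ap u m mod q ^ l \<in> Ob)"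
proof (induction l)
  case 0 then show ?case using subgrp_0[OF U(1)] by (intro exI[of _ "{0}"]) auto
next
  case (Suc l)
  then obtain Ob where Ob: "Ob \<subseteq> {..<q ^ l}" "card Ob \<le> 1 + q * (\<Sum>i<l. s i)" "\<And>m. \<exists>u\<in>U. ap u m mod q ^ l \<in> Ob"
    by blast
  have finO: "finite Ob" using Ob(1) finite_subset by blast
  \<comment> \<open>The number r is also its own child with digit 0. So a transitive representative
    is kept as it is, and a nontransitive one is replaced by all its children.\<close>
  let ?T = "{r \<in> Ob. trans l r}" let ?N = "{r \<in> Ob. \<not> trans l r}"
  let ?E = "(\<lambda>(r, x). r + q ^ l * x) ` (?N \<times> {..<q})"
  have "card (?T \<union> ?E) \<le> card ?T + card ?E" by (rule card_Un_le)
  also have "card ?E \<le> card (?N \<times> {..<q})" by (rule card_image_le) (use finO in auto)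
  also have "\<dots> = card ?N * q" by (simp add: card_cartesian_product)
  also have "card ?N \<le> s l" unfolding s_def using Ob(1) by (intro card_mono) auto
  also have "card ?T \<le> card Ob" using finO by (intro card_mono) auto
  finally have c: "card (?T \<union> ?E) \<le> 1 + q * (\<Sum>i<Suc l. s i)" using Ob(2) by (simp add: algebra_simps)
  have sub: "?T \<union> ?E \<subseteq> {..<q ^ Suc l}"
  proof -
    have "r < q ^ Suc l" if "r < q ^ l" for r using child_lt[OF that, of 0] by simp
    then show ?thesis using Ob(1) child_lt by (auto simp del: power_Suc)
  qed
  have "\<exists>u\<in>U. ap u m mod q ^ Suc l \<in> ?T \<union> ?E" for m
  proof -
    obtain u where u: "u \<in> U" "ap u m mod q ^ l \<in> Ob" using Ob(3) by blast
    define o' where "o' = ap u m mod q ^ l"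
    define k where "k = ap u m div q ^ l"
    have y: "ap u m = o' + q ^ l * k" by (simp add: o'_def k_def)
    have ol: "o' < q ^ l" by (simp add: o'_def)
    have oO: "o' \<in> Ob" using u by (simp add: o'_def)
    show ?thesis
    proof (cases "trans l o'")
      case True
      then obtain u1 where u1: "u1 \<in> U" "\<And>m. ap u1 (o' + q ^ l * m) mod q ^ Suc l = o' + q ^ l * shf 1 (m mod q)"
        by (auto simp: trans_def)
      have it: "ap (nm i u1) (o' + q ^ l * k) mod q ^ Suc l = o' + q ^ l * shf (int i) (k mod q)" for i
      proof (induction i)
        case 0
        show ?case using child_mod[OF ol, of "k mod q" "o' + q ^ l * k"] ol by (simp del: power_Suc)
      next
        case (Suc i)
        let ?z = "ap (nm i u1) (o' + q ^ l * k)"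
        have z: "?z mod q ^ l = o' \<and> ?z div q ^ l mod q = shf (int i) (k mod q)"
          using Suc child_mod[OF ol shf_lt] by blast
        have "ap u1 ?z mod q ^ Suc l = o' + q ^ l * shf 1 (?z div q ^ l mod q)"
          using u1(2)[of "?z div q ^ l"] level_eq[of ?z l o'] z by simp
        then show ?case using z by simp
      qed
      have "ap (nm (q - k mod q) u1 + u) m mod q ^ Suc l = o' + q ^ l * shf (int (q - k mod q)) (k mod q)"
        using it by (simp add: y)
      also have "shf (int (q - k mod q)) (k mod q) = 0"
        by (simp add: shf_def of_nat_diff)
      finally have "ap (nm (q - k mod q) u1 + u) m mod q ^ Suc l \<in> ?T" using True oO by simp
      moreover have "nm (q - k mod q) u1 + u \<in> U" using u u1 U(1) nm_subgrp subgrp_add by blast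
      ultimately show ?thesis by blast
    next
      case False
      have "ap u m mod q ^ Suc l = o' + q ^ l * (k mod q)"
        using child_mod[OF ol, of "k mod q" "ap u m"] ol by (simp add: y del: power_Suc)
      moreover have "(o', k mod q) \<in> ?N \<times> {..<q}" using False oO by simp
      ultimately have "ap u m mod q ^ Suc l \<in> ?E" by (metis (no_types, lifting) case_prod_conv image_eqI)
      then show ?thesis using u(1) by blast
    qed
  qed
  then show ?case using c sub by blast
qed

text \<open>On a covered level h the copies \<open>Kv h r\<close> lie in \<open>U\<close>, and by
  \<open>Kv_lift\<close> and \<open>G_trans\<close> they act transitively below each child of r. So
  orbit representatives on level h + 1 already represent all numbers.\<close>

theorem orbits: "\<exists>Ob. finite Ob \<and> card Ob \<le> 1 + q * (1 + q * d) \<and> (\<forall>m. \<exists>u\<in>U. ap u m \<in> Ob)"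
proof -
  obtain h where h: "\<forall>r<q ^ h. covered h r" using covered_level by blast
  obtain Ob where Ob: "Ob \<subseteq> {..<q ^ Suc h}" "card Ob \<le> 1 + q * (\<Sum>i<Suc h. s i)" "\<And>m. \<exists>u\<in>U. ap u m mod q ^ Suc h \<in> Ob"
    using orbit_level[of "Suc h"] by blast
  have "q * (\<Sum>i<Suc h. s i) \<le> q * (1 + q * d)" by (intro mult_le_mono2 sum_s)
  then have "card Ob \<le> 1 + q * (1 + q * d)" using Ob(2) by linarith
  moreover have "\<exists>u\<in>U. ap u m \<in> Ob" for m
  proof -
    obtain u where u: "u \<in> U" "ap u m mod q ^ Suc h \<in> Ob" using Ob(3) by blast
    have "ap u m mod q ^ Suc h < q ^ Suc h" by (simp del: power_Suc)
    then obtain r x where r: "ap u m mod q ^ Suc h = r + q ^ h * x" "r < q ^ h" "x < q" by (rule child_split)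
    obtain k where k: "ap u m = (r + q ^ h * x) + q ^ Suc h * k" using level_eq[OF r(1)] by blast
    obtain g where g: "g \<in> G (Suc h)" "ap g k = 0" using G_trans by blast
    obtain v where v: "v \<in> Kv h r" "\<And>m. ap v ((r + q ^ h * x) + q ^ Suc h * m) = (r + q ^ h * x) + q ^ Suc h * ap g m"
      using Kv_lift[OF g(1) r(2,3)] by blast
    have "v \<in> U" using v(1) h r(2) comm_gp_sub[OF U(1)] by (auto simp: covered_def)
    then have "v + u \<in> U" using u U(1) subgrp_add by blast
    moreover have "ap (v + u) m \<in> Ob" using v(2)[of k] u(2) r(1) g(2) by (simp add: k del: power_Suc)
    ultimately show ?thesis by blast
  qed
  moreover have "finite Ob" using Ob(1) finite_subset by blast
  ultimately show ?thesis by blast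
qed

end

section \<open>Subgroups of finite index in p-groups\<close>

lemma (in group) rcosets_translate:
  assumes "subgroup W G" "C \<in> rcosets W" "g \<in> carrier G"
  shows "C #> g \<in> rcosets W"
  using assms by (auto simp: RCOSETS_def subgroup.subset coset_mult_assoc)

lemma (in group) rcosets_sub:
  assumes "subgroup W G" "C \<in> rcosets W" shows "C \<subseteq> carrier G"
  using assms by (auto simp: RCOSETS_def dest: r_coset_subset_G[OF subgroup.subset])

text \<open>The inverse turns right translation into a left action; the restriction is what
  membership in \<open>BijGroup\<close> demands.\<close>

lemma (in group) rcosets_action:
  assumes W: "subgroup W G" and V: "subgroup V G"
  shows "group_action (G\<lparr>carrier := V\<rparr>) (rcosets W) (\<lambda>v. \<lambda>C\<in>rcosets W. C #> inv v)"
proof -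
  let ?E = "rcosets W" let ?f = "\<lambda>v. \<lambda>C\<in>rcosets W. C #> inv v"
  have V': "v \<in> carrier G" if "v \<in> V" for v using that subgroup.subset[OF V] by auto
  have comp: "C #> inv u #> inv v = C #> inv (v \<otimes> u)"
    if "C \<in> ?E" "v \<in> V" "u \<in> V" for C u v
    using that V' by (simp add: coset_mult_assoc rcosets_sub[OF W] inv_mult_group)
  have B: "?f v \<in> Bij ?E" if v: "v \<in> V" for v
  proof -
    have "bij_betw (\<lambda>C. C #> inv v) ?E ?E"
    proof (rule bij_betw_byWitness[where f' = "\<lambda>C. C #> v"])
      show "\<forall>C\<in>?E. C #> inv v #> v = C" "\<forall>C\<in>?E. C #> v #> inv v = C"
        using V'[OF v] by (auto simp: coset_mult_assoc rcosets_sub[OF W])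
      show "(\<lambda>C. C #> inv v) ` ?E \<subseteq> ?E" "(\<lambda>C. C #> v) ` ?E \<subseteq> ?E"
        using V'[OF v] rcosets_translate[OF W] by auto
    qed
    then have "bij_betw (?f v) ?E ?E" by (rule bij_betw_cong[THEN iffD1, rotated]) simp
    then show ?thesis by (simp add: Bij_def)
  qed
  have "group_hom (G\<lparr>carrier := V\<rparr>) (BijGroup ?E) ?f"
  proof (intro group_hom.intro group_hom_axioms.intro homI)
    show "group (G\<lparr>carrier := V\<rparr>)" using V by (rule subgroup.subgroup_is_group) (rule is_group)
    show "group (BijGroup ?E)" by (rule group_BijGroup)
    show "?f v \<in> carrier (BijGroup ?E)" if "v \<in> carrier (G\<lparr>carrier := V\<rparr>)" for v
      using B that by (simp add: BijGroup_def)
    fix v u assume vu: "v \<in> carrier (G\<lparr>carrier := V\<rparr>)" "u \<in> carrier (G\<lparr>carrier := V\<rparr>)"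
    then have vu: "v \<in> V" "u \<in> V" by auto
    have "?f v \<otimes>\<^bsub>BijGroup ?E\<^esub> ?f u = compose ?E (?f v) (?f u)"
      using B vu by (simp add: BijGroup_def)
    also have "\<dots> = ?f (v \<otimes> u)"
      unfolding compose_def using vu V' rcosets_translate[OF W] comp by (auto simp: fun_eq_iff)
    finally show "?f (v \<otimes>\<^bsub>G\<lparr>carrier := V\<rparr>\<^esub> u) = ?f v \<otimes>\<^bsub>BijGroup ?E\<^esub> ?f u" by simp
  qed
  then show ?thesis by (rule group_action.intro)
qed

text \<open>Another prime dividing the order would give, by Sylow's theorem, a subgroup of that
  prime order, and its nontrivial elements would have this order.\<close>

lemma finite_p_group_order:
  fixes G (structure)
  assumes p: "Factorial_Ring.prime p" and G: "is_p_group p G" and fin: "finite (carrier G)"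
  shows "\<exists>m. order G = p ^ m"
proof (rule ccontr)
  assume no: "\<nexists>m. order G = p ^ m"
  interpret group G using G by (simp add: is_p_group_def)
  have pos: "order G > 0" using fin by (simp add: order_gt_0_iff_finite)
  obtain a m where am: "order G = p ^ a * m" "\<not> p dvd m"
    using pos p by (metis multiplicity_decompose' not_prime_unit neq0_conv)
  then have "m \<noteq> 1" using no by auto
  then obtain r where r: "Factorial_Ring.prime r" "r dvd m" using prime_factor_nat by blast
  then have "r \<noteq> p" using am by auto
  obtain m' where "order G = r ^ 1 * m'" using r(2) am(1) by (metis dvd_def dvd_mult power_one_right)
  then obtain H where H: "subgroup H G" "card H = r ^ 1"
    using sylow_thm[OF r(1) is_group _ fin] by blast
  have "card H > 1" using H r(1) by (simp add: prime_gt_Suc_0_nat)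
  have "\<exists>x\<in>H. x \<noteq> \<one>"
  proof (rule ccontr)
    assume "\<not> (\<exists>x\<in>H. x \<noteq> \<one>)"
    then have "card H \<le> card {\<one>}" by (intro card_mono) auto
    then show False using \<open>card H > 1\<close> by simp
  qed
  then obtain x where x: "x \<in> H" "x \<noteq> \<one>" by blast
  have xG: "x \<in> carrier G" using x subgroup.subset[OF H(1)] by auto
  interpret H: group "G\<lparr>carrier := H\<rparr>" using H(1) by (rule subgroup.subgroup_is_group) (rule is_group)
  have "x [^]\<^bsub>G\<lparr>carrier := H\<rparr>\<^esub> order (G\<lparr>carrier := H\<rparr>) = \<one>"
    using H.pow_order_eq_1[of x] x by simp
  then have "x [^] r = \<one>" using H(2) nat_pow_consistent[of x r H] by (simp add: order_def)
  then have "ord x dvd r" using pow_eq_id[OF xG] by simp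
  moreover obtain k where k: "ord x = p ^ k" using G xG by (auto simp: is_p_group_def)
  moreover have "ord x \<noteq> 1" using ord_eq_1[OF xG] x by simp
  ultimately have "p ^ k = r" "k \<noteq> 0" using r(1) by (auto simp: prime_nat_iff)
  then have "p dvd r" by (metis dvd_power neq0_conv)
  then show False using primes_dvd_imp_eq[OF p r(1)] \<open>r \<noteq> p\<close> by blast
qed

text \<open>W acts on its cosets. Their number is divisible by p and orbits have p-power length, so
  the fixed point W cannot be the only one. A second fixed coset \<open>W #> x\<close> means that x
  normalizes W.\<close>

lemma finite_normalizer_grows:
  fixes G (structure)
  assumes p: "Factorial_Ring.prime p" and G: "is_p_group p G" and fin: "finite (carrier G)"
    and W: "subgroup W G" and ne: "W \<noteq> carrier G"
  shows "\<exists>x\<in>carrier G - W. \<forall>w\<in>W. x \<otimes>\<^bsub>G\<^esub> w \<otimes>\<^bsub>G\<^esub> inv\<^bsub>G\<^esub> x \<in> W"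
proof -
  interpret group G using G by (simp add: is_p_group_def)
  interpret W: subgroup W G by (rule W)
  let ?E = "rcosets W" let ?f = "\<lambda>v. \<lambda>C\<in>rcosets W. C #> inv v"
  let ?W = "G\<lparr>carrier := W\<rparr>"
  interpret act: group_action ?W ?E ?f by (rule rcosets_action[OF W W])
  obtain m where m: "order G = p ^ m" using finite_p_group_order[OF p G fin] by blast
  have "card ?E * card W = p ^ m" using lagrange[OF W] m by simp
  then have "card ?E dvd p ^ m" "card W dvd p ^ m" by (metis dvd_triv_left, metis dvd_triv_right)
  then obtain e w where e: "card ?E = p ^ e" and w: "card W = p ^ w"
    using p by (meson divides_primepow_nat)
  have finE: "finite ?E" using fin by (simp add: RCOSETS_def)
  have WE: "W \<in> ?E" by (rule W.subgroup_in_rcosets) (rule is_group)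
  have "e \<noteq> 0"
  proof
    assume "e = 0"
    then have "card W = card (carrier G)" using lagrange[OF W] e by (simp add: order_def)
    then show False using ne card_subset_eq[OF fin W.subset] by simp
  qed
  then have pE: "p dvd card ?E" using e by simp
  have "W #> inv g = W" if "g \<in> W" for g
    using W.rcos_const[OF is_group, of "inv g"] that by simp
  then have im: "(\<lambda>g. ?f g W) ` W = (\<lambda>g. W) ` W"
    using WE by (intro image_cong) simp_all
  have c: "(\<lambda>g. W) ` W = {W}" using W.one_closed by blast
  have "carrier ?W = W" by simp
  then have o: "orbit ?W ?f W = (\<lambda>g. ?f g W) ` W"
    unfolding orbit_def Setcompr_eq_image by (simp only:)
  have WW: "orbit ?W ?f W = {W}" by (simp only: o im c)
  have orb: "\<exists>k. card (orbit ?W ?f C) = p ^ k" if "C \<in> ?E" for C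
  proof -
    have "card (orbit ?W ?f C) * card (stabilizer ?W ?f C) = p ^ w"
      using act.orbit_stabilizer_theorem[OF that] w by (simp add: order_def)
    then have "card (orbit ?W ?f C) dvd p ^ w" by (metis dvd_triv_left)
    then show ?thesis using p by (meson divides_primepow_nat)
  qed
  have "\<exists>C\<in>?E. C \<noteq> W \<and> card (orbit ?W ?f C) = 1"
  proof (rule ccontr)
    assume no: "\<not> ?thesis"
    let ?O = "orbits ?W ?E ?f"
    have finO: "finite ?O" using finE by (simp add: orbits_def)
    have WO: "{W} \<in> ?O" unfolding orbits_def using WE WW by blast
    have "p dvd card B" if B: "B \<in> ?O - {{W}}" for B
    proof -
      obtain C where C: "C \<in> ?E" "B = orbit ?W ?f C" using B by (auto simp: orbits_def)
      then have "C \<noteq> W" using B WW by auto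
      then have "card B \<noteq> 1" using no C by blast
      then show ?thesis using orb[OF C(1)] C(2) by (metis dvd_power power_0 neq0_conv)
    qed
    then have "p dvd (\<Sum>B\<in>?O - {{W}}. card B)" by (rule dvd_sum)
    moreover have "card ?E = (\<Sum>B\<in>?O. card B)"
      using act.disjoint_sum[OF finE, of "\<lambda>_. 1::nat"] by simp
    then have "card ?E = (\<Sum>B\<in>?O - {{W}}. card B) + 1"
      using sum.remove[OF finO WO, of card] by simp
    ultimately have "p dvd 1" using pE by (metis dvd_add_right_iff)
    then show False using p by (metis not_prime_unit)
  qed
  then obtain C where C: "C \<in> ?E" "C \<noteq> W" "card (orbit ?W ?f C) = 1" by blast
  have Corb: "C \<in> orbit ?W ?f C" using act.orbit_refl[OF C(1)] by simp
  have fix_: "C #> inv w = C" if "w \<in> W" for w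
  proof -
    have "?f w C \<in> orbit ?W ?f C" unfolding orbit_def using that by auto
    then show ?thesis using C Corb by (auto simp: card_1_singleton_iff)
  qed
  obtain x where x: "x \<in> carrier G" "C = W #> x" using C(1) by (auto simp: RCOSETS_def)
  have "x \<notin> W" using C(2) x W.rcos_const[OF is_group] by auto
  moreover have "x \<otimes> w \<otimes> inv x \<in> W" if w: "w \<in> W" for w
  proof -
    have "W #> x #> inv (inv w) = W #> x" using fix_[of "inv w"] w x by simp
    then have "W #> (x \<otimes> w) = W #> x" using w x by (simp add: coset_mult_assoc W.subset)
    then have "x \<otimes> w \<in> W #> x" using rcos_self[OF _ W, of "x \<otimes> w"] w x by auto
    then obtain w' where "w' \<in> W" "x \<otimes> w = w' \<otimes> x" by (auto simp: r_coset_def)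
    then show ?thesis using w x by (simp add: m_assoc)
  qed
  ultimately show ?thesis using x by blast
qed

text \<open>The kernel of the action on the cosets, that is the normal core of
  \<open>W\<close>.\<close>

definition ncore :: "('a, 'c) monoid_scheme \<Rightarrow> 'a set \<Rightarrow> 'a set" where
  "ncore G W = {g \<in> carrier G. \<forall>C\<in>rcosets\<^bsub>G\<^esub> W. C #>\<^bsub>G\<^esub> g = C}"

lemma (in group) ncore_subset:
  assumes "subgroup W G" shows "ncore G W \<subseteq> W"
proof
  fix g assume g: "g \<in> ncore G W"
  have "W \<in> rcosets W" using subgroup.subgroup_in_rcosets[OF assms is_group] .
  then have "W #> g = W" "g \<in> carrier G" using g by (auto simp: ncore_def)
  then show "g \<in> W" using coset_join1 assms subgroup.subset by (metis rcos_self)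
qed

lemma (in group) ncore_normal:
  assumes W: "subgroup W G" shows "ncore G W \<lhd> G"
proof -
  note sub = rcosets_sub[OF W]
  have "subgroup (ncore G W) G"
  proof
    show "ncore G W \<subseteq> carrier G" by (auto simp: ncore_def)
    show "\<one> \<in> ncore G W" using sub by (auto simp: ncore_def)
    fix x y assume xy: "x \<in> ncore G W" "y \<in> ncore G W"
    then show "x \<otimes> y \<in> ncore G W" using sub by (auto simp: ncore_def coset_mult_assoc[symmetric])
    have "C #> inv x = C" if C: "C \<in> rcosets W" for C
    proof -
      have Cx: "C #> x = C" "x \<in> carrier G" using xy C by (auto simp: ncore_def)
      have "C #> x #> inv x = C" using Cx(2) sub[OF C] by (simp add: coset_mult_assoc)
      then show ?thesis using Cx by simp
    qed
    then show "inv x \<in> ncore G W" using xy by (auto simp: ncore_def)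
  qed
  moreover have "g \<otimes> x \<otimes> inv g \<in> ncore G W" if "g \<in> carrier G" "x \<in> ncore G W" for g x
  proof -
    have "C #> (g \<otimes> x \<otimes> inv g) = C" if C: "C \<in> rcosets W" for C
    proof -
      have "C #> (g \<otimes> x \<otimes> inv g) = C #> g #> x #> inv g"
        using \<open>g \<in> _\<close> \<open>x \<in> _\<close> C sub by (simp add: ncore_def coset_mult_assoc m_assoc r_coset_subset_G)
      also have "C #> g #> x = C #> g"
        using rcosets_translate[OF W C \<open>g \<in> _\<close>] \<open>x \<in> _\<close> by (auto simp: ncore_def)
      also have "C #> g #> inv g = C" using C sub \<open>g \<in> _\<close> by (simp add: coset_mult_assoc)
      finally show ?thesis .
    qed
    then show ?thesis using that by (auto simp: ncore_def)
  qed
  ultimately show ?thesis by (simp add: normal_inv_iff)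
qed

lemma (in group) ncore_finite_index:
  assumes W: "subgroup W G" and fin: "finite (rcosets W)"
  shows "finite (rcosets (ncore G W))"
proof -
  let ?h = "\<lambda>g. \<lambda>C\<in>rcosets W. C #> g"
  have "finite (PiE (rcosets W) (\<lambda>_. rcosets W))" using fin by (intro finite_PiE) auto
  then have fi: "finite (?h ` carrier G)"
    by (rule finite_subset[rotated]) (auto intro: rcosets_translate[OF W])
  have "rcosets (ncore G W) \<subseteq> (\<lambda>h. ncore G W #> (SOME g. g \<in> carrier G \<and> ?h g = h)) ` ?h ` carrier G"
  proof
    fix D assume "D \<in> rcosets (ncore G W)"
    then obtain g where g: "g \<in> carrier G" "D = ncore G W #> g" by (auto simp: RCOSETS_def)
    let ?g = "SOME x. x \<in> carrier G \<and> ?h x = ?h g"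
    have g': "?g \<in> carrier G \<and> ?h ?g = ?h g" by (rule someI[of _ g]) (use g in simp)
    have "g \<otimes> inv ?g \<in> ncore G W"
    proof -
      have "C #> (g \<otimes> inv ?g) = C" if C: "C \<in> rcosets W" for C
      proof -
        have "C #> g = C #> ?g" using g' C by (metis (mono_tags, lifting) restrict_apply')
        then have "C #> g #> inv ?g = C #> ?g #> inv ?g" by simp
        then show ?thesis using g g' C rcosets_sub[OF W C] by (simp add: coset_mult_assoc)
      qed
      then show ?thesis using g g' by (auto simp: ncore_def)
    qed
    then have "g \<in> ncore G W #> ?g"
      using g g' by (auto simp: r_coset_def m_assoc intro!: bexI[of _ "g \<otimes> inv ?g"])
    then have "D = ncore G W #> ?g"
      unfolding g(2) using g' repr_independence[OF _ _ normal_imp_subgroup[OF ncore_normal[OF W]]] by blast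
    then show "D \<in> (\<lambda>h. ncore G W #> (SOME g. g \<in> carrier G \<and> ?h g = h)) ` ?h ` carrier G" using g by blast
  qed
  then show ?thesis using fi finite_surj by blast
qed

lemma p_group_quotient:
  fixes G (structure)
  assumes G: "is_p_group p G" and N: "N \<lhd> G" and p: "Factorial_Ring.prime p"
  shows "is_p_group p (G Mod N)"
proof -
  interpret N: normal N G by (rule N)
  interpret Q: group "G Mod N" by (rule N.factorgroup_is_group)
  have "\<exists>m. Q.ord Z = p ^ m" if Z: "Z \<in> carrier (G Mod N)" for Z
  proof -
    obtain x where x: "x \<in> carrier G" "Z = N #>\<^bsub>G\<^esub> x" using Z by (auto simp: FactGroup_def RCOSETS_def)
    obtain m where m: "N.ord x = p ^ m" using G x by (auto simp: is_p_group_def)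
    have "Z [^]\<^bsub>G Mod N\<^esub> (p ^ m) = N #>\<^bsub>G\<^esub> (x [^]\<^bsub>G\<^esub> (p ^ m))"
      using N.FactGroup_pow[OF x(1), of "p ^ m"] x by simp
    also have "x [^]\<^bsub>G\<^esub> (p ^ m) = \<one>\<^bsub>G\<^esub>" using N.pow_ord_eq_1[OF x(1)] m by simp
    also have "N #>\<^bsub>G\<^esub> \<one>\<^bsub>G\<^esub> = \<one>\<^bsub>G Mod N\<^esub>" by (simp add: N.subset)
    finally have "Q.ord Z dvd p ^ m" using Q.pow_eq_id[OF Z] by simp
    then show ?thesis using p by (meson divides_primepow_nat)
  qed
  then show ?thesis by (simp add: is_p_group_def Q.is_group)
qed

lemma p_group_normal_index:
  fixes G (structure)
  assumes G: "is_p_group p G" and N: "N \<lhd> G" and p: "Factorial_Ring.prime p" and fin: "finite (rcosets\<^bsub>G\<^esub> N)"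
  shows "\<exists>m. card (rcosets\<^bsub>G\<^esub> N) = p ^ m"
  using finite_p_group_order[OF p p_group_quotient[OF G N p]] fin
  by (simp add: FactGroup_def order_def)

text \<open>The normal core has finite index, so the finite case applies to the quotient by
  it.\<close>

lemma p_group_normalizer_grows:
  fixes G (structure)
  assumes p: "Factorial_Ring.prime p" and G: "is_p_group p G"
    and W: "subgroup W G" and ne: "W \<noteq> carrier G" and fin: "finite (rcosets\<^bsub>G\<^esub> W)"
  shows "\<exists>x\<in>carrier G - W. \<forall>w\<in>W. x \<otimes>\<^bsub>G\<^esub> w \<otimes>\<^bsub>G\<^esub> inv\<^bsub>G\<^esub> x \<in> W"
proof -
  interpret group G using G by (simp add: is_p_group_def)
  interpret W: subgroup W G by (rule W)
  define N where "N = ncore G W"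
  have NG: "N \<lhd> G" unfolding N_def by (rule ncore_normal[OF W])
  interpret N: normal N G by (rule NG)
  interpret Q: group "G Mod N" by (rule N.factorgroup_is_group)
  have NW: "N \<subseteq> W" unfolding N_def by (rule ncore_subset[OF W])
  have finQ: "finite (carrier (G Mod N))" using ncore_finite_index[OF W fin] by (simp add: FactGroup_def N_def)
  let ?W = "(\<lambda>w. N #> w) ` W"
  interpret h: group_hom G "G Mod N" "\<lambda>w. N #> w"
    using N.r_coset_hom_Mod by unfold_locales auto
  have WQ: "subgroup ?W (G Mod N)" by (rule h.subgroup_img_is_subgroup[OF W])
  have memW: "x \<in> W" if x: "x \<in> carrier G" "N #> x \<in> ?W" for x
  proof -
    obtain w where w: "w \<in> W" "N #> x = N #> w" using x by auto
    then have "x \<in> N #> w" using rcos_self[OF x(1) N.subgroup_axioms] by simp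
    then obtain n where "n \<in> N" "x = n \<otimes> w" by (auto simp: r_coset_def)
    then show ?thesis using w NW by auto
  qed
  obtain y where y: "y \<in> carrier G" "y \<notin> W" using ne W.subset by blast
  then have "N #> y \<notin> ?W" using memW by blast
  moreover have "N #> y \<in> carrier (G Mod N)" using y by (auto simp: FactGroup_def RCOSETS_def)
  ultimately have "?W \<noteq> carrier (G Mod N)" by blast
  then obtain Z where Z: "Z \<in> carrier (G Mod N)" "Z \<notin> ?W"
    "\<And>w. w \<in> ?W \<Longrightarrow> Z \<otimes>\<^bsub>G Mod N\<^esub> w \<otimes>\<^bsub>G Mod N\<^esub> inv\<^bsub>G Mod N\<^esub> Z \<in> ?W"
    using finite_normalizer_grows[OF p p_group_quotient[OF G NG p] finQ WQ] by blast
  obtain x where x: "x \<in> carrier G" "Z = N #> x" using Z(1) by (auto simp: FactGroup_def RCOSETS_def)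
  have "x \<otimes> w \<otimes> inv x \<in> W" if w: "w \<in> W" for w
  proof (rule memW)
    have "N #> (x \<otimes> w \<otimes> inv x) = Z \<otimes>\<^bsub>G Mod N\<^esub> (N #> w) \<otimes>\<^bsub>G Mod N\<^esub> inv\<^bsub>G Mod N\<^esub> Z"
      using w x by (simp only: h.hom_mult h.hom_inv W.mem_carrier m_closed inv_closed)
    then show "N #> (x \<otimes> w \<otimes> inv x) \<in> ?W" using Z(3) w by simp
  qed (use w x in simp)
  moreover have "x \<notin> W" using Z x by blast
  ultimately show ?thesis using x by blast
qed

text \<open>The bridge from the additive, type class based notation to HOL-Algebra.\<close>

definition GA :: "'g::group_add set \<Rightarrow> 'g monoid" where
  "GA S = \<lparr>carrier = S, mult = (+), one = 0\<rparr>"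

lemma GA_simps [simp]: "carrier (GA S) = S" "mult (GA S) = (+)" "one (GA S) = 0"
  by (simp_all add: GA_def)

lemma group_GA: assumes "subgrp S" shows "group (GA S)"
proof (rule groupI)
  show "\<exists>y\<in>carrier (GA S). y \<otimes>\<^bsub>GA S\<^esub> x = \<one>\<^bsub>GA S\<^esub>" if "x \<in> carrier (GA S)" for x
    using that subgrp_minus[OF assms] by (intro bexI[of _ "- x"]) auto
qed (use assms in \<open>auto simp: add.assoc intro: subgrp_add subgrp_0\<close>)

lemma inv_GA: assumes "subgrp S" "x \<in> S" shows "inv\<^bsub>GA S\<^esub> x = - x"
proof -
  interpret group "GA S" by (rule group_GA[OF assms(1)])
  show ?thesis by (rule inv_equality) (use assms subgrp_minus in auto)
qed

lemma subgroup_GA: assumes "subgrp S" shows "subgroup K (GA S) \<longleftrightarrow> subgrp K \<and> K \<subseteq> S"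
proof
  interpret group "GA S" by (rule group_GA[OF assms])
  assume K: "subgroup K (GA S)"
  have "- x \<in> K" if "x \<in> K" for x
    using subgroup.m_inv_closed[OF K that] inv_GA[OF assms, of x] subgroup.subset[OF K] that by auto
  then show "subgrp K \<and> K \<subseteq> S" unfolding subgrp_def
    using subgroup.one_closed[OF K] subgroup.m_closed[OF K] subgroup.subset[OF K] by auto
next
  interpret group "GA S" by (rule group_GA[OF assms])
  assume K: "subgrp K \<and> K \<subseteq> S"
  show "subgroup K (GA S)"
    by (rule subgroupI)
      (use K subgrp_0 in \<open>auto simp: inv_GA[OF assms] subset_iff intro: subgrp_add subgrp_minus\<close>)
qed

definition rc :: "'g::group_add set \<Rightarrow> 'g set \<Rightarrow> 'g set set" where
  "rc S K = (\<lambda>x. (\<lambda>k. k + x) ` K) ` S"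

lemma rcosets_GA: "rcosets\<^bsub>GA S\<^esub> K = rc S K"
  by (auto simp: RCOSETS_def r_coset_def rc_def)

lemma coset_eq_iff:
  assumes "subgrp K" shows "(\<lambda>k. k + x) ` K = (\<lambda>k. k + y) ` K \<longleftrightarrow> x - y \<in> K"
proof
  assume eq: "(\<lambda>k. k + x) ` K = (\<lambda>k. k + y) ` K"
  have "0 + x \<in> (\<lambda>k. k + x) ` K" by (rule imageI) (rule subgrp_0[OF assms])
  then obtain k where "k \<in> K" "x = k + y" unfolding eq by auto
  then show "x - y \<in> K" by simp
next
  assume xy: "x - y \<in> K"
  show "(\<lambda>k. k + x) ` K = (\<lambda>k. k + y) ` K"
  proof (intro equalityI subsetI)
    fix z assume "z \<in> (\<lambda>k. k + x) ` K"
    then obtain k where k: "k \<in> K" "z = k + x" by auto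
    have "z = (k + (x - y)) + y" by (simp add: k add.assoc)
    then show "z \<in> (\<lambda>k. k + y) ` K" using subgrp_add[OF assms k(1) xy] by blast
  next
    fix z assume "z \<in> (\<lambda>k. k + y) ` K"
    then obtain k where k: "k \<in> K" "z = k + y" by auto
    have "z = (k + - (x - y)) + x" by (simp add: k grp_simps del: add_uminus_conv_diff)
    then show "z \<in> (\<lambda>k. k + x) ` K" using subgrp_add[OF assms k(1) subgrp_minus[OF assms xy]] by blast
  qed
qed

text \<open>\<open>cov\<close> speaks of left cosets and \<open>rc\<close> of right ones; negation
  exchanges the two.\<close>

lemma rc_cov:
  assumes S: "subgrp S" and K: "subgrp K" and cov: "cov n S K"
  shows "finite (rc S K)" "card (rc S K) \<le> n"
proof -
  obtain F where F: "finite F" "card F \<le> n" "\<And>x. x \<in> S \<Longrightarrow> \<exists>f\<in>F. - f + x \<in> K"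
    using cov unfolding cov_def by auto
  have sub: "rc S K \<subseteq> (\<lambda>f. (\<lambda>k. k + - f) ` K) ` F"
  proof
    fix C assume "C \<in> rc S K"
    then obtain x where x: "x \<in> S" "C = (\<lambda>k. k + x) ` K" by (auto simp: rc_def)
    obtain f where f: "f \<in> F" "- f + - x \<in> K" using F(3)[OF subgrp_minus[OF S x(1)]] by blast
    then have "- f - x \<in> K" by simp
    then have "C = (\<lambda>k. k + - f) ` K" unfolding x(2) coset_eq_iff[OF K, symmetric] by simp
    then show "C \<in> (\<lambda>f. (\<lambda>k. k + - f) ` K) ` F" using f by blast
  qed
  then show "finite (rc S K)" using F(1) finite_subset by blast
  show "card (rc S K) \<le> n"
    using surj_card_le[OF F(1) sub] F(2) by simp
qed

lemma nm_pow: "x [^]\<^bsub>GA S\<^esub> (n::nat) = nm n x"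
proof (induction n)
  case (Suc n)
  have "nm n x + x = x + nm n x" by (induction n) (simp_all add: add.assoc)
  then show ?case using Suc by simp
qed simp

lemma p_group_GA:
  assumes S: "subgrp S" and t: "\<And>x. x \<in> S \<Longrightarrow> p_torsion p x" and p: "Factorial_Ring.prime p"
  shows "is_p_group p (GA S)"
proof -
  interpret group "GA S" by (rule group_GA[OF S])
  have "\<exists>m. ord x = p ^ m" if x: "x \<in> S" for x
  proof -
    obtain m where "nm (p ^ m) x = 0" using t[OF x] by (auto simp: p_torsion_def)
    then have "ord x dvd p ^ m" using x pow_eq_id[of x "p ^ m"] by (simp add: nm_pow)
    then show ?thesis using p by (meson divides_primepow_nat)
  qed
  then show ?thesis by (simp add: is_p_group_def is_group)
qed

lemma normalizer_grows:
  assumes p: "Factorial_Ring.prime p" and S: "subgrp S" and t: "\<And>x. x \<in> S \<Longrightarrow> p_torsion p x"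
    and W: "subgrp W" "W \<subseteq> S" "W \<noteq> S" and fin: "finite (rc S W)"
  shows "\<exists>x\<in>S - W. nm p x \<in> W \<and> (\<forall>w\<in>W. x + w - x \<in> W)"
proof -
  have "subgroup W (GA S)" using W by (simp add: subgroup_GA[OF S])
  from p_group_normalizer_grows[OF p p_group_GA[OF S t p] this] W fin
  obtain x where x: "x \<in> S" "x \<notin> W" "\<And>w. w \<in> W \<Longrightarrow> x + w - x \<in> W"
    by (auto simp: rcosets_GA inv_GA[OF S])
  obtain m where m: "nm (p ^ m) x = 0" using t[OF x(1)] by (auto simp: p_torsion_def)
  then have ex: "nm (p ^ m) x \<in> W" using subgrp_0[OF W(1)] by simp
  \<comment> \<open>The last p-power multiple of \<open>x\<close> outside \<open>W\<close>
    normalizes \<open>W\<close> too, and its p-fold lies in \<open>W\<close>.\<close>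
  define k where "k = (LEAST m. nm (p ^ m) x \<in> W)"
  have k: "nm (p ^ k) x \<in> W" unfolding k_def by (rule LeastI[where P = "\<lambda>m. nm (p ^ m) x \<in> W", OF ex])
  have "k \<noteq> 0" using k x(2) by (intro notI) simp
  then obtain j where j: "k = Suc j" by (cases k) auto
  have jn: "nm (p ^ j) x \<notin> W" using not_less_Least[of j "\<lambda>m. nm (p ^ m) x \<in> W"] j by (simp add: k_def)
  have norm: "nm i x + w - nm i x \<in> W" if "w \<in> W" for i w
  proof (induction i)
    case 0 then show ?case using that by simp
  next
    case (Suc i)
    have "x + (nm i x + w - nm i x) - x \<in> W" by (rule x(3)[OF Suc])
    then show ?case by (simp add: grp_simps del: add_uminus_conv_diff)
  qed
  have "nm p (nm (p ^ j) x) \<in> W" using k j by (simp add: nm_mult)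
  then show ?thesis using jn norm nm_subgrp[OF S x(1)] by (intro bexI[of _ "nm (p ^ j) x"]) auto
qed

section \<open>Homomorphisms to a cyclic group\<close>

text \<open>\<open>\<rat>/\<int>\<close>: it contains a cyclic group \<open>mu p\<close> of each order \<open>p\<close>.\<close>

typedef qz = "{x :: rat. 0 \<le> x \<and> x < 1}"
  morphisms rep_qz abs_qz
  by (rule exI[of _ 0]) simp

definition qz_of :: "rat \<Rightarrow> qz" where "qz_of x = abs_qz (frac x)"

lemma rep_qz_of [simp]: "rep_qz (qz_of x) = frac x"
  unfolding qz_of_def by (rule abs_qz_inverse) (simp add: frac_lt_1)

lemma qz_of_rep [simp]: "qz_of (rep_qz x) = x"
  unfolding qz_of_def using rep_qz[of x] by (simp add: frac_eq[THEN iffD2] rep_qz_inverse)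

lemma qz_of_eq_iff: "qz_of x = qz_of y \<longleftrightarrow> x - y \<in> \<int>"
proof -
  have "qz_of x = qz_of y \<longleftrightarrow> frac x = frac y"
    by (metis rep_qz_of rep_qz_inject)
  also have "\<dots> \<longleftrightarrow> x - y \<in> \<int>"
  proof
    assume "frac x = frac y"
    then have "x - y = of_int (\<lfloor>x\<rfloor> - \<lfloor>y\<rfloor>)" by (simp add: frac_def algebra_simps)
    then show "x - y \<in> \<int>" by (simp only: Ints_of_int)
  next
    assume "x - y \<in> \<int>"
    then obtain k where "x - y = of_int k" by (auto elim: Ints_cases)
    then have "x = y + of_int k" by (simp add: algebra_simps)
    then show "frac x = frac y" by (simp add: frac_def)
  qed
  finally show ?thesis .
qed

instantiation qz :: ab_group_add
begin

definition zero_qz :: qz where "zero_qz = qz_of 0"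
definition plus_qz :: "qz \<Rightarrow> qz \<Rightarrow> qz" where "plus_qz x y = qz_of (rep_qz x + rep_qz y)"
definition uminus_qz :: "qz \<Rightarrow> qz" where "uminus_qz x = qz_of (- rep_qz x)"
definition minus_qz :: "qz \<Rightarrow> qz \<Rightarrow> qz" where "minus_qz x y = x + - y"

lemma qz_of_add: "qz_of x + qz_of y = qz_of (x + y)"
  unfolding plus_qz_def qz_of_eq_iff by (simp add: frac_def)

lemma qz_of_minus: "- qz_of x = qz_of (- x)"
  unfolding uminus_qz_def qz_of_eq_iff by (simp add: frac_def)

instance
proof
  fix a b c :: qz
  obtain x y z where abc: "a = qz_of x" "b = qz_of y" "c = qz_of z" by (metis qz_of_rep)
  show "a + b + c = a + (b + c)" "a + b = b + a" "0 + a = a" "- a + a = 0" "a - b = a + - b"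
    unfolding abc minus_qz_def by (simp_all add: qz_of_add qz_of_minus zero_qz_def add_ac)
qed

end

definition ec :: "nat \<Rightarrow> int \<Rightarrow> qz" where "ec p j = qz_of (of_int j / of_nat p)"

lemma ec_add: "ec p (i + j) = ec p i + ec p j"
  by (simp add: ec_def qz_of_add add_divide_distrib)

lemma ec_0 [simp]: "ec p 0 = 0"
  by (simp add: ec_def zero_qz_def)

lemma ec_minus: "ec p (- j) = - ec p j"
  by (simp add: ec_def qz_of_minus)

lemma ec_eq_0: assumes "p > 0" shows "ec p j = 0 \<longleftrightarrow> int p dvd j"
proof -
  have "ec p j = 0 \<longleftrightarrow> (of_int j / of_nat p :: rat) \<in> \<int>"
    by (simp add: ec_def zero_qz_def qz_of_eq_iff)
  also have "\<dots> \<longleftrightarrow> int p dvd j"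
  proof
    assume "(of_int j / of_nat p :: rat) \<in> \<int>"
    then obtain k where "(of_int j / of_nat p :: rat) = of_int k" by (auto elim: Ints_cases)
    then have "(of_int j :: rat) = of_int (k * int p)" using assms by (simp add: field_simps)
    then have "j = k * int p" by (simp only: of_int_eq_iff)
    then show "int p dvd j" by simp
  next
    assume "int p dvd j"
    then obtain k where "j = int p * k" by blast
    then show "(of_int j / of_nat p :: rat) \<in> \<int>" using assms by simp
  qed
  finally show ?thesis .
qed

lemma ec_eq: assumes "p > 0" shows "ec p i = ec p j \<longleftrightarrow> int p dvd i - j"
proof -
  have "ec p i = ec p j \<longleftrightarrow> ec p (i - j) = 0"
    using ec_add[of p i "- j"] by (simp add: ec_minus)
  then show ?thesis using ec_eq_0[OF assms] by simp
qed

definition mu :: "nat \<Rightarrow> qz set" where "mu p = range (ec p)"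

lemma mu_closed: "0 \<in> mu p" "x \<in> mu p \<Longrightarrow> y \<in> mu p \<Longrightarrow> x + y \<in> mu p"
  "x \<in> mu p \<Longrightarrow> - x \<in> mu p" "x \<in> mu p \<Longrightarrow> y \<in> mu p \<Longrightarrow> x - y \<in> mu p"
proof -
  show "0 \<in> mu p" unfolding mu_def by (rule image_eqI[of _ _ 0]) auto
  show a: "x \<in> mu p \<Longrightarrow> y \<in> mu p \<Longrightarrow> x + y \<in> mu p" for x y
    unfolding mu_def by (auto simp flip: ec_add)
  show m: "x \<in> mu p \<Longrightarrow> - x \<in> mu p" for x unfolding mu_def by (auto simp flip: ec_minus)
  show "x \<in> mu p \<Longrightarrow> y \<in> mu p \<Longrightarrow> x - y \<in> mu p"
    using a[OF _ m, of x y] by simp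
qed

lemma mu_eq: assumes "p > 0" shows "mu p = (\<lambda>j. ec p (int j)) ` {..<p}"
proof -
  have "ec p j \<in> (\<lambda>j. ec p (int j)) ` {..<p}" for j
  proof (rule image_eqI[of _ _ "nat (j mod int p)"])
    have "int p dvd j - j mod int p" by (simp add: minus_mod_eq_mult_div)
    then show "ec p j = ec p (int (nat (j mod int p)))" using assms by (simp add: ec_eq)
    show "nat (j mod int p) \<in> {..<p}" using assms by (simp add: nat_less_iff)
  qed
  then show ?thesis unfolding mu_def by auto
qed

lemma finite_mu: "p > 0 \<Longrightarrow> finite (mu p)"
  by (simp add: mu_eq)

lemma card_mu_le: "p > 0 \<Longrightarrow> card (mu p) \<le> p"
  using card_image_le[of "{..<p}" "\<lambda>j. ec p (int j)"] by (simp add: mu_eq)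

lemma mu_nm: "nm p (ec p j) = 0" if "p > 0"
proof -
  have "nm n (ec p j) = ec p (int n * j)" for n
    by (induction n) (simp_all add: algebra_simps ec_add)
  then show ?thesis using that by (simp add: ec_eq_0)
qed

text \<open>The value 0 outside \<open>U\<close> makes every homomorphism on \<open>U\<close> a
  single function, so cardinalities count homomorphisms.\<close>

definition homs :: "nat \<Rightarrow> 'g::group_add set \<Rightarrow> ('g \<Rightarrow> qz) set" where
  "homs p U = {\<phi>. (\<forall>x. x \<notin> U \<longrightarrow> \<phi> x = 0) \<and> (\<forall>x\<in>U. \<phi> x \<in> mu p) \<and>
     (\<forall>x\<in>U. \<forall>y\<in>U. \<phi> (x + y) = \<phi> x + \<phi> y)}"

lemma homsD: assumes "\<phi> \<in> homs p U"
  shows "x \<notin> U \<Longrightarrow> \<phi> x = 0" "x \<in> U \<Longrightarrow> \<phi> x \<in> mu p" "x \<in> U \<Longrightarrow> y \<in> U \<Longrightarrow> \<phi> (x + y) = \<phi> x + \<phi> y"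
  using assms by (auto simp: homs_def)

lemma homs_0: assumes "\<phi> \<in> homs p U" "subgrp U" shows "\<phi> 0 = 0"
  using homsD(3)[OF assms(1) subgrp_0 subgrp_0, OF assms(2,2)] by simp

lemma homs_minus: assumes "\<phi> \<in> homs p U" "subgrp U" "x \<in> U" shows "\<phi> (- x) = - \<phi> x"
  using homsD(3)[OF assms(1) subgrp_minus[OF assms(2,3)] assms(3)] homs_0[OF assms(1,2)]
  by (simp add: eq_neg_iff_add_eq_0)

lemma homs_diff: assumes "\<phi> \<in> homs p U" "subgrp U" "x \<in> U" "y \<in> U" shows "\<phi> (x - y) = \<phi> x - \<phi> y"
  using homsD(3)[OF assms(1) assms(3) subgrp_minus[OF assms(2,4)]] homs_minus[OF assms(1,2,4)] by simp

lemma homs_nm: assumes "\<phi> \<in> homs p U" "subgrp U" "x \<in> U" shows "\<phi> (nm n x) = nm n (\<phi> x)"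
  by (induction n) (simp_all add: homs_0[OF assms(1,2)] homsD(3)[OF assms(1,3)] nm_subgrp[OF assms(2,3)])

lemma homs_subtract: "\<phi> \<in> homs p U \<Longrightarrow> \<psi> \<in> homs p U \<Longrightarrow> (\<lambda>x. \<phi> x - \<psi> x) \<in> homs p U"
  by (auto simp: homs_def mu_closed)

lemma homs_restrict: "\<phi> \<in> homs p U \<Longrightarrow> subgrp U \<Longrightarrow> subgrp W \<Longrightarrow> W \<subseteq> U \<Longrightarrow> (\<lambda>x. if x \<in> W then \<phi> x else 0) \<in> homs p W"
  by (auto simp: homs_def subset_iff intro: subgrp_add)

lemma homs_comm: assumes "\<phi> \<in> homs p U" "subgrp U" "x \<in> comm_gp U" shows "\<phi> x = 0"
proof -
  have "comm_gp U \<subseteq> {x \<in> U. \<phi> x = 0}"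
  proof (rule comm_gp_least)
    show "subgrp {x \<in> U. \<phi> x = 0}"
      unfolding subgrp_def using assms(1,2) subgrp_0 subgrp_add subgrp_minus
      by (auto simp: homs_0 homs_minus homsD(3))
    show "x + y - x - y \<in> {x \<in> U. \<phi> x = 0}" if "x \<in> U" "y \<in> U" for x y
      using that assms by (simp add: homs_diff homsD(3) subgrp_diff subgrp_add)
  qed
  then show ?thesis using assms(3) by auto
qed

lemma card_fibers:
  assumes B: "finite B" "f ` A \<subseteq> B" and fib: "\<And>b. b \<in> B \<Longrightarrow> finite {a \<in> A. f a = b} \<and> card {a \<in> A. f a = b} \<le> n"
  shows "finite A" "card A \<le> card B * n"
proof -
  have A: "A = (\<Union>b\<in>B. {a \<in> A. f a = b})" using B(2) by auto
  show "finite A" by (subst A) (use B(1) fib in blast)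
  have "card A \<le> (\<Sum>b\<in>B. card {a \<in> A. f a = b})" by (subst A) (rule card_UN_le[OF B(1)])
  also have "\<dots> \<le> (\<Sum>b\<in>B. n)" using fib by (intro sum_mono) auto
  finally show "card A \<le> card B * n" by simp
qed

text \<open>A maximal list in \<open>U\<close> that is independent modulo \<open>R\<close> has at
  most d entries. By maximality each x in \<open>U\<close> satisfies
  \<open>- t' + (x + t) \<in> R\<close> for some subproducts t and t', so a homomorphism killing
  \<open>R\<close> is determined by its values on the list.\<close>

lemma hom_count:
  assumes p: "p > 0" and R: "subgrp R" "R \<subseteq> U" and U: "subgrp U" "U \<subseteq> L"
    and cov: "cov n L R" "n < 2 ^ Suc d"
    and A: "A \<subseteq> homs p U" "\<And>\<phi> r. \<phi> \<in> A \<Longrightarrow> r \<in> R \<Longrightarrow> \<phi> r = 0"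
  shows "finite A \<and> card A \<le> p ^ d"
proof -
  let ?Q = "\<lambda>xs. set xs \<subseteq> U \<and> indep R xs"
  have bnd: "length xs \<le> d" if "?Q xs" for xs
  proof -
    have "prods xs \<subseteq> L" using that prods_subset[OF U(1)] U(2) by blast
    then have "2 ^ length xs < (2::nat) ^ Suc d"
      using indep_bound[OF R(1), of xs n L] that cov by simp
    then have "length xs < Suc d" by (simp only: power_strict_increasing_iff)
    then show ?thesis by simp
  qed
  have "?Q []" by simp
  then obtain xs where xs: "?Q xs" "\<And>ys. ?Q ys \<Longrightarrow> length ys \<le> length xs"
    using ex_has_greatest_nat[of ?Q "[]" length "Suc d"] bnd by (auto simp: less_Suc_eq_le)
  have det: "\<phi> = \<psi>" if \<phi>: "\<phi> \<in> A" "\<psi> \<in> A" "map \<phi> xs = map \<psi> xs" for \<phi> \<psi>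
  proof
    have h: "\<phi> \<in> homs p U" "\<psi> \<in> homs p U" using A(1) \<phi> by auto
    have pr: "\<phi> t = \<psi> t" if "set ys \<subseteq> U" "\<forall>y\<in>set ys. \<phi> y = \<psi> y" "t \<in> prods ys" for t ys
      using that
    proof (induction ys arbitrary: t)
      case Nil then show ?case using homs_0[OF h(1) U(1)] homs_0[OF h(2) U(1)] by simp
    next
      case (Cons y ys)
      have "prods ys \<subseteq> U" using Cons.prems prods_subset[OF U(1)] by simp
      then show ?case using Cons by (auto simp: homsD(3)[OF h(1)] homsD(3)[OF h(2)] subset_iff)
    qed
    fix x
    show "\<phi> x = \<psi> x"
    proof (cases "x \<in> U")
      case False then show ?thesis using homsD(1)[OF h(1)] homsD(1)[OF h(2)] by simp
    next
      case True
      have "\<not> ?Q (x # xs)" using xs(2)[of "x # xs"] by auto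
      then obtain t t' where t: "t \<in> prods xs" "t' \<in> prods xs" "- t' + (x + t) \<in> R"
        using xs(1) True by auto
      have tU: "t \<in> U" "t' \<in> U" using t prods_subset[OF U(1)] xs(1) by auto
      have e: "\<phi> t = \<psi> t" "\<phi> t' = \<psi> t'" using pr[of xs] xs(1) t \<phi>(3) by auto
      have val: "\<theta> x = \<theta> t' - \<theta> t" if c: "\<theta> \<in> A" "\<theta> \<in> homs p U" for \<theta>
      proof -
        have "\<theta> (- t' + (x + t)) = 0" by (rule A(2)[OF c(1) t(3)])
        then have "- \<theta> t' + (\<theta> x + \<theta> t) = 0"
          using tU True c(2) U(1) by (simp add: homsD(3)[OF c(2)] homs_minus[OF c(2)] subgrp_minus subgrp_add)
        then show ?thesis by (simp add: algebra_simps eq_neg_iff_add_eq_0)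
      qed
      show ?thesis using val[OF \<phi>(1) h(1)] val[OF \<phi>(2) h(2)] e by simp
    qed
  qed
  let ?T = "{ys. set ys \<subseteq> mu p \<and> length ys = length xs}"
  have fin: "finite ?T" using finite_mu[OF p] by (rule finite_lists_length_eq)
  have inj: "inj_on (\<lambda>\<phi>. map \<phi> xs) A" using det by (auto intro: inj_onI)
  have im: "(\<lambda>\<phi>. map \<phi> xs) ` A \<subseteq> ?T"
    using A(1) xs(1) by (auto simp: homs_def subset_iff)
  have "card A \<le> card ?T" by (rule card_inj_on_le[OF inj im fin])
  also have "\<dots> = card (mu p) ^ length xs" using finite_mu[OF p] by (rule card_lists_length_eq)
  also have "\<dots> \<le> p ^ length xs" using card_mu_le[OF p] by (rule power_mono) simp
  also have "\<dots> \<le> p ^ d" using bnd[OF xs(1)] p by (intro power_increasing) auto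
  finally show ?thesis using finite_imageD[OF finite_subset[OF im fin] inj] by blast
qed

section \<open>Normal steps of index p\<close>

definition adj :: "'g::group_add set \<Rightarrow> 'g \<Rightarrow> 'g set" where
  "adj W x = {w + nm j x | w j. w \<in> W}"

lemma adj_sub: "W \<subseteq> adj W x"
proof
  fix w assume "w \<in> W"
  moreover have "w = w + nm 0 x" by simp
  ultimately show "w \<in> adj W x" unfolding adj_def by blast
qed

lemma adj_mem: "subgrp W \<Longrightarrow> x \<in> adj W x"
proof -
  assume "subgrp W"
  then have "0 \<in> W" by (rule subgrp_0)
  moreover have "x = 0 + nm 1 x" by simp
  ultimately show "x \<in> adj W x" unfolding adj_def by blast
qed

lemma adj_least: "subgrp S \<Longrightarrow> W \<subseteq> S \<Longrightarrow> x \<in> S \<Longrightarrow> adj W x \<subseteq> S"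
  unfolding adj_def by (auto intro: subgrp_add nm_subgrp)

locale normal_step =
  fixes p :: nat and W :: "'g::group_add set" and x :: 'g
  assumes prime_p: "Factorial_Ring.prime p" and W: "subgrp W" and xW: "x \<notin> W"
    and px: "nm p x \<in> W" and norm: "\<And>w. w \<in> W \<Longrightarrow> x + w - x \<in> W" and tor: "p_torsion p x"
begin

lemma p_gt0: "p > 0" using prime_p by (simp add: prime_gt_0_nat)

lemma norm_nm: "w \<in> W \<Longrightarrow> nm i x + w - nm i x \<in> W"
proof (induction i)
  case (Suc i)
  have "x + (nm i x + w - nm i x) - x \<in> W" by (rule norm[OF Suc.IH[OF Suc.prems]])
  then show ?case by (simp add: grp_simps del: add_uminus_conv_diff)
qed simp

text \<open>Since x has finite order, its natural multiples already form a group.\<close>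

lemma minus_nm: "\<exists>i. - nm j x = nm i x"
proof -
  obtain m where m: "nm (p ^ m) x = 0" using tor by (auto simp: p_torsion_def)
  have "j \<le> j * p ^ m" using p_gt0 by simp
  then have "nm (j * p ^ m - j) x + nm j x = nm (j * p ^ m) x" by (simp flip: nm_add)
  also have "\<dots> = 0" using m nm_mult[of j "p ^ m" x] by simp
  finally show ?thesis by (metis add.inverse_unique minus_unique neg_eq_iff_add_eq_0 add_eq_0_iff2)
qed

lemma norm_minus_nm: "w \<in> W \<Longrightarrow> - nm i x + w + nm i x \<in> W"
  using minus_nm[of i] norm_nm by (metis diff_minus_eq_add)

lemma subgrp_adj: "subgrp (adj W x)"
  unfolding subgrp_def
proof (intro conjI ballI)
  show "0 \<in> adj W x" using adj_sub subgrp_0[OF W] by blast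
next
  fix a b assume "a \<in> adj W x" "b \<in> adj W x"
  then obtain w j v i where ab: "a = w + nm j x" "b = v + nm i x" "w \<in> W" "v \<in> W"
    by (auto simp: adj_def)
  have "a + b = (w + (nm j x + v - nm j x)) + nm (j + i) x"
    by (simp add: ab nm_add grp_simps del: add_uminus_conv_diff)
  moreover have "w + (nm j x + v - nm j x) \<in> W" using ab norm_nm W by (intro subgrp_add)
  ultimately show "a + b \<in> adj W x" unfolding adj_def by blast
next
  fix a assume "a \<in> adj W x"
  then obtain w j where a: "a = w + nm j x" "w \<in> W" by (auto simp: adj_def)
  obtain i where i: "- nm j x = nm i x" using minus_nm by blast
  have "- a = (- nm j x + - w + nm j x) + - nm j x"
    by (simp add: a grp_simps del: add_uminus_conv_diff)
  then have "- a = (- nm j x + - w + nm j x) + nm i x" using i by simp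
  moreover have "- nm j x + - w + nm j x \<in> W" using a(2) W by (intro norm_minus_nm subgrp_minus)
  ultimately show "- a \<in> adj W x" unfolding adj_def by blast
qed

lemma nm_mem_iff: "nm j x \<in> W \<longleftrightarrow> p dvd j"
proof
  assume j: "nm j x \<in> W"
  show "p dvd j"
  proof (rule ccontr)
    assume "\<not> p dvd j"
    then have "coprime j p" using prime_p by (metis coprime_commute prime_imp_coprime)
    then obtain a b where "j * a = p * b + 1"
      using bezout_nat[of j p] \<open>\<not> p dvd j\<close> by (cases "j = 0") (auto simp: coprime_iff_gcd_eq_1)
    then have "nm (j * a) x = nm (p * b) x + x" by (simp only: nm_add) simp
    moreover have "nm (j * a) x \<in> W" "nm (p * b) x \<in> W"
      using nm_subgrp[OF W j] nm_subgrp[OF W px] by (simp_all add: nm_mult mult.commute)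
    ultimately have "x \<in> W" by (metis subgrp_add_left[OF W])
    then show False using xW by simp
  qed
next
  assume "p dvd j"
  then obtain b where "j = b * p" by (metis dvd_def mult.commute)
  then show "nm j x \<in> W" using nm_subgrp[OF W px, of b] by (simp add: nm_mult)
qed

lemma nm_diff: "i \<le> j \<Longrightarrow> nm j x - nm i x = nm (j - i) x"
  using nm_add[of "j - i" i x] by simp

lemma coord_unique:
  assumes "w + nm i x = v + nm j x" "w \<in> W" "v \<in> W" shows "int p dvd int i - int j"
proof -
  have key: "int p dvd int i - int j" if "w + nm i x = v + nm j x" "w \<in> W" "v \<in> W" "i \<le> j" for w v i j
  proof -
    have "- v + w + nm i x = nm j x" using that by (simp add: add.assoc)
    then have "- v + w = nm j x - nm i x" by (simp add: eq_diff_eq)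
    then have "nm (j - i) x \<in> W"
      using that W by (simp add: nm_diff[symmetric]) (metis subgrp_add subgrp_minus)
    then have "p dvd j - i" by (simp add: nm_mem_iff)
    then have "int p dvd int (j - i)" by simp
    then show ?thesis using that by (simp add: of_nat_diff dvd_diff_commute)
  qed
  show ?thesis
  proof (cases "i \<le> j")
    case True then show ?thesis using key assms by blast
  next
    case False
    then have "int p dvd int j - int i" using key[of v j w i] assms by auto
    then show ?thesis by (simp add: dvd_diff_commute)
  qed
qed

text \<open>The character of \<open>adj W x\<close> that reads off the coefficient of x mod p. Its
  kernel is \<open>W\<close>, which is why counting \<open>homs\<close> counts the possible next
  members of a chain.\<close>

definition chi :: "'g \<Rightarrow> qz" where
  "chi y = (if y \<in> adj W x then ec p (int (SOME j. \<exists>w\<in>W. y = w + nm j x)) else 0)"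

lemma chi_eq: assumes "w \<in> W" shows "chi (w + nm j x) = ec p (int j)"
proof -
  let ?j = "SOME i. \<exists>v\<in>W. w + nm j x = v + nm i x"
  have "\<exists>v\<in>W. w + nm j x = v + nm ?j x" by (rule someI[of _ j]) (use assms in blast)
  then obtain v where "v \<in> W" "w + nm j x = v + nm ?j x" by blast
  then have "int p dvd int ?j - int j" using coord_unique[of v ?j w j] assms by simp
  moreover have "w + nm j x \<in> adj W x" using assms by (auto simp: adj_def)
  ultimately show ?thesis using p_gt0 by (simp add: chi_def ec_eq)
qed

lemma chi_homs: "chi \<in> homs p (adj W x)"
  unfolding homs_def
proof (intro CollectI conjI ballI allI impI)
  show "y \<notin> adj W x \<Longrightarrow> chi y = 0" for y by (simp add: chi_def)
  show "chi y \<in> mu p" if "y \<in> adj W x" for y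
    using that by (simp add: chi_def) (simp add: mu_def)
  fix a b assume "a \<in> adj W x" "b \<in> adj W x"
  then obtain w j v i where ab: "a = w + nm j x" "b = v + nm i x" "w \<in> W" "v \<in> W"
    by (auto simp: adj_def)
  have "a + b = (w + (nm j x + v - nm j x)) + nm (j + i) x"
    by (simp add: ab nm_add grp_simps del: add_uminus_conv_diff)
  moreover have "w + (nm j x + v - nm j x) \<in> W" using ab norm_nm W by (intro subgrp_add)
  ultimately have "chi (a + b) = ec p (int (j + i))" by (simp only: chi_eq)
  then show "chi (a + b) = chi a + chi b" by (simp add: ab chi_eq ec_add)
qed

lemma chi_kernel: "W = {y \<in> adj W x. chi y = 0}"
proof -
  have "w + nm j x \<in> W \<longleftrightarrow> chi (w + nm j x) = 0" if "w \<in> W" for w j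
    using that p_gt0 by (simp add: chi_eq ec_eq_0 subgrp_add_left[OF W that] nm_mem_iff)
  then show ?thesis using adj_sub[of W x] by (auto simp: adj_def)
qed

lemma cov_adj: "cov p (adj W x) W"
  unfolding cov_def
proof (intro exI[of _ "(\<lambda>j. nm j x) ` {..<p}"] conjI ballI)
  show "card ((\<lambda>j. nm j x) ` {..<p}) \<le> p" using card_image_le[of "{..<p}" "\<lambda>j. nm j x"] by simp
  fix y assume "y \<in> adj W x"
  then obtain w j where y: "y = w + nm j x" "w \<in> W" by (auto simp: adj_def)
  have "nm j x = nm (j mod p) x + nm (p * (j div p)) x" by (simp flip: nm_add)
  moreover have pW: "nm (p * (j div p)) x \<in> W" by (simp add: nm_mem_iff)
  ultimately have "- nm (j mod p) x + y = (- nm (j mod p) x + w + nm (j mod p) x) + nm (p * (j div p)) x"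
    by (simp add: y add.assoc)
  moreover have "- nm (j mod p) x + w + nm (j mod p) x \<in> W" by (rule norm_minus_nm[OF y(2)])
  ultimately have "- nm (j mod p) x + y \<in> W" using pW subgrp_add[OF W] by simp
  then show "\<exists>f\<in>(\<lambda>j. nm j x) ` {..<p}. - f + y \<in> W" using p_gt0 by (intro bexI[of _ "nm (j mod p) x"]) auto
qed simp

lemma rc_adj:
  assumes S: "subgrp S" "adj W x \<subseteq> S" and fin: "finite (rc S W)"
  shows "finite (rc S (adj W x))" "p * card (rc S (adj W x)) \<le> card (rc S W)"
proof -
  let ?U = "adj W x"
  define h where "h C = (SOME y. y \<in> S \<and> C = (\<lambda>k. k + y) ` ?U)" for C
  have h: "h C \<in> S \<and> C = (\<lambda>k. k + h C) ` ?U" if "C \<in> rc S ?U" for C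
    unfolding h_def by (rule someI_ex) (use that in \<open>auto simp: rc_def\<close>)
  let ?f = "\<lambda>(C, j). (\<lambda>k. k + (nm j x + h C)) ` W"
  have inj: "inj_on ?f (rc S ?U \<times> {..<p})"
  proof (rule inj_onI, clarify)
    fix C j C' j' assume C: "C \<in> rc S ?U" "C' \<in> rc S ?U" and j: "j < p" "j' < p"
      and eq: "(\<lambda>k. k + (nm j x + h C)) ` W = (\<lambda>k. k + (nm j' x + h C')) ` W"
    have "(nm j x + h C) - (nm j' x + h C') \<in> W" using eq unfolding coset_eq_iff[OF W] .
    then have eW: "nm j x + h C - h C' - nm j' x \<in> W" by (simp add: grp_simps del: add_uminus_conv_diff)
    then have "- nm j x + (nm j x + h C - h C' - nm j' x) + nm j' x \<in> ?U"
      using adj_sub[of W x] nm_subgrp[OF subgrp_adj adj_mem[OF W]]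
      by (intro subgrp_add[OF subgrp_adj] subgrp_minus[OF subgrp_adj]) auto
    then have "h C - h C' \<in> ?U" by (simp add: grp_simps del: add_uminus_conv_diff)
    then have CC: "C = C'" using h[OF C(1)] h[OF C(2)] coset_eq_iff[OF subgrp_adj] by metis
    have "nm j x - nm j' x \<in> W" using eW by (simp add: CC grp_simps del: add_uminus_conv_diff)
    then obtain w where "w \<in> W" "nm j x - nm j' x = w" by blast
    then have "0 + nm j x = w + nm j' x" by (simp add: diff_eq_eq)
    then have "int p dvd int j - int j'" using coord_unique[of 0 j w j'] subgrp_0[OF W] \<open>w \<in> W\<close> by simp
    then have "int j mod int p = int j' mod int p" by (simp add: mod_eq_dvd_iff)
    then show "C = C' \<and> j = j'" using j CC by simp
  qed
  have im: "?f ` (rc S ?U \<times> {..<p}) \<subseteq> rc S W"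
  proof clarify
    fix C j assume C: "C \<in> rc S ?U" "j < p"
    have "nm j x \<in> S" using S nm_subgrp[OF subgrp_adj adj_mem[OF W]] by blast
    then have "nm j x + h C \<in> S" using h[OF C(1)] subgrp_add[OF S(1)] by blast
    then show "(\<lambda>k. k + (nm j x + h C)) ` W \<in> rc S W" by (auto simp: rc_def)
  qed
  have "finite (rc S ?U \<times> {..<p})" using finite_imageD[OF finite_subset[OF im fin] inj] .
  then show "finite (rc S ?U)" using p_gt0 by (auto dest!: finite_cartesian_productD1)
  have "card (rc S ?U \<times> {..<p}) \<le> card (rc S W)" by (rule card_inj_on_le[OF inj im fin])
  then show "p * card (rc S ?U) \<le> card (rc S W)" by (simp add: card_cartesian_product mult.commute)
qed

end

text \<open>The final terms of chains of \<open>i\<close> normal steps of index \<open>p\<close> starting at \<open>S\<close>.\<close>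

primrec chain_ends :: "nat \<Rightarrow> 'g::group_add set \<Rightarrow> nat \<Rightarrow> 'g set set" where
  "chain_ends p S 0 = {S}"
| "chain_ends p S (Suc i) = {W. \<exists>x. normal_step p W x \<and> adj W x \<in> chain_ends p S i}"

lemma chain_ends_props:
  assumes "subgrp S" shows "U \<in> chain_ends p S i \<Longrightarrow> subgrp U \<and> U \<subseteq> S \<and> cov (p ^ i) S U"
proof (induction i arbitrary: U)
  case 0 then show ?case using assms cov_one[OF assms] by simp
next
  case (Suc i)
  then obtain x where x: "normal_step p U x" "adj U x \<in> chain_ends p S i" by auto
  interpret normal_step p U x by (rule x(1))
  have IH: "adj U x \<subseteq> S" "cov (p ^ i) S (adj U x)" using Suc.IH[OF x(2)] by auto
  have "cov (p ^ i * p) S U" by (rule cov_trans[OF IH(2) cov_adj])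
  then show ?case using W IH(1) adj_sub[of U x] by (auto simp: mult.commute)
qed

lemma chain_ends_count:
  assumes S: "subgrp S" and hom: "\<And>i U. U \<in> chain_ends p S i \<Longrightarrow> finite (homs p U) \<and> card (homs p U) \<le> p ^ D i"
  shows "finite (chain_ends p S i) \<and> card (chain_ends p S i) \<le> p ^ (\<Sum>j<i. D j)"
proof (induction i)
  case (Suc i)
  let ?A = "\<lambda>U. (\<lambda>\<phi>. {y \<in> U. \<phi> y = 0}) ` homs p U"
  have sub: "chain_ends p S (Suc i) \<subseteq> (\<Union>U\<in>chain_ends p S i. ?A U)"
  proof
    fix W assume "W \<in> chain_ends p S (Suc i)"
    then obtain x where x: "normal_step p W x" "adj W x \<in> chain_ends p S i" by auto
    interpret normal_step p W x by (rule x(1))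
    have "W \<in> ?A (adj W x)" by (rule image_eqI[of _ _ chi], rule chi_kernel, rule chi_homs)
    then show "W \<in> (\<Union>U\<in>chain_ends p S i. ?A U)" using x(2) by blast
  qed
  have fin: "finite (\<Union>U\<in>chain_ends p S i. ?A U)" using Suc hom by blast
  have "card (chain_ends p S (Suc i)) \<le> card (\<Union>U\<in>chain_ends p S i. ?A U)" by (rule card_mono[OF fin sub])
  also have "\<dots> \<le> (\<Sum>U\<in>chain_ends p S i. card (?A U))" using Suc by (intro card_UN_le) auto
  also have "\<dots> \<le> (\<Sum>U\<in>chain_ends p S i. p ^ D i)"
    using hom by (intro sum_mono order_trans[OF card_image_le]) blast+
  also have "\<dots> \<le> p ^ (\<Sum>j<i. D j) * p ^ D i" using Suc by simp
  finally show ?case using finite_subset[OF sub fin] by (simp add: power_add)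
qed simp

text \<open>Strong induction on the index: \<open>normalizer_grows\<close> supplies a normal step
  upwards, and it lowers the index at least by the factor p.\<close>

lemma in_chain:
  assumes p: "Factorial_Ring.prime p" and S: "subgrp S" and tor: "\<And>x. x \<in> S \<Longrightarrow> p_torsion p x"
    and "subgrp W" "W \<subseteq> S" "finite (rc S W)"
  shows "\<exists>i. W \<in> chain_ends p S i \<and> p ^ i \<le> card (rc S W)"
  using assms(4-)
proof (induction "card (rc S W)" arbitrary: W rule: less_induct)
  case less
  show ?case
  proof (cases "W = S")
    case True
    have "rc S W \<noteq> {}" using subgrp_0[OF S] by (auto simp: rc_def)
    then have "1 \<le> card (rc S W)" using less.prems by (simp add: card_gt_0_iff Suc_leI)
    then show ?thesis using True by (intro exI[of _ 0]) auto
  next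
    case False
    obtain x where x: "x \<in> S" "x \<notin> W" "nm p x \<in> W" "\<And>w. w \<in> W \<Longrightarrow> x + w - x \<in> W"
      using normalizer_grows[OF p S tor less.prems(1,2) False less.prems(3)] by blast
    interpret normal_step p W x by unfold_locales (use p less.prems x tor in auto)
    have sub: "adj W x \<subseteq> S" by (rule adj_least[OF S less.prems(2) x(1)])
    note rc = rc_adj[OF S sub less.prems(3)]
    have "rc S (adj W x) \<noteq> {}" using subgrp_0[OF S] by (auto simp: rc_def)
    then have "card (rc S (adj W x)) > 0" using rc(1) by (simp add: card_gt_0_iff)
    then have "card (rc S (adj W x)) < p * card (rc S (adj W x))" using prime_gt_1_nat[OF p] by simp
    then have "card (rc S (adj W x)) < card (rc S W)" using rc(2) by linarith
    then obtain i where i: "adj W x \<in> chain_ends p S i" "p ^ i \<le> card (rc S (adj W x))"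
      using less.hyps[OF _ subgrp_adj sub rc(1)] by blast
    have "W \<in> chain_ends p S (Suc i)" using i(1) normal_step_axioms by auto
    moreover have "p * p ^ i \<le> p * card (rc S (adj W x))" using i(2) by (rule mult_le_mono2)
    then have "p * p ^ i \<le> card (rc S W)" using rc(2) by (rule order_trans)
    then have "p ^ Suc i \<le> card (rc S W)" by simp
    ultimately show ?thesis by blast
  qed
qed

section \<open>Extensions by an elementary abelian group\<close>

locale elem_module =
  fixes p :: nat and T M :: "'g::group_add set"
  assumes prime_p: "Factorial_Ring.prime p" and T: "subgrp T" and M: "subgrp M" and MT: "M \<subseteq> T"
    and comm: "\<And>x y. x \<in> M \<Longrightarrow> y \<in> M \<Longrightarrow> x + y = y + x"
    and expo: "\<And>x. x \<in> M \<Longrightarrow> nm p x = 0"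
    and nrm: "\<And>t x. t \<in> T \<Longrightarrow> x \<in> M \<Longrightarrow> t + x - t \<in> M"
    and tor: "\<And>x. x \<in> T \<Longrightarrow> p_torsion p x"
begin

text \<open>The restriction to \<open>U \<inter> M\<close> of a homomorphism on \<open>U\<close> is
  invariant under conjugation and so lies here; \<open>hom0\<close> collects the homomorphisms with
  zero restriction.\<close>

definition invs :: "'g set \<Rightarrow> ('g \<Rightarrow> qz) set" where
  "invs U = {l \<in> homs p (U \<inter> M). \<forall>u\<in>U. \<forall>n\<in>U \<inter> M. l (u + n - u) = l n}"

definition hom0 :: "'g set \<Rightarrow> ('g \<Rightarrow> qz) set" where
  "hom0 U = {f \<in> homs p U. \<forall>n\<in>U \<inter> M. f n = 0}"

lemma conj_UM: "subgrp U \<Longrightarrow> U \<subseteq> T \<Longrightarrow> u \<in> U \<Longrightarrow> n \<in> U \<inter> M \<Longrightarrow> u + n - u \<in> U \<inter> M"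
  using nrm by (auto intro: subgrp_diff subgrp_add)

lemma homs_le:
  assumes U: "subgrp U" "U \<subseteq> T" and fin: "finite (hom0 U)" "finite (invs U)"
  shows "finite (homs p U) \<and> card (homs p U) \<le> card (invs U) * card (hom0 U)"
proof -
  have UM: "subgrp (U \<inter> M)" by (rule subgrp_Int[OF U(1) M])
  let ?f = "\<lambda>f x. if x \<in> U \<inter> M then f x else 0"
  have im: "?f ` homs p U \<subseteq> invs U"
  proof clarify
    fix f assume f: "f \<in> homs p U"
    have "f (u + n - u) = f n" if "u \<in> U" "n \<in> U \<inter> M" for u n
      using that f U by (simp add: homs_diff homsD(3) subgrp_add)
    then show "?f f \<in> invs U"
      using homs_restrict[OF f U(1) UM] conj_UM[OF U] unfolding invs_def by auto
  qed
  have fib: "finite {a \<in> homs p U. ?f a = b} \<and> card {a \<in> homs p U. ?f a = b} \<le> card (hom0 U)" for b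
  proof (cases "{a \<in> homs p U. ?f a = b} = {}")
    case False
    then obtain a0 where a0: "a0 \<in> homs p U" "?f a0 = b" by blast
    let ?g = "\<lambda>a x. a x - a0 x"
    have inj: "inj_on ?g {a \<in> homs p U. ?f a = b}"
      by (rule inj_onI) (simp add: fun_eq_iff)
    have sub: "?g ` {a \<in> homs p U. ?f a = b} \<subseteq> hom0 U"
    proof clarify
      fix a assume a: "a \<in> homs p U" "b = ?f a"
      have "a x = a0 x" if "x \<in> U \<inter> M" for x
        using fun_cong[of "?f a" "?f a0" x] a(2) a0(2) that by simp
      then show "?g a \<in> hom0 U" using homs_subtract[OF a(1) a0(1)] by (simp add: hom0_def)
    qed
    show ?thesis
      using card_inj_on_le[OF inj sub fin(1)] finite_imageD[OF finite_subset[OF sub fin(1)] inj] by blast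
  next
    case True then show ?thesis by (simp only: card.empty finite.emptyI le0 simp_thms)
  qed
  show ?thesis using card_fibers[OF fin(2) im fib] by blast
qed

context
  fixes U :: "'g set" and x :: 'g
  assumes U: "subgrp U" "U \<subseteq> T" and xM: "x \<in> M" and xU: "x \<notin> U"
    and xn: "\<And>u. u \<in> U \<Longrightarrow> x + u - x \<in> U"
begin

lemma nstep: "normal_step p U x"
  by unfold_locales (use prime_p U xM xU xn expo subgrp_0 tor MT in auto)

lemma UM: "subgrp (U \<inter> M)" by (rule subgrp_Int[OF U(1) M])

lemma cdiff_mem: "u \<in> U \<Longrightarrow> u + x - u - x \<in> U \<inter> M"
proof -
  assume u: "u \<in> U"
  have "(u + x - u) - x \<in> M" using nrm[of u x] u U xM M by (auto intro: subgrp_diff)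
  moreover have "u + (x + - u - x) \<in> U"
    by (rule subgrp_add[OF U(1) u xn[OF subgrp_minus[OF U(1) u]]])
  then have "u + x - u - x \<in> U" by (simp add: grp_simps del: add_uminus_conv_diff)
  ultimately show ?thesis by blast
qed

text \<open>The obstruction to extending l over x: an additive extension invariant under
  \<open>U\<close> has to vanish on every commutator \<open>u + x - u - x\<close>.\<close>

definition cl :: "('g \<Rightarrow> qz) \<Rightarrow> 'g \<Rightarrow> qz" where
  "cl l u = (if u \<in> U then l (u + x - u - x) else 0)"

lemma cl_hom0: assumes l: "l \<in> invs U" shows "cl l \<in> hom0 U"
proof -
  have lh: "l \<in> homs p (U \<inter> M)" and li: "\<And>u n. u \<in> U \<Longrightarrow> n \<in> U \<inter> M \<Longrightarrow> l (u + n - u) = l n"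
    using l by (auto simp: invs_def)
  have "cl l (u + v) = cl l u + cl l v" if uv: "u \<in> U" "v \<in> U" for u v
  proof -
    have "(u + v) + x - (u + v) - x = (u + (v + x - v - x) - u) + (u + x - u - x)"
      by (simp add: grp_simps del: add_uminus_conv_diff)
    then have "l ((u + v) + x - (u + v) - x) = l (u + (v + x - v - x) - u) + l (u + x - u - x)"
      using homsD(3)[OF lh] conj_UM[OF U uv(1) cdiff_mem[OF uv(2)]] cdiff_mem[OF uv(1)] by simp
    then show ?thesis using uv subgrp_add[OF U(1) uv] li[OF uv(1) cdiff_mem[OF uv(2)]]
      by (simp add: cl_def)
  qed
  moreover have "cl l n = 0" if n: "n \<in> U \<inter> M" for n
  proof -
    have "n + x - n - x = 0" using comm[of n x] n xM by (simp add: grp_simps del: add_uminus_conv_diff)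
    then show ?thesis using homs_0[OF lh UM] by (simp add: cl_def)
  qed
  ultimately show ?thesis
    using homsD(2)[OF lh cdiff_mem] mu_closed(1) by (auto simp: hom0_def homs_def cl_def)
qed

text \<open>The extension that is 0 on the multiples of x. The choice of n is harmless by
  \<open>coord_M\<close>, since x has order p modulo \<open>U\<close> and in
  \<open>M\<close>.\<close>

definition ext :: "('g \<Rightarrow> qz) \<Rightarrow> 'g \<Rightarrow> qz" where
  "ext l y = (if y \<in> adj U x \<inter> M then l (SOME n. n \<in> U \<inter> M \<and> (\<exists>j. y = n + nm j x)) else 0)"

lemma nm_M: "nm j x \<in> M" by (rule nm_subgrp[OF M xM])

lemma coord_M:
  assumes "n + nm j x = n' + nm j' x" "n \<in> U" "n' \<in> U" shows "n = n'"
proof -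
  interpret normal_step p U x by (rule nstep)
  have d: "int p dvd int j - int j'" by (rule coord_unique[OF assms])
  have key: "nm i x = nm i' x" if ii: "int p dvd int i - int i'" "i' \<le> i" for i i'
  proof -
    have "int (i - i') = int i - int i'" using ii by simp
    then have "int p dvd int (i - i')" using ii by simp
    then have "p dvd i - i'" by (simp only: of_nat_dvd_iff)
    then obtain k where "i = k * p + i'" using ii(2) by (metis dvd_div_mult_self le_add_diff_inverse2)
    then have "nm i x = nm k (nm p x) + nm i' x" by (simp add: nm_add nm_mult)
    then show ?thesis using expo[OF xM] by simp
  qed
  have "nm j x = nm j' x"
    using key[of j j'] key[of j' j] d by (metis dvd_diff_commute nat_le_linear)
  then show ?thesis using assms(1) by simp
qed

lemma ext_eq: assumes "n \<in> U \<inter> M" shows "ext l (n + nm j x) = l n"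
proof -
  let ?n = "SOME n'. n' \<in> U \<inter> M \<and> (\<exists>i. n + nm j x = n' + nm i x)"
  have "?n \<in> U \<inter> M \<and> (\<exists>i. n + nm j x = ?n + nm i x)"
    by (rule someI[of _ n]) (use assms in blast)
  then obtain i where "?n \<in> U" "n + nm j x = ?n + nm i x" by blast
  then have "?n = n" using coord_M[of n j ?n i] assms by simp
  moreover have "n + nm j x \<in> adj U x \<inter> M"
    using assms nm_M subgrp_add[OF M] by (auto simp: adj_def)
  ultimately show ?thesis by (simp add: ext_def)
qed

lemma adj_M: assumes "y \<in> adj U x \<inter> M" obtains n j where "y = n + nm j x" "n \<in> U \<inter> M"
proof -
  obtain n j where y: "y = n + nm j x" "n \<in> U" using assms by (auto simp: adj_def)
  then have "n \<in> M" using assms subgrp_add_right[OF M nm_M] by auto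
  then show ?thesis using that y by blast
qed

lemma nm_comm_add: assumes "a \<in> M" "b \<in> M" shows "nm j (a + b) = nm j a + nm j b"
proof (induction j)
  case (Suc j)
  have "b + nm j a = nm j a + b" using assms nm_subgrp[OF M] comm by blast
  then have "b + (nm j a + nm j b) = nm j a + (b + nm j b)" by (metis add.assoc)
  then show ?case using Suc by (simp add: add.assoc)
qed simp

lemma nm_conj: "nm j (u + a - u) = u + nm j a - (u :: 'g)"
proof (induction j)
  case (Suc j)
  then show ?case by (simp add: grp_simps del: add_uminus_conv_diff)
qed simp

lemma ext_invs:
  assumes l: "l \<in> invs U" and c: "\<And>u. u \<in> U \<Longrightarrow> l (u + x - u - x) = 0"
  shows "ext l \<in> invs (adj U x)"
proof -
  interpret ns: normal_step p U x by (rule nstep)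
  have lh: "l \<in> homs p (U \<inter> M)" and li: "\<And>u n. u \<in> U \<Longrightarrow> n \<in> U \<inter> M \<Longrightarrow> l (u + n - u) = l n"
    using l by (auto simp: invs_def)
  have add: "ext l (y + z) = ext l y + ext l z" if y: "y \<in> adj U x \<inter> M" and z: "z \<in> adj U x \<inter> M" for y z
  proof -
    obtain n j where n: "y = n + nm j x" "n \<in> U \<inter> M" using adj_M[OF y] .
    obtain m i where m: "z = m + nm i x" "m \<in> U \<inter> M" using adj_M[OF z] .
    have "nm j x + m = m + nm j x" using m nm_M comm by blast
    then have "y + z = (n + m) + nm (j + i) x" unfolding n m nm_add by (metis add.assoc)
    moreover have "n + m \<in> U \<inter> M" using n m UM subgrp_add by blast
    ultimately have "ext l (y + z) = l (n + m)" by (simp only: ext_eq)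
    also have "\<dots> = l n + l m" using n m homsD(3)[OF lh] by blast
    finally show ?thesis unfolding n(1) m(1) ext_eq[OF n(2)] ext_eq[OF m(2)] .
  qed
  have mu: "ext l y \<in> mu p" if y: "y \<in> adj U x \<inter> M" for y
  proof -
    obtain n j where n: "y = n + nm j x" "n \<in> U \<inter> M" using adj_M[OF y] .
    show ?thesis unfolding n(1) ext_eq[OF n(2)] by (rule homsD(2)[OF lh n(2)])
  qed
  have inv: "ext l (a + y - a) = ext l y" if a: "a \<in> adj U x" and y: "y \<in> adj U x \<inter> M" for a y
  proof -
    obtain n j where n: "y = n + nm j x" "n \<in> U \<inter> M" using adj_M[OF y] .
    obtain u i where u: "a = u + nm i x" "u \<in> U" using a by (auto simp: adj_def)
    define e where "e = u + x - u - x"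
    have e: "e \<in> U \<inter> M" unfolding e_def by (rule cdiff_mem[OF u(2)])
    \<comment> \<open>Both lie in the commutative \<open>M\<close>, so only the part
      \<open>u\<close> of \<open>a\<close> acts on \<open>y\<close>.\<close>
    have "nm i x + y - nm i x = y" using comm[of "nm i x" y] nm_M y by simp
    then have "a + y - a = u + y - u"
      by (simp add: u grp_simps del: add_uminus_conv_diff) (metis add.assoc)
    also have "\<dots> = (u + n - u) + (u + nm j x - u)" by (simp add: n grp_simps del: add_uminus_conv_diff)
    also have "u + nm j x - u = nm j (u + x - u)" by (simp add: nm_conj)
    \<comment> \<open>Conjugation changes \<open>x\<close> by a commutator, and \<open>l\<close>
      vanishes on it by assumption.\<close>
    also have "u + x - u = e + x" by (simp add: e_def)
    also have "nm j (e + x) = nm j e + nm j x" using e xM by (intro nm_comm_add) auto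
    finally have eq: "a + y - a = (u + n - u + nm j e) + nm j x" by (simp add: add.assoc)
    have m: "u + n - u \<in> U \<inter> M" by (rule conj_UM[OF U u(2) n(2)])
    have je: "nm j e \<in> U \<inter> M" by (rule nm_subgrp[OF UM e])
    have "ext l (a + y - a) = l (u + n - u + nm j e)"
      unfolding eq by (rule ext_eq) (rule subgrp_add[OF UM m je])
    also have "\<dots> = l n + nm j (l e)"
      using homsD(3)[OF lh m je] homs_nm[OF lh UM e] li[OF u(2) n(2)] by simp
    also have "l e = 0" unfolding e_def by (rule c[OF u(2)])
    finally show ?thesis unfolding n(1) ext_eq[OF n(2)] by simp
  qed
  show ?thesis unfolding invs_def homs_def using add mu inv by (auto simp: ext_def)
qed

text \<open>Two functionals with the same obstruction differ by one without obstruction, and those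
  embed by \<open>ext\<close> into the functionals for \<open>adj U x\<close>.\<close>

lemma invs_step:
  assumes fin: "finite (hom0 U)" "finite (invs (adj U x))"
  shows "finite (invs U) \<and> card (invs U) \<le> card (hom0 U) * card (invs (adj U x))"
proof -
  have im: "cl ` invs U \<subseteq> hom0 U" using cl_hom0 by blast
  have fib: "finite {a \<in> invs U. cl a = b} \<and> card {a \<in> invs U. cl a = b} \<le> card (invs (adj U x))" for b
  proof (cases "{a \<in> invs U. cl a = b} = {}")
    case False
    then obtain a0 where a0: "a0 \<in> invs U" "cl a0 = b" by blast
    have a0h: "a0 \<in> homs p (U \<inter> M)" using a0 by (simp add: invs_def)
    let ?g = "\<lambda>a. ext (\<lambda>y. a y - a0 y)"
    have ah: "a \<in> homs p (U \<inter> M)" if "a \<in> invs U" for a using that by (simp add: invs_def)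
    have val: "?g a y = a y - a0 y" if "y \<in> U \<inter> M" for a y
      using ext_eq[OF that, of "\<lambda>y. a y - a0 y" 0] by simp
    have inj: "inj_on ?g {a \<in> invs U. cl a = b}"
    proof (rule inj_onI, rule ext)
      fix a a' y assume a: "a \<in> {a \<in> invs U. cl a = b}" "a' \<in> {a \<in> invs U. cl a = b}" and eq: "?g a = ?g a'"
      show "a y = a' y"
      proof (cases "y \<in> U \<inter> M")
        case True
        then show ?thesis using fun_cong[OF eq, of y] val by simp
      next
        case False
        then show ?thesis using homsD(1)[OF ah, of a y] homsD(1)[OF ah, of a' y] a by simp
      qed
    qed
    have sub: "?g ` {a \<in> invs U. cl a = b} \<subseteq> invs (adj U x)"
    proof clarify
      fix a assume a: "a \<in> invs U" "b = cl a"
      have "(\<lambda>y. a y - a0 y) \<in> invs U"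
        using homs_subtract[OF ah[OF a(1)] a0h] a(1) a0(1) by (auto simp: invs_def)
      moreover have "a (u + x - u - x) - a0 (u + x - u - x) = 0" if u: "u \<in> U" for u
      proof -
        have "cl a u = cl a0 u" using a(2) a0(2) by simp
        then show ?thesis using u by (simp add: cl_def)
      qed
      ultimately show "?g a \<in> invs (adj U x)" by (rule ext_invs)
    qed
    show ?thesis
      using card_inj_on_le[OF inj sub fin(2)] finite_imageD[OF finite_subset[OF sub fin(2)] inj] by blast
  next
    case True then show ?thesis by (simp only: card.empty finite.emptyI le0 simp_thms)
  qed
  show ?thesis using card_fibers[OF fin(1) im fib] by blast
qed

end

text \<open>Climb from \<open>U\<close> to \<open>S\<close> by adjoining elements of
  \<open>M\<close>. Each step costs a factor \<open>B\<close> and divides the index by at least p,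
  which bounds the number r of steps.\<close>

lemma invs_chain:
  assumes S: "subgrp S" "S \<subseteq> T" "M \<subseteq> S" and SU: "\<And>y. y \<in> S \<Longrightarrow> \<exists>u\<in>U. - u + y \<in> M"
    and U: "subgrp U" "U \<subseteq> S" and fin: "finite (rc S U)"
    and B: "\<And>V. subgrp V \<Longrightarrow> U \<subseteq> V \<Longrightarrow> V \<subseteq> S \<Longrightarrow> finite (hom0 V) \<and> card (hom0 V) \<le> B"
    and B': "finite (invs S)" "card (invs S) \<le> B'"
  shows "\<exists>r. p ^ r \<le> card (rc S U) \<and> finite (invs U) \<and> card (invs U) \<le> B ^ r * B'"
  using U SU fin B
proof (induction "card (rc S U)" arbitrary: U rule: less_induct)
  case less
  show ?case
  proof (cases "U = S")
    case True
    have "rc S U \<noteq> {}" using subgrp_0[OF S(1)] by (auto simp: rc_def)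
    then have "1 \<le> card (rc S U)" using less.prems by (simp add: card_gt_0_iff Suc_leI)
    then show ?thesis using B' True by (intro exI[of _ 0]) auto
  next
    case False
    obtain y where y: "y \<in> S" "y \<notin> U" "nm p y \<in> U" "\<And>w. w \<in> U \<Longrightarrow> y + w - y \<in> U"
      using normalizer_grows[OF prime_p S(1) _ less.prems(1,2) False less.prems(4)] tor S(2) by blast
    obtain u where u: "u \<in> U" "- u + y \<in> M" using less.prems(3)[OF y(1)] by blast
    \<comment> \<open>As every element of \<open>S\<close> lies in \<open>M\<close> up to one of
      \<open>U\<close>, the normalizing element can be corrected into \<open>M\<close>. It still
      normalizes \<open>U\<close> and lies outside it.\<close>
    define x where "x = - u + y"
    have UT: "U \<subseteq> T" using less.prems(2) S(2) by blast
    have xM: "x \<in> M" using u by (simp add: x_def)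
    have xU: "x \<notin> U" using y(2) u(1) subgrp_add_left[OF less.prems(1) subgrp_minus[OF less.prems(1) u(1)]]
      by (simp add: x_def)
    have xn: "x + w - x \<in> U" if w: "w \<in> U" for w
    proof -
      have "- u + (y + w - y) + u \<in> U"
        using y(4)[OF w] u(1) by (intro subgrp_add[OF less.prems(1)] subgrp_minus[OF less.prems(1)])
      then show ?thesis by (simp add: x_def grp_simps del: add_uminus_conv_diff)
    qed
    interpret ns: normal_step p U x by (rule nstep[OF less.prems(1) UT xM xU xn])
    have xS: "x \<in> S" using xM S(3) by blast
    have sub: "adj U x \<subseteq> S" by (rule adj_least[OF S(1) less.prems(2) xS])
    note rc = ns.rc_adj[OF S(1) sub less.prems(4)]
    have "rc S (adj U x) \<noteq> {}" using subgrp_0[OF S(1)] by (auto simp: rc_def)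
    then have "card (rc S (adj U x)) > 0" using rc(1) by (simp add: card_gt_0_iff)
    then have "card (rc S (adj U x)) < p * card (rc S (adj U x))" using prime_gt_1_nat[OF prime_p] by simp
    then have lt: "card (rc S (adj U x)) < card (rc S U)" using rc(2) by linarith
    have ex: "\<exists>u\<in>adj U x. - u + y \<in> M" if "y \<in> S" for y using less.prems(3)[OF that] adj_sub by blast
    obtain r where r: "p ^ r \<le> card (rc S (adj U x))" "finite (invs (adj U x))" "card (invs (adj U x)) \<le> B ^ r * B'"
      using less.hyps[OF lt ns.subgrp_adj sub ex rc(1)] less.prems(5) adj_sub by (metis subset_trans)
    have h0: "finite (hom0 U)" "card (hom0 U) \<le> B" using less.prems(5)[OF less.prems(1) order_refl less.prems(2)] by auto
    have iv: "finite (invs U) \<and> card (invs U) \<le> card (hom0 U) * card (invs (adj U x))"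
      by (rule invs_step[OF less.prems(1) UT xM xU xn h0(1) r(2)])
    have "card (hom0 U) * card (invs (adj U x)) \<le> B * (B ^ r * B')" using h0(2) r(3) by (rule mult_le_mono)
    then have "card (invs U) \<le> B ^ Suc r * B'" using iv by (simp add: mult.assoc)
    moreover have "p * p ^ r \<le> card (rc S U)" using mult_le_mono2[OF r(1), of p] rc(2) by (rule order_trans)
    ultimately show ?thesis using iv by (intro exI[of _ "Suc r"]) auto
  qed
qed

theorem homs_bound:
  assumes S: "subgrp S" "S \<subseteq> T" "M \<subseteq> S" and SU: "\<And>y. y \<in> S \<Longrightarrow> \<exists>u\<in>U. - u + y \<in> M"
    and U: "subgrp U" "U \<subseteq> S" and fin: "finite (rc S U)"
    and B: "\<And>V. subgrp V \<Longrightarrow> U \<subseteq> V \<Longrightarrow> V \<subseteq> S \<Longrightarrow> finite (hom0 V) \<and> card (hom0 V) \<le> B"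
    and B': "finite (invs S)" "card (invs S) \<le> B'"
  shows "\<exists>r. p ^ r \<le> card (rc S U) \<and> finite (homs p U) \<and> card (homs p U) \<le> B ^ Suc r * B'"
proof -
  obtain r where r: "p ^ r \<le> card (rc S U)" "finite (invs U)" "card (invs U) \<le> B ^ r * B'"
    using invs_chain[OF assms] by blast
  have h0: "finite (hom0 U)" "card (hom0 U) \<le> B" using B[OF U(1) order_refl U(2)] by auto
  have UT: "U \<subseteq> T" using U(2) S(2) by blast
  have "finite (homs p U)" "card (homs p U) \<le> card (invs U) * card (hom0 U)"
    using homs_le[OF U(1) UT h0(1) r(2)] by auto
  moreover have "card (invs U) * card (hom0 U) \<le> (B ^ r * B') * B" using r(3) h0(2) by (rule mult_le_mono)
  ultimately show ?thesis using r(1) by (intro exI[of _ r]) (auto simp: mult_ac)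
qed

end

section \<open>The semidirect product\<close>

definition act :: "(nat \<Rightarrow> nperm) \<Rightarrow> nat list \<Rightarrow> nat list" where
  "act g y = map (\<lambda>i. ap (g i) (y ! i)) [0..<length y]"

lemma length_act [simp]: "length (act g y) = length y"
  by (simp add: act_def)

lemma nth_act [simp]: "i < length y \<Longrightarrow> act g y ! i = ap (g i) (y ! i)"
  by (simp add: act_def)

lemma act_add: "act g (act h y) = act (\<lambda>i. g i + h i) y"
  by (rule nth_equalityI) auto

lemma act_0 [simp]: "act (\<lambda>i. 0) y = y"
  by (rule nth_equalityI) auto

lemma act_minus [simp]: "act (\<lambda>i. - g i) (act g y) = y" "act g (act (\<lambda>i. - g i) y) = y"
  by (rule nth_equalityI; simp)+

text \<open>Neither p nor the number of factors enters the type, so one instance of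
  \<open>group_add\<close> serves all cases; \<open>H\<close> cuts out the intended group.\<close>

datatype semi = Semi (mo: "nat list \<Rightarrow> qz") (gp: "nat \<Rightarrow> nperm")

instantiation semi :: group_add
begin

definition zero_semi :: semi where "zero_semi = Semi (\<lambda>_. 0) (\<lambda>_. 0)"
definition plus_semi :: "semi \<Rightarrow> semi \<Rightarrow> semi" where
  "plus_semi a b = Semi (\<lambda>y. mo a y + mo b (act (\<lambda>i. - gp a i) y)) (\<lambda>i. gp a i + gp b i)"
definition uminus_semi :: "semi \<Rightarrow> semi" where
  "uminus_semi a = Semi (\<lambda>y. - mo a (act (gp a) y)) (\<lambda>i. - gp a i)"
definition minus_semi :: "semi \<Rightarrow> semi \<Rightarrow> semi" where "minus_semi a b = a + - b"

instance
  by standard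
    (auto simp: zero_semi_def plus_semi_def uminus_semi_def minus_semi_def act_add add.assoc
      minus_add semi.expand simp del: add_uminus_conv_diff)

end

lemma gp_add [simp]: "gp (a + b) i = gp a i + gp b i"
  and gp_minus [simp]: "gp (- a) i = - gp a i"
  and gp_0 [simp]: "gp 0 i = 0"
  by (simp_all add: zero_semi_def plus_semi_def uminus_semi_def)

lemma gp_diff [simp]: "gp (a - b) i = gp a i - gp b i"
  by (metis diff_conv_add_uminus gp_add gp_minus)

lemma gp_nm: "gp (nm n a) i = nm n (gp a i)"
  by (induction n) simp_all

lemma mo_add: "mo (a + b) y = mo a y + mo b (act (\<lambda>i. - gp a i) y)"
  by (simp add: plus_semi_def)

lemma mo_minus: "mo (- a) y = - mo a (act (gp a) y)"
  by (simp add: uminus_semi_def)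

lemma semi_eqI: "(\<And>y. mo a y = mo b y) \<Longrightarrow> (\<And>i. gp a i = gp b i) \<Longrightarrow> a = b"
  by (auto intro!: semi.expand)

abbreviation inj_m :: "(nat list \<Rightarrow> qz) \<Rightarrow> semi" where "inj_m m \<equiv> Semi m (\<lambda>_. 0)"

lemma inj_m_add: "inj_m m + inj_m m' = inj_m (\<lambda>y. m y + m' y)"
  by (rule semi_eqI) (simp_all add: mo_add)

lemma inj_m_0: "inj_m (\<lambda>_. 0) = 0"
  by (simp add: zero_semi_def)

lemma inj_m_conj: "a + inj_m m - a = inj_m (\<lambda>y. m (act (\<lambda>i. - gp a i) y))"
  unfolding diff_conv_add_uminus
  by (rule semi_eqI) (simp_all add: mo_add mo_minus del: add_uminus_conv_diff)

lemma inj_m_nm: "nm n (inj_m m) = inj_m (\<lambda>y. nm n (m y))"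
  by (induction n) (simp_all add: inj_m_0 inj_m_add)

definition inj_g :: "nat \<Rightarrow> nperm \<Rightarrow> semi" where
  "inj_g j g = Semi (\<lambda>_. 0) (\<lambda>i. if i = j then g else 0)"

lemma inj_g_add: "inj_g j (g + h) = inj_g j g + inj_g j h"
  unfolding inj_g_def by (rule semi_eqI) (simp_all add: mo_add)

lemma inj_g_minus: "inj_g j (- g) = - inj_g j g"
  unfolding inj_g_def by (rule semi_eqI) (simp_all add: mo_minus)

lemma gp_inj_g [simp]: "gp (inj_g j g) i = (if i = j then g else 0)"
  by (simp add: inj_g_def)

section \<open>The group H and its module\<close>

locale spinal_k = spinal +
  fixes k :: nat
  assumes k_pos: "k \<ge> 1"
begin

text \<open>For \<open>k = 1\<close> the group \<open>G 0\<close> itself has the required growth, and the module is dropped.\<close>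

definition Y :: "nat list set" where "Y = (if k = 1 then {} else {y. length y = k})"

definition Mm :: "(nat list \<Rightarrow> qz) set" where
  "Mm = {m. (\<forall>y. m y \<in> mu p) \<and> finite {y. m y \<noteq> 0} \<and> (\<forall>y. y \<notin> Y \<longrightarrow> m y = 0)}"

definition H :: "semi set" where
  "H = {a. mo a \<in> Mm \<and> (\<forall>i<k. gp a i \<in> G 0) \<and> (\<forall>i\<ge>k. gp a i = 0)}"

definition MM :: "semi set" where "MM = inj_m ` Mm"

lemma p_gt0 [simp]: "p > 0" using p_ge2 by simp

lemma act_Y [simp]: "act g y \<in> Y \<longleftrightarrow> y \<in> Y"
  by (simp add: Y_def)

lemma Mm_0: "(\<lambda>_. 0) \<in> Mm" by (simp add: Mm_def mu_closed)

lemma Mm_add: assumes "m \<in> Mm" "m' \<in> Mm" shows "(\<lambda>y. m y + m' y) \<in> Mm"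
proof -
  have "{y. m y + m' y \<noteq> 0} \<subseteq> {y. m y \<noteq> 0} \<union> {y. m' y \<noteq> 0}" by auto
  then have "finite {y. m y + m' y \<noteq> 0}" using assms by (auto simp: Mm_def intro: finite_subset)
  then show ?thesis using assms by (simp add: Mm_def mu_closed)
qed

lemma Mm_minus: "m \<in> Mm \<Longrightarrow> (\<lambda>y. - m y) \<in> Mm"
  by (simp add: Mm_def mu_closed)

lemma Mm_act: assumes "m \<in> Mm" shows "(\<lambda>y. m (act g y)) \<in> Mm"
proof -
  have "{y. m (act g y) \<noteq> 0} \<subseteq> act (\<lambda>i. - g i) ` {y. m y \<noteq> 0}"
    by (auto intro!: image_eqI[of _ _ "act g _"])
  then have "finite {y. m (act g y) \<noteq> 0}" using assms by (auto simp: Mm_def intro: finite_subset)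
  then show ?thesis using assms by (simp add: Mm_def)
qed

lemma subgrp_H: "subgrp H"
  unfolding subgrp_def
proof (intro conjI ballI)
  show "0 \<in> H" using Mm_0 G_zero by (auto simp: H_def zero_semi_def)
next
  fix a b assume ab: "a \<in> H" "b \<in> H"
  have "(\<lambda>y. mo a y + mo b (act (\<lambda>i. - gp a i) y)) \<in> Mm" using ab by (intro Mm_add Mm_act) (auto simp: H_def)
  then have "mo (a + b) \<in> Mm" by (simp add: mo_add[abs_def])
  then show "a + b \<in> H" using ab by (simp add: H_def G_add)
next
  fix a assume a: "a \<in> H"
  have "(\<lambda>y. - mo a (act (gp a) y)) \<in> Mm" using a by (intro Mm_minus Mm_act) (auto simp: H_def)
  then have "mo (- a) \<in> Mm" by (simp add: mo_minus[abs_def])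
  then show "- a \<in> H" using a by (simp add: H_def G_minus)
qed

lemma MM_iff: "a \<in> MM \<longleftrightarrow> a \<in> H \<and> (\<forall>i. gp a i = 0)"
proof
  assume "a \<in> H \<and> (\<forall>i. gp a i = 0)"
  then have "a = inj_m (mo a)" "mo a \<in> Mm" by (auto simp: H_def intro: semi_eqI)
  then show "a \<in> MM" unfolding MM_def by blast
qed (auto simp: MM_def H_def G_zero)

lemma H_gp: "a \<in> H \<Longrightarrow> gp a i \<in> G 0"
  by (cases "i < k") (auto simp: H_def G_zero)

lemma inj_g_H: "g \<in> G 0 \<Longrightarrow> j < k \<Longrightarrow> inj_g j g \<in> H"
  by (auto simp: H_def inj_g_def G_zero Mm_0)

lemma p_torsion_zero_pow: "nm (p ^ e) x = 0 \<Longrightarrow> e \<le> f \<Longrightarrow> nm (p ^ f) x = 0"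
proof -
  assume h: "nm (p ^ e) x = 0" "e \<le> f"
  then have "p ^ f = p ^ (f - e) * p ^ e" by (simp flip: power_add)
  then show ?thesis using h by (simp flip: nm_mult)
qed

sublocale elem_module p H MM
proof
  show "Factorial_Ring.prime p" by (rule prime_p)
  show "subgrp H" by (rule subgrp_H)
  show sM: "subgrp MM" using subgrp_H unfolding subgrp_def by (auto simp: MM_iff)
  show "MM \<subseteq> H" by (auto simp: MM_iff)
  show "x + y = y + x" if "x \<in> MM" "y \<in> MM" for x y
    using that by (auto simp: MM_def inj_m_add add.commute)
  show expo: "nm p x = 0" if "x \<in> MM" for x
  proof -
    obtain m where m: "x = inj_m m" "m \<in> Mm" using \<open>x \<in> MM\<close> by (auto simp: MM_def)
    have "nm p (m y) = 0" for y
    proof -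
      have "m y \<in> mu p" using m by (simp add: Mm_def)
      then show ?thesis using mu_nm[OF p_gt0] by (auto simp: mu_def)
    qed
    then show ?thesis by (simp add: m inj_m_nm inj_m_0)
  qed
  show "t + x - t \<in> MM" if "t \<in> H" "x \<in> MM" for t x
    using that subgrp_H by (auto simp: MM_iff intro: subgrp_add subgrp_diff)
  show "p_torsion p x" if x: "x \<in> H" for x
  proof -
    have "\<forall>i. \<exists>e. nm (p ^ e) (gp x i) = 0" using G_p_torsion[OF H_gp[OF x]] by (auto simp: p_torsion_def)
    then obtain e where e: "\<And>i. nm (p ^ e i) (gp x i) = 0" by metis
    define f where "f = (\<Sum>i<k. e i)"
    have "nm (p ^ f) (gp x i) = 0" for i
    proof (cases "i < k")
      case True
      then have "e i \<le> f" unfolding f_def by (intro member_le_sum) auto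
      then show ?thesis by (rule p_torsion_zero_pow[OF e])
    next
      case False then show ?thesis using x by (simp add: H_def)
    qed
    \<comment> \<open>The group components are zero now; what is left in the module is killed by one
      more factor p.\<close>
    then have "nm (p ^ f) x \<in> MM" using nm_subgrp[OF subgrp_H x] by (simp add: MM_iff gp_nm)
    then have "nm (p ^ Suc f) x = 0" using expo by (simp add: nm_mult[symmetric])
    then show ?thesis unfolding p_torsion_def by blast
  qed
qed

definition unit_vec :: "nat list \<Rightarrow> semi" where "unit_vec y = inj_m (\<lambda>z. if z = y then ec p 1 else 0)"

lemma ec1_mu: "ec p j \<in> mu p" by (simp add: mu_def)

lemma unit_vec_MM: "y \<in> Y \<Longrightarrow> unit_vec y \<in> MM"
  by (auto simp: unit_vec_def MM_def Mm_def ec1_mu mu_closed)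

lemma unit_vec_conj: "a + unit_vec y - a = unit_vec (act (gp a) y)"
proof -
  have "act (\<lambda>i. - gp a i) z = y \<longleftrightarrow> z = act (gp a) y" for z by (metis act_minus)
  then show ?thesis unfolding unit_vec_def inj_m_conj by simp
qed

lemma MM_gen: "MM \<subseteq> gen (unit_vec ` Y)"
proof -
  have "inj_m m \<in> gen (unit_vec ` Y)" if "finite A" "m \<in> Mm" "{y. m y \<noteq> 0} = A" for A m
    using that
  proof (induction A arbitrary: m rule: finite_induct)
    case empty
    then have "m = (\<lambda>_. 0)" by auto
    then show ?case by (simp add: inj_m_0 subgrp_0[OF subgrp_gen])
  next
    case (insert y A)
    have y: "y \<in> Y" using insert.prems by (auto simp: Mm_def)
    have m': "m(y := 0) \<in> Mm" "{z. (m(y := 0)) z \<noteq> 0} = A"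
      using insert by (auto simp: Mm_def mu_closed split: if_splits intro: finite_subset[of _ "insert y A"])
    have "m y \<in> (\<lambda>j. ec p (int j)) ` {..<p}"
      using insert.prems(1) by (simp add: Mm_def mu_eq[OF p_gt0, symmetric])
    then obtain j where j: "m y = ec p (int j)" by blast
    have nme: "nm j (ec p 1) = ec p (int j)"
      by (induction j) (simp_all add: ec_add)
    have "inj_m m = inj_m (m(y := 0)) + nm j (unit_vec y)"
      unfolding unit_vec_def inj_m_nm inj_m_add
      by (rule arg_cong[where f = inj_m], rule ext) (simp add: j nme)
    moreover have "inj_m (m(y := 0)) \<in> gen (unit_vec ` Y)" using insert.IH m' by blast
    moreover have "unit_vec y \<in> gen (unit_vec ` Y)" by (rule subsetD[OF gen_incl imageI[OF y]])
    then have "nm j (unit_vec y) \<in> gen (unit_vec ` Y)" by (rule nm_subgrp[OF subgrp_gen])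
    ultimately show ?case by (simp add: subgrp_add[OF subgrp_gen])
  qed
  then show ?thesis by (auto simp: MM_def Mm_def)
qed

text \<open>The unit vectors generate the module and are permuted like the tuples, so an invariant
  functional is known from one tuple in each orbit.\<close>

lemma invs_det:
  assumes S: "subgrp S" "S \<subseteq> H" "MM \<subseteq> S"
    and l: "l \<in> invs S" "l' \<in> invs S"
    and rep: "\<And>y. y \<in> Y \<Longrightarrow> \<exists>u\<in>S. act (gp u) y \<in> Y0" and eq: "\<And>y. y \<in> Y0 \<Longrightarrow> l (unit_vec y) = l' (unit_vec y)"
  shows "l = l'"
proof
  have SM: "S \<inter> MM = MM" using S(3) by blast
  have lh: "l \<in> homs p MM" "l' \<in> homs p MM" using l by (simp_all add: invs_def SM)
  have inv: "\<And>u n. u \<in> S \<Longrightarrow> n \<in> MM \<Longrightarrow> l (u + n - u) = l n" "\<And>u n. u \<in> S \<Longrightarrow> n \<in> MM \<Longrightarrow> l' (u + n - u) = l' n"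
    using l by (simp_all add: invs_def SM)
  have sg: "subgrp {x \<in> MM. l x = l' x}"
    using M subgrp_0 subgrp_add subgrp_minus unfolding subgrp_def
    by (auto simp: homs_0[OF lh(1) M] homs_0[OF lh(2) M] homsD(3)[OF lh(1)] homsD(3)[OF lh(2)]
        homs_minus[OF lh(1) M] homs_minus[OF lh(2) M])
  have "unit_vec ` Y \<subseteq> {x \<in> MM. l x = l' x}"
  proof clarify
    fix y assume y: "y \<in> Y"
    obtain u where u: "u \<in> S" "act (gp u) y \<in> Y0" using rep[OF y] by blast
    have "l (unit_vec y) = l' (unit_vec y)"
      using inv(1)[OF u(1) unit_vec_MM[OF y]] inv(2)[OF u(1) unit_vec_MM[OF y]] eq[OF u(2)] by (simp add: unit_vec_conj)
    then show "unit_vec y \<in> MM \<and> l (unit_vec y) = l' (unit_vec y)" using unit_vec_MM[OF y] by blast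
  qed
  from gen_least[OF sg this] have eqM: "l x = l' x" if "x \<in> MM" for x using MM_gen that by blast
  show "l x = l' x" for x
    using eqM homsD(1)[OF lh(1)] homsD(1)[OF lh(2)] by (cases "x \<in> MM") auto
qed

lemma invs_count:
  assumes S: "subgrp S" "S \<subseteq> H" "MM \<subseteq> S" and Y0: "finite Y0" "Y0 \<subseteq> Y"
    and rep: "\<And>y. y \<in> Y \<Longrightarrow> \<exists>u\<in>S. act (gp u) y \<in> Y0"
  shows "finite (invs S) \<and> card (invs S) \<le> p ^ card Y0"
proof -
  let ?r = "\<lambda>l. restrict (\<lambda>y. l (unit_vec y)) Y0"
  have inj: "inj_on ?r (invs S)"
  proof (rule inj_onI)
    fix l l' assume l: "l \<in> invs S" "l' \<in> invs S" and eq: "?r l = ?r l'"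
    have "l (unit_vec y) = l' (unit_vec y)" if "y \<in> Y0" for y using fun_cong[OF eq, of y] that by simp
    then show "l = l'" using invs_det[OF S l rep] by blast
  qed
  have im: "?r ` invs S \<subseteq> PiE Y0 (\<lambda>_. mu p)"
    using unit_vec_MM S(3) Y0(2) by (fastforce simp: invs_def homs_def)
  have fin: "finite (PiE Y0 (\<lambda>_. mu p))" using Y0(1) finite_mu[OF p_gt0] by (intro finite_PiE) auto
  have "card (invs S) \<le> card (PiE Y0 (\<lambda>_. mu p))" by (rule card_inj_on_le[OF inj im fin])
  also have "\<dots> = card (mu p) ^ card Y0" using Y0(1) by (simp add: card_PiE)
  also have "\<dots> \<le> p ^ card Y0" using card_mu_le[OF p_gt0] by (rule power_mono) simp
  finally show ?thesis using finite_imageD[OF finite_subset[OF im fin] inj] by blast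
qed

text \<open>Not the projection of \<open>U\<close>: all group components other than j must vanish,
  while the module component is free. Such elements can be combined independently over the
  coordinates, as in \<open>coord_proj_sum\<close>.\<close>

definition coord_proj :: "semi set \<Rightarrow> nat \<Rightarrow> nperm set" where
  "coord_proj U j = {g \<in> G 0. \<exists>u\<in>U. \<forall>i. gp u i = (if i = j then g else 0)}"

lemma subgrp_coord_proj: assumes "subgrp U" shows "subgrp (coord_proj U j)"
  unfolding subgrp_def
proof (intro conjI ballI)
  show "0 \<in> coord_proj U j" using subgrp_0[OF assms] G_zero by (force simp: coord_proj_def)
next
  fix x y assume "x \<in> coord_proj U j" "y \<in> coord_proj U j"
  then obtain u v where "x \<in> G 0" "y \<in> G 0" "u \<in> U" "v \<in> U" "\<forall>i. gp u i = (if i = j then x else 0)"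
    "\<forall>i. gp v i = (if i = j then y else 0)" by (auto simp: coord_proj_def)
  then show "x + y \<in> coord_proj U j" using subgrp_add[OF assms, of u v] G_add
    by (auto simp: coord_proj_def intro!: bexI[of _ "u + v"])
next
  fix x assume "x \<in> coord_proj U j"
  then obtain u where "x \<in> G 0" "u \<in> U" "\<forall>i. gp u i = (if i = j then x else 0)" by (auto simp: coord_proj_def)
  then show "- x \<in> coord_proj U j" using subgrp_minus[OF assms, of u] G_minus
    by (auto simp: coord_proj_def intro!: bexI[of _ "- u"])
qed

lemma cov_coord_proj:
  assumes U: "subgrp U" "U \<subseteq> H" and cov: "cov n H U" and j: "j < k"
  shows "cov n (G 0) (coord_proj U j)"
proof (rule cov_mono[OF cov_vimage[OF cov U(1), of "G 0" "inj_g j"]])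
  show "inj_g j (- x + y) = - inj_g j x + inj_g j y" for x y by (simp add: inj_g_add inj_g_minus)
  show "- x + y \<in> G 0" if "x \<in> G 0" "y \<in> G 0" for x y using that by (intro G_add G_minus)
  show "inj_g j ` G 0 \<subseteq> H" using inj_g_H[OF _ j] by blast
  show "{x \<in> G 0. inj_g j x \<in> U} \<subseteq> coord_proj U j"
    by (auto simp: coord_proj_def intro!: bexI[of _ "inj_g j _"])
qed auto

lemma coord_proj_sum:
  assumes U: "subgrp U" and g: "\<And>j. j < k \<Longrightarrow> g j \<in> coord_proj U j"
  shows "\<exists>u\<in>U. \<forall>i. gp u i = (if i < k then g i else 0)"
proof -
  have "\<exists>u\<in>U. \<forall>i. gp u i = (if i < m then g i else 0)" if "m \<le> k" for m
    using that
  proof (induction m)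
    case 0 then show ?case using subgrp_0[OF U] by force
  next
    case (Suc m)
    then obtain u where u: "u \<in> U" "\<forall>i. gp u i = (if i < m then g i else 0)" by auto
    obtain v where v: "v \<in> U" "\<forall>i. gp v i = (if i = m then g m else 0)"
      using g[of m] Suc.prems by (auto simp: coord_proj_def)
    have "\<forall>i. gp (u + v) i = (if i < Suc m then g i else 0)" using u v by auto
    then show ?case using subgrp_add[OF U u(1) v(1)] by blast
  qed
  then show ?thesis by blast
qed

definition comm_index :: "nat \<Rightarrow> nat" where "comm_index d = q ^ 3 * branch_index ^ (1 + q * ((2 * q + 4) * d + 2))"

lemma cov_comm_coord_proj:
  assumes U: "subgrp U" "U \<subseteq> H" and cov: "cov n H U" "n < 2 ^ Suc d" and j: "j < k"
  shows "cov (comm_index d) (G 0) (comm_gp (coord_proj U j))"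
proof -
  interpret s: spinal_sub p "coord_proj U j" n d
    by unfold_locales (use subgrp_coord_proj[OF U(1)] cov_coord_proj[OF U cov(1) j] cov(2) in \<open>auto simp: coord_proj_def\<close>)
  show ?thesis using s.cov_comm by (simp add: comm_index_def s.Cb_def)
qed

text \<open>If every component of r lies in the derived subgroup of the corresponding
  \<open>coord_proj U j\<close>, then r differs from an element of \<open>comm_gp U\<close> by one
  of the module. Functions in \<open>hom0 U\<close> vanish on both, and these r have index at most
  \<open>comm_index d ^ k\<close> in \<open>U\<close>, so \<open>hom_count\<close> applies.\<close>

lemma hom0_bound:
  assumes U: "subgrp U" "U \<subseteq> H" and cov: "cov n H U" "n < 2 ^ Suc d" and e: "comm_index d ^ k < 2 ^ Suc e"
  shows "finite (hom0 U) \<and> card (hom0 U) \<le> p ^ e"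
proof -
  let ?R = "\<lambda>m. {u \<in> U. \<forall>j<m. gp u j \<in> comm_gp (coord_proj U j)}"
  have subR: "subgrp (?R m)" for m
    using U(1) subgrp_comm_gp unfolding subgrp_def by auto
  have covR: "cov (comm_index d ^ m) U (?R m)" if "m \<le> k" for m
    using that
  proof (induction m)
    case 0
    show ?case using cov_one[OF U(1) order_refl] by simp
  next
    case (Suc m)
    have "cov (comm_index d) U {u \<in> U. gp u m \<in> comm_gp (coord_proj U m)}"
    proof (rule cov_vimage[OF cov_comm_coord_proj[OF U cov] subgrp_comm_gp, of m])
      show "(\<lambda>u. gp u m) ` U \<subseteq> G 0" using H_gp U(2) by blast
      show "- x + y \<in> U" if "x \<in> U" "y \<in> U" for x y
        using that by (intro subgrp_add[OF U(1)] subgrp_minus[OF U(1)])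
    qed (use Suc.prems in auto)
    moreover have "subgrp {u \<in> U. gp u m \<in> comm_gp (coord_proj U m)}"
      using U(1) subgrp_comm_gp[of "coord_proj U m"] unfolding subgrp_def by auto
    ultimately have "cov (comm_index d * comm_index d ^ m) U ({u \<in> U. gp u m \<in> comm_gp (coord_proj U m)} \<inter> ?R m)"
      using Suc by (intro cov_Int subR) auto
    moreover have "{u \<in> U. gp u m \<in> comm_gp (coord_proj U m)} \<inter> ?R m = ?R (Suc m)" by (auto simp: less_Suc_eq)
    ultimately show ?case by simp
  qed
  have comm: "\<exists>u\<in>comm_gp U. \<forall>i. gp u i = (if i = j then g else 0)" if "g \<in> comm_gp (coord_proj U j)" for j g
  proof -
    let ?T = "{g. \<exists>u\<in>comm_gp U. \<forall>i. gp u i = (if i = j then g else 0)}"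
    have "comm_gp (coord_proj U j) \<subseteq> ?T"
    proof (rule comm_gp_least)
      show "subgrp ?T" unfolding subgrp_def
      proof (intro conjI ballI)
        show "0 \<in> ?T" using subgrp_0[OF subgrp_comm_gp] by force
      next
        fix x y assume "x \<in> ?T" "y \<in> ?T"
        then obtain u v where "u \<in> comm_gp U" "v \<in> comm_gp U" "\<forall>i. gp u i = (if i = j then x else 0)"
          "\<forall>i. gp v i = (if i = j then y else 0)" by blast
        then show "x + y \<in> ?T" using subgrp_add[OF subgrp_comm_gp, of u U v]
          by (auto intro!: bexI[of _ "u + v"])
      next
        fix x assume "x \<in> ?T"
        then obtain u where "u \<in> comm_gp U" "\<forall>i. gp u i = (if i = j then x else 0)" by blast
        then show "- x \<in> ?T" using subgrp_minus[OF subgrp_comm_gp, of u U]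
          by (auto intro!: bexI[of _ "- u"])
      qed
      fix x y assume "x \<in> coord_proj U j" "y \<in> coord_proj U j"
      then obtain u v where "u \<in> U" "v \<in> U" "\<forall>i. gp u i = (if i = j then x else 0)"
        "\<forall>i. gp v i = (if i = j then y else 0)" by (auto simp: coord_proj_def)
      then show "x + y - x - y \<in> ?T" using comm_gp_I[of u U v]
        by (auto intro!: bexI[of _ "u + v - u - v"])
    qed
    then show ?thesis using that by blast
  qed
  have van: "f r = 0" if f: "f \<in> hom0 U" and r: "r \<in> ?R k" for f r
  proof -
    have fh: "f \<in> homs p U" using f by (simp add: hom0_def)
    have "\<exists>u\<in>comm_gp U. \<forall>i. gp u i = (if i < m then gp r i else 0)" if "m \<le> k" for m
      using that
    proof (induction m)
      case 0 then show ?case using subgrp_0[OF subgrp_comm_gp] by force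
    next
      case (Suc m)
      then obtain u where u: "u \<in> comm_gp U" "\<forall>i. gp u i = (if i < m then gp r i else 0)" by auto
      obtain v where v: "v \<in> comm_gp U" "\<forall>i. gp v i = (if i = m then gp r m else 0)"
        using comm[of "gp r m" m] r Suc.prems by auto
      have "\<forall>i. gp (u + v) i = (if i < Suc m then gp r i else 0)" using u v by auto
      then show ?case using subgrp_add[OF subgrp_comm_gp u(1) v(1)] by blast
    qed
    then obtain u where u: "u \<in> comm_gp U" "\<forall>i. gp u i = (if i < k then gp r i else 0)" by blast
    have uU: "u \<in> U" using u(1) comm_gp_sub[OF U(1)] by blast
    have rU: "r \<in> U" using r by blast
    have "gp (r - u) i = 0" for i using u(2) rU U(2) by (auto simp: H_def)
    moreover have "r - u \<in> U" by (rule subgrp_diff[OF U(1) rU uU])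
    ultimately have "r - u \<in> U \<inter> MM" using U(2) by (auto simp: MM_iff)
    then have "f (r - u) = 0" using f by (simp add: hom0_def)
    moreover have "f u = 0" by (rule homs_comm[OF fh U(1) u(1)])
    ultimately show ?thesis using homs_diff[OF fh U(1) rU uU] by simp
  qed
  show ?thesis
  proof (rule hom_count[OF p_gt0 subR[of k] _ U(1) order_refl covR[OF order_refl] e])
    show "hom0 U \<subseteq> homs p U" by (auto simp: hom0_def)
    show "f r = 0" if "f \<in> hom0 U" "r \<in> ?R k" for f r by (rule van[OF that])
  qed auto
qed

text \<open>All tuples with entries in the union of the coordinatewise representatives suffice,
  since \<open>U\<close> moves the coordinates independently.\<close>

lemma orbit_reps:
  assumes U: "subgrp U" "U \<subseteq> H" and cov: "cov n H U" "n < 2 ^ Suc d"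
  shows "\<exists>Y0. finite Y0 \<and> Y0 \<subseteq> Y \<and> card Y0 \<le> (if k = 1 then 0 else (k * (1 + q * (1 + q * d))) ^ k) \<and>
    (\<forall>y\<in>Y. \<exists>u\<in>U. act (gp u) y \<in> Y0)"
proof (cases "k = 1")
  case True
  then have "Y = {}" unfolding Y_def by (rule if_P)
  then show ?thesis by (intro exI[of _ "{}"]) auto
next
  case False
  have "\<exists>Ob. finite Ob \<and> card Ob \<le> 1 + q * (1 + q * d) \<and> (\<forall>m. \<exists>u\<in>coord_proj U j. ap u m \<in> Ob)" if j: "j < k" for j
  proof -
    interpret s: spinal_sub p "coord_proj U j" n d
      by unfold_locales (use subgrp_coord_proj[OF U(1)] cov_coord_proj[OF U cov(1) j] cov(2) in \<open>auto simp: coord_proj_def\<close>)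
    show ?thesis by (rule s.orbits)
  qed
  then obtain Ob where Ob: "\<And>j. j < k \<Longrightarrow> finite (Ob j) \<and> card (Ob j) \<le> 1 + q * (1 + q * d) \<and> (\<forall>m. \<exists>u\<in>coord_proj U j. ap u m \<in> Ob j)"
    by metis
  define A where "A = (\<Union>j<k. Ob j)"
  have finA: "finite A" unfolding A_def using Ob by blast
  have "card A \<le> (\<Sum>j<k. card (Ob j))" unfolding A_def by (rule card_UN_le) simp
  also have "\<dots> \<le> (\<Sum>j<k. 1 + q * (1 + q * d))" using Ob by (intro sum_mono) auto
  finally have cA: "card A \<le> k * (1 + q * (1 + q * d))" by simp
  define Y0 where "Y0 = {ys. set ys \<subseteq> A \<and> length ys = k}"
  have "finite Y0" unfolding Y0_def using finA by (rule finite_lists_length_eq)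
  moreover have "card Y0 \<le> (k * (1 + q * (1 + q * d))) ^ k"
    unfolding Y0_def card_lists_length_eq[OF finA] by (rule power_mono[OF cA]) simp
  moreover have "Y0 \<subseteq> Y" using False by (auto simp: Y0_def Y_def)
  moreover have "\<exists>u\<in>U. act (gp u) y \<in> Y0" if y: "y \<in> Y" for y
  proof -
    have len: "length y = k" using y False by (simp add: Y_def)
    have "\<forall>j<k. \<exists>g\<in>coord_proj U j. ap g (y ! j) \<in> Ob j" using Ob by blast
    then obtain g where g: "\<And>j. j < k \<Longrightarrow> g j \<in> coord_proj U j \<and> ap (g j) (y ! j) \<in> Ob j" by metis
    obtain u where u: "u \<in> U" "\<forall>i. gp u i = (if i < k then g i else 0)"
      using coord_proj_sum[OF U(1), of g] g by blast
    have "set (act (gp u) y) \<subseteq> A"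
      using u(2) g len by (auto simp: act_def A_def)
    then have "act (gp u) y \<in> Y0" using len by (simp add: Y0_def)
    then show ?thesis using u(1) by blast
  qed
  ultimately show ?thesis using False by auto
qed

text \<open>Chosen so that \<open>comm_index d\<close> is at most
  \<open>2 ^ (comm_rate * (d + 1))\<close>, replacing each base x by \<open>2 ^ x\<close>.\<close>

definition comm_rate :: nat where "comm_rate = q ^ 3 + branch_index * (1 + q * (2 * q + 4) + 2 * q)"
text \<open>The first summand comes from \<open>hom0_bound\<close> with \<open>d = p * i\<close>,
  the second from the orbit representatives.\<close>

definition hom_rate :: nat where "hom_rate = k * comm_rate * p + (k * (1 + q + q * q * p)) ^ k"

lemma comm_index_bound: "comm_index d \<le> 2 ^ (comm_rate * (d + 1))"
proof -
  have le: "x \<le> 2 ^ x" for x :: nat by (rule less_imp_le[OF less_exp])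
  have "comm_index d \<le> 2 ^ (q ^ 3) * (2 ^ branch_index) ^ (1 + q * ((2 * q + 4) * d + 2))"
    unfolding comm_index_def by (intro mult_le_mono le power_mono) auto
  also have "\<dots> = 2 ^ (q ^ 3 + branch_index * (1 + q * ((2 * q + 4) * d + 2)))"
    by (simp only: power_mult[symmetric] power_add[symmetric])
  also have "\<dots> \<le> 2 ^ (comm_rate * (d + 1))"
    by (rule power_increasing) (simp_all add: comm_rate_def algebra_simps)
  finally show ?thesis .
qed

theorem homs_upper:
  assumes U: "U \<in> chain_ends p H i"
  shows "finite (homs p U) \<and> card (homs p U) \<le> p ^ (hom_rate * (i + 1) ^ k)"
proof -
  have Up: "subgrp U" "U \<subseteq> H" "cov (p ^ i) H U" using chain_ends_props[OF subgrp_H U] by auto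
  define S where "S = {u + m | u m. u \<in> U \<and> m \<in> MM}"
  have S: "subgrp S" unfolding subgrp_def
  proof (intro conjI ballI)
    have "0 + 0 \<in> S" unfolding S_def using subgrp_0[OF Up(1)] subgrp_0[OF M] by blast
    then show "0 \<in> S" by simp
  next
    fix x y assume "x \<in> S" "y \<in> S"
    then obtain u m v m' where xy: "x = u + m" "y = v + m'" "u \<in> U" "m \<in> MM" "v \<in> U" "m' \<in> MM"
      by (auto simp: S_def)
    have "x + y = (u + v) + ((- v + m - (- v)) + m')"
      by (simp add: xy grp_simps del: add_uminus_conv_diff)
    moreover have "- v + m - (- v) \<in> MM" using xy Up(2) by (intro nrm subgrp_minus[OF subgrp_H]) auto
    ultimately show "x + y \<in> S" unfolding S_def
      using subgrp_add[OF Up(1) xy(3,5)] subgrp_add[OF M _ xy(6)] by blast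
  next
    fix x assume "x \<in> S"
    then obtain u m where x: "x = u + m" "u \<in> U" "m \<in> MM" by (auto simp: S_def)
    have "- x = - u + (u + - m - u)" by (simp add: x grp_simps del: add_uminus_conv_diff)
    moreover have "u + - m - u \<in> MM" using x Up(2) by (intro nrm subgrp_minus[OF M]) auto
    ultimately show "- x \<in> S" unfolding S_def using subgrp_minus[OF Up(1) x(2)] by blast
  qed
  have SH: "S \<subseteq> H" unfolding S_def using Up(2) MT subgrp_add[OF subgrp_H] by blast
  have US: "U \<subseteq> S"
  proof
    fix u assume "u \<in> U"
    then have "u + 0 \<in> S" unfolding S_def using subgrp_0[OF M] by blast
    then show "u \<in> S" by simp
  qed
  have MS: "MM \<subseteq> S"
  proof
    fix m assume "m \<in> MM"
    then have "0 + m \<in> S" unfolding S_def using subgrp_0[OF Up(1)] by blast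
    then show "m \<in> S" by simp
  qed
  have SU: "\<exists>u\<in>U. - u + y \<in> MM" if y: "y \<in> S" for y
  proof -
    obtain u m where "y = u + m" "u \<in> U" "m \<in> MM" using y by (auto simp: S_def)
    then have "- u + y = m" by simp
    then show ?thesis using \<open>u \<in> U\<close> \<open>m \<in> MM\<close> by blast
  qed
  have covS: "cov (p ^ i) S U" by (rule cov_mono[OF Up(3) order_refl SH order_refl])
  note rc = rc_cov[OF S Up(1) covS]
  \<comment> \<open>Since p is at most \<open>2 ^ p\<close>, this bounds the binary logarithm of the
    index \<open>p ^ i\<close>.\<close>
  define d where "d = p * i"
  have "p ^ i \<le> (2 ^ p) ^ i" by (intro power_mono less_imp_le[OF less_exp]) simp
  then have "p ^ i \<le> 2 ^ d" by (simp add: d_def power_mult)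
  also have "\<dots> < (2::nat) ^ Suc d" by simp
  finally have pd: "p ^ i < 2 ^ Suc d" .
  define e where "e = k * (comm_rate * (d + 1))"
  have "comm_index d ^ k \<le> (2 ^ (comm_rate * (d + 1))) ^ k" by (intro power_mono comm_index_bound) simp
  also have "\<dots> = 2 ^ e" by (simp only: e_def power_mult[symmetric] mult.commute[of k])
  also have "\<dots> < (2::nat) ^ Suc e" by simp
  finally have ce: "comm_index d ^ k < 2 ^ Suc e" .
  have B: "finite (hom0 V) \<and> card (hom0 V) \<le> p ^ e" if V: "subgrp V" "U \<subseteq> V" "V \<subseteq> S" for V
    using hom0_bound[OF V(1) _ cov_mono[OF Up(3) order_refl order_refl V(2)] pd ce] V(3) SH by blast
  obtain Y0 where Y0: "finite Y0" "Y0 \<subseteq> Y" "card Y0 \<le> (if k = 1 then 0 else (k * (1 + q * (1 + q * d))) ^ k)"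
    "\<And>y. y \<in> Y \<Longrightarrow> \<exists>u\<in>U. act (gp u) y \<in> Y0"
    using orbit_reps[OF Up pd] by blast
  have iv: "finite (invs S)" "card (invs S) \<le> p ^ card Y0"
    using invs_count[OF S SH MS Y0(1,2)] Y0(4) US by blast+
  obtain r where r: "p ^ r \<le> card (rc S U)" "finite (homs p U)" "card (homs p U) \<le> (p ^ e) ^ Suc r * p ^ card Y0"
    using homs_bound[OF S SH MS SU Up(1) US rc(1) B iv] by blast
  have "p ^ r \<le> p ^ i" using r(1) rc(2) by simp
  then have ri: "r \<le> i" using prime_gt_1_nat[OF prime_p] by simp
  have ed: "e \<le> k * comm_rate * p * (i + 1)"
  proof -
    have "d + 1 \<le> p * (i + 1)" using p_gt0 by (simp add: d_def Suc_leI)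
    then have "k * (comm_rate * (d + 1)) \<le> k * (comm_rate * (p * (i + 1)))" by (intro mult_le_mono2)
    then show ?thesis unfolding e_def by (simp only: mult.assoc)
  qed
  \<comment> \<open>With r at most i and e linear in i, the first term is quadratic in i. This fits
    under \<open>(i + 1) ^ k\<close> for k at least 2. For k = 1 the module is trivial, hence S = U,
    r = 0 and the term is linear.\<close>
  have "e * Suc r + card Y0 \<le> hom_rate * (i + 1) ^ k"
  proof (cases "k = 1")
    case True
    have "MM = {0}"
    proof -
      have "Y = {}" unfolding Y_def using True by (rule if_P)
      then have "m = (\<lambda>_. 0)" if "m \<in> Mm" for m using that by (auto simp: Mm_def)
      then have "Mm = {\<lambda>_. 0}" using Mm_0 by blast
      then show ?thesis by (simp add: MM_def inj_m_0)
    qed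
    then have "S = U" by (auto simp: S_def)
    then have "rc S U = {U}"
    proof -
      have "(\<lambda>k. k + x) ` U = U" if "x \<in> U" for x
        using coset_eq_iff[OF Up(1), of x 0] that by simp
      then show ?thesis using \<open>S = U\<close> subgrp_0[OF Up(1)] by (auto simp: rc_def)
    qed
    then have "p ^ r \<le> 1" using r(1) by simp
    then have "r = 0" using prime_gt_1_nat[OF prime_p] one_less_power[of p r] by (cases "r = 0") auto
    moreover have "card Y0 = 0" using Y0(3) True by simp
    ultimately have "e * Suc r + card Y0 = e" by simp
    also have "\<dots> \<le> k * comm_rate * p * (i + 1)" by (rule ed)
    also have "\<dots> \<le> hom_rate * (i + 1) ^ k"
      using k_pos self_le_power[of "i + 1" k] by (intro mult_le_mono) (simp_all add: hom_rate_def)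
    finally show ?thesis .
  next
    case False
    then have k2: "2 \<le> k" using k_pos by simp
    have "e * Suc r \<le> (k * comm_rate * p * (i + 1)) * (i + 1)" using ed ri by (intro mult_le_mono) auto
    also have "\<dots> = k * comm_rate * p * (i + 1) ^ 2" by (simp only: power2_eq_square mult.assoc)
    also have "\<dots> \<le> k * comm_rate * p * (i + 1) ^ k" using k2 by (intro mult_le_mono2 power_increasing) auto
    finally have 1: "e * Suc r \<le> k * comm_rate * p * (i + 1) ^ k" .
    have "1 + q * (1 + q * d) \<le> (1 + q + q * q * p) * (i + 1)"
      by (simp add: d_def algebra_simps)
    then have "k * (1 + q * (1 + q * d)) \<le> k * (1 + q + q * q * p) * (i + 1)"
      unfolding mult.assoc by (intro mult_le_mono2) simp
    then have "(k * (1 + q * (1 + q * d))) ^ k \<le> (k * (1 + q + q * q * p) * (i + 1)) ^ k" by (rule power_mono) simp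
    moreover have "card Y0 \<le> (k * (1 + q * (1 + q * d))) ^ k" using Y0(3) by (simp only: False if_False)
    ultimately have "card Y0 \<le> (k * (1 + q + q * q * p) * (i + 1)) ^ k" by (rule order_trans[rotated])
    then have "card Y0 \<le> (k * (1 + q + q * q * p)) ^ k * (i + 1) ^ k"
      by (simp only: power_mult_distrib[of "k * (1 + q + q * q * p)"])
    with 1 show ?thesis unfolding hom_rate_def by (simp only: add_mult_distrib)
  qed
  then have "p ^ (e * Suc r + card Y0) \<le> p ^ (hom_rate * (i + 1) ^ k)" by (intro power_increasing) (auto simp: Suc_leI)
  then have "card (homs p U) \<le> p ^ (hom_rate * (i + 1) ^ k)"
    using r(3) unfolding power_mult[symmetric] power_add[symmetric] by (rule order_trans[rotated])
  then show ?thesis using r(2) by blast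
qed

end

section \<open>Many subgroups of small index\<close>

lemma cov_classes:
  assumes fin: "finite B" "card B \<le> n" and f: "f ` L \<subseteq> B"
    and eq: "\<And>x y. x \<in> L \<Longrightarrow> y \<in> L \<Longrightarrow> f x = f y \<Longrightarrow> - x + y \<in> W"
  shows "cov n L W"
proof -
  define c where "c b = (SOME x. x \<in> L \<and> f x = b)" for b
  have c: "c (f x) \<in> L \<and> f (c (f x)) = f x" if "x \<in> L" for x
    unfolding c_def by (rule someI[of _ x]) (use that in simp)
  show ?thesis unfolding cov_def
  proof (intro exI[of _ "c ` B"] conjI ballI)
    show "card (c ` B) \<le> n" using card_image_le[OF fin(1), of c] fin(2) by simp
    fix x assume x: "x \<in> L"
    then have "- c (f x) + x \<in> W" using c[OF x] eq by blast
    then show "\<exists>e\<in>c ` B. - e + x \<in> W" using f x by blast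
  qed (use fin in auto)
qed

text \<open>
  The subgroups are the kernels of \<open>(\<Phi>\<^sub>i + \<Sum>\<^sub>j a\<^sub>i\<^sub>j \<Phi>\<^sub>j)\<^sub>i\<close> with \<open>i\<close> in a fixed set of size \<open>t\<close>, \<open>j\<close> outside it,
  and arbitrary \<open>a\<^sub>i\<^sub>j\<close> modulo \<open>p\<close>.
\<close>

lemma many_subgroups:
  fixes U L :: "'g::group_add set" and \<Phi> :: "'j \<Rightarrow> 'g \<Rightarrow> qz"
  assumes p: "p > 0" and L: "U \<subseteq> L" and U: "subgrp U" "cov n L U" and J: "finite J" "t \<le> card J"
    and hom: "\<And>j. j \<in> J \<Longrightarrow> \<Phi> j \<in> homs p U"
    and surj: "\<And>c :: 'j \<Rightarrow> nat. \<exists>u\<in>U. \<forall>j\<in>J. \<Phi> j u = ec p (int (c j))"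
    and S: "finite S" "\<And>W. subgrp W \<Longrightarrow> W \<subseteq> L \<Longrightarrow> cov (n * p ^ t) L W \<Longrightarrow> W \<in> S"
  shows "p ^ (t * (card J - t)) \<le> card S"
proof -
  obtain J1 where J1: "J1 \<subseteq> J" "card J1 = t" "finite J1"
    using obtain_subset_with_card_n[OF J(2)] J(1) finite_subset by metis
  define J2 where "J2 = J - J1"
  have J2: "finite J2" "card J2 = card J - t" "J2 \<subseteq> J"
    using J J1 by (auto simp: J2_def card_Diff_subset)
  define f where "f A i u = \<Phi> i u + (\<Sum>j\<in>J2. nm (A (i, j)) (\<Phi> j u))" for A :: "'j \<times> 'j \<Rightarrow> nat" and i u
  have fadd: "f A i (u + v) = f A i u + f A i v" if "i \<in> J1" "u \<in> U" "v \<in> U" for A i u v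
  proof -
    have nma: "nm a (x + y) = nm a x + nm a (y :: qz)" for a x y by (induction a) (simp_all add: algebra_simps)
    have "(\<Sum>j\<in>J2. nm (A (i, j)) (\<Phi> j (u + v))) = (\<Sum>j\<in>J2. nm (A (i, j)) (\<Phi> j u) + nm (A (i, j)) (\<Phi> j v))"
      using that J2(3) by (intro sum.cong refl) (simp add: homsD(3)[OF hom] subset_iff nma)
    then show ?thesis using that J1(1) homsD(3)[OF hom, of i u v] by (auto simp: f_def sum.distrib algebra_simps)
  qed
  have smu: "subgrp (mu p)" by (simp add: subgrp_def mu_closed)
  have fmu: "f A i u \<in> mu p" if "i \<in> J1" "u \<in> U" for A i u
  proof -
    have "(\<Sum>j\<in>J2'. nm (A (i, j)) (\<Phi> j u)) \<in> mu p" if "J2' \<subseteq> J2" for J2'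
      using finite_subset[OF that J2(1)] that
    proof (induction J2' rule: finite_induct)
      case (insert j F)
      have "nm (A (i, j)) (\<Phi> j u) \<in> mu p"
        using insert J2(3) \<open>u \<in> U\<close> by (intro nm_subgrp[OF smu] homsD(2)[OF hom]) auto
      then show ?case using insert by (simp add: mu_closed)
    qed (simp add: mu_closed)
    then show ?thesis using that J1(1) homsD(2)[OF hom, of i u] by (auto simp: f_def mu_closed)
  qed
  have f0: "f A i 0 = 0" if "i \<in> J1" for A i
    using fadd[OF that subgrp_0[OF U(1)] subgrp_0[OF U(1)]] by simp
  have fmin: "f A i (- u) = - f A i u" if "i \<in> J1" "u \<in> U" for A i u
    using fadd[OF that(1) subgrp_minus[OF U(1) that(2)] that(2), of A] f0[OF that(1)]
    by (simp add: eq_neg_iff_add_eq_0)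
  define W where "W A I = {u \<in> U. \<forall>i\<in>I. f A i u = 0}" for A I
  have Wsub: "subgrp (W A I)" if "I \<subseteq> J1" for A I
    unfolding subgrp_def W_def using U(1) that subgrp_0 subgrp_add subgrp_minus
    by (auto simp: f0 fadd fmin subset_iff)
  have covmu: "cov p (mu p) {0}"
    unfolding cov_def using finite_mu[OF p] card_mu_le[OF p] by (intro exI[of _ "mu p"]) auto
  have cov1: "cov p U {u \<in> U. f A i u \<in> {0}}" if "i \<in> J1" for A i
  proof (rule cov_vimage[OF covmu subgrp_zero])
    show "f A i (- x + y) = - f A i x + f A i y" if "x \<in> U" "y \<in> U" for x y
      using fadd[OF \<open>i \<in> J1\<close> subgrp_minus[OF U(1) \<open>x \<in> U\<close>] \<open>y \<in> U\<close>] fmin[OF \<open>i \<in> J1\<close> \<open>x \<in> U\<close>] by simp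
  qed (use that U(1) fmu in \<open>auto intro: subgrp_add subgrp_minus\<close>)
  have covW: "cov (p ^ card I) U (W A I)" if "finite I" "I \<subseteq> J1" for A I
    using that
  proof (induction I rule: finite_induct)
    case empty
    show ?case using cov_one[OF U(1) order_refl] by (simp add: W_def)
  next
    case (insert i I)
    have sg: "subgrp {u \<in> U. f A i u \<in> {0}}" using Wsub[of "{i}" A] insert.prems by (simp add: W_def)
    have "cov (p * p ^ card I) U ({u \<in> U. f A i u \<in> {0}} \<inter> W A I)"
      using insert by (intro cov_Int cov1 Wsub sg) auto
    moreover have "{u \<in> U. f A i u \<in> {0}} \<inter> W A I = W A (insert i I)" by (auto simp: W_def)
    ultimately show ?case using insert by simp
  qed
  let ?P = "PiE (J1 \<times> J2) (\<lambda>_. {..<p})"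
  have inS: "(\<lambda>A. W A J1) ` ?P \<subseteq> S"
  proof clarify
    fix A
    have "cov (n * p ^ t) L (W A J1)"
      using cov_trans[OF U(2) covW[OF J1(3) order_refl]] J1(2) by simp
    then show "W A J1 \<in> S" using L by (intro S(2) Wsub) (auto simp: W_def)
  qed
  have inj: "inj_on (\<lambda>A. W A J1) ?P"
  proof (rule inj_onI)
    fix A B assume A: "A \<in> ?P" and B: "B \<in> ?P" and eq: "W A J1 = W B J1"
    have "A (i, j) = B (i, j)" if ij: "i \<in> J1" "j \<in> J2" for i j
    proof -
      \<comment> \<open>A test element: with these values \<open>f C a u\<close> is
        \<open>C (a, j) - A (a, j)\<close> mod p. So u lies in the kernel for \<open>A\<close>, and
        if it also lies in that for \<open>B\<close>, the two agree at (i, j).\<close>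
      define c where "c a = (if a \<in> J1 then p - A (a, j) else if a = j then 1 else 0)" for a
      obtain u where u: "u \<in> U" "\<forall>a\<in>J. \<Phi> a u = ec p (int (c a))" using surj by blast
      have nme: "nm a (ec p b) = ec p (int a * b)" for a b
        by (induction a) (simp_all add: algebra_simps ec_add)
      have val: "f C a u = ec p (int (C (a, j)) - int (A (a, j)))" if "a \<in> J1" "C \<in> ?P" for C a
      proof -
        have jn: "j \<notin> J1" using ij by (simp add: J2_def)
        have "(\<Sum>b\<in>J2. nm (C (a, b)) (\<Phi> b u)) = (\<Sum>b\<in>J2. if b = j then ec p (int (C (a, j))) else 0)"
        proof (rule sum.cong[OF refl])
          fix b assume b: "b \<in> J2"
          then have "\<Phi> b u = ec p (int (c b))" "b \<notin> J1" using u J2(3) by (auto simp: J2_def)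
          then show "nm (C (a, b)) (\<Phi> b u) = (if b = j then ec p (int (C (a, j))) else 0)"
            by (simp add: c_def nme)
        qed
        also have "\<dots> = ec p (int (C (a, j)))" using ij J2(1) by simp
        finally have "f C a u = ec p (int (c a)) + ec p (int (C (a, j)))"
          using u that J1(1) by (auto simp: f_def)
        also have "\<dots> = ec p (int (p - A (a, j)) + int (C (a, j)))" using that by (simp add: c_def ec_add)
        also have "\<dots> = ec p (int (C (a, j)) - int (A (a, j)))"
        proof -
          have "A (a, j) < p" using PiE_mem[OF A, of "(a, j)"] that ij by auto
          then have "int (p - A (a, j)) + int (C (a, j)) - (int (C (a, j)) - int (A (a, j))) = int p"
            by (simp add: of_nat_diff)
          then show ?thesis using p by (simp add: ec_eq)
        qed
        finally show ?thesis .
      qed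
      have "u \<in> W A J1" using u val[OF _ A] by (simp add: W_def)
      then have "u \<in> W B J1" using eq by simp
      then have "ec p (int (B (i, j)) - int (A (i, j))) = 0" using val[OF ij(1) B] ij by (simp add: W_def)
      then have "int (B (i, j)) mod int p = int (A (i, j)) mod int p" using p by (simp add: ec_eq_0 mod_eq_dvd_iff)
      moreover have "A (i, j) < p" "B (i, j) < p"
        using PiE_mem[OF A, of "(i, j)"] PiE_mem[OF B, of "(i, j)"] ij by auto
      ultimately show ?thesis by simp
    qed
    then show "A = B" using A B by (intro PiE_ext[OF A B]) auto
  qed
  have "card ?P = p ^ (t * (card J - t))"
    using J1 J2 by (simp add: card_PiE card_cartesian_product)
  then show ?thesis using card_inj_on_le[OF inj inS S(1)] by simp
qed

context spinal
begin

section \<open>Level stabilizers and their rotations\<close>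

definition level_stab :: "nat \<Rightarrow> nperm set" where
  "level_stab n = {g \<in> G 0. \<forall>m. ap g m mod q ^ n = m mod q ^ n}"

lemma subgrp_level_stab: "subgrp (level_stab n)"
  unfolding subgrp_def level_stab_def
proof (intro conjI ballI CollectI allI)
  fix x m assume "x \<in> {g \<in> G 0. \<forall>m. ap g m mod q ^ n = m mod q ^ n}"
  then have "ap x (ap (- x) m) mod q ^ n = ap (- x) m mod q ^ n" by blast
  then show "ap (- x) m mod q ^ n = m mod q ^ n" by simp
qed (auto simp: G_zero G_add G_minus)

lemma level_stab_0: "level_stab 0 = G 0" by (simp add: level_stab_def)

lemma G_level: assumes "g \<in> G 0" shows "ap g a mod q ^ l = ap g b mod q ^ l \<longleftrightarrow> a mod q ^ l = b mod q ^ l"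
proof -
  have key: "ap g a mod q ^ l = ap g b mod q ^ l" if g: "g \<in> G 0" and ab: "a mod q ^ l = b mod q ^ l" for g a b
  proof -
    have r: "a mod q ^ l < q ^ l" by simp
    obtain h r' where h: "r' < q ^ l" "\<And>m. ap g (a mod q ^ l + q ^ l * m) = r' + q ^ l * ap h m"
      using level_section[OF g r] by blast
    have "ap g a mod q ^ l = r'" using h(2)[of "a div q ^ l"] h(1) by simp
    moreover have "ap g b mod q ^ l = r'" using h(2)[of "b div q ^ l"] h(1) ab by simp
    ultimately show ?thesis by simp
  qed
  show ?thesis
  proof
    assume "ap g a mod q ^ l = ap g b mod q ^ l"
    from key[OF G_minus[OF assms] this] show "a mod q ^ l = b mod q ^ l" by simp
  qed (rule key[OF assms])
qed

lemma level_stab_rotation: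
  assumes g: "g \<in> level_stab l" and r: "r < q ^ l"
  shows "\<exists>c. \<forall>m. ap g (r + q ^ l * m) mod q ^ Suc l = r + q ^ l * shf c (m mod q)"
proof -
  have gG: "g \<in> G 0" using g by (simp add: level_stab_def)
  obtain h r' where h: "h \<in> G l" "r' < q ^ l" "\<And>m. ap g (r + q ^ l * m) = r' + q ^ l * ap h m"
    using level_section[OF gG r] by blast
  have "ap g r mod q ^ l = r mod q ^ l" using g by (simp add: level_stab_def)
  then have "ap g (r + q ^ l * 0) mod q ^ l = r" using r by simp
  then have rr: "r' = r" using h(3)[of 0] h(2) by simp
  obtain c hs where hs: "sections h c hs" using sections_G[OF h(1)] by metis
  have "ap g (r + q ^ l * m) mod q ^ Suc l = r + q ^ l * shf c (m mod q)" for m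
  proof -
    obtain v k where m: "m = v + q * k" "v < q" by (rule digits)
    have "ap g (r + q ^ l * m) = r + q ^ l * (shf c v + q * ap (hs v) k)"
      using h(3) hs m by (simp add: rr sections_def)
    also have "\<dots> = (r + q ^ l * shf c v) + q ^ Suc l * ap (hs v) k" by (simp add: algebra_simps)
    finally show ?thesis using child_lt[OF r shf_lt, of c v] m by (simp del: power_Suc)
  qed
  then show ?thesis by blast
qed

text \<open>For g in the stabilizer of level l, the rotation it performs on the children of r, read
  off at the child with digit 0.\<close>

definition rho :: "nat \<Rightarrow> nat \<Rightarrow> nperm \<Rightarrow> nat" where
  "rho l r g = ap g r div q ^ l mod q"

lemma rho_lt: "rho l r g < q" by (simp add: rho_def)

lemma rho_eq:
  assumes g: "g \<in> level_stab l" and r: "r < q ^ l"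
  shows "ap g (r + q ^ l * m) mod q ^ Suc l = r + q ^ l * shf (int (rho l r g)) (m mod q)"
proof -
  obtain c where c: "\<And>m. ap g (r + q ^ l * m) mod q ^ Suc l = r + q ^ l * shf c (m mod q)"
    using level_stab_rotation[OF g r] by blast
  have "ap g r mod q ^ Suc l = r + q ^ l * shf c 0" using c[of 0] by simp
  then have rho: "rho l r g = shf c 0" using child_mod[OF r shf_lt] unfolding rho_def by blast
  have "int q dvd int (rho l r g) - c" unfolding rho int_shf
    by (simp add: mod_eq_dvd_iff[symmetric])
  then show ?thesis using c[of m] shf_cong by metis
qed

text \<open>Elements with the same rotation at all \<open>q ^ l\<close> vertices of level l act in
  the same way on level l + 1.\<close>

lemma cov_level_stab_Suc: "cov (q ^ (q ^ l)) (level_stab l) (level_stab (Suc l))"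
proof (rule cov_classes)
  let ?B = "PiE {..<q ^ l} (\<lambda>_. {..<q})"
  show "finite ?B" by (intro finite_PiE) auto
  show "card ?B \<le> q ^ (q ^ l)" by (simp add: card_PiE)
  let ?f = "\<lambda>g. restrict (\<lambda>r. rho l r g) {..<q ^ l}"
  show "?f ` level_stab l \<subseteq> ?B" by (intro image_subsetI) (simp add: restrict_PiE_iff rho_lt)
  fix x y assume xy: "x \<in> level_stab l" "y \<in> level_stab l" and eq: "?f x = ?f y"
  have e: "rho l r x = rho l r y" if "r < q ^ l" for r using fun_cong[OF eq, of r] that by simp
  have xG: "x \<in> G 0" "y \<in> G 0" using xy by (auto simp: level_stab_def)
  have "ap (- x + y) m mod q ^ Suc l = m mod q ^ Suc l" for m
  proof -
    have m: "m = m mod q ^ l + q ^ l * (m div q ^ l)" by simp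
    have r: "m mod q ^ l < q ^ l" by simp
    have "ap y m mod q ^ Suc l = ap x m mod q ^ Suc l"
      using rho_eq[OF xy(1) r, of "m div q ^ l"] rho_eq[OF xy(2) r, of "m div q ^ l"] e[OF r] m by metis
    then have "ap x (ap (- x) (ap y m)) mod q ^ Suc l = ap x m mod q ^ Suc l" by (simp del: power_Suc)
    then show ?thesis unfolding ap_add G_level[OF xG(1)] .
  qed
  moreover have "- x + y \<in> G 0" using xG by (intro G_add G_minus)
  ultimately show "- x + y \<in> level_stab (Suc l)" by (simp add: level_stab_def)
qed

lemma cov_level_stab: "cov (q ^ (q ^ l)) (G 0) (level_stab l)"
proof -
  have "cov (q ^ (\<Sum>i<l. q ^ i)) (G 0) (level_stab l)"
  proof (induction l)
    case 0 then show ?case using cov_one[OF subgrp_G order_refl] by (simp add: level_stab_0)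
  next
    case (Suc l)
    from cov_trans[OF this cov_level_stab_Suc] show ?case by (simp add: power_add)
  qed
  moreover have "(\<Sum>i<l. q ^ i) \<le> q ^ l"
  proof (induction l)
    case (Suc l)
    have "q ^ l + q ^ l \<le> q * q ^ l" using q_ge8 by (simp flip: mult_2)
    then show ?case using Suc by simp
  qed simp
  then have "q ^ (\<Sum>i<l. q ^ i) \<le> q ^ (q ^ l)" using q_ge8 by (intro power_increasing) auto
  ultimately show ?thesis using cov_mono by blast
qed

lemma Kv_level_stab: "r < q ^ l \<Longrightarrow> Kv l r \<subseteq> level_stab (Suc l)"
  using Kv_G Kv_mod unfolding level_stab_def by blast

lemma rho_add:
  assumes g: "g \<in> level_stab l" "h \<in> level_stab l" and r: "r < q ^ l"
  shows "int q dvd int (rho l r (g + h)) - (int (rho l r g) + int (rho l r h))"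
proof -
  have h: "ap h r mod q ^ Suc l = r + q ^ l * shf (int (rho l r h)) 0" using rho_eq[OF g(2) r, of 0] by simp
  then have hr: "ap h r mod q ^ l = r \<and> ap h r div q ^ l mod q = shf (int (rho l r h)) 0"
    using child_mod[OF r shf_lt] by blast
  then have "ap h r = r + q ^ l * (ap h r div q ^ l)" by (intro level_eq) simp
  then have "ap (g + h) r mod q ^ Suc l = r + q ^ l * shf (int (rho l r g)) (shf (int (rho l r h)) 0)"
    using rho_eq[OF g(1) r, of "ap h r div q ^ l"] hr by simp
  then have "ap (g + h) r mod q ^ Suc l = r + q ^ l * shf (int (rho l r g) + int (rho l r h)) 0" by simp
  then have "rho l r (g + h) = shf (int (rho l r g) + int (rho l r h)) 0"
    using child_mod[OF r shf_lt] unfolding rho_def by blast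
  then have "int (rho l r (g + h)) = (int (rho l r g) + int (rho l r h)) mod int q" by (simp add: int_shf)
  then show ?thesis by (simp add: mod_eq_dvd_iff[symmetric])
qed

lemma ec_rho_add:
  assumes "g \<in> level_stab l" "h \<in> level_stab l" "r < q ^ l"
  shows "ec p (int (rho l r (g + h))) = ec p (int (rho l r g)) + ec p (int (rho l r h))"
proof -
  have "int p dvd int q" by (simp add: q_def)
  then have "int p dvd int (rho l r (g + h)) - (int (rho l r g) + int (rho l r h))"
    using rho_add[OF assms] dvd_trans by blast
  then show ?thesis using p_ge2 by (simp add: ec_add[symmetric] ec_eq)
qed

text \<open>Only the children with digit 0 are prescribed, one for each vertex of level l, because
  \<open>Kv_lift\<close> controls the action below a single child. This loses a factor
  \<open>q\<close> in the number of coordinates, which affects only the constants of the growth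
  type.\<close>

lemma rho_surj: "\<exists>g\<in>level_stab (Suc l). \<forall>r<q ^ l. ec p (int (rho (Suc l) r g)) = ec p (int (c r))"
proof -
  have rS: "r < q ^ Suc l" if "r < q ^ l" for r using child_lt[OF that, of 0] by simp
  have "\<exists>g\<in>level_stab (Suc l). (\<forall>r<q ^ l. ec p (int (rho (Suc l) r g)) = (if r < n then ec p (int (c r)) else 0))"
    if "n \<le> q ^ l" for n
    using that
  proof (induction n)
    case 0
    have "\<forall>r<q ^ l. rho (Suc l) r 0 = 0" using rS by (simp add: rho_def del: power_Suc)
    then show ?case using subgrp_0[OF subgrp_level_stab] by (intro bexI[of _ 0]) auto
  next
    case (Suc n)
    then obtain g where g: "g \<in> level_stab (Suc l)" "\<forall>r<q ^ l. ec p (int (rho (Suc l) r g)) = (if r < n then ec p (int (c r)) else 0)"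
      by auto
    have n: "n < q ^ l" using Suc.prems by simp
    obtain k where k: "k \<in> Kv l n" "\<forall>m. ap k ((n + q ^ l * 0) + q ^ Suc l * m) = (n + q ^ l * 0) + q ^ Suc l * ap (rot (int (c n))) m"
      using Kv_lift[OF rot_G n q_gt0] by blast
    have kL: "k \<in> level_stab (Suc l)" using k(1) Kv_level_stab[OF n] by blast
    have kn: "ap k n = n + q ^ Suc l * rotf (int (c n)) 0" using k(2)[rule_format, of 0] by (simp add: ap_rot)
    have rho_n: "rho (Suc l) n k = shf (int (c n)) 0"
      unfolding rho_def kn using rS[OF n] by (simp add: rotf_def del: power_Suc)
    have "int q dvd int (rho (Suc l) n k) - int (c n)" unfolding rho_n int_shf
      by (simp add: mod_eq_dvd_iff[symmetric])
    moreover have "int p dvd int q" by (simp add: q_def)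
    ultimately have "int p dvd int (rho (Suc l) n k) - int (c n)" using dvd_trans by blast
    then have en: "ec p (int (rho (Suc l) n k)) = ec p (int (c n))" using p_ge2 by (simp add: ec_eq)
    have eo: "rho (Suc l) r k = 0" if "r < q ^ l" "r \<noteq> n" for r
      using Kv_fix[OF k(1), of r] that rS by (simp add: rho_def del: power_Suc)
    have "ec p (int (rho (Suc l) r (g + k))) = (if r < Suc n then ec p (int (c r)) else 0)" if r: "r < q ^ l" for r
      using ec_rho_add[OF g(1) kL rS[OF r]] g(2) r en eo[OF r] by (cases "r = n") (auto simp: less_Suc_eq)
    then show ?case using subgrp_add[OF subgrp_level_stab g(1) kL] by blast
  qed
  from this[of "q ^ l"] show ?thesis by auto
qed

lemma level_stab_separates: assumes "g \<noteq> 0" shows "\<exists>n0. \<forall>n\<ge>n0. g \<notin> level_stab n"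
proof -
  obtain m where m: "ap g m \<noteq> m" using assms by (metis nperm_eqI ap_zero)
  let ?n = "ap g m + m"
  have "g \<notin> level_stab n" if "n \<ge> ?n" for n
  proof
    assume "g \<in> level_stab n"
    have "x < q ^ n" if "x \<le> n" for x
    proof -
      have "n < 2 ^ n" by (rule less_exp)
      also have "(2::nat) ^ n \<le> q ^ n" using q_ge8 by (intro power_mono) auto
      finally show ?thesis using that by simp
    qed
    then have "ap g m < q ^ n" "m < q ^ n" using \<open>n \<ge> ?n\<close> by auto
    moreover have "ap g m mod q ^ n = m mod q ^ n" using \<open>g \<in> level_stab n\<close> by (simp add: level_stab_def)
    ultimately show False using m by simp
  qed
  then show ?thesis by blast
qed

end

context spinal_k
begin

definition level_stabs :: "nat \<Rightarrow> semi set" where "level_stabs n = {a \<in> H. \<forall>i<k. gp a i \<in> level_stab n}"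

lemma subgrp_level_stabs: "subgrp (level_stabs n)"
  using subgrp_H subgrp_level_stab[of n] unfolding subgrp_def level_stabs_def by auto

lemma cov_level_stabs: "cov (q ^ (k * q ^ n)) H (level_stabs n)"
proof -
  have sg: "subgrp {a \<in> H. gp a i \<in> level_stab n}" for i
    using subgrp_H subgrp_level_stab[of n] unfolding subgrp_def by auto
  have "cov ((q ^ (q ^ n)) ^ m) H {a \<in> H. \<forall>i<m. gp a i \<in> level_stab n} \<and> subgrp {a \<in> H. \<forall>i<m. gp a i \<in> level_stab n}" for m
  proof (induction m)
    case 0
    show ?case using cov_one[OF subgrp_H order_refl] subgrp_H by simp
  next
    case (Suc m)
    have "cov (q ^ (q ^ n)) H {a \<in> H. gp a m \<in> level_stab n}"
      by (rule cov_vimage[OF cov_level_stab subgrp_level_stab])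
        (use H_gp in \<open>auto intro: subgrp_add[OF subgrp_H] subgrp_minus[OF subgrp_H]\<close>)
    from cov_Int[OF this conjunct1[OF Suc] sg conjunct2[OF Suc]] subgrp_Int[OF sg conjunct2[OF Suc], of m]
    show ?case by (simp add: Int_def less_Suc_eq all_conj_distrib conj_ac disj_imp) 
        (smt (verit, del_insts) Collect_cong less_antisym nat_less_le)
  qed
  from conjunct1[OF this[of k]] show ?thesis by (simp add: level_stabs_def power_mult[symmetric] mult.commute)
qed

section \<open>Class sums on the module\<close>

definition cls :: "nat \<Rightarrow> nat list \<Rightarrow> nat list" where "cls n y = map (\<lambda>x. x mod q ^ n) y"

definition csum :: "nat \<Rightarrow> nat list \<Rightarrow> (nat list \<Rightarrow> qz) \<Rightarrow> qz" where
  "csum n j m = (\<Sum>y\<in>{y. m y \<noteq> 0 \<and> cls n y = j}. m y)"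

lemma csum_superset:
  assumes "finite S" "{y. m y \<noteq> 0} \<subseteq> S" shows "csum n j m = (\<Sum>y\<in>{y \<in> S. cls n y = j}. m y)"
  unfolding csum_def using assms by (intro sum.mono_neutral_left) auto

lemma csum_add:
  assumes "finite {y. m y \<noteq> 0}" "finite {y. m' y \<noteq> 0}"
  shows "csum n j (\<lambda>y. m y + m' y) = csum n j m + csum n j m'"
proof -
  let ?S = "{y. m y \<noteq> 0} \<union> {y. m' y \<noteq> 0}"
  have S: "finite ?S" using assms by simp
  have "csum n j (\<lambda>y. m y + m' y) = (\<Sum>y\<in>{y \<in> ?S. cls n y = j}. m y + m' y)"
    by (rule csum_superset[OF S]) auto
  also have "\<dots> = csum n j m + csum n j m'"
    unfolding sum.distrib by (intro arg_cong2[where f = "(+)"] csum_superset[symmetric, OF S]) auto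
  finally show ?thesis .
qed

lemma csum_act:
  assumes "\<And>y. cls n (act g y) = cls n y"
  shows "csum n j (\<lambda>y. m (act g y)) = csum n j m"
  unfolding csum_def
proof (rule sum.reindex_bij_witness[of _ "act (\<lambda>i. - g i)" "act g"])
  fix z assume z: "z \<in> {y. m y \<noteq> 0 \<and> cls n y = j}"
  have "cls n (act (\<lambda>i. - g i) z) = cls n (act g (act (\<lambda>i. - g i) z))" by (rule assms[symmetric])
  then show "act (\<lambda>i. - g i) z \<in> {y. m (act g y) \<noteq> 0 \<and> cls n y = j}" using z by simp
qed (auto simp: assms)

lemma cls_act: assumes "a \<in> level_stabs n" shows "cls n (act (gp a) y) = cls n y"
proof (rule nth_equalityI)
  fix i assume "i < length (cls n (act (gp a) y))"
  then have i: "i < length y" by (simp add: cls_def)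
  have "gp a i \<in> level_stab n"
    using assms subgrp_0[OF subgrp_level_stab] by (cases "i < k") (auto simp: level_stabs_def H_def)
  then show "cls n (act (gp a) y) ! i = cls n y ! i" using i by (simp add: cls_def level_stab_def)
qed (simp add: cls_def)

text \<open>Elements of \<open>level_stabs n\<close> preserve the residues mod \<open>q ^ n\<close>
  of a tuple, so summing the module part over one class is a homomorphism on them. The default 0 is
  the one required by \<open>homs\<close>.\<close>

definition Psi :: "nat \<Rightarrow> nat list \<Rightarrow> semi \<Rightarrow> qz" where
  "Psi n j a = (if a \<in> level_stabs n then csum n j (mo a) else 0)"

lemma H_supp: "a \<in> H \<Longrightarrow> finite {y. mo a y \<noteq> 0}"
  by (simp add: H_def Mm_def)

lemma Psi_homs: "Psi n j \<in> homs p (level_stabs n)"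
  unfolding homs_def
proof (intro CollectI conjI ballI allI impI)
  fix a assume a: "a \<in> level_stabs n"
  have "(\<Sum>y\<in>F. mo a y) \<in> mu p" if "finite F" for F
    using that by induction (use a in \<open>auto simp: mu_closed level_stabs_def H_def Mm_def\<close>)
  moreover have "finite {y. mo a y \<noteq> 0 \<and> cls n y = j}"
    using H_supp[of a] a by (auto simp: level_stabs_def intro: finite_subset[rotated])
  ultimately show "Psi n j a \<in> mu p" using a by (simp add: Psi_def csum_def)
next
  fix a b assume ab: "a \<in> level_stabs n" "b \<in> level_stabs n"
  have cl: "cls n (act (\<lambda>i. - gp a i) y) = cls n y" for y
    using cls_act[OF subgrp_minus[OF subgrp_level_stabs ab(1)], of y] by (simp add: uminus_semi_def)
  have "mo b \<in> Mm" using ab by (simp add: level_stabs_def H_def)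
  then have "finite {y. mo b (act (\<lambda>i. - gp a i) y) \<noteq> 0}" using Mm_act[of "mo b"] by (simp add: Mm_def)
  moreover have "finite {y. mo a y \<noteq> 0}" using ab H_supp by (simp add: level_stabs_def)
  ultimately have "csum n j (\<lambda>y. mo a y + mo b (act (\<lambda>i. - gp a i) y)) = csum n j (mo a) + csum n j (mo b)"
    using csum_act[OF cl, of j "mo b"] by (simp add: csum_add)
  then show "Psi n j (a + b) = Psi n j a + Psi n j b"
    using ab subgrp_add[OF subgrp_level_stabs ab] by (simp add: Psi_def mo_add[abs_def])
qed (simp add: Psi_def)

definition Jn :: "nat \<Rightarrow> nat list set" where "Jn n = {y. set y \<subseteq> {..<q ^ n} \<and> length y = k}"

lemma Jn: "finite (Jn n)" "card (Jn n) = (q ^ n) ^ k"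
  unfolding Jn_def by (simp_all add: finite_lists_length_eq card_lists_length_eq)

lemma cls_Jn: "y \<in> Jn n \<Longrightarrow> cls n y = y"
  by (auto simp: cls_def Jn_def intro!: map_idI)

lemma Psi_inj_m:
  assumes m: "m \<in> Mm" "{y. m y \<noteq> 0} \<subseteq> Jn n" and j: "j \<in> Jn n"
  shows "inj_m m \<in> level_stabs n" "Psi n j (inj_m m) = m j"
proof -
  show u: "inj_m m \<in> level_stabs n" using m subgrp_0[OF subgrp_level_stab] G_zero by (simp add: level_stabs_def H_def)
  have "csum n j m = (\<Sum>y\<in>{y \<in> Jn n. cls n y = j}. m y)" by (rule csum_superset[OF Jn(1) m(2)])
  also have "{y \<in> Jn n. cls n y = j} = {j}" using j cls_Jn by auto
  finally show "Psi n j (inj_m m) = m j" using u by (simp add: Psi_def)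
qed

text \<open>The independent homomorphisms are class sums on the module if k is at least 2, and
  rotations at vertices of level n + 1 if k = 1. The level \<open>Suc n\<close> in the index covers
  both cases.\<close>

lemma lower_family:
  assumes S: "finite S" "\<And>W. subgrp W \<Longrightarrow> W \<subseteq> H \<Longrightarrow> cov (q ^ (k * q ^ Suc n) * p ^ t) H W \<Longrightarrow> W \<in> S"
    and t: "t \<le> (q ^ n) ^ k"
  shows "p ^ (t * ((q ^ n) ^ k - t)) \<le> card S"
proof (cases "k = 1")
  case True
  let ?U = "level_stabs (Suc n)"
  let ?F = "\<lambda>r a. if a \<in> ?U then ec p (int (rho (Suc n) r (gp a 0))) else 0"
  have rS: "r < q ^ Suc n" if "r < q ^ n" for r using child_lt[OF that, of 0] by simp
  have "p ^ (t * (card {..<q ^ n} - t)) \<le> card S"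
  proof (rule many_subgroups[OF p_gt0 _ subgrp_level_stabs cov_level_stabs])
    show "?U \<subseteq> H" by (auto simp: level_stabs_def)
    show "?F r \<in> homs p ?U" if r: "r \<in> {..<q ^ n}" for r
    proof -
      have L: "gp a 0 \<in> level_stab (Suc n)" if "a \<in> ?U" for a using that k_pos by (simp add: level_stabs_def)
      show ?thesis unfolding homs_def
        using L ec_rho_add rS r subgrp_add[OF subgrp_level_stabs] by (auto simp: mu_def simp del: power_Suc)
    qed
    show "\<exists>u\<in>?U. \<forall>r\<in>{..<q ^ n}. ?F r u = ec p (int (c r))" for c
    proof -
      obtain g where g: "g \<in> level_stab (Suc n)" "\<forall>r<q ^ n. ec p (int (rho (Suc n) r g)) = ec p (int (c r))"
        using rho_surj by blast
      have "g \<in> G 0" using g(1) by (simp add: level_stab_def)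
      then have "inj_g 0 g \<in> H" using k_pos by (intro inj_g_H) auto
      then have "inj_g 0 g \<in> ?U" using g(1) subgrp_0[OF subgrp_level_stab] unfolding level_stabs_def by simp
      then show ?thesis using g by (intro bexI[of _ "inj_g 0 g"]) auto
    qed
    show "W \<in> S" if "subgrp W" "W \<subseteq> H" "cov (q ^ (k * q ^ Suc n) * p ^ t) H W" for W by (rule S(2)[OF that])
  qed (use S t True in auto)
  then show ?thesis using True by simp
next
  case False
  have "q ^ n \<le> q ^ Suc n" using q_ge8 by simp
  then have "q ^ (k * q ^ n) * p ^ t \<le> q ^ (k * q ^ Suc n) * p ^ t"
    using q_ge8 by (intro mult_le_mono1 power_increasing mult_le_mono2) auto
  then have S': "W \<in> S" if "subgrp W" "W \<subseteq> H" "cov (q ^ (k * q ^ n) * p ^ t) H W" for W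
    using S(2)[OF that(1,2) cov_mono[OF that(3) _ order_refl order_refl]] by blast
  have "p ^ (t * (card (Jn n) - t)) \<le> card S"
  proof (rule many_subgroups[OF p_gt0 _ subgrp_level_stabs cov_level_stabs])
    show "level_stabs n \<subseteq> H" by (auto simp: level_stabs_def)
    show "Psi n j \<in> homs p (level_stabs n)" if "j \<in> Jn n" for j by (rule Psi_homs)
    show "\<exists>u\<in>level_stabs n. \<forall>j\<in>Jn n. Psi n j u = ec p (int (c j))" for c
    proof -
      let ?m = "\<lambda>y. if y \<in> Jn n then ec p (int (c y)) else 0"
      have "Jn n \<subseteq> Y" using False by (auto simp: Jn_def Y_def)
      moreover have sub: "{y. ?m y \<noteq> 0} \<subseteq> Jn n" by auto
      ultimately have "?m \<in> Mm"
        using finite_subset[OF sub Jn(1)] unfolding Mm_def by (auto simp: mu_closed ec1_mu)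
      then have "inj_m ?m \<in> level_stabs n \<and> Psi n j (inj_m ?m) = ec p (int (c j))" if "j \<in> Jn n" for j
        using Psi_inj_m[OF _ sub that] that by simp
      moreover have "Jn n \<noteq> {}" using Jn(2)[of n] by (metis card.empty power_eq_0_iff q_neq0)
      ultimately show ?thesis by blast
    qed
    show "W \<in> S" if "subgrp W" "W \<subseteq> H" "cov (q ^ (k * q ^ n) * p ^ t) H W" for W by (rule S'[OF that])
  qed (use S t Jn in auto)
  then show ?thesis by (simp add: Jn)
qed

text \<open>If a group component is nonzero, some level stabilizer misses a. Otherwise a level is
  taken so deep that the tuples in the support of a lie in distinct classes, and the kernel of a
  class sum misses a.\<close>

lemma separates:
  assumes a: "a \<in> H" "a \<noteq> 0"
  shows "\<exists>W n. subgrp W \<and> W \<subseteq> H \<and> cov n H W \<and> a \<notin> W"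
proof (cases "\<exists>i. gp a i \<noteq> 0")
  case True
  then obtain i where i: "gp a i \<noteq> 0" by blast
  then have ik: "i < k" using a by (metis (mono_tags, lifting) H_def mem_Collect_eq not_le)
  obtain n where "gp a i \<notin> level_stab n" using level_stab_separates[OF i] by blast
  then have "a \<notin> level_stabs n" using ik by (auto simp: level_stabs_def)
  then show ?thesis using subgrp_level_stabs cov_level_stabs by (intro exI[of _ "level_stabs n"]) (auto simp: level_stabs_def)
next
  case False
  then have a': "a = inj_m (mo a)" by (intro semi_eqI) auto
  have m: "mo a \<in> Mm" using a by (simp add: H_def)
  obtain y where y: "mo a y \<noteq> 0" using a(2) a' by (metis inj_m_0 ext)
  define N where "N = Max (\<Union>z\<in>{z. mo a z \<noteq> 0}. insert 0 (set z))"
  have fin: "finite (\<Union>z\<in>{z. mo a z \<noteq> 0}. insert 0 (set z))" using H_supp[OF a(1)] by blast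
  have "x \<le> N" if "mo a z \<noteq> 0" "x \<in> set z" for x z
    unfolding N_def by (rule Max_ge[OF fin]) (use that in auto)
  moreover have "N < q ^ N"
  proof -
    have "N < 2 ^ N" by (rule less_exp)
    also have "(2::nat) ^ N \<le> q ^ N" using q_ge8 by (intro power_mono) auto
    finally show ?thesis .
  qed
  ultimately have sub: "{z. mo a z \<noteq> 0} \<subseteq> Jn N"
    using m by (fastforce simp: Jn_def Mm_def Y_def split: if_splits)
  have yJ: "y \<in> Jn N" using sub y by blast
  have val: "Psi N y a = mo a y" using Psi_inj_m(2)[OF m sub yJ] a' by simp
  let ?W = "{u \<in> level_stabs N. Psi N y u \<in> {0}}"
  have "cov p (level_stabs N) ?W"
  proof (rule cov_vimage[of p "mu p"])
    show "cov p (mu p) {0}"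
      unfolding cov_def using finite_mu[OF p_gt0] card_mu_le[OF p_gt0] by (intro exI[of _ "mu p"]) auto
    show "Psi N y (- x + z) = - Psi N y x + Psi N y z" if "x \<in> level_stabs N" "z \<in> level_stabs N" for x z
      using homsD(3)[OF Psi_homs subgrp_minus[OF subgrp_level_stabs that(1)] that(2)] homs_minus[OF Psi_homs subgrp_level_stabs that(1)]
      by simp
    show "Psi N y ` level_stabs N \<subseteq> mu p" using homsD(2)[OF Psi_homs] by blast
  qed (auto simp: subgrp_zero intro: subgrp_add[OF subgrp_level_stabs] subgrp_minus[OF subgrp_level_stabs])
  then have "cov (q ^ (k * q ^ N) * p) H ?W" by (rule cov_trans[OF cov_level_stabs])
  moreover have "subgrp ?W"
    unfolding subgrp_def using subgrp_0[OF subgrp_level_stabs] subgrp_add[OF subgrp_level_stabs] subgrp_minus[OF subgrp_level_stabs]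
    by (auto simp: homs_0[OF Psi_homs subgrp_level_stabs] homsD(3)[OF Psi_homs] homs_minus[OF Psi_homs subgrp_level_stabs])
  moreover have "a \<notin> ?W" using val y by simp
  moreover have "?W \<subseteq> H" by (auto simp: level_stabs_def)
  ultimately show ?thesis by blast
qed

end

section \<open>Strict growth type\<close>

context spinal_k
begin

lemma subgroups_index_le_H:
  "subgroups_index_le (GA H) n = {W. subgrp W \<and> W \<subseteq> H \<and> finite (rc H W) \<and> card (rc H W) \<le> n}"
  by (auto simp: subgroups_index_le_def subgroup_GA[OF subgrp_H] rcosets_GA)

text \<open>Chains of length at most m reach all these subgroups. Summing the exponents along a
  chain raises the power of m by one, and the number m + 1 of lengths is absorbed by
  \<open>p ^ (m ^ Suc k)\<close>.\<close>

lemma upper_count: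
  assumes n: "n < p ^ Suc m"
  shows "finite (subgroups_index_le (GA H) n)"
    and "card (subgroups_index_le (GA H) n) \<le> p ^ ((hom_rate + 1) * m ^ Suc k)"
proof -
  let ?S = "subgroups_index_le (GA H) n"
  let ?D = "\<lambda>j. hom_rate * (j + 1) ^ k"
  have chain_ends: "finite (chain_ends p H i) \<and> card (chain_ends p H i) \<le> p ^ (\<Sum>j<i. ?D j)" for i
    by (rule chain_ends_count[OF subgrp_H]) (rule homs_upper)
  have sub: "?S \<subseteq> (\<Union>i\<in>{..m}. chain_ends p H i)"
  proof
    fix W assume "W \<in> ?S"
    then have W: "subgrp W" "W \<subseteq> H" "finite (rc H W)" "card (rc H W) \<le> n"
      by (auto simp: subgroups_index_le_H)
    obtain i where i: "W \<in> chain_ends p H i" "p ^ i \<le> card (rc H W)"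
      using in_chain[OF prime_p subgrp_H tor W(1-3)] by auto
    have "p ^ i < p ^ Suc m" using i(2) W(4) n by linarith
    then have "i < Suc m" by (rule power_less_imp_less_exp[rotated]) (use p_ge2 in simp)
    then show "W \<in> (\<Union>i\<in>{..m}. chain_ends p H i)" using i(1) by auto
  qed
  have fin: "finite (\<Union>i\<in>{..m}. chain_ends p H i)" using chain_ends by auto
  show "finite ?S" by (rule finite_subset[OF sub fin])
  have ci: "card (chain_ends p H i) \<le> p ^ (hom_rate * m ^ Suc k)" if i: "i \<le> m" for i
  proof -
    have "(\<Sum>j<i. ?D j) \<le> (\<Sum>j<i. hom_rate * m ^ k)"
      by (rule sum_mono) (use i in \<open>auto intro!: mult_left_mono power_mono\<close>)
    also have "\<dots> \<le> m * (hom_rate * m ^ k)" using i by simp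
    also have "\<dots> = hom_rate * m ^ Suc k" by (simp add: mult_ac)
    finally have "p ^ (\<Sum>j<i. ?D j) \<le> p ^ (hom_rate * m ^ Suc k)"
      using p_ge2 by (intro power_increasing) simp_all
    then show ?thesis using chain_ends[of i] by linarith
  qed
  have "card ?S \<le> card (\<Union>i\<in>{..m}. chain_ends p H i)" by (rule card_mono[OF fin sub])
  also have "\<dots> \<le> (\<Sum>i\<le>m. card (chain_ends p H i))" by (rule card_UN_le) simp
  also have "\<dots> \<le> (\<Sum>i\<le>m. p ^ (hom_rate * m ^ Suc k))" by (rule sum_mono) (use ci in simp)
  also have "\<dots> = Suc m * p ^ (hom_rate * m ^ Suc k)" by simp
  also have "\<dots> \<le> p ^ (m ^ Suc k) * p ^ (hom_rate * m ^ Suc k)"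
  proof (rule mult_right_mono)
    have "Suc m \<le> 2 ^ m" by (rule Suc_leI) (rule less_exp)
    also have "\<dots> \<le> p ^ m" using p_ge2 by (intro power_mono) auto
    also have "\<dots> \<le> p ^ (m ^ Suc k)"
    proof (rule power_increasing)
      show "m \<le> m ^ Suc k" by (cases "m = 0") (simp, intro self_le_power, simp_all del: power_Suc)
    qed (use p_ge2 in simp)
    finally show "Suc m \<le> p ^ (m ^ Suc k)" .
  qed simp
  also have "\<dots> = p ^ ((hom_rate + 1) * m ^ Suc k)" by (simp add: power_add[symmetric] del: power_Suc)
  finally show "card ?S \<le> p ^ ((hom_rate + 1) * m ^ Suc k)" .
qed

text \<open>With \<open>N = q ^ n\<close>, the stabilizer of level n + 1 and a codimension of N/2
  cost at most \<open>(3 * k * q + 1) * N\<close> in the exponent of p; the 3 is that of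
  \<open>q = p ^ 3\<close>. The last factor \<open>q\<close> is lost in rounding M down to such a
  value.\<close>

definition index_scale :: nat where "index_scale = (3 * k * q + 1) * q"

lemma lower_count:
  assumes M: "index_scale \<le> M" and fin: "finite (subgroups_index_le (GA H) (p ^ M))"
  shows "\<exists>e. p ^ e \<le> card (subgroups_index_le (GA H) (p ^ M)) \<and> real M ^ Suc k \<le> 8 * real index_scale ^ Suc k * real e"
proof -
  let ?S = "subgroups_index_le (GA H) (p ^ M)"
  let ?B = "3 * k * q + 1"
  have q2: "q \<ge> 2" using p_ge2 self_le_power[of p 3] unfolding q_def by linarith
  have B: "index_scale = ?B * q" by (simp add: index_scale_def)
  have 1: "1 \<le> M div ?B"
  proof -
    have "?B * 1 \<le> ?B * q" using q2 by (intro mult_left_mono) auto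
    then have "?B \<le> M" using M unfolding B by (metis mult_1_right order_trans)
    then show ?thesis by (simp add: Suc_le_eq div_greater_zero_iff)
  qed
  obtain n where n: "q ^ n \<le> M div ?B" "M div ?B < q ^ (n + 1)"
    using ex_power_ivl1[OF q2 1] by auto
  define N where "N = q ^ n"
  have n1: "n \<ge> 1"
  proof (rule ccontr)
    assume "\<not> n \<ge> 1"
    then have "n = 0" by simp
    then have "M div ?B < q" using n(2) by simp
    moreover have "q \<le> M div ?B" using M B by (simp add: less_eq_div_iff_mult_less_eq mult.commute)
    ultimately show False by linarith
  qed
  have N2: "N \<ge> 2"
  proof -
    have "q ^ 1 \<le> q ^ n" using n1 q2 by (intro power_increasing) auto
    then show ?thesis using q2 by (simp add: N_def)
  qed
  have BN: "?B * N \<le> M"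
    using n(1) by (simp add: N_def less_eq_div_iff_mult_less_eq mult.commute)
  have MN: "M < index_scale * N"
  proof -
    have "M < ?B * q ^ (n + 1)" using n(2) by (simp add: div_less_iff_less_mult mult.commute)
    also have "\<dots> = index_scale * N" by (simp add: B N_def algebra_simps)
    finally show ?thesis .
  qed
  \<comment> \<open>Half of N and not of \<open>N ^ k\<close>: a codimension t costs t in the
    exponent of the index, which has to stay of order N.\<close>
  define t where "t = N div 2"
  have NK: "N \<le> N ^ k" using N2 k_pos by (intro self_le_power) auto
  have tN: "t \<le> N ^ k" using NK by (simp add: t_def)
  have mem: "W \<in> ?S" if W: "subgrp W" "W \<subseteq> H" "cov (q ^ (k * q ^ Suc n) * p ^ t) H W" for W
  proof -
    have "q ^ (k * q ^ Suc n) * p ^ t = p ^ (3 * (k * q ^ Suc n) + t)"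
      by (simp add: q_def power_mult[symmetric] power_add del: power_Suc)
    also have "\<dots> \<le> p ^ M"
    proof (rule power_increasing)
      have "3 * (k * q ^ Suc n) + t \<le> ?B * N" by (simp add: N_def t_def algebra_simps)
      then show "3 * (k * q ^ Suc n) + t \<le> M" using BN by linarith
    qed (use p_ge2 in simp)
    finally have "cov (p ^ M) H W" using W(3) cov_mono by blast
    then show ?thesis using W(1,2) rc_cov[OF subgrp_H W(1)] by (auto simp: subgroups_index_le_H)
  qed
  have low: "p ^ (t * (N ^ k - t)) \<le> card ?S"
    using lower_family[OF fin mem, of n t] tN by (simp add: N_def)
  have "real M ^ Suc k \<le> (real index_scale * real N) ^ Suc k"
    using MN by (intro power_mono) (simp_all flip: of_nat_mult)
  also have "\<dots> = real index_scale ^ Suc k * (real N * real N ^ k)" by (simp add: power_mult_distrib)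
  also have "\<dots> \<le> real index_scale ^ Suc k * (8 * real (t * (N ^ k - t)))"
  proof (rule mult_left_mono)
    have a: "N \<le> 4 * t" using N2 by (simp add: t_def)
    have "2 * t \<le> N ^ k" using NK by (simp add: t_def)
    then have b: "N ^ k \<le> 2 * (N ^ k - t)" by simp
    have "N * N ^ k \<le> (4 * t) * (2 * (N ^ k - t))" by (rule mult_mono[OF a b]) auto
    also have "\<dots> = 8 * (t * (N ^ k - t))" by simp
    finally have "real (N * N ^ k) \<le> real (8 * (t * (N ^ k - t)))" by (simp only: of_nat_le_iff)
    then show "real N * real N ^ k \<le> 8 * real (t * (N ^ k - t))" by simp
  qed simp
  finally show "\<exists>e. p ^ e \<le> card ?S \<and> real M ^ Suc k \<le> 8 * real index_scale ^ Suc k * real e"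
    using low by (intro exI[of _ "t * (N ^ k - t)"]) (simp add: mult_ac)
qed

lemma growth_powr:
  assumes "n \<ge> 1"
  shows "(real n powr (log p n ^ k)) powr a = real p powr (a * log p n ^ Suc k)"
proof -
  have "real n = real p powr log p n" using p_ge2 assms by simp
  then have "(real n powr (log p n ^ k)) powr a = ((real p powr log p n) powr (log p n ^ k)) powr a" by simp
  then show ?thesis by (simp add: powr_powr mult_ac)
qed

lemma growth_H:
  "strict_growth_type p (\<lambda>n. real n powr (log p n ^ k)) (subgroups_index_le (GA H))"
  unfolding strict_growth_type_def
proof (intro exI conjI allI impI)
  let ?S = "subgroups_index_le (GA H)"
  \<comment> \<open>The exponent above is that of \<open>upper_count\<close>; the one below inverts
    the constant of \<open>lower_count\<close>.\<close>
  let ?a = "real (hom_rate + 1)" let ?b = "1 / (8 * real index_scale ^ Suc k)"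
  have q0: "q > 0" by (simp add: q_def)
  have index_scale: "index_scale > 0" using q0 by (simp add: index_scale_def)
  show "?a > 0" by simp
  show "?b > 0" using index_scale by simp
  have p1: "real p > 1" using p_ge2 by simp
  fix n :: nat assume n: "1 \<le> n"
  obtain m where m: "p ^ m \<le> n" "n < p ^ (m + 1)" using ex_power_ivl1[OF p_ge2 n] by auto
  have up: "finite (?S n)" "card (?S n) \<le> p ^ ((hom_rate + 1) * m ^ Suc k)"
    using upper_count[of n m] m(2) by simp_all
  show "finite (?S n)" by (rule up)
  have "real m = log p (real p ^ m)" using p1 by (simp add: log_nat_power)
  also have "\<dots> \<le> log p n" using p1 m(1) n by (subst log_le_cancel_iff) (auto simp flip: of_nat_power)
  finally have mL: "real m \<le> log p n" .
  have "real (card (?S n)) \<le> real (p ^ ((hom_rate + 1) * m ^ Suc k))" using up(2) by (simp only: of_nat_le_iff)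
  also have "\<dots> = real p powr real ((hom_rate + 1) * m ^ Suc k)" using p1 by (subst powr_realpow) simp_all
  also have "\<dots> = real p powr (?a * real m ^ Suc k)" by (simp add: algebra_simps)
  also have "\<dots> \<le> real p powr (?a * log p n ^ Suc k)"
    using p1 mL by (intro powr_mono mult_left_mono power_mono) auto
  also have "\<dots> = (real n powr (log p n ^ k)) powr ?a" using growth_powr[OF n] by simp
  finally show "real (card (?S n)) \<le> (real n powr (log p n ^ k)) powr ?a" .
next
  let ?S = "subgroups_index_le (GA H)"
  let ?b = "1 / (8 * real index_scale ^ Suc k)"
  have q0: "q > 0" by (simp add: q_def)
  have index_scale: "index_scale > 0" using q0 by (simp add: index_scale_def)
  have p1: "real p > 1" using p_ge2 by simp
  have "(real (p ^ M) powr (log p (real (p ^ M)) ^ k)) powr ?b \<le> real (card (?S (p ^ M)))" if M: "index_scale \<le> M" for M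
  proof -
    have fin: "finite (?S (p ^ M))" by (rule upper_count(1)[of _ M]) (use p_ge2 in simp)
    obtain e where e: "p ^ e \<le> card (?S (p ^ M))" "real M ^ Suc k \<le> 8 * real index_scale ^ Suc k * real e"
      using lower_count[OF M fin] by blast
    have L: "log p (real (p ^ M)) = real M" using p1 by (simp add: log_nat_power)
    have "(real (p ^ M) powr (log p (real (p ^ M)) ^ k)) powr ?b = real p powr (?b * real M ^ Suc k)"
      using growth_powr[of "p ^ M" ?b] p_gt0 by (simp only: L) (simp del: power_Suc)
    also have "\<dots> \<le> real p powr real e"
      using p1 e(2) index_scale by (intro powr_mono) (simp_all add: field_simps del: power_Suc)
    also have "\<dots> = real (p ^ e)" using p1 by (simp add: powr_realpow)
    also have "\<dots> \<le> real (card (?S (p ^ M)))" using e(1) by (simp only: of_nat_le_iff)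
    finally show ?thesis .
  qed
  then show "\<forall>\<^sub>F m in sequentially. (real (p ^ m) powr (log p (real (p ^ m)) ^ k)) powr ?b \<le> real (card (?S (p ^ m)))"
    unfolding eventually_sequentially by blast
qed

end

section \<open>The pro-p completion\<close>

locale p_completion = group G for G (structure) +
  fixes p :: nat
  assumes p_group: "is_p_group p G" and prime_p: "Factorial_Ring.prime p"
begin

definition I :: "'a set set" where "I = p_power_normal_subgroups p G"
definition C :: "('a set \<Rightarrow> 'a set) monoid" where "C = pro_p_completion p G"
definition T :: "('a set \<Rightarrow> 'a set) topology" where "T = pro_p_completion_topology p G"

text \<open>Finite quotients of a p-group have p-power order, so the inverse system consists of all
  normal subgroups of finite index.\<close>

lemma I_iff: "N \<in> I \<longleftrightarrow> N \<lhd> G \<and> finite (rcosets N)"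
proof
  assume N: "N \<in> I"
  then obtain m where m: "N \<lhd> G" "card (rcosets N) = p ^ m"
    by (auto simp: I_def p_power_normal_subgroups_def)
  then show "N \<lhd> G \<and> finite (rcosets N)"
    using prime_gt_0_nat[OF prime_p] by (auto intro: card_ge_0_finite)
next
  assume "N \<lhd> G \<and> finite (rcosets N)"
  then show "N \<in> I" using p_group_normal_index[OF p_group _ prime_p]
    by (auto simp: I_def p_power_normal_subgroups_def)
qed

lemma I_normal: "N \<in> I \<Longrightarrow> N \<lhd> G" by (simp add: I_iff)
lemma I_subgroup: "N \<in> I \<Longrightarrow> subgroup N G" by (simp add: I_iff normal_imp_subgroup)

lemma rcos_eq:
  assumes "subgroup K G" "g \<in> carrier G" "h \<in> carrier G"
  shows "K #> g = K #> h \<longleftrightarrow> g \<otimes> inv h \<in> K"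
  using assms by (metis is_group repr_independence rcos_self subgroup.rcos_module)

lemma set_mult_rcos:
  assumes N: "subgroup N G" and M: "subgroup M G" and NM: "N \<subseteq> M" and g: "g \<in> carrier G"
  shows "M <#> (N #> g) = M #> g"
proof -
  have "M <#> N = M"
  proof
    show "M <#> N \<subseteq> M" using NM subgroup.m_closed[OF M] by (auto simp: set_mult_def)
    show "M \<subseteq> M <#> N"
    proof
      fix x assume "x \<in> M"
      then have "x \<in> M" "x = x \<otimes> \<one>" using subgroup.mem_carrier[OF M] by auto
      then show "x \<in> M <#> N" unfolding set_mult_def using subgroup.one_closed[OF N] by blast
    qed
  qed
  then show ?thesis using setmult_rcos_assoc[OF subgroup.subset[OF M] subgroup.subset[OF N] g] by simp
qed

lemma I_Int: assumes "N \<in> I" "M \<in> I" shows "N \<inter> M \<in> I"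
proof -
  have sN: "subgroup N G" "subgroup M G" using assms by (auto simp: I_subgroup)
  have s: "subgroup (N \<inter> M) G" using sN by (rule subgroups_Inter_pair)
  have n: "N \<inter> M \<lhd> G"
    unfolding normal_inv_iff
    using s assms I_normal[unfolded normal_inv_iff] by auto
  have "rcosets (N \<inter> M) \<subseteq> (\<lambda>(A, B). A \<inter> B) ` ((rcosets N) \<times> (rcosets M))"
  proof
    fix A assume "A \<in> rcosets (N \<inter> M)"
    then obtain g where g: "g \<in> carrier G" "A = (N \<inter> M) #> g" by (auto simp: RCOSETS_def)
    have "A = (N #> g) \<inter> (M #> g)"
    proof -
      have "u = v" if "u \<in> N" "v \<in> M" "u \<otimes> g = v \<otimes> g" for u v
        using that g(1) sN by (meson right_cancel subgroup.mem_carrier)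
      then show ?thesis unfolding g(2) r_coset_def by fastforce
    qed
    then show "A \<in> (\<lambda>(A, B). A \<inter> B) ` ((rcosets N) \<times> (rcosets M))"
      using g(1) by (auto simp: RCOSETS_def)
  qed
  then have "finite (rcosets (N \<inter> M))"
    by (rule finite_subset) (use assms in \<open>auto simp: I_iff\<close>)
  then show ?thesis using n by (simp add: I_iff)
qed

lemma carrier_I: "carrier G \<in> I"
proof -
  have "rcosets (carrier G) = {carrier G}"
    using coset_join2[OF _ subgroup_self] by (auto simp: RCOSETS_def)
  then show ?thesis by (simp add: I_iff normal_inv_iff subgroup_self)
qed

lemma I_Inter: "finite F \<Longrightarrow> F \<subseteq> I \<Longrightarrow> \<exists>N\<in>I. \<forall>M\<in>F. N \<subseteq> M"
proof (induction F rule: finite_induct)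
  case empty then show ?case using carrier_I by auto
next
  case (insert M F)
  then obtain N where N: "N \<in> I" "\<forall>M\<in>F. N \<subseteq> M" by auto
  then show ?case using insert.prems I_Int[of N M] by (intro bexI[of _ "N \<inter> M"]) auto
qed

section \<open>The completion as a topological group\<close>

lemma mult_C: "x \<otimes>\<^bsub>C\<^esub> y = (\<lambda>N\<in>I. x N <#> y N)"
  by (simp add: C_def pro_p_completion_def Let_def I_def product_group_def)

lemma one_C: "\<one>\<^bsub>C\<^esub> = (\<lambda>N\<in>I. N)"
  by (simp add: C_def pro_p_completion_def Let_def I_def product_group_def)

lemma carrier_C_iff:
  "x \<in> carrier C \<longleftrightarrow> x \<in> (\<Pi>\<^sub>E N\<in>I. rcosets N) \<and> (\<forall>N\<in>I. \<forall>M\<in>I. N \<subseteq> M \<longrightarrow> x M = M <#> x N)"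
  by (simp add: C_def pro_p_completion_def Let_def I_def product_group_def FactGroup_def)

lemma C_rcosets: "x \<in> carrier C \<Longrightarrow> N \<in> I \<Longrightarrow> x N \<in> rcosets N"
  unfolding carrier_C_iff PiE_iff by blast

lemma C_coherent: "x \<in> carrier C \<Longrightarrow> N \<in> I \<Longrightarrow> M \<in> I \<Longrightarrow> N \<subseteq> M \<Longrightarrow> x M = M <#> x N"
  unfolding carrier_C_iff by blast

lemma rep_C: assumes "x \<in> carrier C" "N \<in> I" obtains g where "g \<in> carrier G" "x N = N #> g"
  using C_rcosets[OF assms] that by (auto simp: RCOSETS_def)

lemma C_mono: "x \<in> carrier C \<Longrightarrow> N \<in> I \<Longrightarrow> M \<in> I \<Longrightarrow> N \<subseteq> M \<Longrightarrow> g \<in> carrier G \<Longrightarrow> x N = N #> g \<Longrightarrow> x M = M #> g"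
  by (metis C_coherent set_mult_rcos I_subgroup)

text \<open>Coherence is checked through one g that represents both cosets; products and inverses
  are then computed on representatives.\<close>

lemma carrier_CI:
  assumes "x \<in> extensional I"
    and "\<And>N M. N \<in> I \<Longrightarrow> M \<in> I \<Longrightarrow> N \<subseteq> M \<Longrightarrow> \<exists>g\<in>carrier G. x N = N #> g \<and> x M = M #> g"
  shows "x \<in> carrier C"
  unfolding carrier_C_iff
proof (intro conjI ballI impI)
  show "x \<in> (\<Pi>\<^sub>E N\<in>I. rcosets N)"
    unfolding PiE_iff
  proof (intro conjI ballI assms(1))
    fix N assume "N \<in> I"
    then obtain g where "g \<in> carrier G" "x N = N #> g" using assms(2)[of N N] by blast
    then show "x N \<in> rcosets N" by (auto simp: RCOSETS_def)
  qed
  fix N M assume NM: "N \<in> I" "M \<in> I" "N \<subseteq> M"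
  then obtain g where "g \<in> carrier G" "x N = N #> g" "x M = M #> g" using assms(2) by blast
  then show "x M = M <#> x N" using NM by (simp add: set_mult_rcos I_subgroup)
qed

lemma rcos_mult: "N \<in> I \<Longrightarrow> g \<in> carrier G \<Longrightarrow> h \<in> carrier G \<Longrightarrow> (N #> g) <#> (N #> h) = N #> (g \<otimes> h)"
  by (rule normal.rcos_sum[OF I_normal])

lemma mult_closed: assumes x: "x \<in> carrier C" and y: "y \<in> carrier C" shows "x \<otimes>\<^bsub>C\<^esub> y \<in> carrier C"
proof (rule carrier_CI)
  show "x \<otimes>\<^bsub>C\<^esub> y \<in> extensional I" by (simp add: mult_C)
  fix N M assume NM: "N \<in> I" "M \<in> I" "N \<subseteq> M"
  obtain g where g: "g \<in> carrier G" "x N = N #> g" using rep_C[OF x NM(1)] .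
  obtain h where h: "h \<in> carrier G" "y N = N #> h" using rep_C[OF y NM(1)] .
  show "\<exists>a\<in>carrier G. (x \<otimes>\<^bsub>C\<^esub> y) N = N #> a \<and> (x \<otimes>\<^bsub>C\<^esub> y) M = M #> a"
    using g h NM C_mono[OF x NM g] C_mono[OF y NM h]
    by (intro bexI[of _ "g \<otimes> h"]) (auto simp: mult_C rcos_mult)
qed

definition embed :: "'a \<Rightarrow> 'a set \<Rightarrow> 'a set" where "embed g = (\<lambda>N\<in>I. N #> g)"

lemma embed_C: "g \<in> carrier G \<Longrightarrow> embed g \<in> carrier C"
  by (rule carrier_CI) (auto simp: embed_def)

lemma embed_mult: "g \<in> carrier G \<Longrightarrow> h \<in> carrier G \<Longrightarrow> embed (g \<otimes> h) = embed g \<otimes>\<^bsub>C\<^esub> embed h"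
  by (auto simp: embed_def mult_C rcos_mult fun_eq_iff)

lemma C_eqI: "x \<in> carrier C \<Longrightarrow> y \<in> carrier C \<Longrightarrow> (\<And>N. N \<in> I \<Longrightarrow> x N = y N) \<Longrightarrow> x = y"
  by (rule PiE_ext[OF carrier_C_iff[THEN iffD1, THEN conjunct1] carrier_C_iff[THEN iffD1, THEN conjunct1]])

lemma embed_one: "embed \<one> = \<one>\<^bsub>C\<^esub>"
  using I_subgroup[THEN subgroup.subset] by (simp add: embed_def one_C fun_eq_iff)

definition invC :: "('a set \<Rightarrow> 'a set) \<Rightarrow> 'a set \<Rightarrow> 'a set" where
  "invC x = (\<lambda>N\<in>I. set_inv (x N))"

lemma set_inv_rcos: "N \<in> I \<Longrightarrow> g \<in> carrier G \<Longrightarrow> set_inv (N #> g) = N #> inv g"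
  by (rule normal.rcos_inv[OF I_normal])

lemma invC_closed: assumes x: "x \<in> carrier C" shows "invC x \<in> carrier C"
proof (rule carrier_CI)
  show "invC x \<in> extensional I" by (simp add: invC_def)
  fix N M assume NM: "N \<in> I" "M \<in> I" "N \<subseteq> M"
  obtain g where g: "g \<in> carrier G" "x N = N #> g" using rep_C[OF x NM(1)] .
  show "\<exists>a\<in>carrier G. invC x N = N #> a \<and> invC x M = M #> a"
    using g NM C_mono[OF x NM g] by (intro bexI[of _ "inv g"]) (auto simp: invC_def set_inv_rcos)
qed

lemma invC_left: assumes x: "x \<in> carrier C" shows "invC x \<otimes>\<^bsub>C\<^esub> x = \<one>\<^bsub>C\<^esub>"
proof (rule ext)
  fix N show "(invC x \<otimes>\<^bsub>C\<^esub> x) N = \<one>\<^bsub>C\<^esub> N"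
  proof (cases "N \<in> I")
    case True
    obtain g where g: "g \<in> carrier G" "x N = N #> g" using rep_C[OF x True] .
    then show ?thesis using True I_subgroup[OF True, THEN subgroup.subset]
      by (simp add: mult_C one_C invC_def set_inv_rcos rcos_mult coset_mult_one)
  qed (simp add: mult_C one_C)
qed

lemma group_C: "group C"
proof (rule groupI)
  show "\<one>\<^bsub>C\<^esub> \<in> carrier C" using embed_C[of \<one>] embed_one by simp
  show "x \<otimes>\<^bsub>C\<^esub> y \<in> carrier C" if "x \<in> carrier C" "y \<in> carrier C" for x y using mult_closed that .
  show "\<exists>y\<in>carrier C. y \<otimes>\<^bsub>C\<^esub> x = \<one>\<^bsub>C\<^esub>" if "x \<in> carrier C" for x
    using invC_closed[OF that] invC_left[OF that] by blast
  show "\<one>\<^bsub>C\<^esub> \<otimes>\<^bsub>C\<^esub> x = x" if x: "x \<in> carrier C" for x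
  proof (rule C_eqI)
    show "\<one>\<^bsub>C\<^esub> \<otimes>\<^bsub>C\<^esub> x \<in> carrier C" using mult_closed[OF embed_C[of \<one>] x] embed_one by simp
    fix N assume N: "N \<in> I"
    obtain g where g: "g \<in> carrier G" "x N = N #> g" using rep_C[OF x N] .
    show "(\<one>\<^bsub>C\<^esub> \<otimes>\<^bsub>C\<^esub> x) N = x N"
      using N g rcos_mult[OF N one_closed g(1)] I_subgroup[OF N, THEN subgroup.subset] by (simp add: mult_C one_C coset_mult_one)
  qed (rule x)
  fix x y z assume xyz: "x \<in> carrier C" "y \<in> carrier C" "z \<in> carrier C"
  show "x \<otimes>\<^bsub>C\<^esub> y \<otimes>\<^bsub>C\<^esub> z = x \<otimes>\<^bsub>C\<^esub> (y \<otimes>\<^bsub>C\<^esub> z)"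
  proof (rule C_eqI)
    fix N assume N: "N \<in> I"
    obtain a where a: "a \<in> carrier G" "x N = N #> a" using rep_C[OF xyz(1) N] .
    obtain b where b: "b \<in> carrier G" "y N = N #> b" using rep_C[OF xyz(2) N] .
    obtain c where c: "c \<in> carrier G" "z N = N #> c" using rep_C[OF xyz(3) N] .
    show "(x \<otimes>\<^bsub>C\<^esub> y \<otimes>\<^bsub>C\<^esub> z) N = (x \<otimes>\<^bsub>C\<^esub> (y \<otimes>\<^bsub>C\<^esub> z)) N"
      using N a b c by (simp add: mult_C rcos_mult m_assoc)
  qed (use xyz mult_closed in auto)
qed

lemma inv_C: "x \<in> carrier C \<Longrightarrow> inv\<^bsub>C\<^esub> x = invC x"
  using group.inv_equality[OF group_C invC_left] invC_closed by blast

lemma T_eq: "T = subtopology (product_topology (\<lambda>N. discrete_topology (rcosets N)) I) (carrier C)"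
  by (simp add: T_def pro_p_completion_topology_def I_def[symmetric] C_def[symmetric] FactGroup_def)

lemma top_T: "topspace T = carrier C"
proof -
  have "carrier C \<subseteq> (\<Pi>\<^sub>E N\<in>I. rcosets N)" unfolding carrier_C_iff subset_iff by blast
  then show ?thesis by (simp add: T_eq Int_absorb1)
qed

lemma proj_continuous: "N \<in> I \<Longrightarrow> continuous_map T (discrete_topology (rcosets N)) (\<lambda>x. x N)"
  unfolding T_eq by (rule continuous_map_from_subtopology) (rule continuous_map_product_projection)

lemma clopen_proj: assumes "N \<in> I" shows "openin T {x \<in> carrier C. x N \<in> A}" "closedin T {x \<in> carrier C. x N \<in> A}"
proof -
  have e: "{x \<in> carrier C. x N \<in> A} = {x \<in> topspace T. x N \<in> A \<inter> rcosets N}"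
    using assms C_rcosets by (auto simp: top_T)
  show "openin T {x \<in> carrier C. x N \<in> A}" unfolding e
    by (rule openin_continuous_map_preimage[OF proj_continuous[OF assms]]) simp
  show "closedin T {x \<in> carrier C. x N \<in> A}" unfolding e
    by (rule closedin_continuous_map_preimage[OF proj_continuous[OF assms]]) simp
qed

text \<open>Coherence is a family of conditions on two coordinates each, and such a condition is
  closed for discrete factors. So the completion is a closed subspace of a product of finite spaces,
  which is compact by Tychonoff's theorem.\<close>

lemma compact_T: "compact_space T" and Hausdorff_T: "Hausdorff_space T"
proof -
  let ?P = "product_topology (\<lambda>N. discrete_topology (rcosets N)) I"
  have pr: "continuous_map ?P (discrete_topology (rcosets N)) (\<lambda>x. x N)" if "N \<in> I" for N
    using that by (rule continuous_map_product_projection)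
  have cl: "closedin ?P {x \<in> topspace ?P. (x N, x M) \<in> A}" if NM: "N \<in> I" "M \<in> I" for N M A
  proof -
    let ?D = "\<lambda>N. discrete_topology (rcosets N)"
    have "continuous_map ?P (prod_topology (?D N) (?D M)) (\<lambda>x. (x N, x M))"
      by (rule continuous_map_pairedI) (rule pr[OF NM(1)], rule pr[OF NM(2)])
    moreover have "closedin (prod_topology (?D N) (?D M)) (A \<inter> (rcosets N) \<times> (rcosets M))"
      by (simp flip: prod_topology_discrete_topology)
    ultimately have "closedin ?P {x \<in> topspace ?P. (x N, x M) \<in> A \<inter> (rcosets N) \<times> (rcosets M)}"
      by (rule closedin_continuous_map_preimage)
    moreover have "{x \<in> topspace ?P. (x N, x M) \<in> A \<inter> (rcosets N) \<times> (rcosets M)} = {x \<in> topspace ?P. (x N, x M) \<in> A}"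
      using NM by auto
    ultimately show ?thesis by simp
  qed
  let ?Z = "{z \<in> I \<times> I. fst z \<subseteq> snd z}"
  have "closedin ?P (\<Inter>z\<in>?Z. {x \<in> topspace ?P. (x (fst z), x (snd z)) \<in> {(A, B). B = snd z <#> A}})"
    using carrier_I by (intro closedin_INT cl) auto
  moreover have "(\<Inter>z\<in>?Z. {x \<in> topspace ?P. (x (fst z), x (snd z)) \<in> {(A, B). B = snd z <#> A}}) = carrier C"
    unfolding carrier_C_iff set_eq_iff using carrier_I by simp blast
  ultimately have cl: "closedin ?P (carrier C)" by simp
  have "compact_space ?P"
    unfolding compact_space_product_topology by (auto simp: compact_space_discrete_topology I_iff)
  then show "compact_space T" unfolding T_eq
    by (intro compact_space_subtopology closedin_compact_space cl)
  show "Hausdorff_space T" unfolding T_eq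
    by (intro Hausdorff_space_subtopology) (simp add: Hausdorff_space_product_topology)
qed

lemma continuous_into_C:
  assumes "f ` topspace Z \<subseteq> carrier C"
    and "\<And>N. N \<in> I \<Longrightarrow> continuous_map Z (discrete_topology (rcosets N)) (\<lambda>z. f z N)"
  shows "continuous_map Z T f"
  unfolding T_eq
proof (rule continuous_map_into_subtopology)
  have "f ` topspace Z \<subseteq> extensional I"
    using assms(1) unfolding carrier_C_iff PiE_iff image_subset_iff by blast
  then show "continuous_map Z (product_topology (\<lambda>N. discrete_topology (rcosets N)) I) f"
    using assms(2) by (auto simp: continuous_map_componentwise)
qed (use assms(1) in blast)

lemma topological_group_C: "is_topological_group C T"
  unfolding is_topological_group_def
proof (intro conjI group_C top_T)
  let ?D = "\<lambda>N. discrete_topology (rcosets N)"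
  show "continuous_map (prod_topology T T) T (\<lambda>(x, y). x \<otimes>\<^bsub>C\<^esub> y)"
  proof (rule continuous_into_C)
    show "(\<lambda>(x, y). x \<otimes>\<^bsub>C\<^esub> y) ` topspace (prod_topology T T) \<subseteq> carrier C"
      using mult_closed by (auto simp: top_T)
    fix N assume N: "N \<in> I"
    have 1: "continuous_map (prod_topology T T) (prod_topology (?D N) (?D N)) (\<lambda>z. (fst z N, snd z N))"
      by (intro continuous_map_pairedI continuous_map_compose[OF continuous_map_fst proj_continuous[OF N], unfolded comp_def]
          continuous_map_compose[OF continuous_map_snd proj_continuous[OF N], unfolded comp_def])
    have 2: "continuous_map (prod_topology (?D N) (?D N)) (?D N) (\<lambda>(A, B). A <#> B)"
      using N by (auto simp: RCOSETS_def rcos_mult simp flip: prod_topology_discrete_topology)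
    have "continuous_map (prod_topology T T) (?D N) (\<lambda>z. fst z N <#> snd z N)"
      using continuous_map_compose[OF 1 2] by (simp add: comp_def)
    then show "continuous_map (prod_topology T T) (?D N) (\<lambda>z. (case z of (x, y) \<Rightarrow> x \<otimes>\<^bsub>C\<^esub> y) N)"
      using N by (simp add: mult_C case_prod_beta)
  qed
  have "continuous_map T T invC"
  proof (rule continuous_into_C)
    show "invC ` topspace T \<subseteq> carrier C" using invC_closed by (auto simp: top_T)
    fix N assume N: "N \<in> I"
    have "continuous_map (?D N) (?D N) (\<lambda>A. set_inv A)"
      using N by (auto simp: RCOSETS_def set_inv_rcos)
    from continuous_map_compose[OF proj_continuous[OF N] this]
    show "continuous_map T (?D N) (\<lambda>x. invC x N)" using N by (simp add: comp_def invC_def)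
  qed
  then show "continuous_map T T (\<lambda>x. inv\<^bsub>C\<^esub> x)"
    by (rule continuous_map_eq) (simp add: top_T inv_C)
qed

definition Kn :: "'a set \<Rightarrow> ('a set \<Rightarrow> 'a set) set" where "Kn N = {x \<in> carrier C. x N = N}"

text \<open>A basic neighbourhood restricts finitely many coordinates, and these are all determined
  by the coordinate at one smaller normal subgroup.\<close>

lemma Kn_base: assumes U: "openin T U" "\<one>\<^bsub>C\<^esub> \<in> U" shows "\<exists>N\<in>I. Kn N \<subseteq> U"
proof -
  obtain W where W: "openin (product_topology (\<lambda>N. discrete_topology (rcosets N)) I) W" "U = W \<inter> carrier C"
    using U(1) by (auto simp: T_eq openin_subtopology)
  have "\<one>\<^bsub>C\<^esub> \<in> W" using U(2) W(2) by blast
  then obtain V where V: "finite {N \<in> I. V N \<noteq> rcosets N}" "\<one>\<^bsub>C\<^esub> \<in> Pi\<^sub>E I V" "Pi\<^sub>E I V \<subseteq> W"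
    using W(1) unfolding openin_product_topology_alt by fastforce
  obtain N where N: "N \<in> I" "\<forall>M\<in>{N \<in> I. V N \<noteq> rcosets N}. N \<subseteq> M"
    using I_Inter[OF V(1)] by auto
  have "Kn N \<subseteq> U"
  proof
    fix x assume "x \<in> Kn N"
    then have x: "x \<in> carrier C" "x N = N #> \<one>"
      using I_subgroup[OF N(1), THEN subgroup.subset] by (auto simp: Kn_def)
    have "x M \<in> V M" if M: "M \<in> I" for M
    proof (cases "V M = rcosets M")
      case True then show ?thesis using C_rcosets[OF x(1) M] by simp
    next
      case False
      then have "x M = M #> \<one>" using N M C_mono[OF x(1) N(1) M _ _ x(2)] by blast
      then have "x M = \<one>\<^bsub>C\<^esub> M" using M I_subgroup[OF M, THEN subgroup.subset] by (simp add: one_C)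
      then show ?thesis using V(2) M by (auto simp: PiE_iff)
    qed
    then have "x \<in> Pi\<^sub>E I V" using x(1) unfolding carrier_C_iff PiE_iff by blast
    then show "x \<in> U" using V(3) W(2) x(1) by blast
  qed
  then show ?thesis using N(1) by blast
qed

lemma subgroup_Kn: assumes N: "N \<in> I" shows "subgroup (Kn N) C"
proof (rule group.subgroupI[OF group_C])
  have s: "N \<subseteq> carrier G" using N I_subgroup subgroup.subset by blast
  have e: "x \<in> Kn N \<longleftrightarrow> x \<in> carrier C \<and> x N = N #> \<one>" for x using s by (simp add: Kn_def)
  show "Kn N \<subseteq> carrier C" by (auto simp: Kn_def)
  have "embed \<one> \<in> Kn N" unfolding e using embed_C[of \<one>] N by (simp add: embed_def)
  then show "Kn N \<noteq> {}" by blast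
  show "inv\<^bsub>C\<^esub> x \<in> Kn N" if "x \<in> Kn N" for x
    using that N set_inv_rcos[OF N one_closed] by (simp add: e inv_C invC_closed) (simp add: invC_def)
  show "x \<otimes>\<^bsub>C\<^esub> y \<in> Kn N" if "x \<in> Kn N" "y \<in> Kn N" for x y
    using that N rcos_mult[OF N one_closed one_closed] by (simp add: e mult_closed) (simp add: mult_C)
qed

lemma open_Kn: "N \<in> I \<Longrightarrow> openin T (Kn N)"
  using clopen_proj(1)[of N "{N}"] by (simp add: Kn_def)

lemma profinite_C: "is_profinite_group C T"
  unfolding is_profinite_group_def
  using topological_group_C compact_T Hausdorff_T Kn_base subgroup_Kn open_Kn by blast

text \<open>Density of the image: at any coordinate N an element of the completion agrees with some
  \<open>embed g\<close>.\<close>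

lemma near_embed: assumes x: "x \<in> carrier C" and N: "N \<in> I"
  obtains g where "g \<in> carrier G" "x N = N #> g" "x \<otimes>\<^bsub>C\<^esub> inv\<^bsub>C\<^esub> (embed g) \<in> Kn N"
proof -
  obtain g where g: "g \<in> carrier G" "x N = N #> g" using rep_C[OF x N] .
  have "(x \<otimes>\<^bsub>C\<^esub> invC (embed g)) N = N"
    using g N I_subgroup[OF N, THEN subgroup.subset]
    by (simp add: mult_C invC_def embed_def set_inv_rcos rcos_mult)
  moreover have "x \<otimes>\<^bsub>C\<^esub> invC (embed g) \<in> carrier C" using x g mult_closed invC_closed embed_C by blast
  ultimately show ?thesis using that g embed_C[OF g(1)] by (simp add: Kn_def inv_C)
qed

lemma embed_inv: "g \<in> carrier G \<Longrightarrow> embed (inv g) = inv\<^bsub>C\<^esub> (embed g)"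
  by (simp add: inv_C embed_C) (simp add: invC_def embed_def set_inv_rcos cong: restrict_cong)

section \<open>Subgroups of the group and of its completion\<close>

definition trace :: "('a set \<Rightarrow> 'a set) set \<Rightarrow> 'a set" where "trace V = {g \<in> carrier G. embed g \<in> V}"

lemma trace_iff: "g \<in> trace V \<longleftrightarrow> g \<in> carrier G \<and> embed g \<in> V" by (simp add: trace_def)

lemma rcos_eqC:
  assumes "subgroup V C" "x \<in> carrier C" "y \<in> carrier C"
  shows "V #>\<^bsub>C\<^esub> x = V #>\<^bsub>C\<^esub> y \<longleftrightarrow> x \<otimes>\<^bsub>C\<^esub> inv\<^bsub>C\<^esub> y \<in> V"
  using assms by (metis group_C group.repr_independence group.rcos_self subgroup.rcos_module)

lemma subgroup_trace: assumes V: "subgroup V C" shows "subgroup (trace V) G"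
proof (rule subgroupI)
  show "trace V \<subseteq> carrier G" by (auto simp: trace_def)
  show "trace V \<noteq> {}" using subgroup.one_closed[OF V] embed_one by (auto simp: trace_def)
  show "inv a \<in> trace V" if "a \<in> trace V" for a
    using that subgroup.m_inv_closed[OF V] by (simp add: trace_iff embed_inv)
  show "a \<otimes> b \<in> trace V" if "a \<in> trace V" "b \<in> trace V" for a b
    using that subgroup.m_closed[OF V] by (simp add: trace_iff embed_mult)
qed

text \<open>By density each coset of \<open>V\<close> contains some \<open>embed g\<close>, and two
  of these lie in one coset exactly if their origins agree modulo \<open>trace V\<close>.\<close>

lemma card_rcosets_trace:
  assumes V: "subgroup V C" and N: "N \<in> I" and NV: "Kn N \<subseteq> V"
  shows "finite (rcosets\<^bsub>C\<^esub> V)" "finite (rcosets (trace V))"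
    "card (rcosets\<^bsub>C\<^esub> V) = card (rcosets (trace V))"
proof -
  let ?K = "trace V"
  have K: "subgroup ?K G" by (rule subgroup_trace[OF V])
  have NK: "N \<subseteq> ?K"
  proof
    fix g assume g: "g \<in> N"
    then have "g \<in> carrier G" by (rule subgroup.mem_carrier[OF I_subgroup[OF N]])
    then have "embed g \<in> Kn N" using g N coset_join2[OF _ I_subgroup[OF N]] embed_C by (simp add: Kn_def) (simp add: embed_def)
    then show "g \<in> ?K" using NV \<open>g \<in> carrier G\<close> by (auto simp: trace_def)
  qed
  have "rcosets ?K \<subseteq> (\<lambda>A. ?K <#> A) ` (rcosets N)"
    using set_mult_rcos[OF I_subgroup[OF N] K NK] by (auto simp: RCOSETS_def image_iff)
  then show fin: "finite (rcosets ?K)" by (rule finite_subset) (use N in \<open>simp add: I_iff\<close>)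
  have eq: "?K #> g = ?K #> h \<longleftrightarrow> V #>\<^bsub>C\<^esub> embed g = V #>\<^bsub>C\<^esub> embed h" if "g \<in> carrier G" "h \<in> carrier G" for g h
    using that by (simp add: rcos_eq[OF K] rcos_eqC[OF V] embed_C trace_iff embed_mult embed_inv)
  define F where "F A = V #>\<^bsub>C\<^esub> embed (SOME g. g \<in> carrier G \<and> A = ?K #> g)" for A
  have F: "F (?K #> g) = V #>\<^bsub>C\<^esub> embed g" if g: "g \<in> carrier G" for g
  proof -
    let ?P = "\<lambda>h. h \<in> carrier G \<and> ?K #> g = ?K #> h"
    have "?P (SOME h. ?P h)" by (rule someI[of ?P g]) (use g in simp)
    then show ?thesis using eq[OF g] unfolding F_def by metis
  qed
  have inj: "inj_on F (rcosets ?K)"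
  proof (rule inj_onI)
    fix A B assume AB: "A \<in> rcosets ?K" "B \<in> rcosets ?K" and FF: "F A = F B"
    obtain g where g: "g \<in> carrier G" "A = ?K #> g" using AB(1) by (auto simp: RCOSETS_def)
    obtain h where h: "h \<in> carrier G" "B = ?K #> h" using AB(2) by (auto simp: RCOSETS_def)
    show "A = B" using FF eq[OF g(1) h(1)] F g h by simp
  qed
  have img: "F ` (rcosets ?K) = rcosets\<^bsub>C\<^esub> V"
  proof
    show "F ` (rcosets ?K) \<subseteq> rcosets\<^bsub>C\<^esub> V" using F embed_C by (auto simp: RCOSETS_def)
    show "rcosets\<^bsub>C\<^esub> V \<subseteq> F ` (rcosets ?K)"
    proof
      fix A assume "A \<in> rcosets\<^bsub>C\<^esub> V"
      then obtain x where x: "x \<in> carrier C" "A = V #>\<^bsub>C\<^esub> x" by (auto simp: RCOSETS_def)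
      obtain g where g: "g \<in> carrier G" "x \<otimes>\<^bsub>C\<^esub> inv\<^bsub>C\<^esub> (embed g) \<in> Kn N" using near_embed[OF x(1) N] by blast
      then have "A = F (?K #> g)" using rcos_eqC[OF V x(1) embed_C[OF g(1)]] NV x(2) F[OF g(1)] by auto
      then show "A \<in> F ` (rcosets ?K)" using g(1) by (auto simp: RCOSETS_def)
    qed
  qed
  show "finite (rcosets\<^bsub>C\<^esub> V)" using fin img by (metis finite_imageI)
  show "card (rcosets\<^bsub>C\<^esub> V) = card (rcosets ?K)" using inj img by (metis card_image)
qed

lemma pro_p_C: "is_pro_p_group p C T"
  unfolding is_pro_p_group_def
proof (intro conjI profinite_C allI impI, elim conjE)
  fix V assume V: "V \<lhd> C" "openin T V"
  have sV: "subgroup V C" using V(1) by (rule normal_imp_subgroup)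
  obtain N where N: "N \<in> I" "Kn N \<subseteq> V" using Kn_base[OF V(2) subgroup.one_closed[OF sV]] by blast
  note card = card_rcosets_trace[OF sV N]
  have "trace V \<lhd> G"
    unfolding normal_inv_iff using subgroup_trace[OF sV] V(1)[unfolded group.normal_inv_iff[OF group_C]]
    by (auto simp: trace_iff embed_mult embed_inv embed_C)
  then show "\<exists>m. card (rcosets\<^bsub>C\<^esub> V) = p ^ m"
    using p_group_normal_index[OF p_group _ prime_p card(2)] card(3) by simp
qed

text \<open>The complement is a finite union of cosets, each closed as the preimage of
  \<open>V\<close> under a translation.\<close>

lemma closed_finite_index_open:
  assumes V: "subgroup V C" "finite (rcosets\<^bsub>C\<^esub> V)" "closedin T V" shows "openin T V"
proof -
  have cl: "closedin T A" if "A \<in> rcosets\<^bsub>C\<^esub> V" for A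
  proof -
    obtain x where x: "x \<in> carrier C" "A = V #>\<^bsub>C\<^esub> x" using \<open>A \<in> rcosets\<^bsub>C\<^esub> V\<close> unfolding RCOSETS_def by blast
    have ix: "inv\<^bsub>C\<^esub> x \<in> carrier C" using x(1) group.inv_closed[OF group_C] by blast
    have 1: "continuous_map T (prod_topology T T) (\<lambda>y. (y, inv\<^bsub>C\<^esub> x))"
      using ix by (intro continuous_map_pairedI) (simp_all add: top_T)
    have 2: "continuous_map (prod_topology T T) T (\<lambda>(x, y). x \<otimes>\<^bsub>C\<^esub> y)"
      using topological_group_C by (simp add: is_topological_group_def)
    have "closedin T {y \<in> topspace T. y \<otimes>\<^bsub>C\<^esub> inv\<^bsub>C\<^esub> x \<in> V}"
      using closedin_continuous_map_preimage[OF continuous_map_compose[OF 1 2] V(3)] by (simp add: comp_def)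
    moreover have "{y \<in> topspace T. y \<otimes>\<^bsub>C\<^esub> inv\<^bsub>C\<^esub> x \<in> V} = A"
      using x group.rcosets_sub[OF group_C V(1) that] subgroup.rcos_module[OF V(1) group_C x(1)] by (auto simp: top_T)
    ultimately show ?thesis by simp
  qed
  have VV: "V \<in> rcosets\<^bsub>C\<^esub> V" by (rule subgroup.subgroup_in_rcosets[OF V(1) group_C])
  have "V = topspace T - \<Union>(rcosets\<^bsub>C\<^esub> V - {V})"
  proof -
    have "\<Union>(rcosets\<^bsub>C\<^esub> V) = topspace T" using group.rcosets_part_G[OF group_C V(1)] by (simp add: top_T)
    moreover have "A \<inter> V = {}" if "A \<in> rcosets\<^bsub>C\<^esub> V - {V}" for A
      using group.rcos_disjoint[OF group_C V(1)] that VV by (auto simp: pairwise_def disjnt_def)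
    ultimately show ?thesis using VV by blast
  qed
  moreover have "closedin T (\<Union>(rcosets\<^bsub>C\<^esub> V - {V}))" using V(2) cl by (intro closedin_Union) auto
  ultimately show ?thesis by (metis openin_diff openin_topspace)
qed

text \<open>The closure of the image of \<open>K\<close> in the completion.\<close>

definition hat :: "'a set \<Rightarrow> ('a set \<Rightarrow> 'a set) set" where
  "hat K = {x \<in> carrier C. \<exists>N\<in>I. N \<subseteq> K \<and> x N \<subseteq> K}"

lemma rcos_subset_iff:
  assumes "subgroup K G" "N \<in> I" "N \<subseteq> K" "g \<in> carrier G" shows "N #> g \<subseteq> K \<longleftrightarrow> g \<in> K"
proof
  show "N #> g \<subseteq> K" if "g \<in> K" using that assms subgroup.m_closed[OF assms(1)] by (auto simp: r_coset_def)
  show "g \<in> K" if "N #> g \<subseteq> K" using that rcos_self[OF assms(4) I_subgroup[OF assms(2)]] by blast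
qed

text \<open>Membership in \<open>hat K\<close> asks for some N; comparing two choices at their
  intersection shows that any N inside K decides it.\<close>

lemma hat_iff:
  assumes K: "subgroup K G" and N: "N \<in> I" "N \<subseteq> K" and x: "x \<in> carrier C" and g: "g \<in> carrier G" "x N = N #> g"
  shows "x \<in> hat K \<longleftrightarrow> g \<in> K"
proof
  show "x \<in> hat K" if "g \<in> K"
    using that rcos_subset_iff[OF K N g(1)] N x g by (auto simp: hat_def)
  assume "x \<in> hat K"
  then obtain M where M: "M \<in> I" "M \<subseteq> K" "x M \<subseteq> K" by (auto simp: hat_def)
  have NM: "N \<inter> M \<in> I" by (rule I_Int[OF N(1) M(1)])
  obtain h where h: "h \<in> carrier G" "x (N \<inter> M) = N \<inter> M #> h" using rep_C[OF x NM] .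
  have "x M = M #> h" using C_mono[OF x NM M(1) _ h] by blast
  then have hK: "h \<in> K" using M(3) rcos_subset_iff[OF K M(1,2) h(1)] by simp
  have "x N = N #> h" using C_mono[OF x NM N(1) _ h] by blast
  then have "N #> g \<subseteq> K" using g(2) hK rcos_subset_iff[OF K N h(1)] by simp
  then show "g \<in> K" using rcos_subset_iff[OF K N g(1)] by simp
qed

lemma ex_core: assumes "subgroup K G" "finite (rcosets K)" shows "\<exists>N\<in>I. N \<subseteq> K"
  using ncore_subset[OF assms(1)] ncore_normal[OF assms(1)] ncore_finite_index[OF assms] by (auto simp: I_iff)

lemma hat_props:
  assumes K: "subgroup K G" "finite (rcosets K)"
  shows "subgroup (hat K) C" "closedin T (hat K)" "trace (hat K) = K" "\<exists>N\<in>I. Kn N \<subseteq> hat K"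
proof -
  obtain N where N: "N \<in> I" "N \<subseteq> K" using ex_core[OF K] by blast
  note h = hat_iff[OF K(1) N]
  have s: "N \<subseteq> carrier G" using I_subgroup[OF N(1)] subgroup.subset by blast
  have embed: "embed g \<in> hat K \<longleftrightarrow> g \<in> K" if "g \<in> carrier G" for g
    using h[OF embed_C[OF that] that] N(1) by (simp add: embed_def)
  show "trace (hat K) = K" using embed subgroup.subset[OF K(1)] by (auto simp: trace_def)
  show "\<exists>N\<in>I. Kn N \<subseteq> hat K"
  proof (intro bexI[of _ N] subsetI)
    fix x assume "x \<in> Kn N"
    then show "x \<in> hat K" using h[of x \<one>] s subgroup.one_closed[OF K(1)] by (simp add: Kn_def)
  qed (rule N)
  have "hat K = {x \<in> carrier C. x N \<in> Pow K}"
  proof -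
    have "x \<in> hat K \<longleftrightarrow> x N \<subseteq> K" if x: "x \<in> carrier C" for x
    proof -
      obtain g where g: "g \<in> carrier G" "x N = N #> g" using rep_C[OF x N(1)] .
      show ?thesis using h[OF x g] rcos_subset_iff[OF K(1) N g(1)] g(2) by simp
    qed
    moreover have "hat K \<subseteq> carrier C" by (auto simp: hat_def)
    ultimately show ?thesis by auto
  qed
  then show "closedin T (hat K)" by (simp only: clopen_proj(2)[OF N(1)])
  show "subgroup (hat K) C"
  proof (rule group.subgroupI[OF group_C])
    show sub: "hat K \<subseteq> carrier C" by (auto simp: hat_def)
    show "hat K \<noteq> {}" using embed[of \<one>] subgroup.one_closed[OF K(1)] by auto
    show "inv\<^bsub>C\<^esub> x \<in> hat K" if x: "x \<in> hat K" for x
    proof -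
      have xC: "x \<in> carrier C" using x sub by blast
      obtain g where g: "g \<in> carrier G" "x N = N #> g" using rep_C[OF xC N(1)] .
      have "invC x N = N #> inv g" using N(1) g by (simp add: invC_def set_inv_rcos)
      then show ?thesis using h[OF xC g] h[OF invC_closed[OF xC] inv_closed[OF g(1)]] x
          subgroup.m_inv_closed[OF K(1)] by (simp add: inv_C[OF xC])
    qed
    show "x \<otimes>\<^bsub>C\<^esub> y \<in> hat K" if xy: "x \<in> hat K" "y \<in> hat K" for x y
    proof -
      have xC: "x \<in> carrier C" and yC: "y \<in> carrier C" using xy sub by blast+
      obtain a where a: "a \<in> carrier G" "x N = N #> a" using rep_C[OF xC N(1)] .
      obtain b where b: "b \<in> carrier G" "y N = N #> b" using rep_C[OF yC N(1)] .
      have "(x \<otimes>\<^bsub>C\<^esub> y) N = N #> (a \<otimes> b)" using N(1) a b by (simp add: mult_C rcos_mult)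
      then show ?thesis using h[OF xC a] h[OF yC b] h[OF mult_closed[OF xC yC] m_closed[OF a(1) b(1)]] xy
          subgroup.m_closed[OF K(1)] by simp
    qed
  qed
qed

text \<open>Both subgroups contain some \<open>Kn\<close>. Modulo the smaller one an element may be
  replaced by an \<open>embed g\<close>, and there they agree because
  \<open>trace (hat K) = K\<close>.\<close>

lemma hat_trace:
  assumes V: "subgroup V C" and N: "N \<in> I" and NV: "Kn N \<subseteq> V" shows "hat (trace V) = V"
proof -
  note c = card_rcosets_trace[OF V N NV]
  have K: "subgroup (trace V) G" by (rule subgroup_trace[OF V])
  obtain M where M: "M \<in> I" "Kn M \<subseteq> hat (trace V)" using hat_props(4)[OF K c(2)] by blast
  have eq: "x \<in> hat (trace V) \<longleftrightarrow> x \<in> V" if x: "x \<in> carrier C" for x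
  proof -
    have NM: "N \<inter> M \<in> I" by (rule I_Int[OF N M(1)])
    obtain g where g: "g \<in> carrier G" "x \<otimes>\<^bsub>C\<^esub> inv\<^bsub>C\<^esub> (embed g) \<in> Kn (N \<inter> M)" using near_embed[OF x NM] by blast
    have "Kn (N \<inter> M) \<subseteq> Kn N \<inter> Kn M"
    proof
      fix z assume "z \<in> Kn (N \<inter> M)"
      then have z: "z \<in> carrier C" "z (N \<inter> M) = N \<inter> M #> \<one>"
        using I_subgroup[OF NM, THEN subgroup.subset] by (auto simp: Kn_def)
      show "z \<in> Kn N \<inter> Kn M"
        using C_mono[OF z(1) NM N _ _ z(2)] C_mono[OF z(1) NM M(1) _ _ z(2)] z(1)
          I_subgroup[OF N, THEN subgroup.subset] I_subgroup[OF M(1), THEN subgroup.subset] by (simp add: Kn_def)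
    qed
    then have in2: "x \<otimes>\<^bsub>C\<^esub> inv\<^bsub>C\<^esub> (embed g) \<in> V" "x \<otimes>\<^bsub>C\<^esub> inv\<^bsub>C\<^esub> (embed g) \<in> hat (trace V)" using g(2) NV M(2) by auto
    have tr: "y \<in> W \<longleftrightarrow> embed g \<in> W" if W: "subgroup W C" and y: "y \<in> carrier C" "y \<otimes>\<^bsub>C\<^esub> inv\<^bsub>C\<^esub> (embed g) \<in> W" for y W
      using rcos_eqC[OF W y(1) embed_C[OF g(1)]] y(2) group.coset_join1[OF group_C _ y(1) W]
        group.coset_join2[OF group_C y(1) W] group.coset_join1[OF group_C _ embed_C[OF g(1)] W]
        group.coset_join2[OF group_C embed_C[OF g(1)] W] subgroup.subset[OF W] by metis
    have "x \<in> hat (trace V) \<longleftrightarrow> g \<in> trace (hat (trace V))"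
      using tr[OF hat_props(1)[OF K c(2)] x in2(2)] g(1) by (simp add: trace_iff)
    also have "\<dots> \<longleftrightarrow> g \<in> trace V" using hat_props(3)[OF K c(2)] by simp
    also have "\<dots> \<longleftrightarrow> x \<in> V" using tr[OF V x in2(1)] g(1) by (simp add: trace_iff)
    finally show ?thesis .
  qed
  moreover have "hat (trace V) \<subseteq> carrier C" by (auto simp: hat_def)
  ultimately show ?thesis using subgroup.subset[OF V] by blast
qed

lemma bij_hat: "bij_betw hat (subgroups_index_le G n) (closed_subgroups_index_le C T n)"
proof (rule bij_betw_byWitness[where f' = trace])
  show "\<forall>K\<in>subgroups_index_le G n. trace (hat K) = K"
    using hat_props(3) by (auto simp: subgroups_index_le_def)
  have V: "\<exists>N\<in>I. Kn N \<subseteq> V" if "V \<in> closed_subgroups_index_le C T n" for V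
  proof -
    have "subgroup V C" "finite (rcosets\<^bsub>C\<^esub> V)" "closedin T V"
      using that by (auto simp: subgroups_index_le_def closed_subgroups_index_le_def)
    then show ?thesis using Kn_base[OF closed_finite_index_open] subgroup.one_closed by blast
  qed
  show "\<forall>V\<in>closed_subgroups_index_le C T n. hat (trace V) = V"
    using V hat_trace by (fastforce simp: subgroups_index_le_def closed_subgroups_index_le_def)
  show "trace ` closed_subgroups_index_le C T n \<subseteq> subgroups_index_le G n"
  proof
    fix K assume "K \<in> trace ` closed_subgroups_index_le C T n"
    then obtain V where V': "V \<in> closed_subgroups_index_le C T n" "K = trace V" by blast
    then obtain N where N: "N \<in> I" "Kn N \<subseteq> V" using V by blast
    have sV: "subgroup V C" "card (rcosets\<^bsub>C\<^esub> V) \<le> n"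
      using V'(1) by (auto simp: subgroups_index_le_def closed_subgroups_index_le_def)
    show "K \<in> subgroups_index_le G n"
      using card_rcosets_trace[OF sV(1) N] subgroup_trace[OF sV(1)] sV(2) V'(2) by (simp add: subgroups_index_le_def)
  qed
  show "hat ` subgroups_index_le G n \<subseteq> closed_subgroups_index_le C T n"
  proof
    fix V assume "V \<in> hat ` subgroups_index_le G n"
    then obtain K where K: "subgroup K G" "finite (rcosets K)" "card (rcosets K) \<le> n" "V = hat K"
      by (auto simp: subgroups_index_le_def)
    note h = hat_props[OF K(1,2)]
    obtain N where N: "N \<in> I" "Kn N \<subseteq> hat K" using h(4) by blast
    show "V \<in> closed_subgroups_index_le C T n"
      using card_rcosets_trace[OF h(1) N] h K by (simp add: subgroups_index_le_def closed_subgroups_index_le_def)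
  qed
qed

end

lemma strict_growth_type_bij:
  assumes "\<And>n. bij_betw (F n) (S n) (S' n)" "strict_growth_type p f S" shows "strict_growth_type p f S'"
proof -
  have "card (S' n) = card (S n)" "finite (S' n) = finite (S n)" for n
    using bij_betw_same_card[OF assms(1)[of n]] bij_betw_finite[OF assms(1)[of n]] by simp_all
  then show ?thesis using assms(2) by (simp add: strict_growth_type_def)
qed

section \<open>Transport to sets of natural numbers\<close>

lemma card_rcosets_iso:
  assumes \<phi>: "\<phi> \<in> iso G H" and G: "group G" and H: "group H" and K: "subgroup K G"
  shows "finite (rcosets\<^bsub>H\<^esub> (\<phi> ` K)) = finite (rcosets\<^bsub>G\<^esub> K)" "card (rcosets\<^bsub>H\<^esub> (\<phi> ` K)) = card (rcosets\<^bsub>G\<^esub> K)"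
proof -
  have hom: "\<phi> \<in> hom G H" and inj: "inj_on \<phi> (carrier G)" and img: "\<phi> ` carrier G = carrier H"
    using \<phi> by (auto simp: Group.iso_iff)
  have Ks: "k \<in> K \<Longrightarrow> k \<in> carrier G" for k using subgroup.subset[OF K] by blast
  have coset: "(\<phi> ` K) #>\<^bsub>H\<^esub> \<phi> g = \<phi> ` (K #>\<^bsub>G\<^esub> g)" if "g \<in> carrier G" for g
    using that Ks hom_mult[OF hom] by (auto simp: r_coset_def image_UN)
  have eq: "rcosets\<^bsub>H\<^esub> (\<phi> ` K) = (`) \<phi> ` (rcosets\<^bsub>G\<^esub> K)"
  proof -
    have "rcosets\<^bsub>H\<^esub> (\<phi> ` K) = (\<lambda>y. (\<phi> ` K) #>\<^bsub>H\<^esub> y) ` \<phi> ` carrier G"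
      by (auto simp: RCOSETS_def img)
    also have "\<dots> = (\<lambda>g. \<phi> ` (K #>\<^bsub>G\<^esub> g)) ` carrier G"
      unfolding image_image by (rule image_cong[OF refl]) (rule coset)
    also have "\<dots> = (`) \<phi> ` (rcosets\<^bsub>G\<^esub> K)" by (auto simp: RCOSETS_def)
    finally show ?thesis .
  qed
  have "inj_on ((`) \<phi>) (rcosets\<^bsub>G\<^esub> K)"
    using inj group.rcosets_sub[OF G K] by (intro inj_onI) (metis inj_on_image_eq_iff)
  then show "finite (rcosets\<^bsub>H\<^esub> (\<phi> ` K)) = finite (rcosets\<^bsub>G\<^esub> K)" "card (rcosets\<^bsub>H\<^esub> (\<phi> ` K)) = card (rcosets\<^bsub>G\<^esub> K)"
    unfolding eq by (simp_all add: finite_image_iff card_image)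
qed

lemma bij_betw_subgroups_iso:
  assumes \<phi>: "\<phi> \<in> iso G H" and G: "group G" and H: "group H"
  shows "bij_betw ((`) \<phi>) (subgroups_index_le G n) (subgroups_index_le H n)"
proof (rule bij_betw_byWitness[where f' = "(`) (inv_into (carrier G) \<phi>)"])
  have inj: "inj_on \<phi> (carrier G)" and img: "\<phi> ` carrier G = carrier H"
    using \<phi> by (auto simp: Group.iso_iff)
  have sub: "(`) \<psi> ` subgroups_index_le A n \<subseteq> subgroups_index_le B n"
    if "\<psi> \<in> iso A B" "group A" "group B"
    for \<psi> and A :: "('x, 'u) monoid_scheme" and B :: "('y, 'v) monoid_scheme"
    using card_rcosets_iso[OF that] subgroup.iso_subgroup[OF _ that(2,3,1)]
    by (fastforce simp: subgroups_index_le_def)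
  show "(`) \<phi> ` subgroups_index_le G n \<subseteq> subgroups_index_le H n" by (rule sub[OF \<phi> G H])
  show "(`) (inv_into (carrier G) \<phi>) ` subgroups_index_le H n \<subseteq> subgroups_index_le G n"
    by (rule sub[OF group.iso_set_sym[OF G \<phi>] H G])
  show "\<forall>K\<in>subgroups_index_le G n. inv_into (carrier G) \<phi> ` \<phi> ` K = K"
    using inv_into_image_cancel[OF inj subgroup.subset] by (simp add: subgroups_index_le_def)
  show "\<forall>K\<in>subgroups_index_le H n. \<phi> ` inv_into (carrier G) \<phi> ` K = K"
    using image_inv_into_cancel[OF img subgroup.subset] by (simp add: subgroups_index_le_def)
qed

lemma is_p_group_iso:
  assumes \<phi>: "\<phi> \<in> iso G H" and H: "group H" and G: "is_p_group p G" and p: "Factorial_Ring.prime p"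
  shows "is_p_group p H"
proof -
  have gG: "group G" using G by (simp add: is_p_group_def)
  have "\<exists>m. group.ord H y = p ^ m" if y: "y \<in> carrier H" for y
  proof -
    obtain x where x: "x \<in> carrier G" "y = \<phi> x" using y \<phi>[unfolded Group.iso_iff, THEN conjunct2, THEN conjunct1, symmetric] by (auto simp only:)
    obtain m where m: "group.ord G x = p ^ m" using G x(1) by (auto simp: is_p_group_def)
    have hom: "\<phi> \<in> hom G H" using \<phi> by (simp add: Group.iso_iff)
    have "x [^]\<^bsub>G\<^esub> (p ^ m) = \<one>\<^bsub>G\<^esub>" using group.pow_ord_eq_1[OF gG x(1)] m by simp
    then have "y [^]\<^bsub>H\<^esub> (p ^ m) = \<one>\<^bsub>H\<^esub>"
      using hom_nat_pow[OF hom x(1) gG H] hom_one[OF hom gG H] x(2) by metis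
    then have "group.ord H y dvd p ^ m" using group.pow_eq_id[OF H y] by simp
    then show ?thesis using p by (meson divides_primepow_nat)
  qed
  then show ?thesis using H by (simp add: is_p_group_def)
qed

lemma residually_finite_iso:
  assumes \<phi>: "\<phi> \<in> iso G H" and H: "group H" and G: "residually_finite G"
  shows "residually_finite H"
proof -
  have gG: "group G" using G by (simp add: residually_finite_def)
  have hom: "\<phi> \<in> hom G H" and inj: "inj_on \<phi> (carrier G)" using \<phi> by (simp_all add: Group.iso_iff)
  have "\<exists>N. N \<lhd> H \<and> finite (rcosets\<^bsub>H\<^esub> N) \<and> y \<notin> N" if y: "y \<in> carrier H" "y \<noteq> \<one>\<^bsub>H\<^esub>" for y
  proof -
    obtain x where x: "x \<in> carrier G" "y = \<phi> x" using y(1) \<phi>[unfolded Group.iso_iff, THEN conjunct2, THEN conjunct1, symmetric] by (auto simp only:)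
    have "x \<noteq> \<one>\<^bsub>G\<^esub>" using y(2) x(2) hom_one[OF hom gG H] by metis
    then obtain N where N: "N \<lhd> G" "finite (rcosets\<^bsub>G\<^esub> N)" "x \<notin> N" using G x(1) by (auto simp: residually_finite_def)
    have sN: "subgroup N G" using N(1) by (rule normal_imp_subgroup)
    have "y \<notin> \<phi> ` N" using inj_on_image_mem_iff[OF inj x(1) subgroup.subset[OF sN]] x(2) N(3) by simp
    then show ?thesis
      using iso_normal_subgroup[OF \<phi> gG H N(1)] card_rcosets_iso(1)[OF \<phi> gG H sN] N(2) by blast
  qed
  then show ?thesis using H by (simp add: residually_finite_def)
qed

text \<open>The operations are pulled back to the whole target type through a partial inverse of f,
  which allows \<open>hom_imp_img_group\<close> to supply the group on the image.\<close>

lemma (in group) transport_iso: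
  fixes f :: "'a \<Rightarrow> 'x"
  assumes inj: "inj_on f (carrier G)"
  shows "\<exists>H :: 'x monoid. f \<in> iso G H \<and> group H"
proof -
  let ?g = "inv_into (carrier G) f"
  let ?M = "\<lparr>carrier = UNIV, mult = (\<lambda>x y. f (?g x \<otimes> ?g y)), one = f \<one>\<rparr>"
  have "f \<in> hom G ?M" using inj by (auto simp: hom_def)
  then have "group (?M\<lparr>carrier := f ` carrier G, one := f \<one>\<rparr>)" by (rule hom_imp_img_group)
  moreover have "f \<in> iso G (?M\<lparr>carrier := f ` carrier G, one := f \<one>\<rparr>)"
    using inj by (auto simp: iso_def hom_def bij_betw_def)
  ultimately show ?thesis by blast
qed

text \<open>The group has at most continuum many elements: each is determined by a set of triples over a
  countable type, the graphs of its two components.\<close>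

definition enc :: "semi \<Rightarrow> nat set" where
  "enc a = range (\<lambda>y. to_nat (Inl (y, rep_qz (mo a y)) :: (nat list \<times> rat) + (nat \<times> nat \<times> nat)))
    \<union> range (\<lambda>(i, n). to_nat (Inr (i, n, ap (gp a i) n) :: (nat list \<times> rat) + (nat \<times> nat \<times> nat)))"

lemma inj_enc: "inj enc"
proof (rule injI, rule semi_eqI)
  fix a b assume e: "enc a = enc b"
  let ?T = "to_nat :: (nat list \<times> rat) + (nat \<times> nat \<times> nat) \<Rightarrow> nat"
  have l: "?T (Inl (y, r)) \<in> enc a \<longleftrightarrow> r = rep_qz (mo a y)" for a y r
    unfolding enc_def by auto
  have r: "?T (Inr (i, n, m)) \<in> enc a \<longleftrightarrow> m = ap (gp a i) n" for a i n m
    unfolding enc_def by force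
  show "mo a y = mo b y" for y
    using l[of y "rep_qz (mo a y)" a] l[of y "rep_qz (mo a y)" b] e by (simp add: rep_qz_inject)
  show "gp a i = gp b i" for i
    using r[of i _ _ a] r[of i _ _ b] e by (intro nperm_eqI) simp
qed

context spinal_k
begin

text \<open>The subgroups from \<open>separates\<close> need not be normal, but their normal cores
  still have finite index and miss a.\<close>

lemma residually_finite_H: "residually_finite (GA H)"
  unfolding residually_finite_def
proof (intro conjI ballI impI)
  interpret GH: group "GA H" by (rule group_GA[OF subgrp_H])
  show "group (GA H)" by (rule GH.is_group)
  fix a assume a: "a \<in> carrier (GA H)" "a \<noteq> \<one>\<^bsub>GA H\<^esub>"
  then obtain W n where W: "subgrp W" "W \<subseteq> H" "cov n H W" "a \<notin> W" using separates[of a] by auto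
  have sW: "subgroup W (GA H)" using W by (simp add: subgroup_GA[OF subgrp_H])
  have "finite (rcosets\<^bsub>GA H\<^esub> W)" using rc_cov(1)[OF subgrp_H W(1,3)] by (simp add: rcosets_GA)
  then show "\<exists>N. N \<lhd> GA H \<and> finite (rcosets\<^bsub>GA H\<^esub> N) \<and> a \<notin> N"
    using GH.ncore_normal[OF sW] GH.ncore_finite_index[OF sW] GH.ncore_subset[OF sW] W(4) by blast
qed

end

theorem theorem4:
  fixes k p :: nat
  assumes "k \<ge> 1" and "Factorial_Ring.prime p"
  shows "\<exists>H :: continuum_group.
    residually_finite H \<and> is_p_group p H \<and>
    strict_growth_type p (\<lambda>n. real n powr (log (real p) (real n) ^ k)) (subgroups_index_le H) \<and>
    is_pro_p_group p (pro_p_completion p H) (pro_p_completion_topology p H) \<and>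
    strict_growth_type p (\<lambda>n. real n powr (log (real p) (real n) ^ k))
      (closed_subgroups_index_le (pro_p_completion p H) (pro_p_completion_topology p H))"
proof -
  interpret spinal_k p k using assms by unfold_locales
  have gGA: "group (GA H)" by (rule group_GA[OF subgrp_H])
  have pGA: "is_p_group p (GA H)" by (rule p_group_GA[OF subgrp_H tor prime_p])
  obtain H' :: continuum_group where H': "enc \<in> iso (GA H) H'" "group H'"
    using group.transport_iso[OF gGA inj_on_subset[OF inj_enc subset_UNIV]] by blast
  have pH: "is_p_group p H'" by (rule is_p_group_iso[OF H' pGA prime_p])
  interpret C: p_completion H' p
    by (intro p_completion.intro p_completion_axioms.intro H'(2) pH prime_p)
  let ?f = "\<lambda>n. real n powr (log (real p) (real n) ^ k)"
  have growth: "strict_growth_type p ?f (subgroups_index_le H')"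
    by (rule strict_growth_type_bij[OF bij_betw_subgroups_iso[OF H'(1) gGA H'(2)] growth_H])
  have "strict_growth_type p ?f (closed_subgroups_index_le (pro_p_completion p H') (pro_p_completion_topology p H'))"
    using strict_growth_type_bij[OF C.bij_hat growth] by (simp add: C.C_def C.T_def)
  moreover have "is_pro_p_group p (pro_p_completion p H') (pro_p_completion_topology p H')"
    using C.pro_p_C by (simp add: C.C_def C.T_def)
  moreover have "residually_finite H'" by (rule residually_finite_iso[OF H' residually_finite_H])
  ultimately show ?thesis using pH growth by blast
qed

end
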